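(* Let $\Bbbk$ be an algebraically closed field, $q,\,q-q^{-1}\in\Bbbk^\times$, $m\ge1$ and $\mathbf u=(u_1,\dots,u_m)\in(\Bbbk^\times)^m$. If the $\mathbf u$-admissible condition holds, then the cyclotomic Kauffman category $\mathcal{CK}(\mathbf u)$ is an upper finite weakly triangular category.
   Context: CYCLOTOMIC KAUFFMAN CATEGORY. Put $z=q-q^{-1}$, $f(t)=\prod_{i=1}^m(t-u_i)$, and fix $\delta\in\Bbbk^\times$. The affine Kauffman category $\mathcal{AK}$ is the strict $\Bbbk$-linear monoidal category generated by one object (objects: $a\in\mathbb N$, the $a$-th tensor power; identity $1_a$) and morphisms $\cup:0\to2$, $\cap:2\to0$, invertible $T:2\to2$ (the crossing whose over-strand goes from bottom left to top right, $T^{-1}$ being the other crossing) and invertible $x:1\to1$, subject to the braid relation $(T\otimes1_1)(1_1\otimes T)(T\otimes1_1)=(1_1\otimes T)(T\otimes1_1)(1_1\otimes T)$, $(1_1\otimes\cap)(\cup\otimes1_1)=1_1=(\cap\otimes1_1)(1_1\otimes\cup)$, $T-T^{-1}=z(1_2-\cup\cap)$, $\cap T=\delta^{-1}\cap$, $T\cup=\delta^{-1}\cup$, $\cap\cup=1+z^{-1}(\delta-\delta^{-1})$, $(\cap\otimes1_1)(1_1\otimes T^{\pm1})=(1_1\otimes\cap)(T^{\mp1}\otimes1_1)$, $(x\otimes1_1)T=T^{-1}(1_1\otimes x)$, $\cap(x\otimes1_1)=\cap(1_1\otimes x^{-1})$. For fixed scalars $\omega=(\omega_k)_{k\in\mathbb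 Z}$ with $\omega_0=1+z^{-1}(\delta-\delta^{-1})$, $\mathcal{CK}(\mathbf u)$ is the quotient of $\mathcal{AK}$ by the right tensor ideal generated by $f(x)$ and $\cap(x^k\otimes1_1)\cup-\omega_k$, $k\in\mathbb Z$. In diagrams $x$ is $\bullet$ and $x^{-1}$ is $\circ$ (so $h$ $\bullet$'s with $h<0$ means $-h$ $\circ$'s). An $(a,b)$-tangle diagram is an $(a,b)$-Brauer diagram ($a$ lower points, $b$ upper points, joined in pairs; cups/caps join two upper/lower points, other strands are vertical) whose crossings are made into over or under crossings. Label the lower points $1<2<\dots<a$ and the upper points $\bar1,\dots,\bar b$ from left to right, with $i<i+1<\bar j<\overline{j-1}$. It is reduced totally descending if two strands cross at most once, no strand crosses itself, there are no loops, and $(i,j)$ passes over $(k,l)$ whenever they cross and $\min\{i,j\}<\min\{k,l\}$. A normally ordered reduced totally descending dotted diagram carries in addition dots $\bullet$ or $\circ$ (not both on one strand), placed at the lower endpoint of vertical strands, at the left endpoint of caps and at the right endpoint of cups, such that if there are $i$ (resp. $j$) $\bullet$'s near an upper (resp. lower) endpoint then $-i,\,j\in\{\lfloor\frac{m-1}2\rfloor,\lfloor\frac{m-1}2\rfloor-1,\dots,-\lfloor\frac m2\rfloor\}$. Two are equivalent if they have the same underlying pairing and the same dots on corresponding strands; $\mathbb{DB}_{a,b}$ is the set of classes; it always spans $\mathrm{Hom}_{\mathcal{CK}(\mathbf u)}(a,b)$. The $\mathbf u$-admissible condition (on the parameters) is equivalent to $\mathrm{Hom}_{\mathcal{CK}(\mathbf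 u)}(a,b)$ having maximal dimension, i.e. to $\mathbb{DB}_{a,b}$ being a basis of it, for all $a,b\in\mathbb N$. WEAKLY TRIANGULAR CATEGORIES. Let $\mathcal A$ be a small $\Bbbk$-linear category with object set $J$ and finite-dimensional Hom spaces, with an equivalence relation $\sim$ on $J$ all of whose classes are finite; put $I=J/\sim$. The associated algebra is $A=\bigoplus_{a,b\in J}1_aA1_b$, with $1_aA1_b=\mathrm{Hom}_{\mathcal A}(b,a)$ and product given by composition. For $\mathbf a\in I$ put $1_{\mathbf a}=\sum_{b\in\mathbf a}1_b$. For a subspace $B\subseteq A$ put $B_{a,b}=1_aB1_b$, $B_{\mathbf a,\mathbf b}=1_{\mathbf a}B1_{\mathbf b}$, $B_{\mathbf a}=B_{\mathbf a,\mathbf a}$. A weakly triangular decomposition of $A$ is a datum $(I,A^-,A^\circ,A^+)$ such that: (W1) $(I,\preceq)$ is a poset; (W2) $A^-,A^\circ,A^+$ are subspaces of $A$ with $A^\pm=\bigoplus_{b,c\in J}A^\pm_{b,c}$ and $A^\circ=\bigoplus_{\mathbf a\in I}\bigoplus_{b,c\in\mathbf a}A^\circ_{b,c}$; (W3) $A^-_{\mathbf a,\mathbf b}=0$ and $A^+_{\mathbf b,\mathbf a}=0$ unless $\mathbf a\preceq\mathbf b$; and $A^-_{\mathbf a}=A^+_{\mathbf a}=\bigoplus_{c\in\mathbf a}\Bbbk1_c$; (W4) multiplication gives a linear isomorphism $A^-\otimes_{\mathbb K}A^\circ\otimes_{\mathbb K}A^+\to A$, where $\mathbb K=\bigoplus_{b\in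 J}\Bbbk1_b$. It is upper finite if $\{\mathbf b\in I:\mathbf a\preceq\mathbf b\}$ is finite for every $\mathbf a\in I$. $\mathcal A$ is an upper finite weakly triangular category if, for some such $\sim$, $A$ has an upper finite weakly triangular decomposition. *)

theory Defs
  imports
    "HOL-Library.Poly_Mapping"
    "HOL-Algebra.AbelCoset"
    "Jordan_Normal_Form.VS_Connect"
begin

section \<open>Linear algebra with explicit carriers\<close>

text \<open>The ground field is a type \<open>'k::field\<close>, viewed as the ring record \<^term>\<open>class_ring\<close>;
  vector spaces are \<^typ>\<open>('k, 'v) module\<close> records satisfying \<^locale>\<open>vectorspace\<close>. The
  \<open>mult\<close> and \<open>one\<close> fields of these records are irrelevant for the vector space structure.\<close>

definition internal_direct_sum ::
  "('k::field, 'v) module \<Rightarrow> 'v set \<Rightarrow> 'i set \<Rightarrow> ('i \<Rightarrow> 'v set) \<Rightarrow> bool" where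
  "internal_direct_sum V B I S \<longleftrightarrow>
     (\<forall>i\<in>I. submodule class_ring (S i) V) \<and>
     B = LinearCombinations.module.span class_ring V (\<Union>i\<in>I. S i) \<and>
     (\<forall>F s. finite F \<and> F \<subseteq> I \<and> (\<forall>i\<in>F. s i \<in> S i) \<and> (\<Oplus>\<^bsub>V\<^esub>i\<in>F. s i) = \<zero>\<^bsub>V\<^esub>
        \<longrightarrow> (\<forall>i\<in>F. s i = \<zero>\<^bsub>V\<^esub>))"

definition free_space :: "'s set \<Rightarrow> ('k::field, 's \<Rightarrow>\<^sub>0 'k) module" where
  "free_space S = \<lparr>carrier = {p. Poly_Mapping.keys p \<subseteq> S}, mult = undefined, one = undefined,
     zero = 0, add = (+), smult = (\<lambda>c. Poly_Mapping.map ((*) c))\<rparr>"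

text \<open>Scaling a coset elementwise by \<open>0\<close> gives \<open>{0}\<close> rather than the subspace, hence the
  additional sum with \<open>N\<close>.\<close>

definition quotient_space :: "('k::field, 'v) module \<Rightarrow> 'v set \<Rightarrow> ('k, 'v set) module" where
  "quotient_space V N = \<lparr>carrier = a_rcosets\<^bsub>V\<^esub> N, mult = undefined, one = undefined,
     zero = N, add = set_add V, smult = (\<lambda>c X. N <+>\<^bsub>V\<^esub> ((\<lambda>v. c \<odot>\<^bsub>V\<^esub> v) ` X))\<rparr>"


section \<open>Small linear categories and the associated algebra\<close>

text \<open>\<open>Cmp C a b c g f\<close> is the composite of \<open>f : a \<rightarrow> b\<close> and \<open>g : b \<rightarrow> c\<close>.\<close>

record ('k, 'o, 'm) lincat =
  Obj :: "'o set"
  Homs :: "'o \<Rightarrow> 'o \<Rightarrow> ('k, 'm) module"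
  Ide :: "'o \<Rightarrow> 'm"
  Cmp :: "'o \<Rightarrow> 'o \<Rightarrow> 'o \<Rightarrow> 'm \<Rightarrow> 'm \<Rightarrow> 'm"

locale linear_category =
  fixes C :: "('k::field, 'o, 'm) lincat"
  assumes hom_vs: "\<lbrakk>a \<in> Obj C; b \<in> Obj C\<rbrakk> \<Longrightarrow> vectorspace class_ring (Homs C a b)"
    and ide_closed: "a \<in> Obj C \<Longrightarrow> Ide C a \<in> carrier (Homs C a a)"
    and cmp_closed: "\<lbrakk>a \<in> Obj C; b \<in> Obj C; c \<in> Obj C;
        f \<in> carrier (Homs C a b); g \<in> carrier (Homs C b c)\<rbrakk>
        \<Longrightarrow> Cmp C a b c g f \<in> carrier (Homs C a c)"
    and cmp_ide_right: "\<lbrakk>a \<in> Obj C; b \<in> Obj C; f \<in> carrier (Homs C a b)\<rbrakk>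
        \<Longrightarrow> Cmp C a a b f (Ide C a) = f"
    and cmp_ide_left: "\<lbrakk>a \<in> Obj C; b \<in> Obj C; f \<in> carrier (Homs C a b)\<rbrakk>
        \<Longrightarrow> Cmp C a b b (Ide C b) f = f"
    and cmp_assoc: "\<lbrakk>a \<in> Obj C; b \<in> Obj C; c \<in> Obj C; d \<in> Obj C;
        f \<in> carrier (Homs C a b); g \<in> carrier (Homs C b c); h \<in> carrier (Homs C c d)\<rbrakk>
        \<Longrightarrow> Cmp C a b d (Cmp C b c d h g) f = Cmp C a c d h (Cmp C a b c g f)"
    and cmp_linear_left: "\<lbrakk>a \<in> Obj C; b \<in> Obj C; c \<in> Obj C; f \<in> carrier (Homs C a b)\<rbrakk>
        \<Longrightarrow> (\<lambda>g. Cmp C a b c g f) \<in> LinearCombinations.module_hom class_ring (Homs C b c) (Homs C a c)"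
    and cmp_linear_right: "\<lbrakk>a \<in> Obj C; b \<in> Obj C; c \<in> Obj C; g \<in> carrier (Homs C b c)\<rbrakk>
        \<Longrightarrow> (\<lambda>f. Cmp C a b c g f) \<in> LinearCombinations.module_hom class_ring (Homs C a b) (Homs C a c)"

definition finite_dim_homs :: "('k::field, 'o, 'm) lincat \<Rightarrow> bool" where
  "finite_dim_homs C \<longleftrightarrow>
     (\<forall>a\<in>Obj C. \<forall>b\<in>Obj C. vectorspace.fin_dim class_ring (Homs C a b))"

text \<open>Elements of the associated algebra are the finitely supported families \<open>x\<close> with
  \<open>x a b \<in> 1\<^sub>a A 1\<^sub>b = Hom(b, a)\<close>, normalised to \<^term>\<open>undefined\<close> outside the object set. The
  algebra has only local units, so the \<open>one\<close> field is not used.\<close>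

definition assoc_algebra :: "('k::field, 'o, 'm) lincat \<Rightarrow> ('k, 'o \<Rightarrow> 'o \<Rightarrow> 'm) module" where
  "assoc_algebra C = \<lparr>
     carrier = {x.
       (\<forall>a\<in>Obj C. \<forall>b\<in>Obj C. x a b \<in> carrier (Homs C b a)) \<and>
       (\<forall>a b. \<not> (a \<in> Obj C \<and> b \<in> Obj C) \<longrightarrow> x a b = undefined) \<and>
       finite {(a, b). a \<in> Obj C \<and> b \<in> Obj C \<and> x a b \<noteq> \<zero>\<^bsub>Homs C b a\<^esub>}},
     mult = (\<lambda>x y a c. if a \<in> Obj C \<and> c \<in> Obj C
       then \<Oplus>\<^bsub>Homs C c a\<^esub>b\<in>{b \<in> Obj C. x a b \<noteq> \<zero>\<^bsub>Homs C b a\<^esub>}. Cmp C c b a (x a b) (y b c)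
       else undefined),
     one = undefined,
     zero = (\<lambda>a b. if a \<in> Obj C \<and> b \<in> Obj C then \<zero>\<^bsub>Homs C b a\<^esub> else undefined),
     add = (\<lambda>x y a b. if a \<in> Obj C \<and> b \<in> Obj C then x a b \<oplus>\<^bsub>Homs C b a\<^esub> y a b else undefined),
     smult = (\<lambda>c x a b. if a \<in> Obj C \<and> b \<in> Obj C then c \<odot>\<^bsub>Homs C b a\<^esub> x a b else undefined)\<rparr>"

definition obj_idem :: "('k::field, 'o, 'm) lincat \<Rightarrow> 'o \<Rightarrow> 'o \<Rightarrow> 'o \<Rightarrow> 'm" where
  "obj_idem C c = (\<lambda>a b. if a \<in> Obj C \<and> b \<in> Obj C
     then (if a = c \<and> b = c then Ide C c else \<zero>\<^bsub>Homs C b a\<^esub>) else undefined)"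

definition class_idem :: "('k::field, 'o, 'm) lincat \<Rightarrow> 'o set \<Rightarrow> 'o \<Rightarrow> 'o \<Rightarrow> 'm" where
  "class_idem C \<aa> = (\<Oplus>\<^bsub>assoc_algebra C\<^esub>b\<in>\<aa>. obj_idem C b)"

definition corner :: "('k::field, 'v) module \<Rightarrow> 'v \<Rightarrow> 'v set \<Rightarrow> 'v \<Rightarrow> 'v set" where
  "corner A e B f = (\<lambda>x. e \<otimes>\<^bsub>A\<^esub> x \<otimes>\<^bsub>A\<^esub> f) ` B"

abbreviation obj_part ::
  "('k::field, 'o, 'm) lincat \<Rightarrow> ('o \<Rightarrow> 'o \<Rightarrow> 'm) set \<Rightarrow> 'o \<Rightarrow> 'o \<Rightarrow> ('o \<Rightarrow> 'o \<Rightarrow> 'm) set" where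
  "obj_part C B a b \<equiv> corner (assoc_algebra C) (obj_idem C a) B (obj_idem C b)"

abbreviation class_part ::
  "('k::field, 'o, 'm) lincat \<Rightarrow> ('o \<Rightarrow> 'o \<Rightarrow> 'm) set \<Rightarrow> 'o set \<Rightarrow> 'o set \<Rightarrow> ('o \<Rightarrow> 'o \<Rightarrow> 'm) set" where
  "class_part C B \<aa> \<bb> \<equiv> corner (assoc_algebra C) (class_idem C \<aa>) B (class_idem C \<bb>)"


section \<open>Tensor products over a subalgebra\<close>

text \<open>For subspaces \<open>B1\<close>, \<open>B2\<close>, \<open>B3\<close> and a subalgebra \<open>K\<close> of \<open>A\<close> with \<open>B1\<close> closed under right
  multiplication, \<open>B2\<close> under two-sided and \<open>B3\<close> under left multiplication by \<open>K\<close>, this is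
  \<open>B1 \<otimes>\<^sub>K B2 \<otimes>\<^sub>K B3\<close>: the free space on triples modulo linearity in each variable over the
  ground field and \<open>K\<close>-balancedness.\<close>

abbreviation triple :: "'v \<Rightarrow> 'v \<Rightarrow> 'v \<Rightarrow> ('v \<times> 'v \<times> 'v) \<Rightarrow>\<^sub>0 'k::field" where
  "triple x y z \<equiv> Poly_Mapping.single (x, y, z) 1"

definition tensor_relators ::
  "('k::field, 'v) module \<Rightarrow> 'v set \<Rightarrow> 'v set \<Rightarrow> 'v set \<Rightarrow> 'v set \<Rightarrow> (('v \<times> 'v \<times> 'v) \<Rightarrow>\<^sub>0 'k) set" where
  "tensor_relators A K B1 B2 B3 =
     {triple (x \<oplus>\<^bsub>A\<^esub> x') y z - triple x y z - triple x' y z | x x' y z.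
        x \<in> B1 \<and> x' \<in> B1 \<and> y \<in> B2 \<and> z \<in> B3} \<union>
     {triple x (y \<oplus>\<^bsub>A\<^esub> y') z - triple x y z - triple x y' z | x y y' z.
        x \<in> B1 \<and> y \<in> B2 \<and> y' \<in> B2 \<and> z \<in> B3} \<union>
     {triple x y (z \<oplus>\<^bsub>A\<^esub> z') - triple x y z - triple x y z' | x y z z'.
        x \<in> B1 \<and> y \<in> B2 \<and> z \<in> B3 \<and> z' \<in> B3} \<union>
     {triple (c \<odot>\<^bsub>A\<^esub> x) y z - Poly_Mapping.single (x, y, z) c | c x y z.
        x \<in> B1 \<and> y \<in> B2 \<and> z \<in> B3} \<union>
     {triple x (c \<odot>\<^bsub>A\<^esub> y) z - Poly_Mapping.single (x, y, z) c | c x y z.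
        x \<in> B1 \<and> y \<in> B2 \<and> z \<in> B3} \<union>
     {triple x y (c \<odot>\<^bsub>A\<^esub> z) - Poly_Mapping.single (x, y, z) c | c x y z.
        x \<in> B1 \<and> y \<in> B2 \<and> z \<in> B3} \<union>
     {triple (x \<otimes>\<^bsub>A\<^esub> e) y z - triple x (e \<otimes>\<^bsub>A\<^esub> y) z | e x y z.
        e \<in> K \<and> x \<in> B1 \<and> y \<in> B2 \<and> z \<in> B3} \<union>
     {triple x (y \<otimes>\<^bsub>A\<^esub> e) z - triple x y (e \<otimes>\<^bsub>A\<^esub> z) | e x y z.
        e \<in> K \<and> x \<in> B1 \<and> y \<in> B2 \<and> z \<in> B3}"

definition tensor3 ::
  "('k::field, 'v) module \<Rightarrow> 'v set \<Rightarrow> 'v set \<Rightarrow> 'v set \<Rightarrow> 'v set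
     \<Rightarrow> ('k, (('v \<times> 'v \<times> 'v) \<Rightarrow>\<^sub>0 'k) set) module" where
  "tensor3 A K B1 B2 B3 =
     (let F = free_space (B1 \<times> B2 \<times> B3)
      in quotient_space F (LinearCombinations.module.span class_ring F (tensor_relators A K B1 B2 B3)))"

definition mult_lin :: "('k::field, 'v) module \<Rightarrow> (('v \<times> 'v \<times> 'v) \<Rightarrow>\<^sub>0 'k) \<Rightarrow> 'v" where
  "mult_lin A p = (\<Oplus>\<^bsub>A\<^esub>t\<in>Poly_Mapping.keys p.
     Poly_Mapping.lookup p t \<odot>\<^bsub>A\<^esub> (case t of (x, y, z) \<Rightarrow> x \<otimes>\<^bsub>A\<^esub> y \<otimes>\<^bsub>A\<^esub> z))"

text \<open>The map induced on \<^const>\<open>tensor3\<close>; \<^const>\<open>mult_lin\<close> is constant on cosets.\<close>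

definition mult_map :: "('k::field, 'v) module \<Rightarrow> (('v \<times> 'v \<times> 'v) \<Rightarrow>\<^sub>0 'k) set \<Rightarrow> 'v" where
  "mult_map A X = the_elem (mult_lin A ` X)"


section \<open>Weakly triangular categories\<close>

definition local_units :: "('k::field, 'o, 'm) lincat \<Rightarrow> ('o \<Rightarrow> 'o \<Rightarrow> 'm) set" where
  "local_units C = LinearCombinations.module.span class_ring (assoc_algebra C) (obj_idem C ` Obj C)"

definition weakly_triangular_decomposition ::
  "('k::field, 'o, 'm) lincat \<Rightarrow> ('o \<times> 'o) set \<Rightarrow> ('o set \<times> 'o set) set
     \<Rightarrow> ('o \<Rightarrow> 'o \<Rightarrow> 'm) set \<Rightarrow> ('o \<Rightarrow> 'o \<Rightarrow> 'm) set \<Rightarrow> ('o \<Rightarrow> 'o \<Rightarrow> 'm) set \<Rightarrow> bool" where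
  "weakly_triangular_decomposition C R po Am A0 Ap \<longleftrightarrow>
     (let A = assoc_algebra C; J = Obj C; I = J // R;
          one_line = (\<lambda>c. {s \<odot>\<^bsub>A\<^esub> obj_idem C c | s. True})
      in
      partial_order_on I po \<and>
      submodule class_ring Am A \<and> submodule class_ring A0 A \<and> submodule class_ring Ap A \<and>
      internal_direct_sum A Am (J \<times> J) (\<lambda>(b, c). obj_part C Am b c) \<and>
      internal_direct_sum A Ap (J \<times> J) (\<lambda>(b, c). obj_part C Ap b c) \<and>
      internal_direct_sum A A0 {(b, c). \<exists>\<aa>\<in>I. b \<in> \<aa> \<and> c \<in> \<aa>} (\<lambda>(b, c). obj_part C A0 b c) \<and>
      (\<forall>\<aa>\<in>I. \<forall>\<bb>\<in>I. (\<aa>, \<bb>) \<notin> po \<longrightarrow>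
         class_part C Am \<aa> \<bb> = {\<zero>\<^bsub>A\<^esub>} \<and> class_part C Ap \<bb> \<aa> = {\<zero>\<^bsub>A\<^esub>}) \<and>
      (\<forall>\<aa>\<in>I. internal_direct_sum A (class_part C Am \<aa> \<aa>) \<aa> one_line \<and>
              internal_direct_sum A (class_part C Ap \<aa> \<aa>) \<aa> one_line) \<and>
      mult_map A \<in> LinearCombinations.module_hom class_ring (tensor3 A (local_units C) Am A0 Ap) A \<and>
      bij_betw (mult_map A) (carrier (tensor3 A (local_units C) Am A0 Ap)) (carrier A))"

definition upper_finite_weakly_triangular_category :: "('k::field, 'o, 'm) lincat \<Rightarrow> bool" where
  "upper_finite_weakly_triangular_category C \<longleftrightarrow>
     linear_category C \<and> finite_dim_homs C \<and>
     (\<exists>R po Am A0 Ap.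
        equiv (Obj C) R \<and> (\<forall>\<aa> \<in> Obj C // R. finite \<aa>) \<and>
        weakly_triangular_decomposition C R po Am A0 Ap \<and>
        (\<forall>\<aa> \<in> Obj C // R. finite {\<bb> \<in> Obj C // R. (\<aa>, \<bb>) \<in> po}))"


section \<open>The affine Kauffman category\<close>

text \<open>\<open>Cross\<close> is \<open>T\<close>, whose over-strand goes from bottom left to top right, and
  \<open>CrossInv\<close> is its inverse; \<open>Dot\<close> is \<open>x\<close> and \<open>DotInv\<close> its inverse.\<close>

datatype gen = Cup | Cap | Cross | CrossInv | Dot | DotInv

fun gsrc :: "gen \<Rightarrow> nat" where
  "gsrc Cup = 0" | "gsrc Cap = 2" | "gsrc Cross = 2" | "gsrc CrossInv = 2"
| "gsrc Dot = 1" | "gsrc DotInv = 1"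

fun gtgt :: "gen \<Rightarrow> nat" where
  "gtgt Cup = 2" | "gtgt Cap = 0" | "gtgt Cross = 2" | "gtgt CrossInv = 2"
| "gtgt Dot = 1" | "gtgt DotInv = 1"

datatype 'k tm =
    Gen gen
  | Idt nat
  | Comp "'k tm" "'k tm"  (infixr \<open>\<cdot>\<close> 70)
  | Tens "'k tm" "'k tm"  (infixr \<open>\<star>\<close> 75)
  | Zer nat nat
  | Add "'k tm" "'k tm"  (infixl \<open>+.\<close> 65)
  | Scl 'k "'k tm"  (infixr \<open>*.\<close> 68)

inductive arr :: "'k tm \<Rightarrow> nat \<Rightarrow> nat \<Rightarrow> bool" where
  "arr (Gen g) (gsrc g) (gtgt g)"
| "arr (Idt a) a a"
| "\<lbrakk>arr f a b; arr g b c\<rbrakk> \<Longrightarrow> arr (g \<cdot> f) a c"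
| "\<lbrakk>arr f a b; arr g c d\<rbrakk> \<Longrightarrow> arr (f \<star> g) (a + c) (b + d)"
| "arr (Zer a b) a b"
| "\<lbrakk>arr f a b; arr g a b\<rbrakk> \<Longrightarrow> arr (f +. g) a b"
| "arr f a b \<Longrightarrow> arr (c *. f) a b"

text \<open>Equality of morphisms in the affine Kauffman category: the congruence on well-typed terms
  generated by the axioms of a strict linear monoidal category and the defining relations.\<close>

inductive ak_eq :: "'k::field \<Rightarrow> 'k \<Rightarrow> 'k tm \<Rightarrow> 'k tm \<Rightarrow> bool" for q \<delta> :: 'k where
  refl: "arr f a b \<Longrightarrow> ak_eq q \<delta> f f"
| sym: "ak_eq q \<delta> f g \<Longrightarrow> ak_eq q \<delta> g f"
| trans: "\<lbrakk>ak_eq q \<delta> f g; ak_eq q \<delta> g h\<rbrakk> \<Longrightarrow> ak_eq q \<delta> f h"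
| cong_comp: "\<lbrakk>ak_eq q \<delta> f f'; ak_eq q \<delta> g g'; arr f a b; arr g b c\<rbrakk> \<Longrightarrow> ak_eq q \<delta> (g \<cdot> f) (g' \<cdot> f')"
| cong_tens: "\<lbrakk>ak_eq q \<delta> f f'; ak_eq q \<delta> g g'\<rbrakk> \<Longrightarrow> ak_eq q \<delta> (f \<star> g) (f' \<star> g')"
| cong_add: "\<lbrakk>ak_eq q \<delta> f f'; ak_eq q \<delta> g g'; arr f a b; arr g a b\<rbrakk> \<Longrightarrow> ak_eq q \<delta> (f +. g) (f' +. g')"
| cong_scl: "ak_eq q \<delta> f f' \<Longrightarrow> ak_eq q \<delta> (c *. f) (c *. f')"
  \<comment> \<open>category\<close>
| comp_assoc: "\<lbrakk>arr f a b; arr g b c; arr h c d\<rbrakk> \<Longrightarrow> ak_eq q \<delta> ((h \<cdot> g) \<cdot> f) (h \<cdot> (g \<cdot> f))"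
| comp_id_right: "arr f a b \<Longrightarrow> ak_eq q \<delta> (f \<cdot> Idt a) f"
| comp_id_left: "arr f a b \<Longrightarrow> ak_eq q \<delta> (Idt b \<cdot> f) f"
  \<comment> \<open>strict monoidal structure\<close>
| tens_assoc: "\<lbrakk>arr f a b; arr g c d; arr h k l\<rbrakk> \<Longrightarrow> ak_eq q \<delta> ((f \<star> g) \<star> h) (f \<star> (g \<star> h))"
| tens_unit_left: "arr f a b \<Longrightarrow> ak_eq q \<delta> (Idt 0 \<star> f) f"
| tens_unit_right: "arr f a b \<Longrightarrow> ak_eq q \<delta> (f \<star> Idt 0) f"
| tens_id: "ak_eq q \<delta> (Idt a \<star> Idt b) (Idt (a + b))"
| interchange: "\<lbrakk>arr f a b; arr f' b c; arr g k l; arr g' l n\<rbrakk>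
    \<Longrightarrow> ak_eq q \<delta> ((f' \<star> g') \<cdot> (f \<star> g)) ((f' \<cdot> f) \<star> (g' \<cdot> g))"
  \<comment> \<open>vector space structure on morphism spaces\<close>
| add_assoc: "\<lbrakk>arr f a b; arr g a b; arr h a b\<rbrakk> \<Longrightarrow> ak_eq q \<delta> ((f +. g) +. h) (f +. (g +. h))"
| add_comm: "\<lbrakk>arr f a b; arr g a b\<rbrakk> \<Longrightarrow> ak_eq q \<delta> (f +. g) (g +. f)"
| add_zero: "arr f a b \<Longrightarrow> ak_eq q \<delta> (f +. Zer a b) f"
| add_neg: "arr f a b \<Longrightarrow> ak_eq q \<delta> (f +. (- 1) *. f) (Zer a b)"
| scl_add: "\<lbrakk>arr f a b; arr g a b\<rbrakk> \<Longrightarrow> ak_eq q \<delta> (c *. (f +. g)) (c *. f +. c *. g)"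
| add_scl: "arr f a b \<Longrightarrow> ak_eq q \<delta> ((c + d) *. f) (c *. f +. d *. f)"
| scl_scl: "arr f a b \<Longrightarrow> ak_eq q \<delta> ((c * d) *. f) (c *. d *. f)"
| scl_one: "arr f a b \<Longrightarrow> ak_eq q \<delta> (1 *. f) f"
  \<comment> \<open>bilinearity of composition and tensor product\<close>
| comp_add_left: "\<lbrakk>arr f a b; arr g b c; arr g' b c\<rbrakk> \<Longrightarrow> ak_eq q \<delta> ((g +. g') \<cdot> f) (g \<cdot> f +. g' \<cdot> f)"
| comp_add_right: "\<lbrakk>arr f a b; arr f' a b; arr g b c\<rbrakk> \<Longrightarrow> ak_eq q \<delta> (g \<cdot> (f +. f')) (g \<cdot> f +. g \<cdot> f')"
| comp_scl_left: "\<lbrakk>arr f a b; arr g b c\<rbrakk> \<Longrightarrow> ak_eq q \<delta> ((s *. g) \<cdot> f) (s *. (g \<cdot> f))"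
| comp_scl_right: "\<lbrakk>arr f a b; arr g b c\<rbrakk> \<Longrightarrow> ak_eq q \<delta> (g \<cdot> (s *. f)) (s *. (g \<cdot> f))"
| tens_add_left: "\<lbrakk>arr f a b; arr f' a b; arr g c d\<rbrakk> \<Longrightarrow> ak_eq q \<delta> ((f +. f') \<star> g) (f \<star> g +. f' \<star> g)"
| tens_add_right: "\<lbrakk>arr f a b; arr g c d; arr g' c d\<rbrakk> \<Longrightarrow> ak_eq q \<delta> (f \<star> (g +. g')) (f \<star> g +. f \<star> g')"
| tens_scl_left: "\<lbrakk>arr f a b; arr g c d\<rbrakk> \<Longrightarrow> ak_eq q \<delta> ((s *. f) \<star> g) (s *. (f \<star> g))"
| tens_scl_right: "\<lbrakk>arr f a b; arr g c d\<rbrakk> \<Longrightarrow> ak_eq q \<delta> (f \<star> (s *. g)) (s *. (f \<star> g))"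
  \<comment> \<open>defining relations\<close>
| over_under: "ak_eq q \<delta> (Gen Cross \<cdot> Gen CrossInv) (Idt 2)"
| under_over: "ak_eq q \<delta> (Gen CrossInv \<cdot> Gen Cross) (Idt 2)"
| dot_dotinv: "ak_eq q \<delta> (Gen Dot \<cdot> Gen DotInv) (Idt 1)"
| dotinv_dot: "ak_eq q \<delta> (Gen DotInv \<cdot> Gen Dot) (Idt 1)"
| braid: "ak_eq q \<delta>
    ((Gen Cross \<star> Idt 1) \<cdot> (Idt 1 \<star> Gen Cross) \<cdot> (Gen Cross \<star> Idt 1))
    ((Idt 1 \<star> Gen Cross) \<cdot> (Gen Cross \<star> Idt 1) \<cdot> (Idt 1 \<star> Gen Cross))"
| zigzag: "ak_eq q \<delta> ((Idt 1 \<star> Gen Cap) \<cdot> (Gen Cup \<star> Idt 1)) (Idt 1)"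
| zigzag': "ak_eq q \<delta> ((Gen Cap \<star> Idt 1) \<cdot> (Idt 1 \<star> Gen Cup)) (Idt 1)"
| skein: "ak_eq q \<delta> (Gen Cross +. (- 1) *. Gen CrossInv)
    ((q - inverse q) *. (Idt 2 +. (- 1) *. (Gen Cup \<cdot> Gen Cap)))"
| untwist_cap: "ak_eq q \<delta> (Gen Cap \<cdot> Gen Cross) (inverse \<delta> *. Gen Cap)"
| untwist_cup: "ak_eq q \<delta> (Gen Cross \<cdot> Gen Cup) (inverse \<delta> *. Gen Cup)"
| bubble: "ak_eq q \<delta> (Gen Cap \<cdot> Gen Cup) ((1 + (\<delta> - inverse \<delta>) / (q - inverse q)) *. Idt 0)"
| cap_over: "ak_eq q \<delta> ((Gen Cap \<star> Idt 1) \<cdot> (Idt 1 \<star> Gen Cross))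
    ((Idt 1 \<star> Gen Cap) \<cdot> (Gen CrossInv \<star> Idt 1))"
| cap_under: "ak_eq q \<delta> ((Gen Cap \<star> Idt 1) \<cdot> (Idt 1 \<star> Gen CrossInv))
    ((Idt 1 \<star> Gen Cap) \<cdot> (Gen Cross \<star> Idt 1))"
| dot_slide: "ak_eq q \<delta> ((Gen Dot \<star> Idt 1) \<cdot> Gen Cross) (Gen CrossInv \<cdot> (Idt 1 \<star> Gen Dot))"
| dot_cap: "ak_eq q \<delta> (Gen Cap \<cdot> (Gen Dot \<star> Idt 1)) (Gen Cap \<cdot> (Idt 1 \<star> Gen DotInv))"

section \<open>The cyclotomic Kauffman category\<close>

definition dot_power :: "int \<Rightarrow> 'k tm" where
  "dot_power k = ((\<cdot>) (Gen (if k \<ge> 0 then Dot else DotInv)) ^^ nat \<bar>k\<bar>) (Idt 1)"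

text \<open>\<open>cyc_poly m u\<close> is \<open>f(x) = (x - u\<^sub>m) \<cdots> (x - u\<^sub>1)\<close>.\<close>

fun cyc_poly :: "nat \<Rightarrow> (nat \<Rightarrow> 'k::field) \<Rightarrow> 'k tm" where
  "cyc_poly 0 u = Idt 1"
| "cyc_poly (Suc m) u = (Gen Dot +. (- u (Suc m)) *. Idt 1) \<cdot> cyc_poly m u"

text \<open>\<open>ck_ideal q \<delta> m u \<omega> f a b\<close>: the class of \<open>f : a \<rightarrow> b\<close> lies in the right tensor ideal, i.e.
  the smallest family of subspaces closed under composition on both sides and under
  \<open>- \<otimes> 1\<^sub>c\<close> (but not \<open>1\<^sub>c \<otimes> -\<close>) that contains the generators.\<close>

inductive ck_ideal ::
  "'k::field \<Rightarrow> 'k \<Rightarrow> nat \<Rightarrow> (nat \<Rightarrow> 'k) \<Rightarrow> (int \<Rightarrow> 'k) \<Rightarrow> 'k tm \<Rightarrow> nat \<Rightarrow> nat \<Rightarrow> bool"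
  for q \<delta> m u \<omega> where
  gen_poly: "ck_ideal q \<delta> m u \<omega> (cyc_poly m u) 1 1"
| gen_bubble: "ck_ideal q \<delta> m u \<omega>
    ((Gen Cap \<cdot> (dot_power k \<star> Idt 1) \<cdot> Gen Cup) +. (- \<omega> k) *. Idt 0) 0 0"
| zero: "ck_ideal q \<delta> m u \<omega> (Zer a b) a b"
| add: "\<lbrakk>ck_ideal q \<delta> m u \<omega> f a b; ck_ideal q \<delta> m u \<omega> g a b\<rbrakk> \<Longrightarrow> ck_ideal q \<delta> m u \<omega> (f +. g) a b"
| scl: "ck_ideal q \<delta> m u \<omega> f a b \<Longrightarrow> ck_ideal q \<delta> m u \<omega> (c *. f) a b"
| comp_left: "\<lbrakk>ck_ideal q \<delta> m u \<omega> f a b; arr g b c\<rbrakk> \<Longrightarrow> ck_ideal q \<delta> m u \<omega> (g \<cdot> f) a c"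
| comp_right: "\<lbrakk>ck_ideal q \<delta> m u \<omega> g b c; arr f a b\<rbrakk> \<Longrightarrow> ck_ideal q \<delta> m u \<omega> (g \<cdot> f) a c"
| tens_right: "ck_ideal q \<delta> m u \<omega> f a b \<Longrightarrow> ck_ideal q \<delta> m u \<omega> (f \<star> Idt c) (a + c) (b + c)"
| ak: "\<lbrakk>ck_ideal q \<delta> m u \<omega> f a b; ak_eq q \<delta> f g\<rbrakk> \<Longrightarrow> ck_ideal q \<delta> m u \<omega> g a b"

definition ck_rel ::
  "'k::field \<Rightarrow> 'k \<Rightarrow> nat \<Rightarrow> (nat \<Rightarrow> 'k) \<Rightarrow> (int \<Rightarrow> 'k) \<Rightarrow> nat \<Rightarrow> nat \<Rightarrow> ('k tm \<times> 'k tm) set" where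
  "ck_rel q \<delta> m u \<omega> a b =
     {(f, g). arr f a b \<and> arr g a b \<and> ck_ideal q \<delta> m u \<omega> (f +. (- 1) *. g) a b}"

definition ck_class ::
  "'k::field \<Rightarrow> 'k \<Rightarrow> nat \<Rightarrow> (nat \<Rightarrow> 'k) \<Rightarrow> (int \<Rightarrow> 'k) \<Rightarrow> nat \<Rightarrow> nat \<Rightarrow> 'k tm \<Rightarrow> 'k tm set" where
  "ck_class q \<delta> m u \<omega> a b f = ck_rel q \<delta> m u \<omega> a b `` {f}"

definition CK ::
  "'k::field \<Rightarrow> 'k \<Rightarrow> nat \<Rightarrow> (nat \<Rightarrow> 'k) \<Rightarrow> (int \<Rightarrow> 'k) \<Rightarrow> ('k, nat, 'k tm set) lincat" where
  "CK q \<delta> m u \<omega> = \<lparr>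
     Obj = UNIV,
     Homs = (\<lambda>a b. \<lparr>
       carrier = {f. arr f a b} // ck_rel q \<delta> m u \<omega> a b,
       mult = undefined, one = undefined,
       zero = ck_class q \<delta> m u \<omega> a b (Zer a b),
       add = (\<lambda>X Y. \<Union>f\<in>X. \<Union>g\<in>Y. ck_class q \<delta> m u \<omega> a b (f +. g)),
       smult = (\<lambda>c X. \<Union>f\<in>X. ck_class q \<delta> m u \<omega> a b (c *. f))\<rparr>),
     Ide = (\<lambda>a. ck_class q \<delta> m u \<omega> a a (Idt a)),
     Cmp = (\<lambda>a b c Y X. \<Union>g\<in>Y. \<Union>f\<in>X. ck_class q \<delta> m u \<omega> a c (g \<cdot> f))\<rparr>"


section \<open>Tangle diagrams\<close>

text \<open>A tangle diagram is read from bottom to top as a list of slices; the slice \<open>(i, g, j)\<close>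
  is \<open>1\<^sub>i \<otimes> g \<otimes> 1\<^sub>j\<close>.\<close>

type_synonym slice = "nat \<times> gen \<times> nat"

fun tangle :: "nat \<Rightarrow> slice list \<Rightarrow> nat \<Rightarrow> bool" where
  "tangle a [] b \<longleftrightarrow> a = b"
| "tangle a ((i, g, j) # D) b \<longleftrightarrow>
     g \<in> {Cup, Cap, Cross, CrossInv} \<and> a = i + gsrc g + j \<and> tangle (i + gtgt g + j) D b"

fun tangle_tm :: "nat \<Rightarrow> slice list \<Rightarrow> 'k tm" where
  "tangle_tm a [] = Idt a"
| "tangle_tm a ((i, g, j) # D) = tangle_tm (i + gtgt g + j) D \<cdot> (Idt i \<star> Gen g \<star> Idt j)"

text \<open>The point \<open>(h, p)\<close> is the \<open>p\<close>-th point (counted from \<open>0\<close>) on the horizontal line below the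
  \<open>h\<close>-th slice. \<open>segments D\<close> lists the arcs of the slices as pairs of points; the strands of
  \<open>D\<close> are the connected components.\<close>

fun slice_segments :: "nat \<Rightarrow> slice \<Rightarrow> ((nat \<times> nat) \<times> (nat \<times> nat)) set" where
  "slice_segments h (i, g, j) =
     {((h, p), (Suc h, p)) | p. p < i} \<union>
     {((h, i + gsrc g + p), (Suc h, i + gtgt g + p)) | p. p < j} \<union>
     (case g of
        Cup \<Rightarrow> {((Suc h, i), (Suc h, Suc i))}
      | Cap \<Rightarrow> {((h, i), (h, Suc i))}
      | Cross \<Rightarrow> {((h, i), (Suc h, Suc i)), ((h, Suc i), (Suc h, i))}
      | CrossInv \<Rightarrow> {((h, i), (Suc h, Suc i)), ((h, Suc i), (Suc h, i))}
      | Dot \<Rightarrow> {((h, i), (Suc h, i))}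
      | DotInv \<Rightarrow> {((h, i), (Suc h, i))})"

definition segments :: "slice list \<Rightarrow> ((nat \<times> nat) \<times> (nat \<times> nat)) set" where
  "segments D = (\<Union>h<length D. slice_segments h (D ! h))"

definition same_strand :: "slice list \<Rightarrow> nat \<times> nat \<Rightarrow> nat \<times> nat \<Rightarrow> bool" where
  "same_strand D P Q \<longleftrightarrow> (P, Q) \<in> (segments D \<union> (segments D)\<inverse>)\<^sup>*"

text \<open>The \<open>a + b\<close> endpoints of an \<open>(a, b)\<close>-diagram are numbered from \<open>0\<close> in the order
  \<open>1 < \<dots> < a\<close>, followed by the upper endpoints from right to left.\<close>

definition endpoint :: "nat \<Rightarrow> slice list \<Rightarrow> nat \<Rightarrow> nat \<Rightarrow> nat \<times> nat" where
  "endpoint a D b e = (if e < a then (0, e) else (length D, a + b - 1 - e))"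

definition pairing :: "nat \<Rightarrow> slice list \<Rightarrow> nat \<Rightarrow> (nat \<times> nat) set" where
  "pairing a D b = {(e, e'). e < a + b \<and> e' < a + b \<and> e \<noteq> e' \<and>
     same_strand D (endpoint a D b e) (endpoint a D b e')}"

definition strand_min :: "nat \<Rightarrow> slice list \<Rightarrow> nat \<Rightarrow> nat \<times> nat \<Rightarrow> nat" where
  "strand_min a D b P = (LEAST e. e < a + b \<and> same_strand D (endpoint a D b e) P)"

definition crossings :: "slice list \<Rightarrow> nat set" where
  "crossings D = {h. h < length D \<and> fst (snd (D ! h)) \<in> {Cross, CrossInv}}"

fun over_at :: "nat \<Rightarrow> slice \<Rightarrow> nat \<times> nat" where
  "over_at h (i, g, j) = (h, if g = Cross then i else Suc i)"

fun under_at :: "nat \<Rightarrow> slice \<Rightarrow> nat \<times> nat" where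
  "under_at h (i, g, j) = (h, if g = Cross then Suc i else i)"

definition over_pt :: "slice list \<Rightarrow> nat \<Rightarrow> nat \<times> nat" where
  "over_pt D h = over_at h (D ! h)"

definition under_pt :: "slice list \<Rightarrow> nat \<Rightarrow> nat \<times> nat" where
  "under_pt D h = under_at h (D ! h)"

definition reduced_totally_descending :: "nat \<Rightarrow> slice list \<Rightarrow> nat \<Rightarrow> bool" where
  "reduced_totally_descending a D b \<longleftrightarrow>
     tangle a D b \<and>
     \<comment> \<open>no loops: every strand reaches the boundary\<close>
     (\<forall>P \<in> Field (segments D). \<exists>e < a + b. same_strand D (endpoint a D b e) P) \<and>
     \<comment> \<open>no strand crosses itself\<close>
     (\<forall>h \<in> crossings D. \<not> same_strand D (over_pt D h) (under_pt D h)) \<and>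
     \<comment> \<open>two strands cross at most once\<close>
     (\<forall>h \<in> crossings D. \<forall>k \<in> crossings D. h \<noteq> k \<longrightarrow>
        \<not> (same_strand D (over_pt D h) (over_pt D k) \<and> same_strand D (under_pt D h) (under_pt D k)) \<and>
        \<not> (same_strand D (over_pt D h) (under_pt D k) \<and> same_strand D (under_pt D h) (over_pt D k))) \<and>
     (\<forall>h \<in> crossings D. strand_min a D b (over_pt D h) < strand_min a D b (under_pt D h))"


section \<open>Dotted diagrams\<close>

text \<open>A dotted diagram \<open>(lo, D, up)\<close> carries \<open>lo ! p\<close> dots at the \<open>p\<close>-th lower and \<open>up ! p\<close> dots
  at the \<open>p\<close>-th upper endpoint (from left to right), negative numbers counting inverse dots.\<close>

type_synonym dotted = "int list \<times> slice list \<times> int list"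

definition dots_tm :: "int list \<Rightarrow> 'k tm" where
  "dots_tm ds = foldr (\<lambda>k t. dot_power k \<star> t) ds (Idt 0)"

fun dotted_tm :: "nat \<Rightarrow> dotted \<Rightarrow> 'k tm" where
  "dotted_tm a (lo, D, up) = dots_tm up \<cdot> tangle_tm a D \<cdot> dots_tm lo"

fun normally_ordered :: "nat \<Rightarrow> nat \<Rightarrow> nat \<Rightarrow> dotted \<Rightarrow> bool" where
  "normally_ordered m a b (lo, D, up) \<longleftrightarrow>
     reduced_totally_descending a D b \<and> length lo = a \<and> length up = b \<and>
     (\<forall>p<a. lo ! p \<noteq> 0 \<longrightarrow>
        (\<exists>p'<b. same_strand D (0, p) (length D, p')) \<or>
        (\<exists>p'<a. p < p' \<and> same_strand D (0, p) (0, p'))) \<and>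
     (\<forall>p<b. up ! p \<noteq> 0 \<longrightarrow>
        (\<exists>p'<b. p' < p \<and> same_strand D (length D, p) (length D, p'))) \<and>
     (\<forall>p<a. lo ! p \<in> {- int (m div 2) .. int ((m - 1) div 2)}) \<and>
     (\<forall>p<b. - (up ! p) \<in> {- int (m div 2) .. int ((m - 1) div 2)})"

fun dotted_equiv :: "nat \<Rightarrow> nat \<Rightarrow> dotted \<Rightarrow> dotted \<Rightarrow> bool" where
  "dotted_equiv a b (lo, D, up) (lo', D', up') \<longleftrightarrow>
     pairing a D b = pairing a D' b \<and> lo = lo' \<and> up = up'"

definition DB :: "nat \<Rightarrow> nat \<Rightarrow> nat \<Rightarrow> dotted set set" where
  "DB m a b = Collect (normally_ordered m a b) //
     {(D, D'). normally_ordered m a b D \<and> normally_ordered m a b D' \<and> dotted_equiv a b D D'}"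

text \<open>A set of diagram classes being a basis of the morphism space \<open>a \<rightarrow> b\<close> means: equivalent diagrams represent the
  same morphism, distinct classes represent distinct morphisms, and the morphisms so obtained
  form a basis.\<close>

definition DB_is_basis ::
  "'k::field \<Rightarrow> 'k \<Rightarrow> nat \<Rightarrow> (nat \<Rightarrow> 'k) \<Rightarrow> (int \<Rightarrow> 'k) \<Rightarrow> nat \<Rightarrow> nat \<Rightarrow> bool" where
  "DB_is_basis q \<delta> m u \<omega> a b \<longleftrightarrow>
     (\<exists>\<phi>. (\<forall>X \<in> DB m a b. \<forall>D \<in> X. ck_class q \<delta> m u \<omega> a b (dotted_tm a D) = \<phi> X) \<and>
          inj_on \<phi> (DB m a b) \<and>
          vectorspace.basis class_ring (Homs (CK q \<delta> m u \<omega>) a b) (\<phi> ` DB m a b))"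

text \<open>Admissibility of the parameters is expressed as maximality of the morphism spaces, i.e. by
  the property that the dotted diagrams form a basis of every morphism space.\<close>

definition u_admissible ::
  "'k::field \<Rightarrow> 'k \<Rightarrow> nat \<Rightarrow> (nat \<Rightarrow> 'k) \<Rightarrow> (int \<Rightarrow> 'k) \<Rightarrow> bool" where
  "u_admissible q \<delta> m u \<omega> \<longleftrightarrow> (\<forall>a b. DB_is_basis q \<delta> m u \<omega> a b)"

end

theory Submission
  imports Defs
begin

text \<open>
  The objects are graded by the number of strands, and \<open>A\<^sup>-\<close>, \<open>A\<^sup>\<circ>\<close>, \<open>A\<^sup>+\<close> are spanned by dotted cup
  diagrams \<open>d \<rightarrow> a\<close>, dotted permutation diagrams \<open>d \<rightarrow> d\<close> and dotted cap diagrams \<open>b \<rightarrow> d\<close>. A normally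
  ordered dotted diagram may be redrawn within its class so that its cups lie above everything else.
  It then factors through the number \<open>d\<close> of its through-strands, with a dotted cup diagram on the left.
  Applying the anti-involution that reflects diagrams gives the mirror image of this statement, and
  induction on the middle object shows that every composite is a combination of products of the three
  kinds. On the other hand, gluing the pairings embeds the set of such triples into
  the set of dotted pairings, whose size is the dimension of the morphism space by admissibility.
  Hence the products form bases of all morphism spaces, and no straightening of products of
  diagrams is needed.
\<close>

section \<open>The affine Kauffman category\<close>

text \<open>Admissibility says nothing about products of diagrams; what it offers is the freedom to
  pick any reduced diagram in a class. The pick has to be uniform: the cup part may depend on the
  cups of the pairing and their dots, but not on what lies below, since otherwise the factors would
  not be indexed by triples and the count would fail. Uniformity is possible because the sign of a
  crossing in a totally descending diagram is dictated by the order of the endpoints. When the cup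
  with the leftmost right end is split off first, each strand in its way has its other end at a
  smaller number, whatever the lower part looks like, so all signs are known in advance. The
  reflection must keep left and right, as the quotient is taken by a right tensor ideal, and it must
  fix \<open>T\<close>, as exchanging \<open>T\<close> with its inverse would violate the skein
  relation. It has to be checked that cups satisfy the mirror images of the relations imposed on
  caps. The induction on the middle object needs no control over the lower factor of a
  factorisation: a composite through fewer strands is covered by the induction hypothesis whatever
  its factors are.\<close>

fun src :: "'k tm \<Rightarrow> nat" where
  "src (Gen g) = gsrc g"
| "src (Idt a) = a"
| "src (g \<cdot> f) = src f"
| "src (f \<star> g) = src f + src g"
| "src (Zer a b) = a"
| "src (f +. g) = src f"
| "src (c *. f) = src f"

fun tgt :: "'k tm \<Rightarrow> nat" where
  "tgt (Gen g) = gtgt g"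
| "tgt (Idt a) = a"
| "tgt (g \<cdot> f) = tgt g"
| "tgt (f \<star> g) = tgt f + tgt g"
| "tgt (Zer a b) = b"
| "tgt (f +. g) = tgt f"
| "tgt (c *. f) = tgt f"

fun wt :: "'k tm \<Rightarrow> bool" where
  "wt (Gen g) = True"
| "wt (Idt a) = True"
| "wt (g \<cdot> f) = (wt f \<and> wt g \<and> tgt f = src g)"
| "wt (f \<star> g) = (wt f \<and> wt g)"
| "wt (Zer a b) = True"
| "wt (f +. g) = (wt f \<and> wt g \<and> src f = src g \<and> tgt f = tgt g)"
| "wt (c *. f) = wt f"

text \<open>Sources and targets are unique and computable, so typing side conditions become
  simplification with \<open>wt\<close>, \<open>src\<close> and \<open>tgt\<close> instead of
  derivations of \<open>arr\<close>.\<close>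

lemma arr_iff: "arr f a b \<longleftrightarrow> wt f \<and> src f = a \<and> tgt f = b"
proof
  assume "arr f a b" then show "wt f \<and> src f = a \<and> tgt f = b" by induction auto
next
  have "wt f \<Longrightarrow> arr f (src f) (tgt f)" by (induction f) (auto intro: arr.intros)
  then show "wt f \<and> src f = a \<and> tgt f = b \<Longrightarrow> arr f a b" by auto
qed

lemma ak_eq_wt: "ak_eq q \<delta> f g \<Longrightarrow> wt f \<and> wt g \<and> src f = src g \<and> tgt f = tgt g"
  by (induction rule: ak_eq.induct) (auto simp: arr_iff)

lemma ak_eq_arr: "ak_eq q \<delta> f g \<Longrightarrow> arr f a b \<longleftrightarrow> arr g a b"
  using ak_eq_wt by (force simp: arr_iff)

text \<open>Turning a diagram upside down maps \<open>T\<close> to its inverse; composing with the change of all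
  crossings gives an anti-involution that fixes \<open>T\<close>.\<close>

fun flip_gen :: "gen \<Rightarrow> gen" where
  "flip_gen Cup = Cap" | "flip_gen Cap = Cup" | "flip_gen g = g"

lemma flip_gen_flip_gen [simp]: "flip_gen (flip_gen g) = g" by (cases g) auto

text \<open>Tensor factors keep their order. The ideal defining the quotient is closed under
  tensoring on the right only, and a half turn of the plane would send it to a left tensor
  ideal.\<close>

fun flip :: "'k tm \<Rightarrow> 'k tm" where
  "flip (Gen g) = Gen (flip_gen g)"
| "flip (Idt a) = Idt a"
| "flip (g \<cdot> f) = flip f \<cdot> flip g"
| "flip (f \<star> g) = flip f \<star> flip g"
| "flip (Zer a b) = Zer b a"
| "flip (f +. g) = flip f +. flip g"
| "flip (c *. f) = c *. flip f"

lemma flip_flip [simp]: "flip (flip f) = f" by (induction f) auto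

lemma gsrc_flip_gen [simp]: "gsrc (flip_gen g) = gtgt g" and gtgt_flip_gen [simp]: "gtgt (flip_gen g) = gsrc g"
  by (cases g; simp)+

lemma src_flip [simp]: "src (flip f) = tgt f" and tgt_flip [simp]: "tgt (flip f) = src f"
  by (induction f) auto

lemma wt_flip [simp]: "wt (flip f) = wt f" by (induction f) auto

lemma arr_flip [simp]: "arr (flip f) a b \<longleftrightarrow> arr f b a" by (auto simp: arr_iff)

section \<open>Equational calculus in the strict monoidal category\<close>

locale kauffman =
  fixes q \<delta> :: "'k::field" and m :: nat and u :: "nat \<Rightarrow> 'k" and \<omega> :: "int \<Rightarrow> 'k"
begin

abbreviation eqv (infix \<open>\<approx>\<close> 50) where "f \<approx> g \<equiv> ak_eq q \<delta> f g"

lemma eqv_refl [simp]: "wt f \<Longrightarrow> f \<approx> f"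
  by (rule ak_eq.refl[of f "src f" "tgt f"]) (simp add: arr_iff)

lemmas eqv_sym = ak_eq.sym[of q \<delta>]
lemmas [trans] = ak_eq.trans

lemma eqv_comp: "g \<approx> g' \<Longrightarrow> f \<approx> f' \<Longrightarrow> tgt f = src g \<Longrightarrow> g \<cdot> f \<approx> g' \<cdot> f'"
  by (rule ak_eq.cong_comp) (auto simp: arr_iff dest: ak_eq_wt)

lemma eqv_comp_l: "g \<approx> g' \<Longrightarrow> wt f \<Longrightarrow> tgt f = src g \<Longrightarrow> g \<cdot> f \<approx> g' \<cdot> f"
  by (rule eqv_comp) auto

lemma eqv_comp_r: "f \<approx> f' \<Longrightarrow> wt g \<Longrightarrow> tgt f = src g \<Longrightarrow> g \<cdot> f \<approx> g \<cdot> f'"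
  by (rule eqv_comp) auto

lemmas eqv_tens = ak_eq.cong_tens[of q \<delta>]

lemma eqv_tens_l: "g \<approx> g' \<Longrightarrow> wt f \<Longrightarrow> g \<star> f \<approx> g' \<star> f"
  by (rule eqv_tens) auto

lemma eqv_tens_r: "f \<approx> f' \<Longrightarrow> wt g \<Longrightarrow> g \<star> f \<approx> g \<star> f'"
  by (rule eqv_tens) auto

lemma eqv_add: "f \<approx> f' \<Longrightarrow> g \<approx> g' \<Longrightarrow> src f = src g \<Longrightarrow> tgt f = tgt g \<Longrightarrow> f +. g \<approx> f' +. g'"
  by (rule ak_eq.cong_add) (auto simp: arr_iff dest: ak_eq_wt)

lemmas eqv_scl = ak_eq.cong_scl[of q \<delta>]

lemma assoc: "wt (h \<cdot> g \<cdot> f) \<Longrightarrow> (h \<cdot> g) \<cdot> f \<approx> h \<cdot> (g \<cdot> f)"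
  by (rule ak_eq.comp_assoc) (auto simp: arr_iff)

lemma assoc': "wt (h \<cdot> g \<cdot> f) \<Longrightarrow> h \<cdot> (g \<cdot> f) \<approx> (h \<cdot> g) \<cdot> f"
  by (rule eqv_sym, rule assoc)

lemma id_r: "wt f \<Longrightarrow> n = src f \<Longrightarrow> f \<cdot> Idt n \<approx> f"
  using ak_eq.comp_id_right[of f "src f" "tgt f"] by (auto simp: arr_iff)

lemma id_l: "wt f \<Longrightarrow> n = tgt f \<Longrightarrow> Idt n \<cdot> f \<approx> f"
  using ak_eq.comp_id_left[of f "src f" "tgt f"] by (auto simp: arr_iff)

lemma tassoc: "wt f \<Longrightarrow> wt g \<Longrightarrow> wt h \<Longrightarrow> (f \<star> g) \<star> h \<approx> f \<star> (g \<star> h)"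
  by (rule ak_eq.tens_assoc) (auto simp: arr_iff)

lemma tassoc': "wt f \<Longrightarrow> wt g \<Longrightarrow> wt h \<Longrightarrow> f \<star> (g \<star> h) \<approx> (f \<star> g) \<star> h"
  by (rule eqv_sym, rule tassoc)

lemma unit_l: "wt f \<Longrightarrow> Idt 0 \<star> f \<approx> f" and unit_r: "wt f \<Longrightarrow> f \<star> Idt 0 \<approx> f"
  by (auto simp: arr_iff intro!: ak_eq.tens_unit_left ak_eq.tens_unit_right)

lemma exch: "wt (f' \<cdot> f) \<Longrightarrow> wt (g' \<cdot> g) \<Longrightarrow> (f' \<star> g') \<cdot> (f \<star> g) \<approx> (f' \<cdot> f) \<star> (g' \<cdot> g)"
  by (rule ak_eq.interchange) (auto simp: arr_iff)

lemma whisker_l: "wt (g \<cdot> f) \<Longrightarrow> (Idt n \<star> g) \<cdot> (Idt n \<star> f) \<approx> Idt n \<star> (g \<cdot> f)"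
  by (rule ak_eq.trans[OF exch]) (auto intro!: eqv_tens_l id_l)

lemma whisker_r: "wt (g \<cdot> f) \<Longrightarrow> (g \<star> Idt n) \<cdot> (f \<star> Idt n) \<approx> (g \<cdot> f) \<star> Idt n"
  by (rule ak_eq.trans[OF exch]) (auto intro!: eqv_tens_r id_l)

lemma slide1: "wt f \<Longrightarrow> wt g \<Longrightarrow> n = tgt f \<Longrightarrow> k = src g \<Longrightarrow> (Idt n \<star> g) \<cdot> (f \<star> Idt k) \<approx> f \<star> g"
  by (rule ak_eq.trans[OF exch]) (auto intro!: eqv_tens id_l id_r)

lemma slide2: "wt f \<Longrightarrow> wt g \<Longrightarrow> n = src f \<Longrightarrow> k = tgt g \<Longrightarrow> (f \<star> Idt k) \<cdot> (Idt n \<star> g) \<approx> f \<star> g"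
  by (rule ak_eq.trans[OF exch]) (auto intro!: eqv_tens id_l id_r)

text \<open>Morphisms on disjoint strands may change heights, since both orders equal
  \<open>f \<star> g\<close>. This is the planar isotopy used in the bending arguments.\<close>

lemma slide12: "wt f \<Longrightarrow> wt g \<Longrightarrow> n = tgt f \<Longrightarrow> k = src g \<Longrightarrow> n' = src f \<Longrightarrow> k' = tgt g
   \<Longrightarrow> (Idt n \<star> g) \<cdot> (f \<star> Idt k) \<approx> (f \<star> Idt k') \<cdot> (Idt n' \<star> g)"
  using slide1 eqv_sym[OF slide2] ak_eq.trans by metis

lemma slide21: "wt f \<Longrightarrow> wt g \<Longrightarrow> n = tgt f \<Longrightarrow> k = src g \<Longrightarrow> n' = src f \<Longrightarrow> k' = tgt g
   \<Longrightarrow> (f \<star> Idt k') \<cdot> (Idt n' \<star> g) \<approx> (Idt n \<star> g) \<cdot> (f \<star> Idt k)"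
  using slide12 eqv_sym by metis

lemma idt_tens: "n + k = l \<Longrightarrow> Idt n \<star> Idt k \<approx> Idt l"
  using ak_eq.tens_id by metis

lemma idt_idt_l: "wt f \<Longrightarrow> n + k = l \<Longrightarrow> Idt n \<star> (Idt k \<star> f) \<approx> Idt l \<star> f"
  by (rule ak_eq.trans[OF tassoc']) (auto intro: eqv_tens_l idt_tens)

lemma idt_idt_r: "wt f \<Longrightarrow> n + k = l \<Longrightarrow> (f \<star> Idt n) \<star> Idt k \<approx> f \<star> Idt l"
  by (rule ak_eq.trans[OF tassoc]) (auto intro: eqv_tens_r idt_tens)

text \<open>By the zigzag relation, bending the leftmost upper strand down can be undone.\<close>

lemma bend_recover:
  assumes f: "wt f" "src f = 1" "tgt f = 3"
  shows "(Idt 1 \<star> ((Gen Cap \<star> Idt 2) \<cdot> (Idt 1 \<star> f))) \<cdot> (Gen Cup \<star> Idt 1) \<approx> f"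
proof -
  have "(Idt 1 \<star> ((Gen Cap \<star> Idt 2) \<cdot> (Idt 1 \<star> f))) \<cdot> (Gen Cup \<star> Idt 1)
     \<approx> ((Idt 1 \<star> (Gen Cap \<star> Idt 2)) \<cdot> (Idt 1 \<star> (Idt 1 \<star> f))) \<cdot> (Gen Cup \<star> Idt 1)"
    by (rule eqv_comp_l[OF eqv_sym[OF whisker_l]]) (auto simp: f)
  also have "\<dots> \<approx> (Idt 1 \<star> (Gen Cap \<star> Idt 2)) \<cdot> ((Idt 1 \<star> (Idt 1 \<star> f)) \<cdot> (Gen Cup \<star> Idt 1))"
    by (rule assoc) (auto simp: f)
  \<comment> \<open>The new cup lies beside \<open>f\<close> and can be lifted above it; there it
    meets the cap and forms a zigzag on the first output strand.\<close>
  also have "\<dots> \<approx> (Idt 1 \<star> (Gen Cap \<star> Idt 2)) \<cdot> ((Gen Cup \<star> Idt 3) \<cdot> f)"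
  proof (rule eqv_comp_r)
    have "(Idt 1 \<star> (Idt 1 \<star> f)) \<cdot> (Gen Cup \<star> Idt 1) \<approx> (Idt 2 \<star> f) \<cdot> (Gen Cup \<star> Idt 1)"
      by (rule eqv_comp_l[OF idt_idt_l]) (auto simp: f)
    also have "\<dots> \<approx> (Gen Cup \<star> Idt 3) \<cdot> (Idt 0 \<star> f)"
      by (rule slide12) (auto simp: f)
    also have "\<dots> \<approx> (Gen Cup \<star> Idt 3) \<cdot> f"
      by (rule eqv_comp_r[OF unit_l]) (auto simp: f)
    finally show "(Idt 1 \<star> (Idt 1 \<star> f)) \<cdot> (Gen Cup \<star> Idt 1) \<approx> (Gen Cup \<star> Idt 3) \<cdot> f" .
  qed (auto simp: f)
  also have "\<dots> \<approx> ((Idt 1 \<star> (Gen Cap \<star> Idt 2)) \<cdot> (Gen Cup \<star> Idt 3)) \<cdot> f"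
    by (rule assoc') (auto simp: f)
  also have "\<dots> \<approx> Idt 3 \<cdot> f"
  proof (rule eqv_comp_l)
    have "(Idt 1 \<star> (Gen Cap \<star> Idt 2)) \<cdot> (Gen Cup \<star> Idt 3)
        \<approx> ((Idt 1 \<star> Gen Cap) \<star> Idt 2) \<cdot> ((Gen Cup \<star> Idt 1) \<star> Idt 2)"
      by (rule eqv_comp[OF tassoc' eqv_sym[OF idt_idt_r]]) auto
    also have "\<dots> \<approx> ((Idt 1 \<star> Gen Cap) \<cdot> (Gen Cup \<star> Idt 1)) \<star> Idt 2"
      by (rule whisker_r) auto
    also have "\<dots> \<approx> Idt 1 \<star> Idt 2"
      by (rule eqv_tens_l[OF ak_eq.zigzag]) auto
    also have "\<dots> \<approx> Idt 3" by (rule idt_tens) auto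
    finally show "(Idt 1 \<star> (Gen Cap \<star> Idt 2)) \<cdot> (Gen Cup \<star> Idt 3) \<approx> Idt 3" .
  qed (auto simp: f)
  also have "\<dots> \<approx> f" by (rule id_l) (auto simp: f)
  finally show ?thesis .
qed

text \<open>Bending has a left inverse and can be cancelled. An identity between morphisms
  containing cups may thus be checked after capping, where the relations for caps apply.\<close>

lemma bend_inj:
  assumes f: "wt f" "src f = 1" "tgt f = 3" and g: "wt g" "src g = 1" "tgt g = 3"
    and eq: "(Gen Cap \<star> Idt 2) \<cdot> (Idt 1 \<star> f) \<approx> (Gen Cap \<star> Idt 2) \<cdot> (Idt 1 \<star> g)"
  shows "f \<approx> g"
proof -
  have "f \<approx> (Idt 1 \<star> ((Gen Cap \<star> Idt 2) \<cdot> (Idt 1 \<star> f))) \<cdot> (Gen Cup \<star> Idt 1)"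
    by (rule eqv_sym[OF bend_recover]) (auto simp: f)
  also have "\<dots> \<approx> (Idt 1 \<star> ((Gen Cap \<star> Idt 2) \<cdot> (Idt 1 \<star> g))) \<cdot> (Gen Cup \<star> Idt 1)"
    by (rule eqv_comp_l[OF eqv_tens_r[OF eq]]) (auto simp: f)
  also have "\<dots> \<approx> g" by (rule bend_recover) (auto simp: g)
  finally show ?thesis .
qed

text \<open>The slides of a strand past a cap are axioms, those past a cup are not. After bending
  the first output strand both sides become \<open>T\<close>. The letters \<open>T\<close> and
  \<open>S\<close> stand for a crossing and its inverse in either order, so both slides are
  covered.\<close>

lemma cup_slide:
  assumes T: "wt T" "src T = 2" "tgt T = 2" and S: "wt S" "src S = 2" "tgt S = 2"
    and eq: "(Gen Cap \<star> Idt 1) \<cdot> (Idt 1 \<star> S) \<approx> (Idt 1 \<star> Gen Cap) \<cdot> (T \<star> Idt 1)"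
  shows "(Idt 1 \<star> T) \<cdot> (Gen Cup \<star> Idt 1) \<approx> (S \<star> Idt 1) \<cdot> (Idt 1 \<star> Gen Cup)"
proof (rule bend_inj)
  note [simp] = T S
  have "(Gen Cap \<star> Idt 2) \<cdot> (Idt 1 \<star> ((Idt 1 \<star> T) \<cdot> (Gen Cup \<star> Idt 1)))
     \<approx> (Gen Cap \<star> Idt 2) \<cdot> ((Idt 1 \<star> (Idt 1 \<star> T)) \<cdot> (Idt 1 \<star> (Gen Cup \<star> Idt 1)))"
    by (rule eqv_comp_r[OF eqv_sym[OF whisker_l]]) auto
  also have "\<dots> \<approx> ((Gen Cap \<star> Idt 2) \<cdot> (Idt 1 \<star> (Idt 1 \<star> T))) \<cdot> (Idt 1 \<star> (Gen Cup \<star> Idt 1))"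
    by (rule assoc') auto
  also have "\<dots> \<approx> (T \<cdot> (Gen Cap \<star> Idt 2)) \<cdot> (Idt 1 \<star> (Gen Cup \<star> Idt 1))"
  proof (rule eqv_comp_l)
    have "(Gen Cap \<star> Idt 2) \<cdot> (Idt 1 \<star> (Idt 1 \<star> T)) \<approx> (Gen Cap \<star> Idt 2) \<cdot> (Idt 2 \<star> T)"
      by (rule eqv_comp_r[OF idt_idt_l]) auto
    also have "\<dots> \<approx> (Idt 0 \<star> T) \<cdot> (Gen Cap \<star> Idt 2)" by (rule slide21) auto
    also have "\<dots> \<approx> T \<cdot> (Gen Cap \<star> Idt 2)" by (rule eqv_comp_l[OF unit_l]) auto
    finally show "(Gen Cap \<star> Idt 2) \<cdot> (Idt 1 \<star> (Idt 1 \<star> T)) \<approx> T \<cdot> (Gen Cap \<star> Idt 2)" .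
  qed auto
  also have "\<dots> \<approx> T \<cdot> ((Gen Cap \<star> Idt 2) \<cdot> (Idt 1 \<star> (Gen Cup \<star> Idt 1)))" by (rule assoc) auto
  also have "\<dots> \<approx> T \<cdot> Idt 2"
  proof (rule eqv_comp_r)
    have "(Gen Cap \<star> Idt 2) \<cdot> (Idt 1 \<star> (Gen Cup \<star> Idt 1))
       \<approx> ((Gen Cap \<star> Idt 1) \<star> Idt 1) \<cdot> ((Idt 1 \<star> Gen Cup) \<star> Idt 1)"
      by (rule eqv_comp[OF eqv_sym[OF idt_idt_r] tassoc']) auto
    also have "\<dots> \<approx> ((Gen Cap \<star> Idt 1) \<cdot> (Idt 1 \<star> Gen Cup)) \<star> Idt 1" by (rule whisker_r) auto
    also have "\<dots> \<approx> Idt 1 \<star> Idt 1" by (rule eqv_tens_l[OF ak_eq.zigzag']) auto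
    also have "\<dots> \<approx> Idt 2" by (rule idt_tens) auto
    finally show "(Gen Cap \<star> Idt 2) \<cdot> (Idt 1 \<star> (Gen Cup \<star> Idt 1)) \<approx> Idt 2" .
  qed auto
  also have "\<dots> \<approx> T" by (rule id_r) auto
  finally have 1: "(Gen Cap \<star> Idt 2) \<cdot> (Idt 1 \<star> ((Idt 1 \<star> T) \<cdot> (Gen Cup \<star> Idt 1))) \<approx> T" .
  have "(Gen Cap \<star> Idt 2) \<cdot> (Idt 1 \<star> ((S \<star> Idt 1) \<cdot> (Idt 1 \<star> Gen Cup)))
     \<approx> (Gen Cap \<star> Idt 2) \<cdot> ((Idt 1 \<star> (S \<star> Idt 1)) \<cdot> (Idt 1 \<star> (Idt 1 \<star> Gen Cup)))"
    by (rule eqv_comp_r[OF eqv_sym[OF whisker_l]]) auto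
  also have "\<dots> \<approx> ((Gen Cap \<star> Idt 2) \<cdot> (Idt 1 \<star> (S \<star> Idt 1))) \<cdot> (Idt 1 \<star> (Idt 1 \<star> Gen Cup))"
    by (rule assoc') auto
  \<comment> \<open>The hypothesis \<open>eq\<close> replaces \<open>S\<close> by \<open>T\<close>
    and moves the cap; afterwards \<open>T\<close> commutes with the cup on its right and a zigzag
    is left.\<close>
  also have "\<dots> \<approx> ((Idt 1 \<star> (Gen Cap \<star> Idt 1)) \<cdot> (T \<star> Idt 2)) \<cdot> (Idt 2 \<star> Gen Cup)"
  proof (rule eqv_comp)
    have "(Gen Cap \<star> Idt 2) \<cdot> (Idt 1 \<star> (S \<star> Idt 1)) \<approx> ((Gen Cap \<star> Idt 1) \<star> Idt 1) \<cdot> ((Idt 1 \<star> S) \<star> Idt 1)"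
      by (rule eqv_comp[OF eqv_sym[OF idt_idt_r] tassoc']) auto
    also have "\<dots> \<approx> ((Gen Cap \<star> Idt 1) \<cdot> (Idt 1 \<star> S)) \<star> Idt 1" by (rule whisker_r) auto
    also have "\<dots> \<approx> ((Idt 1 \<star> Gen Cap) \<cdot> (T \<star> Idt 1)) \<star> Idt 1" by (rule eqv_tens_l[OF eq]) auto
    also have "\<dots> \<approx> ((Idt 1 \<star> Gen Cap) \<star> Idt 1) \<cdot> ((T \<star> Idt 1) \<star> Idt 1)"
      by (rule eqv_sym[OF whisker_r]) auto
    also have "\<dots> \<approx> (Idt 1 \<star> (Gen Cap \<star> Idt 1)) \<cdot> (T \<star> Idt 2)"
      by (rule eqv_comp[OF tassoc idt_idt_r]) auto
    finally show "(Gen Cap \<star> Idt 2) \<cdot> (Idt 1 \<star> (S \<star> Idt 1)) \<approx> (Idt 1 \<star> (Gen Cap \<star> Idt 1)) \<cdot> (T \<star> Idt 2)" .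
    show "Idt 1 \<star> (Idt 1 \<star> Gen Cup) \<approx> Idt 2 \<star> Gen Cup" by (rule idt_idt_l) auto
  qed auto
  also have "\<dots> \<approx> (Idt 1 \<star> (Gen Cap \<star> Idt 1)) \<cdot> ((T \<star> Idt 2) \<cdot> (Idt 2 \<star> Gen Cup))" by (rule assoc) auto
  also have "\<dots> \<approx> (Idt 1 \<star> (Gen Cap \<star> Idt 1)) \<cdot> ((Idt 2 \<star> Gen Cup) \<cdot> T)"
  proof (rule eqv_comp_r)
    have "(T \<star> Idt 2) \<cdot> (Idt 2 \<star> Gen Cup) \<approx> (Idt 2 \<star> Gen Cup) \<cdot> (T \<star> Idt 0)" by (rule slide21) auto
    also have "\<dots> \<approx> (Idt 2 \<star> Gen Cup) \<cdot> T" by (rule eqv_comp_r[OF unit_r]) auto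
    finally show "(T \<star> Idt 2) \<cdot> (Idt 2 \<star> Gen Cup) \<approx> (Idt 2 \<star> Gen Cup) \<cdot> T" .
  qed auto
  also have "\<dots> \<approx> ((Idt 1 \<star> (Gen Cap \<star> Idt 1)) \<cdot> (Idt 2 \<star> Gen Cup)) \<cdot> T" by (rule assoc') auto
  also have "\<dots> \<approx> Idt 2 \<cdot> T"
  proof (rule eqv_comp_l)
    have "(Idt 1 \<star> (Gen Cap \<star> Idt 1)) \<cdot> (Idt 2 \<star> Gen Cup)
       \<approx> (Idt 1 \<star> (Gen Cap \<star> Idt 1)) \<cdot> (Idt 1 \<star> (Idt 1 \<star> Gen Cup))"
      by (rule eqv_comp_r[OF eqv_sym[OF idt_idt_l]]) auto
    also have "\<dots> \<approx> Idt 1 \<star> ((Gen Cap \<star> Idt 1) \<cdot> (Idt 1 \<star> Gen Cup))" by (rule whisker_l) auto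
    also have "\<dots> \<approx> Idt 1 \<star> Idt 1" by (rule eqv_tens_r[OF ak_eq.zigzag']) auto
    also have "\<dots> \<approx> Idt 2" by (rule idt_tens) auto
    finally show "(Idt 1 \<star> (Gen Cap \<star> Idt 1)) \<cdot> (Idt 2 \<star> Gen Cup) \<approx> Idt 2" .
  qed auto
  also have "\<dots> \<approx> T" by (rule id_l) auto
  finally have "(Gen Cap \<star> Idt 2) \<cdot> (Idt 1 \<star> ((S \<star> Idt 1) \<cdot> (Idt 1 \<star> Gen Cup))) \<approx> T" .
  from 1 eqv_sym[OF this] show
    "(Gen Cap \<star> Idt 2) \<cdot> (Idt 1 \<star> ((Idt 1 \<star> T) \<cdot> (Gen Cup \<star> Idt 1)))
      \<approx> (Gen Cap \<star> Idt 2) \<cdot> (Idt 1 \<star> ((S \<star> Idt 1) \<cdot> (Idt 1 \<star> Gen Cup)))" by (rule ak_eq.trans)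
qed (auto simp: T S)

end

lemma wt_dots:
  fixes t :: "'k tm"
  assumes "gsrc g = 1" "gtgt g = 1" "wt t" "src t = 1" "tgt t = 1"
  shows "wt (((\<cdot>) (Gen g) ^^ n) t) \<and> src (((\<cdot>) (Gen g) ^^ n) t) = 1 \<and> tgt (((\<cdot>) (Gen g) ^^ n) t) = 1"
  using assms by (induction n) auto

lemma dot_power_wt [simp]: "wt (dot_power k)" "src (dot_power k) = 1" "tgt (dot_power k) = 1"
  unfolding dot_power_def by (auto simp: wt_dots)

section \<open>Mirror images of the defining relations\<close>

context kauffman begin

text \<open>Obtained from \<open>dot_slide\<close> by composing with \<open>Gen Cross\<close> on the
  left and \<open>Gen CrossInv\<close> on the right.\<close>

lemma dot_slide_flip: "Gen Cross \<cdot> (Gen Dot \<star> Idt 1) \<approx> (Idt 1 \<star> Gen Dot) \<cdot> Gen CrossInv"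
proof -
  have "Gen Cross \<cdot> (Gen Dot \<star> Idt 1) \<approx> (Gen Cross \<cdot> (Gen Dot \<star> Idt 1)) \<cdot> Idt 2"
    by (rule eqv_sym[OF id_r]) auto
  also have "\<dots> \<approx> (Gen Cross \<cdot> (Gen Dot \<star> Idt 1)) \<cdot> (Gen Cross \<cdot> Gen CrossInv)"
    by (rule eqv_comp_r[OF eqv_sym[OF ak_eq.over_under]]) auto
  also have "\<dots> \<approx> ((Gen Cross \<cdot> (Gen Dot \<star> Idt 1)) \<cdot> Gen Cross) \<cdot> Gen CrossInv" by (rule assoc') auto
  also have "\<dots> \<approx> (Idt 1 \<star> Gen Dot) \<cdot> Gen CrossInv"
  proof (rule eqv_comp_l)
    have "(Gen Cross \<cdot> (Gen Dot \<star> Idt 1)) \<cdot> Gen Cross \<approx> Gen Cross \<cdot> ((Gen Dot \<star> Idt 1) \<cdot> Gen Cross)"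
      by (rule assoc) auto
    also have "\<dots> \<approx> Gen Cross \<cdot> (Gen CrossInv \<cdot> (Idt 1 \<star> Gen Dot))"
      by (rule eqv_comp_r[OF ak_eq.dot_slide]) auto
    also have "\<dots> \<approx> (Gen Cross \<cdot> Gen CrossInv) \<cdot> (Idt 1 \<star> Gen Dot)" by (rule assoc') auto
    also have "\<dots> \<approx> Idt 2 \<cdot> (Idt 1 \<star> Gen Dot)" by (rule eqv_comp_l[OF ak_eq.over_under]) auto
    also have "\<dots> \<approx> Idt 1 \<star> Gen Dot" by (rule id_l) auto
    finally show "(Gen Cross \<cdot> (Gen Dot \<star> Idt 1)) \<cdot> Gen Cross \<approx> Idt 1 \<star> Gen Dot" .
  qed auto
  finally show ?thesis .
qed

text \<open>The analogue of bending for morphisms from \<open>0\<close> to \<open>2\<close>: capping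
  the second output against a new strand gives a morphism from \<open>1\<close> to \<open>1\<close>,
  and a zigzag undoes this.\<close>

lemma bend_cup_recover:
  assumes g: "wt g" "src g = 0" "tgt g = 2"
  shows "(((Idt 1 \<star> Gen Cap) \<cdot> (g \<star> Idt 1)) \<star> Idt 1) \<cdot> Gen Cup \<approx> g"
proof -
  note [simp] = g
  have "(((Idt 1 \<star> Gen Cap) \<cdot> (g \<star> Idt 1)) \<star> Idt 1) \<cdot> Gen Cup
     \<approx> (((Idt 1 \<star> Gen Cap) \<star> Idt 1) \<cdot> ((g \<star> Idt 1) \<star> Idt 1)) \<cdot> Gen Cup"
    by (rule eqv_comp_l[OF eqv_sym[OF whisker_r]]) auto
  also have "\<dots> \<approx> ((Idt 1 \<star> Gen Cap) \<star> Idt 1) \<cdot> (((g \<star> Idt 1) \<star> Idt 1) \<cdot> Gen Cup)" by (rule assoc) auto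
  also have "\<dots> \<approx> (Idt 1 \<star> (Gen Cap \<star> Idt 1)) \<cdot> ((Idt 1 \<star> (Idt 1 \<star> Gen Cup)) \<cdot> g)"
  proof (rule eqv_comp)
    have "((g \<star> Idt 1) \<star> Idt 1) \<cdot> Gen Cup \<approx> (g \<star> Idt 2) \<cdot> (Idt 0 \<star> Gen Cup)"
      by (rule eqv_comp[OF idt_idt_r eqv_sym[OF unit_l]]) auto
    also have "\<dots> \<approx> (Idt 2 \<star> Gen Cup) \<cdot> (g \<star> Idt 0)" by (rule slide21) auto
    also have "\<dots> \<approx> (Idt 1 \<star> (Idt 1 \<star> Gen Cup)) \<cdot> g"
      by (rule eqv_comp[OF eqv_sym[OF idt_idt_l] unit_r]) auto
    finally show "((g \<star> Idt 1) \<star> Idt 1) \<cdot> Gen Cup \<approx> (Idt 1 \<star> (Idt 1 \<star> Gen Cup)) \<cdot> g" .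
    show "(Idt 1 \<star> Gen Cap) \<star> Idt 1 \<approx> Idt 1 \<star> (Gen Cap \<star> Idt 1)" by (rule tassoc) auto
  qed auto
  also have "\<dots> \<approx> ((Idt 1 \<star> (Gen Cap \<star> Idt 1)) \<cdot> (Idt 1 \<star> (Idt 1 \<star> Gen Cup))) \<cdot> g" by (rule assoc') auto
  also have "\<dots> \<approx> Idt 2 \<cdot> g"
  proof (rule eqv_comp_l)
    have "(Idt 1 \<star> (Gen Cap \<star> Idt 1)) \<cdot> (Idt 1 \<star> (Idt 1 \<star> Gen Cup))
       \<approx> Idt 1 \<star> ((Gen Cap \<star> Idt 1) \<cdot> (Idt 1 \<star> Gen Cup))" by (rule whisker_l) auto
    also have "\<dots> \<approx> Idt 1 \<star> Idt 1" by (rule eqv_tens_r[OF ak_eq.zigzag']) auto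
    also have "\<dots> \<approx> Idt 2" by (rule idt_tens) auto
    finally show "(Idt 1 \<star> (Gen Cap \<star> Idt 1)) \<cdot> (Idt 1 \<star> (Idt 1 \<star> Gen Cup)) \<approx> Idt 2" .
  qed auto
  also have "\<dots> \<approx> g" by (rule id_l) auto
  finally show ?thesis .
qed

text \<open>Insert \<open>Gen DotInv \<cdot> Gen Dot\<close> on the right leg, carry its inverse dot
  over the cap by \<open>dot_cap\<close>, and cancel the resulting dot on the left leg.\<close>

lemma cap_dotinv: "Gen Cap \<cdot> (Gen DotInv \<star> Idt 1) \<approx> Gen Cap \<cdot> (Idt 1 \<star> Gen Dot)"
proof -
  let ?d = "Gen Dot \<star> Idt 1" and ?e = "Gen DotInv \<star> Idt 1"
    and ?d' = "Idt 1 \<star> Gen Dot" and ?e' = "Idt 1 \<star> Gen DotInv" and ?c = "Gen Cap"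
  have "?c \<cdot> ?e \<approx> (?c \<cdot> Idt 2) \<cdot> ?e" by (rule eqv_comp_l[OF eqv_sym[OF id_r]]) auto
  also have "\<dots> \<approx> (?c \<cdot> (?e' \<cdot> ?d')) \<cdot> ?e"
  proof (intro eqv_comp_l eqv_comp_r)
    have "?e' \<cdot> ?d' \<approx> Idt 1 \<star> (Gen DotInv \<cdot> Gen Dot)" by (rule whisker_l) auto
    also have "\<dots> \<approx> Idt 1 \<star> Idt 1" by (rule eqv_tens_r[OF ak_eq.dotinv_dot]) auto
    also have "\<dots> \<approx> Idt 2" by (rule idt_tens) auto
    finally show "Idt 2 \<approx> ?e' \<cdot> ?d'" by (rule eqv_sym)
  qed auto
  also have "\<dots> \<approx> ((?c \<cdot> ?e') \<cdot> ?d') \<cdot> ?e" by (intro eqv_comp_l assoc') auto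
  also have "\<dots> \<approx> ((?c \<cdot> ?d) \<cdot> ?d') \<cdot> ?e"
    by (intro eqv_comp_l eqv_sym[OF ak_eq.dot_cap]) auto
  also have "\<dots> \<approx> (?c \<cdot> ?d) \<cdot> (?d' \<cdot> ?e)" by (rule assoc) auto
  also have "\<dots> \<approx> (?c \<cdot> ?d) \<cdot> (?e \<cdot> ?d')" by (intro eqv_comp_r slide12) auto
  also have "\<dots> \<approx> ((?c \<cdot> ?d) \<cdot> ?e) \<cdot> ?d'" by (rule assoc') auto
  also have "\<dots> \<approx> ?c \<cdot> ?d'"
  proof (rule eqv_comp_l)
    have "(?c \<cdot> ?d) \<cdot> ?e \<approx> ?c \<cdot> (?d \<cdot> ?e)" by (rule assoc) auto
    also have "\<dots> \<approx> ?c \<cdot> Idt 2"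
    proof (rule eqv_comp_r)
      have "?d \<cdot> ?e \<approx> (Gen Dot \<cdot> Gen DotInv) \<star> Idt 1" by (rule whisker_r) auto
      also have "\<dots> \<approx> Idt 1 \<star> Idt 1" by (rule eqv_tens_l[OF ak_eq.dot_dotinv]) auto
      also have "\<dots> \<approx> Idt 2" by (rule idt_tens) auto
      finally show "?d \<cdot> ?e \<approx> Idt 2" .
    qed auto
    also have "\<dots> \<approx> ?c" by (rule id_r) auto
    finally show "(?c \<cdot> ?d) \<cdot> ?e \<approx> ?c" .
  qed auto
  finally show ?thesis .
qed

text \<open>Both sides become \<open>Gen Dot\<close> after bending: on the left the dot stays on the
  output strand, on the right the inverse dot passes over the bending cap and turns into a
  dot.\<close>

lemma dot_cup: "(Gen Dot \<star> Idt 1) \<cdot> Gen Cup \<approx> (Idt 1 \<star> Gen DotInv) \<cdot> Gen Cup" (is "?g \<approx> ?h")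
proof -
  have "(Idt 1 \<star> Gen Cap) \<cdot> (?g \<star> Idt 1)
     \<approx> (Idt 1 \<star> Gen Cap) \<cdot> (((Gen Dot \<star> Idt 1) \<star> Idt 1) \<cdot> (Gen Cup \<star> Idt 1))"
    by (rule eqv_comp_r[OF eqv_sym[OF whisker_r]]) auto
  also have "\<dots> \<approx> ((Idt 1 \<star> Gen Cap) \<cdot> ((Gen Dot \<star> Idt 1) \<star> Idt 1)) \<cdot> (Gen Cup \<star> Idt 1)"
    by (rule assoc') auto
  also have "\<dots> \<approx> (Gen Dot \<cdot> (Idt 1 \<star> Gen Cap)) \<cdot> (Gen Cup \<star> Idt 1)"
  proof (rule eqv_comp_l)
    have "(Idt 1 \<star> Gen Cap) \<cdot> ((Gen Dot \<star> Idt 1) \<star> Idt 1) \<approx> (Idt 1 \<star> Gen Cap) \<cdot> (Gen Dot \<star> Idt 2)"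
      by (rule eqv_comp_r[OF idt_idt_r]) auto
    also have "\<dots> \<approx> (Gen Dot \<star> Idt 0) \<cdot> (Idt 1 \<star> Gen Cap)" by (rule slide12) auto
    also have "\<dots> \<approx> Gen Dot \<cdot> (Idt 1 \<star> Gen Cap)" by (rule eqv_comp_l[OF unit_r]) auto
    finally show "(Idt 1 \<star> Gen Cap) \<cdot> ((Gen Dot \<star> Idt 1) \<star> Idt 1) \<approx> Gen Dot \<cdot> (Idt 1 \<star> Gen Cap)" .
  qed auto
  also have "\<dots> \<approx> Gen Dot \<cdot> ((Idt 1 \<star> Gen Cap) \<cdot> (Gen Cup \<star> Idt 1))" by (rule assoc) auto
  also have "\<dots> \<approx> Gen Dot \<cdot> Idt 1" by (rule eqv_comp_r[OF ak_eq.zigzag]) auto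
  also have "\<dots> \<approx> Gen Dot" by (rule id_r) auto
  finally have 1: "(Idt 1 \<star> Gen Cap) \<cdot> (?g \<star> Idt 1) \<approx> Gen Dot" .
  have "(Idt 1 \<star> Gen Cap) \<cdot> (?h \<star> Idt 1)
     \<approx> (Idt 1 \<star> Gen Cap) \<cdot> (((Idt 1 \<star> Gen DotInv) \<star> Idt 1) \<cdot> (Gen Cup \<star> Idt 1))"
    by (rule eqv_comp_r[OF eqv_sym[OF whisker_r]]) auto
  also have "\<dots> \<approx> ((Idt 1 \<star> Gen Cap) \<cdot> ((Idt 1 \<star> Gen DotInv) \<star> Idt 1)) \<cdot> (Gen Cup \<star> Idt 1)"
    by (rule assoc') auto
  also have "\<dots> \<approx> ((Idt 1 \<star> Gen Cap) \<cdot> (Idt 2 \<star> Gen Dot)) \<cdot> (Gen Cup \<star> Idt 1)"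
  proof (rule eqv_comp_l)
    have "(Idt 1 \<star> Gen Cap) \<cdot> ((Idt 1 \<star> Gen DotInv) \<star> Idt 1)
       \<approx> (Idt 1 \<star> Gen Cap) \<cdot> (Idt 1 \<star> (Gen DotInv \<star> Idt 1))"
      by (rule eqv_comp_r[OF tassoc]) auto
    also have "\<dots> \<approx> Idt 1 \<star> (Gen Cap \<cdot> (Gen DotInv \<star> Idt 1))" by (rule whisker_l) auto
    also have "\<dots> \<approx> Idt 1 \<star> (Gen Cap \<cdot> (Idt 1 \<star> Gen Dot))" by (rule eqv_tens_r[OF cap_dotinv]) auto
    also have "\<dots> \<approx> (Idt 1 \<star> Gen Cap) \<cdot> (Idt 1 \<star> (Idt 1 \<star> Gen Dot))"
      by (rule eqv_sym[OF whisker_l]) auto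
    also have "\<dots> \<approx> (Idt 1 \<star> Gen Cap) \<cdot> (Idt 2 \<star> Gen Dot)" by (rule eqv_comp_r[OF idt_idt_l]) auto
    finally show "(Idt 1 \<star> Gen Cap) \<cdot> ((Idt 1 \<star> Gen DotInv) \<star> Idt 1)
       \<approx> (Idt 1 \<star> Gen Cap) \<cdot> (Idt 2 \<star> Gen Dot)" .
  qed auto
  also have "\<dots> \<approx> (Idt 1 \<star> Gen Cap) \<cdot> ((Idt 2 \<star> Gen Dot) \<cdot> (Gen Cup \<star> Idt 1))" by (rule assoc) auto
  also have "\<dots> \<approx> (Idt 1 \<star> Gen Cap) \<cdot> ((Gen Cup \<star> Idt 1) \<cdot> Gen Dot)"
  proof (rule eqv_comp_r)
    have "(Idt 2 \<star> Gen Dot) \<cdot> (Gen Cup \<star> Idt 1) \<approx> (Gen Cup \<star> Idt 1) \<cdot> (Idt 0 \<star> Gen Dot)"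
      by (rule slide12) auto
    also have "\<dots> \<approx> (Gen Cup \<star> Idt 1) \<cdot> Gen Dot" by (rule eqv_comp_r[OF unit_l]) auto
    finally show "(Idt 2 \<star> Gen Dot) \<cdot> (Gen Cup \<star> Idt 1) \<approx> (Gen Cup \<star> Idt 1) \<cdot> Gen Dot" .
  qed auto
  also have "\<dots> \<approx> ((Idt 1 \<star> Gen Cap) \<cdot> (Gen Cup \<star> Idt 1)) \<cdot> Gen Dot" by (rule assoc') auto
  also have "\<dots> \<approx> Idt 1 \<cdot> Gen Dot" by (rule eqv_comp_l[OF ak_eq.zigzag]) auto
  also have "\<dots> \<approx> Gen Dot" by (rule id_l) auto
  finally have 2: "(Idt 1 \<star> Gen Cap) \<cdot> (?h \<star> Idt 1) \<approx> Gen Dot" .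
  have "?g \<approx> (((Idt 1 \<star> Gen Cap) \<cdot> (?g \<star> Idt 1)) \<star> Idt 1) \<cdot> Gen Cup"
    by (rule eqv_sym[OF bend_cup_recover]) auto
  also have "\<dots> \<approx> (((Idt 1 \<star> Gen Cap) \<cdot> (?h \<star> Idt 1)) \<star> Idt 1) \<cdot> Gen Cup"
    by (intro eqv_comp_l eqv_tens_l ak_eq.trans[OF 1 eqv_sym[OF 2]]) auto
  also have "\<dots> \<approx> ?h" by (rule bend_cup_recover) auto
  finally show ?thesis .
qed

text \<open>Most rules are mapped to rules: inverse laws, zigzags and the untwisting relations are
  exchanged in pairs, skein and bubble are fixed. Only the cap slides, the dot slide and the dot on
  a cap leave the list of axioms, and their images are the lemmas above.\<close>

lemma flip_eqv: "f \<approx> g \<Longrightarrow> flip f \<approx> flip g"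
proof (induction rule: ak_eq.induct)
  case (comp_assoc f a b g c h d)
  then show ?case by (auto simp: arr_iff intro!: assoc')
next
  case braid
  let ?T = "Gen Cross" and ?I = "Idt 1"
  have "((?T \<star> ?I) \<cdot> (?I \<star> ?T)) \<cdot> (?T \<star> ?I) \<approx> (?T \<star> ?I) \<cdot> ((?I \<star> ?T) \<cdot> (?T \<star> ?I))" by (rule assoc) auto
  also have "\<dots> \<approx> (?I \<star> ?T) \<cdot> ((?T \<star> ?I) \<cdot> (?I \<star> ?T))" by (rule ak_eq.braid)
  also have "\<dots> \<approx> ((?I \<star> ?T) \<cdot> (?T \<star> ?I)) \<cdot> (?I \<star> ?T)" by (rule assoc') auto
  finally show ?case by simp
next
  case cap_over
  \<comment> \<open>The reflection of one cap slide comes from the other one, because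
    \<open>cup_slide\<close> reverses the roles of the two crossings.\<close>
  show ?case using cup_slide[OF _ _ _ _ _ _ ak_eq.cap_under] by simp
next
  case cap_under
  show ?case using cup_slide[OF _ _ _ _ _ _ ak_eq.cap_over] by simp
next
  case dot_slide
  show ?case using dot_slide_flip by simp
next
  case dot_cap
  show ?case using dot_cup by simp
next
  case zigzag
  show ?case using ak_eq.zigzag' by simp
next
  case zigzag'
  show ?case using ak_eq.zigzag by simp
next
  case (cong_comp f f' g g' a b c)
  then show ?case using eqv_comp[OF cong_comp.IH] by (auto simp: arr_iff)
next
  case (cong_add f f' g g' a b)
  then show ?case using eqv_add[OF cong_add.IH] by (auto simp: arr_iff)
next
  case (trans f g h)
  then show ?case using ak_eq.trans by blast
next
  case (sym f g)
  then show ?case using ak_eq.sym by blast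
next
  case (interchange f a b f' c g k l g' n)
  then show ?case by (auto simp: arr_iff intro!: exch)
next
  case (comp_add_left f a b g c g')
  then show ?case by (auto intro!: ak_eq.comp_add_right)
next
  case (comp_add_right f a b f' g c)
  then show ?case by (auto intro!: ak_eq.comp_add_left)
next
  case (comp_scl_left f a b g c s)
  then show ?case by (auto intro!: ak_eq.comp_scl_right)
next
  case (comp_scl_right f a b g c s)
  then show ?case by (auto intro!: ak_eq.comp_scl_left)
qed (auto intro: ak_eq.intros simp del: One_nat_def)

text \<open>\<open>flip\<close> reverses composites, so the power comes back with its factors nested
  the other way; the fact \<open>c\<close>, that a generator commutes with its own powers, repairs
  this.\<close>

lemma flip_dots:
  assumes g: "g = Dot \<or> g = DotInv"
  shows "flip (((\<cdot>) (Gen g) ^^ n) (Idt 1)) \<approx> ((\<cdot>) (Gen g) ^^ n) (Idt 1)"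
proof -
  have [simp]: "gsrc g = 1" "gtgt g = 1" "flip_gen g = g" using g by auto
  let ?P = "\<lambda>n. ((\<cdot>) (Gen g) ^^ n) (Idt 1 :: 'k tm)"
  have w: "wt (?P n) \<and> src (?P n) = 1 \<and> tgt (?P n) = 1" for n by (rule wt_dots) auto
  have c: "?P n \<cdot> Gen g \<approx> Gen g \<cdot> ?P n" for n
  proof (induction n)
    case 0
    have "Idt 1 \<cdot> Gen g \<approx> Gen g" by (rule id_l) auto
    also have "Gen g \<approx> Gen g \<cdot> Idt 1" by (rule eqv_sym[OF id_r]) auto
    finally show ?case by simp
  next
    case (Suc n)
    have "(Gen g \<cdot> ?P n) \<cdot> Gen g \<approx> Gen g \<cdot> (?P n \<cdot> Gen g)" by (rule assoc) (use w in auto)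
    also have "\<dots> \<approx> Gen g \<cdot> (Gen g \<cdot> ?P n)" by (rule eqv_comp_r[OF Suc]) (use w in auto)
    finally show ?case by simp
  qed
  show ?thesis
  proof (induction n)
    case (Suc n)
    have "flip (?P n) \<cdot> Gen g \<approx> ?P n \<cdot> Gen g" by (rule eqv_comp_l[OF Suc]) (use w in auto)
    also note c
    finally show ?case by simp
  qed auto
qed

lemma flip_dot_power: "flip (dot_power k) \<approx> dot_power k"
  unfolding dot_power_def by (rule flip_dots) auto

lemma cyc_poly_wt [simp]: "wt (cyc_poly n v)" "src (cyc_poly n v) = 1" "tgt (cyc_poly n v) = 1"
  by (induction n) auto

lemma commute_linear_factor:
  assumes f: "wt f" "src f = 1" "tgt f = 1" and c: "f \<cdot> Gen Dot \<approx> Gen Dot \<cdot> f"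
  shows "f \<cdot> (Gen Dot +. s *. Idt 1) \<approx> (Gen Dot +. s *. Idt 1) \<cdot> f"
proof -
  note [simp] = f
  have "f \<cdot> (Gen Dot +. s *. Idt 1) \<approx> f \<cdot> Gen Dot +. f \<cdot> (s *. Idt 1)"
    by (rule ak_eq.comp_add_right) (auto simp: arr_iff)
  also have "\<dots> \<approx> Gen Dot \<cdot> f +. (s *. Idt 1) \<cdot> f"
  proof (rule eqv_add[OF c])
    have "f \<cdot> (s *. Idt 1) \<approx> s *. (f \<cdot> Idt 1)" by (rule ak_eq.comp_scl_right) (auto simp: arr_iff)
    also have "\<dots> \<approx> s *. f" by (rule eqv_scl[OF id_r]) auto
    also have "\<dots> \<approx> s *. (Idt 1 \<cdot> f)" by (rule eqv_scl[OF eqv_sym[OF id_l]]) auto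
    also have "\<dots> \<approx> (s *. Idt 1) \<cdot> f" by (rule eqv_sym[OF ak_eq.comp_scl_left]) (auto simp: arr_iff)
    finally show "f \<cdot> (s *. Idt 1) \<approx> (s *. Idt 1) \<cdot> f" .
  qed auto
  also have "\<dots> \<approx> (Gen Dot +. s *. Idt 1) \<cdot> f"
    by (rule eqv_sym[OF ak_eq.comp_add_left]) (auto simp: arr_iff)
  finally show ?thesis .
qed

lemma cyc_poly_commute: "cyc_poly n v \<cdot> Gen Dot \<approx> Gen Dot \<cdot> cyc_poly n v"
proof (induction n)
  case 0
  have "Idt 1 \<cdot> Gen Dot \<approx> Gen Dot" by (rule id_l) auto
  also have "Gen Dot \<approx> Gen Dot \<cdot> Idt 1" by (rule eqv_sym[OF id_r]) auto
  finally show ?case by simp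
next
  case (Suc n)
  let ?L = "Gen Dot +. (- v (Suc n)) *. Idt 1"
  have "(?L \<cdot> cyc_poly n v) \<cdot> Gen Dot \<approx> ?L \<cdot> (cyc_poly n v \<cdot> Gen Dot)" by (rule assoc) auto
  also have "\<dots> \<approx> ?L \<cdot> (Gen Dot \<cdot> cyc_poly n v)" by (rule eqv_comp_r[OF Suc]) auto
  also have "\<dots> \<approx> (?L \<cdot> Gen Dot) \<cdot> cyc_poly n v" by (rule assoc') auto
  also have "\<dots> \<approx> (Gen Dot \<cdot> ?L) \<cdot> cyc_poly n v"
    by (intro eqv_comp_l eqv_sym[OF commute_linear_factor]) auto
  also have "\<dots> \<approx> Gen Dot \<cdot> (?L \<cdot> cyc_poly n v)" by (rule assoc) auto
  finally show ?case by simp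
qed

text \<open>Reflection reverses the order of the linear factors, which commute because each is a
  polynomial in the dot.\<close>

lemma flip_cyc_poly: "flip (cyc_poly n v) \<approx> cyc_poly n v"
proof (induction n)
  case (Suc n)
  let ?L = "Gen Dot +. (- v (Suc n)) *. Idt 1"
  have "flip (cyc_poly n v) \<cdot> ?L \<approx> cyc_poly n v \<cdot> ?L" by (rule eqv_comp_l[OF Suc]) auto
  also have "\<dots> \<approx> ?L \<cdot> cyc_poly n v" by (rule commute_linear_factor[OF _ _ _ cyc_poly_commute]) auto
  finally show ?case by simp
qed auto

abbreviation "ideal \<equiv> ck_ideal q \<delta> m u \<omega>"

text \<open>This lets reflection descend to the quotient. Both kinds of generators are fixed up to
  \<open>ak_eq\<close>, the two composition rules are exchanged, and tensoring on the right is
  respected because \<open>flip\<close> keeps left and right.\<close>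

lemma flip_ideal: "ideal f a b \<Longrightarrow> ideal (flip f) b a"
proof (induction rule: ck_ideal.induct)
  case gen_poly
  show ?case by (rule ck_ideal.ak[OF ck_ideal.gen_poly eqv_sym[OF flip_cyc_poly]])
next
  case (gen_bubble k)
  show ?case
  proof (rule ck_ideal.ak[OF ck_ideal.gen_bubble])
    have "Gen Cap \<cdot> (dot_power k \<star> Idt 1) \<cdot> Gen Cup \<approx> (Gen Cap \<cdot> (dot_power k \<star> Idt 1)) \<cdot> Gen Cup"
      by (rule assoc') auto
    also have "\<dots> \<approx> (Gen Cap \<cdot> (flip (dot_power k) \<star> Idt 1)) \<cdot> Gen Cup"
      by (intro eqv_comp_l eqv_comp_r eqv_tens_l eqv_sym[OF flip_dot_power]) auto
    finally show "Gen Cap \<cdot> (dot_power k \<star> Idt 1) \<cdot> Gen Cup +. (- \<omega> k) *. Idt 0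
      \<approx> flip (Gen Cap \<cdot> (dot_power k \<star> Idt 1) \<cdot> Gen Cup +. (- \<omega> k) *. Idt 0)"
      by (auto intro!: eqv_add)
  qed
qed (auto intro: ck_ideal.intros flip_eqv)

end

section \<open>Morphisms of the cyclotomic Kauffman category\<close>

context kauffman begin

abbreviation "rel \<equiv> ck_rel q \<delta> m u \<omega>"
abbreviation "cls \<equiv> ck_class q \<delta> m u \<omega>"
abbreviation "CC \<equiv> CK q \<delta> m u \<omega>"
abbreviation "Hom a b \<equiv> Homs CC a b"

lemma neg_neg: "wt f \<Longrightarrow> (- 1) *. (- 1) *. f \<approx> f"
proof -
  assume f: "wt f"
  have "(- 1) *. (- 1) *. f \<approx> ((- 1) * (- 1)) *. f"
    by (rule eqv_sym[OF ak_eq.scl_scl[of f "src f" "tgt f"]]) (simp add: arr_iff f)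
  also have "\<dots> \<approx> f" using ak_eq.scl_one[of f "src f" "tgt f"] f by (simp add: arr_iff)
  finally show ?thesis .
qed

lemma add_exch:
  assumes "arr f a b" "arr g a b" "arr h a b" "arr k a b"
  shows "(f +. g) +. (h +. k) \<approx> (f +. h) +. (g +. k)"
proof -
  note [simp] = assms[unfolded arr_iff]
  have "(f +. g) +. (h +. k) \<approx> f +. (g +. (h +. k))" by (rule ak_eq.add_assoc) (auto simp: arr_iff)
  also have "\<dots> \<approx> f +. (h +. (g +. k))"
  proof (rule eqv_add)
    have "g +. (h +. k) \<approx> (g +. h) +. k" by (rule eqv_sym[OF ak_eq.add_assoc]) (auto simp: arr_iff)
    also have "\<dots> \<approx> (h +. g) +. k" by (intro eqv_add ak_eq.add_comm) (auto simp: arr_iff)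
    also have "\<dots> \<approx> h +. (g +. k)" by (rule ak_eq.add_assoc) (auto simp: arr_iff)
    finally show "g +. (h +. k) \<approx> h +. (g +. k)" .
  qed auto
  also have "\<dots> \<approx> (f +. h) +. (g +. k)" by (rule eqv_sym[OF ak_eq.add_assoc]) (auto simp: arr_iff)
  finally show ?thesis .
qed

text \<open>The cancellation behind the transitivity of \<open>ck_rel\<close>.\<close>

lemma add_telescope:
  assumes "arr f a b" "arr g a b" "arr h a b"
  shows "(f +. (- 1) *. g) +. (g +. (- 1) *. h) \<approx> f +. (- 1) *. h"
proof -
  note [simp] = assms[unfolded arr_iff]
  have "(f +. (- 1) *. g) +. (g +. (- 1) *. h) \<approx> (f +. (- 1) *. g) +. ((- 1) *. h +. g)"
    by (intro eqv_add ak_eq.add_comm) (auto simp: arr_iff)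
  also have "\<dots> \<approx> (f +. (- 1) *. h) +. ((- 1) *. g +. g)"
    by (rule add_exch[of _ a b]) (auto simp: arr_iff)
  also have "\<dots> \<approx> (f +. (- 1) *. h) +. (g +. (- 1) *. g)"
    by (intro eqv_add ak_eq.add_comm) (auto simp: arr_iff)
  also have "\<dots> \<approx> (f +. (- 1) *. h) +. Zer a b"
    by (intro eqv_add ak_eq.add_neg) (auto simp: arr_iff)
  also have "\<dots> \<approx> f +. (- 1) *. h" by (rule ak_eq.add_zero) (auto simp: arr_iff)
  finally show ?thesis .
qed

lemma eqv_rel: "f \<approx> g \<Longrightarrow> arr f a b \<Longrightarrow> (f, g) \<in> rel a b"
proof -
  assume fg: "f \<approx> g" and f: "arr f a b"
  then have g: "arr g a b" using ak_eq_arr by blast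
  note [simp] = f[unfolded arr_iff] g[unfolded arr_iff]
  have "Zer a b \<approx> f +. (- 1) *. f" by (rule eqv_sym[OF ak_eq.add_neg[OF f]])
  also have "\<dots> \<approx> f +. (- 1) *. g" by (intro eqv_add eqv_scl fg) auto
  finally show ?thesis using ck_ideal.ak[OF ck_ideal.zero] f g by (auto simp: ck_rel_def)
qed

lemma equiv_rel: "equiv {f. arr f a b} (rel a b)"
proof (rule equivI)
  show "refl_on {f. arr f a b} (rel a b)"
    by (auto simp: refl_on_def arr_iff intro!: eqv_rel)
  show "sym (rel a b)"
  proof (rule symI)
    fix f g assume "(f, g) \<in> rel a b"
    then have f: "arr f a b" and g: "arr g a b" and i: "ideal (f +. (- 1) *. g) a b"
      by (auto simp: ck_rel_def)
    note [simp] = f[unfolded arr_iff] g[unfolded arr_iff]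
    have "(- 1) *. (f +. (- 1) *. g) \<approx> (- 1) *. f +. (- 1) *. (- 1) *. g"
      by (rule ak_eq.scl_add) (auto simp: arr_iff)
    also have "\<dots> \<approx> (- 1) *. f +. g" by (intro eqv_add neg_neg) auto
    also have "\<dots> \<approx> g +. (- 1) *. f" by (rule ak_eq.add_comm) (auto simp: arr_iff)
    finally show "(g, f) \<in> rel a b"
      using ck_ideal.ak[OF ck_ideal.scl[OF i]] f g by (auto simp: ck_rel_def)
  qed
  show "trans (rel a b)"
  proof (rule transI)
    fix f g h assume "(f, g) \<in> rel a b" "(g, h) \<in> rel a b"
    then have "arr f a b" "arr g a b" "arr h a b"
      "ideal (f +. (- 1) *. g) a b" "ideal (g +. (- 1) *. h) a b" by (auto simp: ck_rel_def)
    then show "(f, h) \<in> rel a b"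
      using ck_ideal.ak[OF ck_ideal.add add_telescope] by (simp add: ck_rel_def)
  qed
  show "rel a b \<subseteq> {f. arr f a b} \<times> {f. arr f a b}" by (auto simp: ck_rel_def)
qed

lemma rel_trans: "(f, g) \<in> rel a b \<Longrightarrow> (g, h) \<in> rel a b \<Longrightarrow> (f, h) \<in> rel a b"
  using equiv_rel[of a b] unfolding equiv_def trans_def by blast

lemma rel_arr: "(f, g) \<in> rel a b \<Longrightarrow> arr f a b \<and> arr g a b"
  by (auto simp: ck_rel_def)

lemma rel_scl: "(f, f') \<in> rel a b \<Longrightarrow> (c *. f, c *. f') \<in> rel a b"
proof -
  assume r: "(f, f') \<in> rel a b"
  then have f: "arr f a b" and g: "arr f' a b" and i: "ideal (f +. (- 1) *. f') a b"
    by (auto simp: ck_rel_def)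
  note [simp] = f[unfolded arr_iff] g[unfolded arr_iff]
  have "c *. (f +. (- 1) *. f') \<approx> c *. f +. c *. (- 1) *. f'" by (rule ak_eq.scl_add) (auto simp: arr_iff)
  also have "\<dots> \<approx> c *. f +. (- 1) *. c *. f'"
  proof (rule eqv_add)
    have "c *. (- 1) *. f' \<approx> (c * (- 1)) *. f'" by (rule eqv_sym[OF ak_eq.scl_scl]) (rule g)
    also have "\<dots> = (- 1 * c) *. f'" by simp
    also have "\<dots> \<approx> (- 1) *. c *. f'" by (rule ak_eq.scl_scl[OF g])
    finally show "c *. (- 1) *. f' \<approx> (- 1) *. c *. f'" .
  qed auto
  finally show ?thesis
    using ck_ideal.ak[OF ck_ideal.scl[OF i]] by (auto simp: ck_rel_def arr_iff)
qed

lemma rel_add: "(f, f') \<in> rel a b \<Longrightarrow> (g, g') \<in> rel a b \<Longrightarrow> (f +. g, f' +. g') \<in> rel a b"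
proof -
  assume r: "(f, f') \<in> rel a b" "(g, g') \<in> rel a b"
  then have i: "ideal (f +. (- 1) *. f') a b" "ideal (g +. (- 1) *. g') a b"
    and [simp]: "wt f" "wt f'" "wt g" "wt g'" "src f = a" "tgt f = b" "src f' = a" "tgt f' = b"
      "src g = a" "tgt g = b" "src g' = a" "tgt g' = b"
    by (auto simp: ck_rel_def arr_iff)
  have "(f +. (- 1) *. f') +. (g +. (- 1) *. g') \<approx> (f +. g) +. ((- 1) *. f' +. (- 1) *. g')"
    by (rule add_exch[of _ a b]) (auto simp: arr_iff)
  also have "\<dots> \<approx> (f +. g) +. (- 1) *. (f' +. g')"
    by (intro eqv_add eqv_sym[OF ak_eq.scl_add[of _ a b]]) (auto simp: arr_iff)
  finally show ?thesis
    using ck_ideal.ak[OF ck_ideal.add[OF i]] by (auto simp: ck_rel_def arr_iff)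
qed

text \<open>The two factors are replaced one after the other, using closure of the ideal under
  composition from the left for \<open>f\<close> and from the right for \<open>g\<close>.\<close>

lemma rel_comp: "(f, f') \<in> rel a b \<Longrightarrow> (g, g') \<in> rel b c \<Longrightarrow> (g \<cdot> f, g' \<cdot> f') \<in> rel a c"
proof -
  assume r: "(f, f') \<in> rel a b" "(g, g') \<in> rel b c"
  then have i: "ideal (f +. (- 1) *. f') a b" "ideal (g +. (- 1) *. g') b c"
    and [simp]: "wt f" "wt f'" "wt g" "wt g'" "src f = a" "tgt f = b" "src f' = a" "tgt f' = b"
      "src g = b" "tgt g = c" "src g' = b" "tgt g' = c"
    by (auto simp: ck_rel_def arr_iff)
  have "g' \<cdot> (f +. (- 1) *. f') \<approx> g' \<cdot> f +. g' \<cdot> ((- 1) *. f')"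
    by (rule ak_eq.comp_add_right[of _ a b _ _ c]) (auto simp: arr_iff)
  also have "\<dots> \<approx> g' \<cdot> f +. (- 1) *. (g' \<cdot> f')"
    by (intro eqv_add ak_eq.comp_scl_right[of _ a b _ c]) (auto simp: arr_iff)
  finally have 1: "(g' \<cdot> f, g' \<cdot> f') \<in> rel a c"
    using ck_ideal.ak[OF ck_ideal.comp_left[OF i(1), of g' c]] by (auto simp: ck_rel_def arr_iff)
  have "(g +. (- 1) *. g') \<cdot> f \<approx> g \<cdot> f +. ((- 1) *. g') \<cdot> f"
    by (rule ak_eq.comp_add_left[of _ a b _ c]) (auto simp: arr_iff)
  also have "\<dots> \<approx> g \<cdot> f +. (- 1) *. (g' \<cdot> f)"
    by (intro eqv_add ak_eq.comp_scl_left[of _ a b _ c]) (auto simp: arr_iff)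
  finally have 2: "(g \<cdot> f, g' \<cdot> f) \<in> rel a c"
    using ck_ideal.ak[OF ck_ideal.comp_right[OF i(2), of f a]] by (auto simp: ck_rel_def arr_iff)
  from 2 1 show ?thesis by (rule rel_trans)
qed

lemma rel_flip: "(f, g) \<in> rel a b \<Longrightarrow> (flip f, flip g) \<in> rel b a"
  using flip_ideal[of "f +. (- 1) *. g"] by (auto simp: ck_rel_def)

lemma in_cls: "g \<in> cls a b f \<longleftrightarrow> (f, g) \<in> rel a b"
  by (auto simp: ck_class_def)

lemma cls_eq_iff: "arr f a b \<Longrightarrow> arr g a b \<Longrightarrow> cls a b f = cls a b g \<longleftrightarrow> (f, g) \<in> rel a b"
  unfolding ck_class_def using eq_equiv_class_iff[OF equiv_rel] by blast

lemma cls_eqI: "f \<approx> g \<Longrightarrow> arr f a b \<Longrightarrow> cls a b f = cls a b g"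
  using cls_eq_iff eqv_rel ak_eq_arr by blast

lemma cls_rel: "(f, g) \<in> rel a b \<Longrightarrow> cls a b g = cls a b f"
  using cls_eq_iff rel_arr by blast

lemma self_in_cls: "arr f a b \<Longrightarrow> f \<in> cls a b f"
  using eqv_rel[OF eqv_refl, of f a b] by (simp add: in_cls arr_iff)

text \<open>The operations of \<open>CK\<close> are unions over all representatives. A family that
  is constant on a nonempty class has that constant as its union, so the unions disappear once
  compatibility with the relation is known.\<close>

lemma UN_cls:
  assumes "arr f a b" "\<And>f'. (f, f') \<in> rel a b \<Longrightarrow> F f' = Z"
  shows "(\<Union>f'\<in>cls a b f. F f') = Z"
proof -
  have "F f' = Z" if "f' \<in> cls a b f" for f' using assms(2) that by (simp add: in_cls)
  with self_in_cls[OF assms(1)] show ?thesis by auto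
qed

lemma UN2_cls:
  assumes "arr f a b" "arr g c d"
    "\<And>f' g'. (f, f') \<in> rel a b \<Longrightarrow> (g, g') \<in> rel c d \<Longrightarrow> F f' g' = Z"
  shows "(\<Union>f'\<in>cls a b f. \<Union>g'\<in>cls c d g. F f' g') = Z"
  using assms by (intro UN_cls)

lemma carrier_Hom: "carrier (Hom a b) = {cls a b f | f. arr f a b}"
  by (auto simp: CK_def quotient_def ck_class_def)

lemma cls_in_Hom [simp]: "arr f a b \<Longrightarrow> cls a b f \<in> carrier (Hom a b)"
  by (auto simp: carrier_Hom)

lemma Hom_cases:
  assumes "X \<in> carrier (Hom a b)" obtains f where "arr f a b" "X = cls a b f"
  using assms by (auto simp: carrier_Hom)

lemma zero_cls: "\<zero>\<^bsub>Hom a b\<^esub> = cls a b (Zer a b)"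
  by (simp add: CK_def)

lemma Ide_cls: "Ide CC a = cls a a (Idt a)"
  by (simp add: CK_def)

lemma CK_ops:
  "X \<oplus>\<^bsub>Hom a b\<^esub> Y = (\<Union>f\<in>X. \<Union>g\<in>Y. cls a b (f +. g))"
  "s \<odot>\<^bsub>Hom a b\<^esub> X = (\<Union>f\<in>X. cls a b (s *. f))"
  "Cmp CC a b c Y X = (\<Union>g\<in>Y. \<Union>f\<in>X. cls a c (g \<cdot> f))"
  by (simp_all add: CK_def del: UN_simps)

lemma add_cls: "arr f a b \<Longrightarrow> arr g a b \<Longrightarrow> cls a b f \<oplus>\<^bsub>Hom a b\<^esub> cls a b g = cls a b (f +. g)"
  unfolding CK_ops by (rule UN2_cls) (assumption | erule (1) cls_rel[OF rel_add])+

lemma scl_cls: "arr f a b \<Longrightarrow> s \<odot>\<^bsub>Hom a b\<^esub> cls a b f = cls a b (s *. f)"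
  unfolding CK_ops by (rule UN_cls) (assumption | erule cls_rel[OF rel_scl])+

lemma Cmp_cls: "arr f a b \<Longrightarrow> arr g b c \<Longrightarrow> Cmp CC a b c (cls b c g) (cls a b f) = cls a c (g \<cdot> f)"
  unfolding CK_ops by (rule UN2_cls) (assumption | erule (1) cls_rel[OF rel_comp, rotated])+

lemma Obj_CC [simp]: "Obj CC = UNIV"
  by (simp add: CK_def)

lemma arr_simps [simp]:
  "arr f a b \<Longrightarrow> arr g a b \<Longrightarrow> arr (f +. g) a b" "arr f a b \<Longrightarrow> arr (s *. f) a b"
  "arr f a b \<Longrightarrow> arr g b c \<Longrightarrow> arr (g \<cdot> f) a c" "arr (Zer a b) a b" "arr (Idt a) a a"
  "arr g b c \<Longrightarrow> arr f a b \<Longrightarrow> arr (g \<cdot> f) a c"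
  "arr f a b \<Longrightarrow> arr (f \<cdot> Idt a) a b" "arr f a b \<Longrightarrow> arr (Idt b \<cdot> f) a b"
  by (auto simp: arr_iff)

lemma Hom_vectorspace: "vectorspace class_ring (Hom a b)"
proof (rule vs_criteria, goal_cases)
  case 1 show ?case by (rule class_field)
next
  case 2 show ?case by (simp add: zero_cls)
next
  case 3 show ?case by (auto elim!: Hom_cases simp: add_cls)
next
  case 4
  show ?case
  proof
    fix v assume "v \<in> carrier (Hom a b)"
    then obtain f where f: "arr f a b" "v = cls a b f" by (rule Hom_cases)
    then show "\<exists>w\<in>carrier (Hom a b). v \<oplus>\<^bsub>Hom a b\<^esub> w = \<zero>\<^bsub>Hom a b\<^esub>"
      by (intro bexI[of _ "cls a b ((- 1) *. f)"])
        (auto simp: add_cls zero_cls intro!: cls_eqI ak_eq.add_neg del: equalityI)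
  qed
next
  case 5 show ?case by (auto elim!: Hom_cases simp: scl_cls)
next
  case 6 show ?case by (auto elim!: Hom_cases simp: add_cls intro!: cls_eqI ak_eq.add_comm del: equalityI)
next
  case 7 show ?case by (auto elim!: Hom_cases simp: add_cls intro!: cls_eqI ak_eq.add_assoc del: equalityI)
next
  case 8 show ?case by (auto elim!: Hom_cases simp: add_cls zero_cls intro!: cls_eqI ak_eq.add_zero del: equalityI)
next
  case 9 show ?case by (auto elim!: Hom_cases simp: scl_cls class_ring_simps intro!: cls_eqI ak_eq.scl_scl del: equalityI)
next
  case 10 show ?case by (auto elim!: Hom_cases simp: scl_cls class_ring_simps intro!: cls_eqI ak_eq.scl_one del: equalityI)
next
  case 11 show ?case by (auto elim!: Hom_cases simp: scl_cls add_cls class_ring_simps intro!: cls_eqI ak_eq.add_scl del: equalityI)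
next
  case 12 show ?case by (auto elim!: Hom_cases simp: scl_cls add_cls intro!: cls_eqI ak_eq.scl_add del: equalityI)
qed

lemma linear_category_CK: "linear_category CC"
proof (rule linear_category.intro, goal_cases)
  case (1 a b) show ?case by (rule Hom_vectorspace)
next
  case (2 a) show ?case by (simp add: Ide_cls)
next
  case (3 a b c f g) then show ?case by (auto elim!: Hom_cases simp: Cmp_cls)
next
  case (4 a b f) then show ?case
    by (auto elim!: Hom_cases simp: Cmp_cls Ide_cls intro!: cls_eqI ak_eq.comp_id_right del: equalityI)
next
  case (5 a b f) then show ?case
    by (auto elim!: Hom_cases simp: Cmp_cls Ide_cls intro!: cls_eqI ak_eq.comp_id_left del: equalityI)
next
  case (6 a b c d f g h) then show ?case
    by (auto elim!: Hom_cases simp: Cmp_cls intro!: cls_eqI ak_eq.comp_assoc del: equalityI)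
next
  case (7 a b c f) then show ?case
    by (auto elim!: Hom_cases simp: Cmp_cls LinearCombinations.module_hom_def add_cls scl_cls
        intro!: cls_eqI ak_eq.comp_add_left ak_eq.comp_scl_left del: equalityI)
next
  case (8 a b c g) then show ?case
    by (auto elim!: Hom_cases simp: Cmp_cls LinearCombinations.module_hom_def add_cls scl_cls
        intro!: cls_eqI ak_eq.comp_add_right ak_eq.comp_scl_right del: equalityI)
qed

section \<open>Reflection on the quotient category\<close>

definition flip_cls :: "'k tm set \<Rightarrow> 'k tm set" where "flip_cls X = flip ` X"

text \<open>Since \<open>flip\<close> is a bijection on terms that respects the relation in both
  directions, the image of a class is a whole class and no closure has to be taken.\<close>

lemma flip_cls_cls: "flip_cls (cls a b f) = cls b a (flip f)"
proof -
  have e: "(flip f, g) \<in> rel b a \<longleftrightarrow> (f, flip g) \<in> rel a b" for g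
    using rel_flip[of "flip f" g b a] rel_flip[of f "flip g" a b] by auto
  have "cls b a (flip f) = {g. flip g \<in> cls a b f}"
    by (rule Set.set_eqI) (simp only: in_cls mem_Collect_eq e)
  also have "\<dots> = flip ` cls a b f" 
  proof
    show "{g. flip g \<in> cls a b f} \<subseteq> flip ` cls a b f"
    proof
      fix g assume "g \<in> {g. flip g \<in> cls a b f}"
      then show "g \<in> flip ` cls a b f" by (intro image_eqI[of _ _ "flip g"]) simp_all
    qed
  qed auto
  finally show ?thesis by (simp add: flip_cls_def)
qed

lemma flip_cls_involutive [simp]: "flip_cls (flip_cls X) = X"
  by (auto simp: flip_cls_def image_image)

lemma flip_cls_closed [simp]: "X \<in> carrier (Hom a b) \<Longrightarrow> flip_cls X \<in> carrier (Hom b a)"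
  by (auto elim!: Hom_cases simp: flip_cls_cls)

lemma flip_cls_hom: "flip_cls \<in> LinearCombinations.module_hom class_ring (Hom a b) (Hom b a)"
  by (auto elim!: Hom_cases simp: LinearCombinations.module_hom_def flip_cls_cls add_cls scl_cls del: equalityI)

lemma flip_cls_Cmp: "X \<in> carrier (Hom a b) \<Longrightarrow> Y \<in> carrier (Hom b c)
   \<Longrightarrow> flip_cls (Cmp CC a b c Y X) = Cmp CC c b a (flip_cls X) (flip_cls Y)"
  by (auto elim!: Hom_cases simp: flip_cls_cls Cmp_cls del: equalityI)

lemma flip_cls_Ide: "flip_cls (Ide CC a) = Ide CC a"
  by (simp add: Ide_cls flip_cls_cls)

end

section \<open>The algebra of a category with a triangular basis\<close>

lemma lookup_scale [simp]: "Poly_Mapping.lookup (Poly_Mapping.map ((*) (c::'k::field)) p) t = c * Poly_Mapping.lookup p t"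
  by (simp add: Poly_Mapping.map.rep_eq when_def)

lemma free_space_simps [simp]:
  "carrier (free_space S) = {p. Poly_Mapping.keys p \<subseteq> S}"
  "add (free_space S) = (+)" "zero (free_space S) = 0"
  "c \<odot>\<^bsub>free_space S\<^esub> p = Poly_Mapping.map ((*) c) p"
  by (simp_all add: free_space_def)

lemma keys_scale: "Poly_Mapping.keys (Poly_Mapping.map ((*) (c::'k::field)) p) \<subseteq> Poly_Mapping.keys p"
  by (auto simp: in_keys_iff)

lemma free_space_vectorspace: "vectorspace class_ring (free_space S)"
proof (rule vs_criteria, goal_cases)
  case 1 show ?case by (rule class_field)
next
  case 3 show ?case using Poly_Mapping.keys_add by fastforce
next
  case 4
  show ?case
  proof
    fix v assume "v \<in> carrier (free_space S)"
    then show "\<exists>w\<in>carrier (free_space S). v \<oplus>\<^bsub>free_space S\<^esub> w = \<zero>\<^bsub>free_space S\<^esub>"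
      by (intro bexI[of _ "- v"]) (auto simp: in_keys_iff)
  qed
next
  case 5 show ?case using keys_scale by fastforce
qed (auto intro!: poly_mapping_eqI simp: lookup_add algebra_simps)

text \<open>The first isomorphism theorem in the encoding of \<open>quotient_space\<close>. A
  homomorphism with kernel \<open>N\<close> is constant on cosets, so each image is a singleton and
  \<open>the_elem\<close> returns the induced value; \<open>mult_map\<close> has this shape.\<close>

lemma quotient_map_iso:
  fixes F :: "('k::field, 'v) module" and A :: "('k, 'w) module"
  assumes F: "Module.module class_ring F" and A: "Module.module class_ring A" and N: "submodule class_ring N F"
    and hom: "\<phi> \<in> LinearCombinations.module_hom class_ring F A"
    and ker: "\<And>p. p \<in> carrier F \<Longrightarrow> \<phi> p = \<zero>\<^bsub>A\<^esub> \<longleftrightarrow> p \<in> N"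
    and surj: "\<phi> ` carrier F = carrier A"
  shows "(\<lambda>X. the_elem (\<phi> ` X)) \<in> LinearCombinations.module_hom class_ring (quotient_space F N) A"
    and "bij_betw (\<lambda>X. the_elem (\<phi> ` X)) (carrier (quotient_space F N)) (carrier A)"
proof -
  interpret F: Module.module class_ring F by (rule F)
  interpret A: Module.module class_ring A by (rule A)
  interpret h: mod_hom class_ring F A \<phi>
    using F A hom by (simp add: mod_hom_def mod_hom_axioms_def)
  interpret N: LinearCombinations.submodule class_ring N F by (rule N)
  have neg: "\<ominus>\<^bsub>F\<^esub> v \<in> N" if "v \<in> N" for v
  proof -
    have "(- 1) \<odot>\<^bsub>F\<^esub> v \<in> N" using that by (intro N.smult_closed) simp_all
    moreover have "(- 1) \<odot>\<^bsub>F\<^esub> v = \<ominus>\<^bsub>F\<^esub> v"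
      using that N.subset F.smult_minus_1[of v] by (auto simp: class_ring_simps)
    ultimately show ?thesis by simp
  qed
  have sg: "subgroup N (add_monoid F)"
  proof (rule F.add.subgroupI)
    show "N \<noteq> {}" using N.zero_closed by blast
  qed (use N.subset neg N.m_closed in \<open>auto simp: a_inv_def[symmetric]\<close>)
  have ag: "additive_subgroup N F" by (rule additive_subgroup.intro) (rule sg)
  interpret S: abelian_subgroup N F
    by (rule abelian_subgroupI3[OF ag]) (rule F.abelian_group_axioms)
  have coset: "N +>\<^bsub>F\<^esub> p = {n \<oplus>\<^bsub>F\<^esub> p | n. n \<in> N}" for p
    by (auto simp: a_r_coset_def')
  have img: "\<phi> ` (N +>\<^bsub>F\<^esub> p) = {\<phi> p}" if p: "p \<in> carrier F" for p
  proof -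
    have eq: "\<phi> (n \<oplus>\<^bsub>F\<^esub> p) = \<phi> p" if "n \<in> N" for n
      using that p N.subset ker[of n] by (auto simp: h.f_add)
    have "\<phi> (\<zero>\<^bsub>F\<^esub> \<oplus>\<^bsub>F\<^esub> p) \<in> \<phi> ` {n \<oplus>\<^bsub>F\<^esub> p | n. n \<in> N}" using N.zero_closed by blast
    then have "\<phi> p \<in> \<phi> ` {n \<oplus>\<^bsub>F\<^esub> p | n. n \<in> N}" using eq[OF N.zero_closed] by simp
    then show ?thesis unfolding coset using eq by blast
  qed
  have el: "the_elem (\<phi> ` (N +>\<^bsub>F\<^esub> p)) = \<phi> p" if "p \<in> carrier F" for p
    using img[OF that] by simp
  have carr: "carrier (quotient_space F N) = (\<lambda>p. N +>\<^bsub>F\<^esub> p) ` carrier F"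
    by (auto simp: quotient_space_def A_RCOSETS_def')
  have add: "(N +>\<^bsub>F\<^esub> p) \<oplus>\<^bsub>quotient_space F N\<^esub> (N +>\<^bsub>F\<^esub> p') = N +>\<^bsub>F\<^esub> (p \<oplus>\<^bsub>F\<^esub> p')"
    if "p \<in> carrier F" "p' \<in> carrier F" for p p'
    using that by (simp add: quotient_space_def S.a_rcos_sum)
  \<comment> \<open>The extra summand \<open>N\<close> in the scalar multiplication is absorbed by
    the coset, also for the scalar \<open>0\<close>, where elementwise scaling alone would give too
    small a set.\<close>
  have scl: "c \<odot>\<^bsub>quotient_space F N\<^esub> (N +>\<^bsub>F\<^esub> p) = N +>\<^bsub>F\<^esub> (c \<odot>\<^bsub>F\<^esub> p)"
    if p: "p \<in> carrier F" for c p
  proof -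
    have "N <+>\<^bsub>F\<^esub> ((\<lambda>v. c \<odot>\<^bsub>F\<^esub> v) ` (N +>\<^bsub>F\<^esub> p)) = {n \<oplus>\<^bsub>F\<^esub> c \<odot>\<^bsub>F\<^esub> (n' \<oplus>\<^bsub>F\<^esub> p) | n n'. n \<in> N \<and> n' \<in> N}"
      by (force simp: set_add_def' coset)
    also have "\<dots> = {n \<oplus>\<^bsub>F\<^esub> c \<odot>\<^bsub>F\<^esub> p | n. n \<in> N}"
    proof (intro equalityI subsetI)
      fix v assume "v \<in> {n \<oplus>\<^bsub>F\<^esub> c \<odot>\<^bsub>F\<^esub> (n' \<oplus>\<^bsub>F\<^esub> p) | n n'. n \<in> N \<and> n' \<in> N}"
      then obtain n n' where n: "n \<in> N" "n' \<in> N" "v = n \<oplus>\<^bsub>F\<^esub> c \<odot>\<^bsub>F\<^esub> (n' \<oplus>\<^bsub>F\<^esub> p)" by blast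
      have "n \<in> carrier F" "n' \<in> carrier F" using n N.subset by auto
      then have "v = (n \<oplus>\<^bsub>F\<^esub> c \<odot>\<^bsub>F\<^esub> n') \<oplus>\<^bsub>F\<^esub> c \<odot>\<^bsub>F\<^esub> p"
        using n p by (simp add: F.smult_r_distr F.a_assoc class_ring_simps)
      moreover have "n \<oplus>\<^bsub>F\<^esub> c \<odot>\<^bsub>F\<^esub> n' \<in> N" using n by (simp add: class_ring_simps)
      ultimately show "v \<in> {n \<oplus>\<^bsub>F\<^esub> c \<odot>\<^bsub>F\<^esub> p | n. n \<in> N}" by blast
    next
      fix v assume "v \<in> {n \<oplus>\<^bsub>F\<^esub> c \<odot>\<^bsub>F\<^esub> p | n. n \<in> N}"
      then obtain n where "n \<in> N" "v = n \<oplus>\<^bsub>F\<^esub> c \<odot>\<^bsub>F\<^esub> (\<zero>\<^bsub>F\<^esub> \<oplus>\<^bsub>F\<^esub> p)" using p by auto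
      moreover have "\<zero>\<^bsub>F\<^esub> \<in> N" by simp
      ultimately show "v \<in> {n \<oplus>\<^bsub>F\<^esub> c \<odot>\<^bsub>F\<^esub> (n' \<oplus>\<^bsub>F\<^esub> p) | n n'. n \<in> N \<and> n' \<in> N}" by blast
    qed
    finally show ?thesis by (simp add: quotient_space_def coset)
  qed
  show "(\<lambda>X. the_elem (\<phi> ` X)) \<in> LinearCombinations.module_hom class_ring (quotient_space F N) A"
    unfolding LinearCombinations.module_hom_def
    using carr by (auto simp: el add scl h.f_add h.f_smult class_ring_simps)
  show "bij_betw (\<lambda>X. the_elem (\<phi> ` X)) (carrier (quotient_space F N)) (carrier A)"
  proof (rule bij_betw_imageI)
    show "inj_on (\<lambda>X. the_elem (\<phi> ` X)) (carrier (quotient_space F N))"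
    proof (rule inj_onI)
      fix X Y assume "X \<in> carrier (quotient_space F N)" "Y \<in> carrier (quotient_space F N)"
        and eq: "the_elem (\<phi> ` X) = the_elem (\<phi> ` Y)"
      then obtain p p' where p: "p \<in> carrier F" "X = N +>\<^bsub>F\<^esub> p" "p' \<in> carrier F" "Y = N +>\<^bsub>F\<^esub> p'"
        unfolding carr by blast
      then have "\<phi> p = \<phi> p'" using eq el by simp
      then have "\<phi> (p \<ominus>\<^bsub>F\<^esub> p') = \<zero>\<^bsub>A\<^esub>" using p by (simp add: A.r_neg a_minus_def)
      then have "p \<ominus>\<^bsub>F\<^esub> p' \<in> N" using iffD1[OF ker[OF F.minus_closed[OF p(1,3)]]] by blast
      then have "p \<in> N +>\<^bsub>F\<^esub> p'" unfolding coset using p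
        by (auto intro!: exI[of _ "p \<ominus>\<^bsub>F\<^esub> p'"] simp: a_minus_def F.a_assoc F.l_neg)
      then show "X = Y" using F.a_repr_independence[OF _ p(3) sg, of p] p(2,4) by simp
    qed
    show "(\<lambda>X. the_elem (\<phi> ` X)) ` carrier (quotient_space F N) = carrier A"
      unfolding carr surj[symmetric] by (force simp: el)
  qed
qed

lemma (in Module.module) submodule_finsum:
  assumes N: "submodule R N M" and s: "\<And>i. i \<in> F \<Longrightarrow> s i \<in> N"
  shows "(\<Oplus>\<^bsub>M\<^esub>i\<in>F. s i) \<in> N"
proof -
  interpret N: LinearCombinations.submodule R N M by (rule N)
  show ?thesis using s
  proof (induction F rule: infinite_finite_induct)
    case (insert i F)
    then have "s \<in> F \<rightarrow> carrier M" "s i \<in> carrier M" using N.subset by auto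
    then show ?case using insert by simp
  qed (use N.zero_closed in auto)
qed

text \<open>Taking every element of the type as an object removes the clauses about
  \<open>undefined\<close> from the associated algebra; \<open>CK\<close> has this property.\<close>

locale lin_cat = linear_category C for C :: "('k::field, 'o, 'm) lincat" +
  assumes Obj_UNIV: "Obj C = UNIV"
begin

abbreviation "H a b \<equiv> Homs C a b"
abbreviation "A \<equiv> assoc_algebra C"

sublocale H: vectorspace class_ring "Homs C a b" for a b
  using hom_vs[of a b] Obj_UNIV by simp

lemma smult_closed_H [simp]: "x \<in> carrier (H a b) \<Longrightarrow> s \<odot>\<^bsub>H a b\<^esub> x \<in> carrier (H a b)"
  by (rule H.smult_closed) simp_all

lemma smult_one_H [simp]: "x \<in> carrier (H a b) \<Longrightarrow> 1 \<odot>\<^bsub>H a b\<^esub> x = x"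
  using H.smult_one[of x a b] by (simp add: class_ring_simps)

lemma smult_0_H [simp]: "x \<in> carrier (H a b) \<Longrightarrow> 0 \<odot>\<^bsub>H a b\<^esub> x = \<zero>\<^bsub>H a b\<^esub>"
  using H.lmult_0[of x a b] by (simp add: class_ring_simps)

lemma smult_r_0_H [simp]: "s \<odot>\<^bsub>H a b\<^esub> \<zero>\<^bsub>H a b\<^esub> = \<zero>\<^bsub>H a b\<^esub>"
  by (rule H.rmult_0) simp

lemma Ide_closed [simp]: "Ide C a \<in> carrier (H a a)"
  using ide_closed[of a] Obj_UNIV by simp

lemma Cmp_closed [simp]: "f \<in> carrier (H a b) \<Longrightarrow> g \<in> carrier (H b c) \<Longrightarrow> Cmp C a b c g f \<in> carrier (H a c)"
  using cmp_closed[of a b c f g] Obj_UNIV by simp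

lemma Cmp_Ide [simp]: "f \<in> carrier (H a b) \<Longrightarrow> Cmp C a a b f (Ide C a) = f"
  "f \<in> carrier (H a b) \<Longrightarrow> Cmp C a b b (Ide C b) f = f"
  using cmp_ide_right[of a b f] cmp_ide_left[of a b f] Obj_UNIV by simp_all

lemma Cmp_add:
  "f \<in> carrier (H a b) \<Longrightarrow> g \<in> carrier (H b c) \<Longrightarrow> g' \<in> carrier (H b c)
    \<Longrightarrow> Cmp C a b c (g \<oplus>\<^bsub>H b c\<^esub> g') f = Cmp C a b c g f \<oplus>\<^bsub>H a c\<^esub> Cmp C a b c g' f"
  "f \<in> carrier (H a b) \<Longrightarrow> f' \<in> carrier (H a b) \<Longrightarrow> g \<in> carrier (H b c)
    \<Longrightarrow> Cmp C a b c g (f \<oplus>\<^bsub>H a b\<^esub> f') = Cmp C a b c g f \<oplus>\<^bsub>H a c\<^esub> Cmp C a b c g f'"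
  using LinearCombinations.module_hom_add[OF cmp_linear_left[of a b c f]]
    LinearCombinations.module_hom_add[OF cmp_linear_right[of a b c g]] Obj_UNIV by simp_all

lemma Cmp_smult:
  "f \<in> carrier (H a b) \<Longrightarrow> g \<in> carrier (H b c)
    \<Longrightarrow> Cmp C a b c (s \<odot>\<^bsub>H b c\<^esub> g) f = s \<odot>\<^bsub>H a c\<^esub> Cmp C a b c g f"
  "f \<in> carrier (H a b) \<Longrightarrow> g \<in> carrier (H b c)
    \<Longrightarrow> Cmp C a b c g (s \<odot>\<^bsub>H a b\<^esub> f) = s \<odot>\<^bsub>H a c\<^esub> Cmp C a b c g f"
  using LinearCombinations.module_hom_smult[OF cmp_linear_left[of a b c f]]
    LinearCombinations.module_hom_smult[OF cmp_linear_right[of a b c g]] Obj_UNIV by simp_all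

lemma Cmp_zero [simp]:
  "f \<in> carrier (H a b) \<Longrightarrow> Cmp C a b c \<zero>\<^bsub>H b c\<^esub> f = \<zero>\<^bsub>H a c\<^esub>"
  "g \<in> carrier (H b c) \<Longrightarrow> Cmp C a b c g \<zero>\<^bsub>H a b\<^esub> = \<zero>\<^bsub>H a c\<^esub>"
  using Cmp_smult(1)[of f a b "\<zero>\<^bsub>H b c\<^esub>" c 0] Cmp_smult(2)[of "\<zero>\<^bsub>H a b\<^esub>" a b g c 0] by simp_all

definition supp :: "('o \<Rightarrow> 'o \<Rightarrow> 'm) \<Rightarrow> ('o \<times> 'o) set" where
  "supp x = {(a, b). x a b \<noteq> \<zero>\<^bsub>H b a\<^esub>}"

lemma in_supp: "(a, b) \<in> supp x \<longleftrightarrow> x a b \<noteq> \<zero>\<^bsub>H b a\<^esub>"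
  by (simp add: supp_def)

lemma finite_supp: "finite S \<Longrightarrow> (\<And>a b. x a b \<noteq> \<zero>\<^bsub>H b a\<^esub> \<Longrightarrow> (a, b) \<in> S) \<Longrightarrow> finite (supp x)"
  by (rule finite_subset[of _ S]) (auto simp: supp_def)

lemma carrier_A: "x \<in> carrier A \<longleftrightarrow> (\<forall>a b. x a b \<in> carrier (H b a)) \<and> finite (supp x)"
  by (simp add: assoc_algebra_def Obj_UNIV supp_def)

lemma A_component [simp]: "x \<in> carrier A \<Longrightarrow> x a b \<in> carrier (H b a)"
  and A_supp [simp]: "x \<in> carrier A \<Longrightarrow> finite (supp x)"
  by (simp_all add: carrier_A)

lemma carrier_AI:
  "finite S \<Longrightarrow> (\<And>a b. x a b \<in> carrier (H b a)) \<Longrightarrow> (\<And>a b. x a b \<noteq> \<zero>\<^bsub>H b a\<^esub> \<Longrightarrow> (a, b) \<in> S) \<Longrightarrow> x \<in> carrier A"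
  unfolding carrier_A by (intro conjI allI finite_supp)

lemma A_add_apply [simp]: "(x \<oplus>\<^bsub>A\<^esub> y) a b = x a b \<oplus>\<^bsub>H b a\<^esub> y a b"
  unfolding assoc_algebra_def Obj_UNIV by simp

lemma A_smult_apply [simp]: "(s \<odot>\<^bsub>A\<^esub> x) a b = s \<odot>\<^bsub>H b a\<^esub> x a b"
  unfolding assoc_algebra_def Obj_UNIV by simp

lemma A_zero_apply [simp]: "\<zero>\<^bsub>A\<^esub> a b = \<zero>\<^bsub>H b a\<^esub>"
  unfolding assoc_algebra_def Obj_UNIV by simp

lemma A_vectorspace: "vectorspace class_ring A"
proof (rule vs_criteria, goal_cases)
  case 1 show ?case by (rule class_field)
next
  case 2 show ?case by (rule carrier_AI[of "{}"]) simp_all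
next
  case 3
  have "x \<oplus>\<^bsub>A\<^esub> y \<in> carrier A" if "x \<in> carrier A" "y \<in> carrier A" for x y
    by (rule carrier_AI[of "supp x \<union> supp y"]) (use that in \<open>auto simp: in_supp\<close>)
  then show ?case by blast
next
  case 4
  show ?case
  proof
    fix x assume x: "x \<in> carrier A"
    have "(- 1) \<odot>\<^bsub>A\<^esub> x \<in> carrier A"
      by (rule carrier_AI[of "supp x"]) (use x in \<open>auto simp: in_supp\<close>)
    moreover have "x \<oplus>\<^bsub>A\<^esub> (- 1) \<odot>\<^bsub>A\<^esub> x = \<zero>\<^bsub>A\<^esub>"
    proof (intro ext)
      fix a b
      have "(- 1) \<odot>\<^bsub>H b a\<^esub> x a b = \<ominus>\<^bsub>H b a\<^esub> x a b"
        using H.smult_minus_1[of "x a b" b a] x by (simp add: class_ring_simps)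
      then show "(x \<oplus>\<^bsub>A\<^esub> (- 1) \<odot>\<^bsub>A\<^esub> x) a b = \<zero>\<^bsub>A\<^esub> a b" using x by (simp add: H.r_neg)
    qed
    ultimately show "\<exists>y\<in>carrier A. x \<oplus>\<^bsub>A\<^esub> y = \<zero>\<^bsub>A\<^esub>" by blast
  qed
next
  case 5
  have "s \<odot>\<^bsub>A\<^esub> x \<in> carrier A" if "x \<in> carrier A" for s x
    by (rule carrier_AI[of "supp x"]) (use that in \<open>auto simp: in_supp\<close>)
  then show ?case by blast
next
  case 6 show ?case by (auto intro!: ext simp: H.a_comm)
next
  case 7 show ?case by (auto intro!: ext simp: H.a_assoc)
next
  case 8 show ?case by (auto intro!: ext)
next
  case 9 show ?case using H.smult_assoc1 by (auto intro!: ext simp: class_ring_simps)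
next
  case 10 show ?case by (auto intro!: ext simp: class_ring_simps)
next
  case 11 show ?case using H.smult_l_distr by (auto intro!: ext simp: class_ring_simps)
next
  case 12 show ?case using H.smult_r_distr by (auto intro!: ext simp: class_ring_simps)
qed

sublocale A: vectorspace class_ring "assoc_algebra C"
  by (rule A_vectorspace)

text \<open>A matrix unit. Elements of the algebra are matrices whose row is the target and whose
  column is the source, so \<open>f\<close> in \<open>Hom(b, a)\<close> sits at position
  \<open>(a, b)\<close>.\<close>

definition E :: "'o \<Rightarrow> 'o \<Rightarrow> 'm \<Rightarrow> 'o \<Rightarrow> 'o \<Rightarrow> 'm" where
  "E a b f = (\<lambda>a' b'. if a' = a \<and> b' = b then f else \<zero>\<^bsub>H b' a'\<^esub>)"

lemma E_apply: "E a b f a' b' = (if a' = a \<and> b' = b then f else \<zero>\<^bsub>H b' a'\<^esub>)"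
  by (simp add: E_def)

lemma E_self [simp]: "E a b f a b = f" by (simp add: E_def)

lemma E_closed [simp]: "f \<in> carrier (H b a) \<Longrightarrow> E a b f \<in> carrier A"
  by (rule carrier_AI[of "{(a, b)}"]) (auto simp: E_def split: if_splits)

lemma E_add: "E a b (f \<oplus>\<^bsub>H b a\<^esub> g) = E a b f \<oplus>\<^bsub>A\<^esub> E a b g"
  by (auto intro!: ext simp: E_def)

lemma E_smult: "E a b (s \<odot>\<^bsub>H b a\<^esub> f) = s \<odot>\<^bsub>A\<^esub> E a b f"
  by (auto intro!: ext simp: E_def)

lemma E_zero: "E a b \<zero>\<^bsub>H b a\<^esub> = \<zero>\<^bsub>A\<^esub>"
  by (auto intro!: ext simp: E_def)

lemma obj_idem_E: "obj_idem C a = E a a (Ide C a)"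
  by (auto intro!: ext simp: obj_idem_def E_def Obj_UNIV)

lemma class_idem_singleton: "class_idem C {a} = E a a (Ide C a)"
  unfolding class_idem_def by (simp add: A.finsum_insert obj_idem_E)

lemma finite_row: "x \<in> carrier A \<Longrightarrow> finite {b. x a b \<noteq> \<zero>\<^bsub>H b a\<^esub>}"
proof (rule finite_subset[of _ "snd ` supp x"])
  show "{b. x a b \<noteq> \<zero>\<^bsub>H b a\<^esub>} \<subseteq> snd ` supp x" by (auto simp: image_iff supp_def)
qed simp

text \<open>The product is defined by a sum over the nonzero entries in a row of \<open>x\<close>.
  Allowing any larger finite index set makes sums over different supports comparable, for instance
  in distributivity.\<close>

lemma mult_apply:
  assumes x: "x \<in> carrier A" and y: "y \<in> carrier A" and S: "finite S" "\<And>b. x a b \<noteq> \<zero>\<^bsub>H b a\<^esub> \<Longrightarrow> b \<in> S"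
  shows "(x \<otimes>\<^bsub>A\<^esub> y) a c = (\<Oplus>\<^bsub>H c a\<^esub>b\<in>S. Cmp C c b a (x a b) (y b c))"
proof -
  have "(x \<otimes>\<^bsub>A\<^esub> y) a c = (\<Oplus>\<^bsub>H c a\<^esub>b\<in>{b. x a b \<noteq> \<zero>\<^bsub>H b a\<^esub>}. Cmp C c b a (x a b) (y b c))"
    unfolding assoc_algebra_def Obj_UNIV by simp
  also have "\<dots> = (\<Oplus>\<^bsub>H c a\<^esub>b\<in>S. Cmp C c b a (x a b) (y b c))"
    by (rule H.add.finprod_mono_neutral_cong_left) (use S x y in auto)
  finally show ?thesis .
qed

lemma mult_row:
  assumes "x \<in> carrier A" "y \<in> carrier A"
  shows "(x \<otimes>\<^bsub>A\<^esub> y) a c = (\<Oplus>\<^bsub>H c a\<^esub>b\<in>{b. x a b \<noteq> \<zero>\<^bsub>H b a\<^esub>}. Cmp C c b a (x a b) (y b c))"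
  by (rule mult_apply[OF assms finite_row[OF assms(1)]]) simp

lemma mult_closed [simp]: "x \<in> carrier A \<Longrightarrow> y \<in> carrier A \<Longrightarrow> x \<otimes>\<^bsub>A\<^esub> y \<in> carrier A"
proof -
  assume x: "x \<in> carrier A" and y: "y \<in> carrier A"
  note ma = mult_row[OF x y]
  have "supp (x \<otimes>\<^bsub>A\<^esub> y) \<subseteq> fst ` supp x \<times> snd ` supp y"
  proof
    fix p assume "p \<in> supp (x \<otimes>\<^bsub>A\<^esub> y)"
    then obtain a c where p: "p = (a, c)" and nz: "(x \<otimes>\<^bsub>A\<^esub> y) a c \<noteq> \<zero>\<^bsub>H c a\<^esub>" by (auto simp: supp_def)
    have "\<exists>b. x a b \<noteq> \<zero>\<^bsub>H b a\<^esub> \<and> y b c \<noteq> \<zero>\<^bsub>H c b\<^esub>"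
    proof (rule ccontr)
      assume "\<not> ?thesis"
      then have "(x \<otimes>\<^bsub>A\<^esub> y) a c = (\<Oplus>\<^bsub>H c a\<^esub>b\<in>{b. x a b \<noteq> \<zero>\<^bsub>H b a\<^esub>}. \<zero>\<^bsub>H c a\<^esub>)"
        unfolding ma using x by (intro H.finsum_cong') auto
      then show False using nz by simp
    qed
    then show "p \<in> fst ` supp x \<times> snd ` supp y" by (force simp: p supp_def)
  qed
  moreover have "finite (fst ` supp x \<times> snd ` supp y)" using x y by simp
  moreover have "(x \<otimes>\<^bsub>A\<^esub> y) a c \<in> carrier (H c a)" for a c
    unfolding ma using x y by (intro H.finsum_closed) auto
  ultimately show ?thesis by (intro carrier_AI[of "fst ` supp x \<times> snd ` supp y"]) (auto simp flip: in_supp)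
qed

lemma mult_add_l: "x \<in> carrier A \<Longrightarrow> x' \<in> carrier A \<Longrightarrow> y \<in> carrier A
  \<Longrightarrow> (x \<oplus>\<^bsub>A\<^esub> x') \<otimes>\<^bsub>A\<^esub> y = x \<otimes>\<^bsub>A\<^esub> y \<oplus>\<^bsub>A\<^esub> x' \<otimes>\<^bsub>A\<^esub> y"
proof (intro ext)
  fix a c assume x: "x \<in> carrier A" and x': "x' \<in> carrier A" and y: "y \<in> carrier A"
  let ?S = "{b. x a b \<noteq> \<zero>\<^bsub>H b a\<^esub>} \<union> {b. x' a b \<noteq> \<zero>\<^bsub>H b a\<^esub>}"
  have S: "finite ?S" using finite_row x x' by simp
  have "((x \<oplus>\<^bsub>A\<^esub> x') \<otimes>\<^bsub>A\<^esub> y) a c = (\<Oplus>\<^bsub>H c a\<^esub>b\<in>?S. Cmp C c b a ((x \<oplus>\<^bsub>A\<^esub> x') a b) (y b c))"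
    by (rule mult_apply) (use x x' y S in auto)
  also have "\<dots> = (\<Oplus>\<^bsub>H c a\<^esub>b\<in>?S. Cmp C c b a (x a b) (y b c) \<oplus>\<^bsub>H c a\<^esub> Cmp C c b a (x' a b) (y b c))"
    by (rule H.finsum_cong') (use x x' y in \<open>auto simp: Cmp_add\<close>)
  also have "\<dots> = (\<Oplus>\<^bsub>H c a\<^esub>b\<in>?S. Cmp C c b a (x a b) (y b c)) \<oplus>\<^bsub>H c a\<^esub> (\<Oplus>\<^bsub>H c a\<^esub>b\<in>?S. Cmp C c b a (x' a b) (y b c))"
    by (rule H.finsum_addf) (use x x' y in auto)
  also have "\<dots> = (x \<otimes>\<^bsub>A\<^esub> y) a c \<oplus>\<^bsub>H c a\<^esub> (x' \<otimes>\<^bsub>A\<^esub> y) a c"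
    using mult_apply[OF x y S, of a c] mult_apply[OF x' y S, of a c] by simp
  finally show "((x \<oplus>\<^bsub>A\<^esub> x') \<otimes>\<^bsub>A\<^esub> y) a c = (x \<otimes>\<^bsub>A\<^esub> y \<oplus>\<^bsub>A\<^esub> x' \<otimes>\<^bsub>A\<^esub> y) a c" by simp
qed

lemma mult_add_r: "x \<in> carrier A \<Longrightarrow> y \<in> carrier A \<Longrightarrow> y' \<in> carrier A
  \<Longrightarrow> x \<otimes>\<^bsub>A\<^esub> (y \<oplus>\<^bsub>A\<^esub> y') = x \<otimes>\<^bsub>A\<^esub> y \<oplus>\<^bsub>A\<^esub> x \<otimes>\<^bsub>A\<^esub> y'"
proof (intro ext)
  fix a c assume x: "x \<in> carrier A" and y': "y' \<in> carrier A" and y: "y \<in> carrier A"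
  let ?S = "{b. x a b \<noteq> \<zero>\<^bsub>H b a\<^esub>}"
  note S = finite_row[OF x, of a]
  have "(x \<otimes>\<^bsub>A\<^esub> (y \<oplus>\<^bsub>A\<^esub> y')) a c = (\<Oplus>\<^bsub>H c a\<^esub>b\<in>?S. Cmp C c b a (x a b) ((y \<oplus>\<^bsub>A\<^esub> y') b c))"
    by (rule mult_apply) (use x y' y S in auto)
  also have "\<dots> = (\<Oplus>\<^bsub>H c a\<^esub>b\<in>?S. Cmp C c b a (x a b) (y b c) \<oplus>\<^bsub>H c a\<^esub> Cmp C c b a (x a b) (y' b c))"
    by (rule H.finsum_cong') (use x y' y in \<open>auto simp: Cmp_add\<close>)
  also have "\<dots> = (\<Oplus>\<^bsub>H c a\<^esub>b\<in>?S. Cmp C c b a (x a b) (y b c)) \<oplus>\<^bsub>H c a\<^esub> (\<Oplus>\<^bsub>H c a\<^esub>b\<in>?S. Cmp C c b a (x a b) (y' b c))"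
    by (rule H.finsum_addf) (use x y' y in auto)
  also have "\<dots> = (x \<otimes>\<^bsub>A\<^esub> y) a c \<oplus>\<^bsub>H c a\<^esub> (x \<otimes>\<^bsub>A\<^esub> y') a c"
    using mult_row[OF x y, of a c] mult_row[OF x y', of a c] by simp
  finally show "(x \<otimes>\<^bsub>A\<^esub> (y \<oplus>\<^bsub>A\<^esub> y')) a c = (x \<otimes>\<^bsub>A\<^esub> y \<oplus>\<^bsub>A\<^esub> x \<otimes>\<^bsub>A\<^esub> y') a c" by simp
qed

lemma mult_smult:
  assumes x: "x \<in> carrier A" and y: "y \<in> carrier A"
  shows "(s \<odot>\<^bsub>A\<^esub> x) \<otimes>\<^bsub>A\<^esub> y = s \<odot>\<^bsub>A\<^esub> (x \<otimes>\<^bsub>A\<^esub> y)" "x \<otimes>\<^bsub>A\<^esub> (s \<odot>\<^bsub>A\<^esub> y) = s \<odot>\<^bsub>A\<^esub> (x \<otimes>\<^bsub>A\<^esub> y)"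
proof -
  let ?S = "\<lambda>a. {b. x a b \<noteq> \<zero>\<^bsub>H b a\<^esub>}"
  note S = finite_row[OF x]
  have sx: "s \<odot>\<^bsub>A\<^esub> x \<in> carrier A" and sy: "s \<odot>\<^bsub>A\<^esub> y \<in> carrier A" using x y by (auto simp: class_ring_simps)
  have r: "s \<odot>\<^bsub>H c a\<^esub> (x \<otimes>\<^bsub>A\<^esub> y) a c = (\<Oplus>\<^bsub>H c a\<^esub>b\<in>?S a. s \<odot>\<^bsub>H c a\<^esub> Cmp C c b a (x a b) (y b c))" for a c
    using mult_row[OF x y, of a c] H.finsum_smult[of s "\<lambda>b. Cmp C c b a (x a b) (y b c)" "?S a" c a] x y
    by simp
  show "(s \<odot>\<^bsub>A\<^esub> x) \<otimes>\<^bsub>A\<^esub> y = s \<odot>\<^bsub>A\<^esub> (x \<otimes>\<^bsub>A\<^esub> y)"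
  proof (intro ext)
    fix a c
    have "((s \<odot>\<^bsub>A\<^esub> x) \<otimes>\<^bsub>A\<^esub> y) a c = (\<Oplus>\<^bsub>H c a\<^esub>b\<in>?S a. Cmp C c b a ((s \<odot>\<^bsub>A\<^esub> x) a b) (y b c))"
      by (rule mult_apply[OF sx y S]) auto
    also have "\<dots> = (\<Oplus>\<^bsub>H c a\<^esub>b\<in>?S a. s \<odot>\<^bsub>H c a\<^esub> Cmp C c b a (x a b) (y b c))"
      by (rule H.finsum_cong') (use x y in \<open>auto simp: Cmp_smult\<close>)
    finally show "((s \<odot>\<^bsub>A\<^esub> x) \<otimes>\<^bsub>A\<^esub> y) a c = (s \<odot>\<^bsub>A\<^esub> (x \<otimes>\<^bsub>A\<^esub> y)) a c" using r by simp
  qed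
  show "x \<otimes>\<^bsub>A\<^esub> (s \<odot>\<^bsub>A\<^esub> y) = s \<odot>\<^bsub>A\<^esub> (x \<otimes>\<^bsub>A\<^esub> y)"
  proof (intro ext)
    fix a c
    have "(x \<otimes>\<^bsub>A\<^esub> (s \<odot>\<^bsub>A\<^esub> y)) a c = (\<Oplus>\<^bsub>H c a\<^esub>b\<in>?S a. Cmp C c b a (x a b) ((s \<odot>\<^bsub>A\<^esub> y) b c))"
      by (rule mult_apply[OF x sy S]) auto
    also have "\<dots> = (\<Oplus>\<^bsub>H c a\<^esub>b\<in>?S a. s \<odot>\<^bsub>H c a\<^esub> Cmp C c b a (x a b) (y b c))"
      by (rule H.finsum_cong') (use x y in \<open>auto simp: Cmp_smult\<close>)
    finally show "(x \<otimes>\<^bsub>A\<^esub> (s \<odot>\<^bsub>A\<^esub> y)) a c = (s \<odot>\<^bsub>A\<^esub> (x \<otimes>\<^bsub>A\<^esub> y)) a c" using r by simp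
  qed
qed

lemma E_mult_left: "f \<in> carrier (H d a) \<Longrightarrow> y \<in> carrier A
   \<Longrightarrow> (E a d f \<otimes>\<^bsub>A\<^esub> y) a' c = (if a' = a then Cmp C c d a f (y d c) else \<zero>\<^bsub>H c a'\<^esub>)"
  by (subst mult_apply[of _ _ "{d}"]) (auto simp: E_apply H.finsum_insert split: if_splits)

lemma E_mult: "f \<in> carrier (H d a) \<Longrightarrow> g \<in> carrier (H b d')
   \<Longrightarrow> E a d f \<otimes>\<^bsub>A\<^esub> E d' b g = (if d = d' then E a b (Cmp C b d a f g) else \<zero>\<^bsub>A\<^esub>)"
  by (auto intro!: ext simp: E_mult_left E_apply)

lemma mult_E_right: "x \<in> carrier A \<Longrightarrow> g \<in> carrier (H b d)
   \<Longrightarrow> (x \<otimes>\<^bsub>A\<^esub> E d b g) a c = (if c = b then Cmp C b d a (x a d) g else \<zero>\<^bsub>H c a\<^esub>)"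
proof -
  assume x: "x \<in> carrier A" and g: "g \<in> carrier (H b d)"
  let ?S = "insert d {b. x a b \<noteq> \<zero>\<^bsub>H b a\<^esub>}"
  have S: "finite ?S" using finite_row[OF x] by simp
  have "(x \<otimes>\<^bsub>A\<^esub> E d b g) a c = (\<Oplus>\<^bsub>H c a\<^esub>b'\<in>?S. Cmp C c b' a (x a b') (E d b g b' c))"
    by (rule mult_apply) (use x g S in auto)
  also have "\<dots> = (\<Oplus>\<^bsub>H c a\<^esub>b'\<in>{d}. Cmp C c b' a (x a b') (E d b g b' c))"
    by (rule H.add.finprod_mono_neutral_cong_right) (use S x g in \<open>auto simp: E_apply\<close>)
  also have "\<dots> = Cmp C c d a (x a d) (E d b g d c)"
    using x g by (simp add: H.finsum_insert A_component[OF E_closed])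
  finally show ?thesis using x by (auto simp: E_apply)
qed

lemma corner_E: "x \<in> carrier A \<Longrightarrow> E a a (Ide C a) \<otimes>\<^bsub>A\<^esub> x \<otimes>\<^bsub>A\<^esub> E b b (Ide C b) = E a b (x a b)"
  by (auto intro!: ext simp: mult_E_right E_mult_left E_apply)

text \<open>Elements have finite support, so each is the finite sum of its entries; the induction
  strips one position from a finite set containing the support.\<close>

lemma submodule_by_components:
  assumes W: "submodule class_ring W A" and x: "x \<in> carrier A"
    and c: "\<And>a b. x a b \<noteq> \<zero>\<^bsub>H b a\<^esub> \<Longrightarrow> E a b (x a b) \<in> W"
  shows "x \<in> W"
proof -
  interpret W: LinearCombinations.submodule class_ring W A by (rule W)
  have "finite S \<Longrightarrow> x \<in> carrier A \<Longrightarrow> supp x \<subseteq> S \<Longrightarrow> (\<And>a b. x a b \<noteq> \<zero>\<^bsub>H b a\<^esub> \<Longrightarrow> E a b (x a b) \<in> W) \<Longrightarrow> x \<in> W"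
    for S x
  proof (induction S arbitrary: x rule: finite_induct)
    case empty
    then have "x = \<zero>\<^bsub>A\<^esub>" by (auto intro!: ext simp: supp_def)
    then show ?case using W.zero_closed by (simp only:)
  next
    case (insert p S)
    obtain a b where p: "p = (a, b)" by (cases p)
    define x' where "x' = (\<lambda>a' b'. if a' = a \<and> b' = b then \<zero>\<^bsub>H b' a'\<^esub> else x a' b')"
    have x': "x' \<in> carrier A"
      by (rule carrier_AI[of "supp x"]) (use insert.prems(1) in \<open>auto simp: x'_def in_supp split: if_splits\<close>)
    have sub: "supp x' \<subseteq> S" using insert.prems(2) by (auto simp: x'_def supp_def p split: if_splits)
    have "E c d (x' c d) \<in> W" if "x' c d \<noteq> \<zero>\<^bsub>H d c\<^esub>" for c d
      using that insert.prems(3)[of c d] by (auto simp: x'_def split: if_splits)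
    then have "x' \<in> W" using insert.IH[OF x' sub] by blast
    moreover have "E a b (x a b) \<in> W"
      using insert.prems(3)[of a b] W.zero_closed by (cases "x a b = \<zero>\<^bsub>H b a\<^esub>") (auto simp: E_zero)
    moreover have "x = E a b (x a b) \<oplus>\<^bsub>A\<^esub> x'"
      using insert.prems(1) by (auto intro!: ext simp: x'_def E_apply)
    ultimately show ?case using W.m_closed by metis
  qed
  then show ?thesis using x c A_supp[OF x] by blast
qed

end

section \<open>Subspaces given entrywise, direct sums and local units\<close>

context lin_cat
begin

abbreviation "sp a b S \<equiv> LinearCombinations.module.span class_ring (H b a) S"

text \<open>The subspaces \<open>A^-\<close>, \<open>A^\<circ>\<close> and \<open>A^+\<close> will
  all have this form, with different families of generators, so the conditions on direct sums are
  verified once for all three.\<close>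

definition gr :: "('o \<Rightarrow> 'o \<Rightarrow> 'm set) \<Rightarrow> ('o \<Rightarrow> 'o \<Rightarrow> 'm) set" where
  "gr G = {x \<in> carrier A. \<forall>a b. x a b \<in> sp a b (G a b)}"

definition graded :: "('o \<Rightarrow> 'o \<Rightarrow> 'm set) \<Rightarrow> bool" where
  "graded G \<longleftrightarrow> (\<forall>a b. G a b \<subseteq> carrier (H b a))"

lemma submodule_A:
  assumes "W \<subseteq> carrier A" "\<zero>\<^bsub>A\<^esub> \<in> W" "\<And>x y. x \<in> W \<Longrightarrow> y \<in> W \<Longrightarrow> x \<oplus>\<^bsub>A\<^esub> y \<in> W"
    "\<And>s x. x \<in> W \<Longrightarrow> s \<odot>\<^bsub>A\<^esub> x \<in> W"
  shows "submodule class_ring W A"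
  by (rule LinearCombinations.submodule.intro) (use assms A.module_axioms in auto)

lemma submodule_H:
  assumes "W \<subseteq> carrier (H a b)" "\<zero>\<^bsub>H a b\<^esub> \<in> W" "\<And>x y. x \<in> W \<Longrightarrow> y \<in> W \<Longrightarrow> x \<oplus>\<^bsub>H a b\<^esub> y \<in> W"
    "\<And>s x. x \<in> W \<Longrightarrow> s \<odot>\<^bsub>H a b\<^esub> x \<in> W"
  shows "submodule class_ring W (H a b)"
  by (rule LinearCombinations.submodule.intro) (use assms H.module_axioms in auto)

lemma submoduleD:
  assumes "submodule class_ring W V"
  shows "W \<subseteq> carrier V" "\<zero>\<^bsub>V\<^esub> \<in> W" "\<And>x y. x \<in> W \<Longrightarrow> y \<in> W \<Longrightarrow> x \<oplus>\<^bsub>V\<^esub> y \<in> W"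
    "\<And>s x. x \<in> W \<Longrightarrow> s \<odot>\<^bsub>V\<^esub> x \<in> W"
  using assms by (auto simp: LinearCombinations.submodule_def)

lemma sp_submodule: "graded G \<Longrightarrow> submodule class_ring (sp a b (G a b)) (H b a)"
  by (rule H.span_is_submodule) (simp add: graded_def)

lemmas sp_closed = submoduleD[OF sp_submodule]

lemma sp_gen: "graded G \<Longrightarrow> g \<in> G a b \<Longrightarrow> g \<in> sp a b (G a b)"
  using H.in_own_span[of "G a b" b a] by (auto simp: graded_def)

lemma gr_submodule: "graded G \<Longrightarrow> submodule class_ring (gr G) A"
  by (rule submodule_A) (auto simp: gr_def sp_closed class_ring_simps)

lemma gr_carrier: "x \<in> gr G \<Longrightarrow> x \<in> carrier A" by (simp add: gr_def)

lemma E_in_gr: "graded G \<Longrightarrow> f \<in> sp a b (G a b) \<Longrightarrow> E a b f \<in> gr G"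
  unfolding gr_def using sp_closed(1)[of G b a] by (auto simp: E_apply sp_closed(2))

lemma preimage_E: "submodule class_ring W A \<Longrightarrow> submodule class_ring {f \<in> carrier (H b a). E a b f \<in> W} (H b a)"
  by (rule submodule_H) (auto simp: E_zero E_add E_smult submoduleD)

text \<open>Reduces a statement about all of \<open>gr G\<close> to the matrix units of the
  generators, first by splitting into entries and then by linearity inside one morphism
  space.\<close>

lemma gr_induct:
  assumes W: "submodule class_ring W A" and G: "graded G" "\<And>a b g. g \<in> G a b \<Longrightarrow> E a b g \<in> W"
  shows "gr G \<subseteq> W"
proof
  fix x assume x: "x \<in> gr G"
  show "x \<in> W"
  proof (rule submodule_by_components[OF W gr_carrier[OF x]])
    fix a b
    have "sp a b (G a b) \<subseteq> {f \<in> carrier (H b a). E a b f \<in> W}"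
      by (rule H.span_is_subset[OF _ preimage_E[OF W]]) (use G in \<open>auto simp: graded_def\<close>)
    then show "E a b (x a b) \<in> W" using x by (auto simp: gr_def)
  qed
qed

lemma obj_part_gr: "graded G \<Longrightarrow> obj_part C (gr G) a b = E a b ` sp a b (G a b)"
proof -
  assume G: "graded G"
  have "obj_part C (gr G) a b = (\<lambda>x. E a b (x a b)) ` gr G"
    unfolding corner_def obj_idem_E by (rule image_cong) (simp_all add: corner_E gr_carrier)
  also have "\<dots> = E a b ` sp a b (G a b)"
  proof (intro equalityI subsetI)
    fix y assume "y \<in> E a b ` sp a b (G a b)"
    then obtain f where f: "f \<in> sp a b (G a b)" "y = E a b f" by blast
    then show "y \<in> (\<lambda>x. E a b (x a b)) ` gr G" using E_in_gr[OF G f(1)] by (intro image_eqI[of _ _ "E a b f"]) auto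
  qed (auto simp: gr_def)
  finally show ?thesis .
qed

lemma E_image_submodule: "submodule class_ring W (H b a) \<Longrightarrow> submodule class_ring (E a b ` W) A"
proof (rule submodule_A)
  assume W: "submodule class_ring W (H b a)"
  note Wd = submoduleD[OF W]
  show "E a b ` W \<subseteq> carrier A" using Wd(1) by auto
  show "\<zero>\<^bsub>A\<^esub> \<in> E a b ` W" using Wd(2) E_zero by (metis imageI)
  show "x \<oplus>\<^bsub>A\<^esub> y \<in> E a b ` W" if "x \<in> E a b ` W" "y \<in> E a b ` W" for x y
    using that Wd(3) by (auto simp flip: E_add)
  show "s \<odot>\<^bsub>A\<^esub> x \<in> E a b ` W" if "x \<in> E a b ` W" for s x
    using that Wd(4) by (auto simp flip: E_smult)
qed

text \<open>Distinct entries of a matrix are independent, hence the sum is direct. The index set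
  \<open>I\<close> may omit positions without generators, which yields the version for
  \<open>A^\<circ>\<close>, supported on pairs in one class.\<close>

lemma direct_sum_gr:
  assumes G: "graded G" and I: "\<And>a b. (a, b) \<notin> I \<Longrightarrow> G a b = {}"
  shows "internal_direct_sum A (gr G) I (\<lambda>(a, b). obj_part C (gr G) a b)"
  unfolding internal_direct_sum_def
proof (intro conjI ballI allI impI)
  let ?S = "\<lambda>(a, b). obj_part C (gr G) a b"
  have S: "?S (a, b) = E a b ` sp a b (G a b)" for a b using obj_part_gr[OF G] by simp
  show sub: "submodule class_ring (?S i) A" for i
    by (cases i) (simp add: obj_part_gr[OF G] E_image_submodule[OF sp_submodule[OF G]])
  have c: "(\<Union>i\<in>I. ?S i) \<subseteq> carrier A" using submoduleD(1)[OF sub] by blast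
  show "gr G = LinearCombinations.module.span class_ring A (\<Union>i\<in>I. ?S i)"
  proof
    show "gr G \<subseteq> LinearCombinations.module.span class_ring A (\<Union>i\<in>I. ?S i)"
    proof (rule gr_induct[OF A.span_is_submodule[OF c] G])
      fix a b g assume g: "g \<in> G a b"
      then have "(a, b) \<in> I" using I by blast
      moreover have "E a b g \<in> ?S (a, b)" unfolding S using sp_gen[OF G g] by blast
      ultimately show "E a b g \<in> LinearCombinations.module.span class_ring A (\<Union>i\<in>I. ?S i)"
        using A.in_own_span[OF c] by blast
    qed
    show "LinearCombinations.module.span class_ring A (\<Union>i\<in>I. ?S i) \<subseteq> gr G"
      by (rule A.span_is_subset[OF _ gr_submodule[OF G]]) (auto simp: obj_part_gr[OF G] E_in_gr[OF G])
  qed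
  fix F s i
  assume F: "finite F \<and> F \<subseteq> I \<and> (\<forall>i\<in>F. s i \<in> ?S i) \<and> (\<Oplus>\<^bsub>A\<^esub>i\<in>F. s i) = \<zero>\<^bsub>A\<^esub>" and i: "i \<in> F"
  obtain a b where ab: "i = (a, b)" by (cases i)
  have sF: "s j \<in> carrier A" if "j \<in> F" for j using F that submoduleD(1)[OF sub] by blast
  \<comment> \<open>The matrices that vanish at the position of \<open>i\<close> form a subspace
    containing all other summands, so the vanishing of the sum forces the entry of
    \<open>s i\<close> to vanish.\<close>
  let ?N = "{x \<in> carrier A. x a b = \<zero>\<^bsub>H b a\<^esub>}"
  have N: "submodule class_ring ?N A" by (rule submodule_A) (auto simp: class_ring_simps)
  have "s j \<in> ?N" if "j \<in> F - {i}" for j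
  proof -
    obtain c d where "j = (c, d)" by (cases j)
    then show ?thesis using that F ab sF[of j] S by (fastforce simp: E_apply)
  qed
  then have rest: "(\<Oplus>\<^bsub>A\<^esub>j\<in>F - {i}. s j) \<in> ?N" by (rule A.submodule_finsum[OF N])
  have "F = insert i (F - {i})" using i by blast
  then have "(\<Oplus>\<^bsub>A\<^esub>j\<in>F. s j) = (\<Oplus>\<^bsub>A\<^esub>j\<in>insert i (F - {i}). s j)" by simp
  also have "\<dots> = s i \<oplus>\<^bsub>A\<^esub> (\<Oplus>\<^bsub>A\<^esub>j\<in>F - {i}. s j)"
    using F sF i by (intro A.finsum_insert) auto
  finally have "s i \<oplus>\<^bsub>A\<^esub> (\<Oplus>\<^bsub>A\<^esub>j\<in>F - {i}. s j) = \<zero>\<^bsub>A\<^esub>" using F by metis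
  then have "(s i \<oplus>\<^bsub>A\<^esub> (\<Oplus>\<^bsub>A\<^esub>j\<in>F - {i}. s j)) a b = \<zero>\<^bsub>A\<^esub> a b" by (rule arg_cong[where f = "\<lambda>x. x a b"])
  then have "s i a b = \<zero>\<^bsub>H b a\<^esub>" using rest sF[OF i] by simp
  moreover obtain f where "s i = E a b f" using F i ab S by fastforce
  ultimately show "s i = \<zero>\<^bsub>A\<^esub>" by (simp add: E_zero)
qed

lemma sp_empty: "sp a b {} = {\<zero>\<^bsub>H b a\<^esub>}"
  by (auto simp: H.span_def H.lincomb_def)

lemma sp_singleton: "v \<in> carrier (H b a) \<Longrightarrow> sp a b {v} = {s \<odot>\<^bsub>H b a\<^esub> v | s. True}"
proof -
  assume v: "v \<in> carrier (H b a)"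
  have "H.lincomb b a c {v} = c v \<odot>\<^bsub>H b a\<^esub> v" for c using v by (simp add: H.lincomb_def H.finsum_insert)
  moreover have "\<exists>c. s \<odot>\<^bsub>H b a\<^esub> v = c v \<odot>\<^bsub>H b a\<^esub> v" for s by (rule exI[of _ "\<lambda>_. s"]) simp
  ultimately show ?thesis using H.finite_span[of "{v}" b a] v by auto
qed

lemma class_part_gr: "class_part C (gr G) {a} {b} = obj_part C (gr G) a b"
  by (simp only: class_idem_singleton obj_idem_E)

text \<open>Every class will be a singleton, so the required decomposition has a single summand, the
  line through the identity of \<open>a\<close>.\<close>

lemma direct_sum_one_line:
  assumes G: "graded G" and aa: "G a a = {Ide C a}"
  shows "internal_direct_sum A (class_part C (gr G) {a} {a}) {a} (\<lambda>c. {s \<odot>\<^bsub>A\<^esub> obj_idem C c | s. True})"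
proof -
  have eq: "class_part C (gr G) {a} {a} = {s \<odot>\<^bsub>A\<^esub> obj_idem C a | s. True}"
  proof -
    have "class_part C (gr G) {a} {a} = E a a ` {s \<odot>\<^bsub>H a a\<^esub> Ide C a | s. True}"
      using class_part_gr obj_part_gr[OF G, of a a] sp_singleton[OF Ide_closed] aa by simp
    also have "\<dots> = {s \<odot>\<^bsub>A\<^esub> obj_idem C a | s. True}"
      by (auto simp: obj_idem_E image_iff simp flip: E_smult)
    finally show ?thesis .
  qed
  have sub: "submodule class_ring {s \<odot>\<^bsub>A\<^esub> obj_idem C a | s. True} A"
    unfolding eq[symmetric] class_part_gr obj_part_gr[OF G] by (rule E_image_submodule[OF sp_submodule[OF G]])
  have sp: "LinearCombinations.module.span class_ring A {s \<odot>\<^bsub>A\<^esub> obj_idem C a | s. True} = {s \<odot>\<^bsub>A\<^esub> obj_idem C a | s. True}"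
    using A.span_is_subset[OF Set.subset_refl sub] A.in_own_span[OF submoduleD(1)[OF sub]] by blast
  show ?thesis unfolding internal_direct_sum_def eq
  proof (intro conjI ballI allI impI)
    fix c assume "c \<in> {a}"
    then show "submodule class_ring {s \<odot>\<^bsub>A\<^esub> obj_idem C c | s. True} A" using sub by simp
  next
    show "{s \<odot>\<^bsub>A\<^esub> obj_idem C a | s. True}
      = LinearCombinations.module.span class_ring A (\<Union>c\<in>{a}. {s \<odot>\<^bsub>A\<^esub> obj_idem C c | s. True})"
      using sp by simp
  next
    fix F s i
    assume F: "finite F \<and> F \<subseteq> {a} \<and> (\<forall>i\<in>F. s i \<in> {t \<odot>\<^bsub>A\<^esub> obj_idem C i | t. True})
      \<and> (\<Oplus>\<^bsub>A\<^esub>i\<in>F. s i) = \<zero>\<^bsub>A\<^esub>" and i: "i \<in> F"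
    then have Fa: "F = {a}" "i = a" by auto
    have "s a \<in> {t \<odot>\<^bsub>A\<^esub> obj_idem C a | t. True}" using F Fa by blast
    then have "s a \<in> carrier A" using submoduleD(1)[OF sub] by (rule rev_subsetD)
    moreover have "(\<Oplus>\<^bsub>A\<^esub>i\<in>{a}. s i) = \<zero>\<^bsub>A\<^esub>" using F Fa by blast
    ultimately show "s i = \<zero>\<^bsub>A\<^esub>" unfolding Fa by (simp add: A.finsum_insert)
  qed
qed

text \<open>The span of the identities is contained in \<open>gr G\<close> for the family
  \<open>G\<close> that has the identities on the diagonal and nothing else, and the entries of such
  matrices are known.\<close>

lemma local_units_diag:
  assumes "e \<in> local_units C"
  shows "e \<in> carrier A" "\<exists>s. \<forall>a b. e a b = (if a = b then s a \<odot>\<^bsub>H a a\<^esub> Ide C a else \<zero>\<^bsub>H b a\<^esub>)"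
proof -
  define G where "G = (\<lambda>a b. if a = b then {Ide C a} else {})"
  have G: "graded G" by (auto simp: graded_def G_def)
  have "obj_idem C c \<in> gr G" for c
    unfolding obj_idem_E by (rule E_in_gr[OF G], rule sp_gen[OF G]) (simp add: G_def)
  then have "local_units C \<subseteq> gr G" unfolding local_units_def
    by (intro A.span_is_subset[OF _ gr_submodule[OF G]]) auto
  then have e: "e \<in> gr G" using assms by blast
  then show "e \<in> carrier A" by (rule gr_carrier)
  have eG: "e a b \<in> sp a b (G a b)" for a b using e by (simp add: gr_def)
  have d: "\<exists>s. e a a = s \<odot>\<^bsub>H a a\<^esub> Ide C a" for a
    using eG[of a a] sp_singleton[OF Ide_closed] by (auto simp: G_def)
  have o: "e a b = \<zero>\<^bsub>H b a\<^esub>" if "a \<noteq> b" for a b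
    using eG[of a b] that sp_empty by (simp add: G_def)
  obtain s where "\<forall>a. e a a = s a \<odot>\<^bsub>H a a\<^esub> Ide C a" using d by metis
  then show "\<exists>s. \<forall>a b. e a b = (if a = b then s a \<odot>\<^bsub>H a a\<^esub> Ide C a else \<zero>\<^bsub>H b a\<^esub>)"
    using o by (intro exI[of _ s]) auto
qed

lemma diag_mult_right:
  assumes x: "x \<in> carrier A" and e: "e \<in> carrier A" "\<And>a b. e a b = (if a = b then s a \<odot>\<^bsub>H a a\<^esub> Ide C a else \<zero>\<^bsub>H b a\<^esub>)"
  shows "(x \<otimes>\<^bsub>A\<^esub> e) a c = s c \<odot>\<^bsub>H c a\<^esub> x a c"
proof -
  let ?S = "insert c {b. x a b \<noteq> \<zero>\<^bsub>H b a\<^esub>}"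
  have S: "finite ?S" using finite_row[OF x] by simp
  have "(x \<otimes>\<^bsub>A\<^esub> e) a c = (\<Oplus>\<^bsub>H c a\<^esub>b\<in>?S. Cmp C c b a (x a b) (e b c))"
    by (rule mult_apply) (use x e S in auto)
  also have "\<dots> = (\<Oplus>\<^bsub>H c a\<^esub>b\<in>{c}. Cmp C c b a (x a b) (e b c))"
    by (rule H.add.finprod_mono_neutral_cong_right) (use S x e(1) in \<open>auto simp: e(2)\<close>)
  also have "\<dots> = Cmp C c c a (x a c) (e c c)" using x e(1) by (simp add: H.finsum_insert)
  also have "\<dots> = s c \<odot>\<^bsub>H c a\<^esub> x a c" using x by (simp add: e(2) Cmp_smult)
  finally show ?thesis .
qed

lemma diag_mult_left:
  assumes y: "y \<in> carrier A" and e: "e \<in> carrier A" "\<And>a b. e a b = (if a = b then s a \<odot>\<^bsub>H a a\<^esub> Ide C a else \<zero>\<^bsub>H b a\<^esub>)"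
  shows "(e \<otimes>\<^bsub>A\<^esub> y) a c = s a \<odot>\<^bsub>H c a\<^esub> y a c"
proof -
  have "(e \<otimes>\<^bsub>A\<^esub> y) a c = (\<Oplus>\<^bsub>H c a\<^esub>b\<in>{a}. Cmp C c b a (e a b) (y b c))"
    by (rule mult_apply) (use y e in \<open>auto simp: e(2) split: if_splits\<close>)
  also have "\<dots> = Cmp C c a a (e a a) (y a c)" using y e(1) by (simp add: H.finsum_insert)
  also have "\<dots> = s a \<odot>\<^bsub>H c a\<^esub> y a c" using y by (simp add: e(2) Cmp_smult)
  finally show ?thesis .
qed

lemma gr_mult_local_units:
  assumes G: "graded G" and x: "x \<in> gr G" and e: "e \<in> local_units C"
  shows "x \<otimes>\<^bsub>A\<^esub> e \<in> gr G" "e \<otimes>\<^bsub>A\<^esub> x \<in> gr G"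
proof -
  note ec = local_units_diag(1)[OF e] and xc = gr_carrier[OF x]
  obtain s where s: "\<And>a b. e a b = (if a = b then s a \<odot>\<^bsub>H a a\<^esub> Ide C a else \<zero>\<^bsub>H b a\<^esub>)"
    using local_units_diag(2)[OF e] by blast
  show "x \<otimes>\<^bsub>A\<^esub> e \<in> gr G" "e \<otimes>\<^bsub>A\<^esub> x \<in> gr G"
    using x xc ec sp_closed(4)[OF G]
    by (auto simp: gr_def diag_mult_right[OF xc ec s] diag_mult_left[OF xc ec s])
qed

text \<open>These two cases of associativity are what the balancing relations of the tensor product
  require; as \<open>e\<close> is a diagonal matrix of scalars, both sides are rescalings of the
  same sum.\<close>

lemma mult_local_units:
  assumes x: "x \<in> carrier A" and y: "y \<in> carrier A" and e: "e \<in> local_units C"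
  shows "(x \<otimes>\<^bsub>A\<^esub> e) \<otimes>\<^bsub>A\<^esub> y = x \<otimes>\<^bsub>A\<^esub> (e \<otimes>\<^bsub>A\<^esub> y)" "x \<otimes>\<^bsub>A\<^esub> (y \<otimes>\<^bsub>A\<^esub> e) = (x \<otimes>\<^bsub>A\<^esub> y) \<otimes>\<^bsub>A\<^esub> e"
proof -
  note ec = local_units_diag(1)[OF e]
  obtain s where s: "\<And>a b. e a b = (if a = b then s a \<odot>\<^bsub>H a a\<^esub> Ide C a else \<zero>\<^bsub>H b a\<^esub>)"
    using local_units_diag(2)[OF e] by blast
  show "(x \<otimes>\<^bsub>A\<^esub> e) \<otimes>\<^bsub>A\<^esub> y = x \<otimes>\<^bsub>A\<^esub> (e \<otimes>\<^bsub>A\<^esub> y)"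
  proof (intro ext)
    fix a c
    let ?S = "{b. x a b \<noteq> \<zero>\<^bsub>H b a\<^esub>}"
    have "((x \<otimes>\<^bsub>A\<^esub> e) \<otimes>\<^bsub>A\<^esub> y) a c = (\<Oplus>\<^bsub>H c a\<^esub>b\<in>?S. Cmp C c b a ((x \<otimes>\<^bsub>A\<^esub> e) a b) (y b c))"
      by (rule mult_apply) (use x y ec finite_row[OF x] in \<open>auto simp: diag_mult_right[OF x ec s]\<close>)
    also have "\<dots> = (\<Oplus>\<^bsub>H c a\<^esub>b\<in>?S. Cmp C c b a (x a b) ((e \<otimes>\<^bsub>A\<^esub> y) b c))"
      by (rule H.finsum_cong')
        (use x y ec in \<open>auto simp: diag_mult_right[OF x ec s] diag_mult_left[OF y ec s] Cmp_smult\<close>)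
    also have "\<dots> = (x \<otimes>\<^bsub>A\<^esub> (e \<otimes>\<^bsub>A\<^esub> y)) a c"
      by (rule mult_row[symmetric]) (use x y ec in auto)
    finally show "((x \<otimes>\<^bsub>A\<^esub> e) \<otimes>\<^bsub>A\<^esub> y) a c = (x \<otimes>\<^bsub>A\<^esub> (e \<otimes>\<^bsub>A\<^esub> y)) a c" .
  qed
  show "x \<otimes>\<^bsub>A\<^esub> (y \<otimes>\<^bsub>A\<^esub> e) = (x \<otimes>\<^bsub>A\<^esub> y) \<otimes>\<^bsub>A\<^esub> e"
  proof (intro ext)
    fix a c
    let ?S = "{b. x a b \<noteq> \<zero>\<^bsub>H b a\<^esub>}"
    have "(x \<otimes>\<^bsub>A\<^esub> (y \<otimes>\<^bsub>A\<^esub> e)) a c = (\<Oplus>\<^bsub>H c a\<^esub>b\<in>?S. Cmp C c b a (x a b) ((y \<otimes>\<^bsub>A\<^esub> e) b c))"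
      by (rule mult_row) (use x y ec in auto)
    also have "\<dots> = (\<Oplus>\<^bsub>H c a\<^esub>b\<in>?S. s c \<odot>\<^bsub>H c a\<^esub> Cmp C c b a (x a b) (y b c))"
      by (rule H.finsum_cong') (use x y in \<open>auto simp: diag_mult_right[OF y ec s] Cmp_smult\<close>)
    also have "\<dots> = s c \<odot>\<^bsub>H c a\<^esub> (\<Oplus>\<^bsub>H c a\<^esub>b\<in>?S. Cmp C c b a (x a b) (y b c))"
      by (rule H.finsum_smult[symmetric]) (use x y in auto)
    also have "\<dots> = ((x \<otimes>\<^bsub>A\<^esub> y) \<otimes>\<^bsub>A\<^esub> e) a c"
      using x y by (simp add: diag_mult_right[OF _ ec s] mult_row)
    finally show "(x \<otimes>\<^bsub>A\<^esub> (y \<otimes>\<^bsub>A\<^esub> e)) a c = ((x \<otimes>\<^bsub>A\<^esub> y) \<otimes>\<^bsub>A\<^esub> e) a c" .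
  qed
qed

end

lemma keys_minus_sub: "Poly_Mapping.keys p \<subseteq> S \<Longrightarrow> Poly_Mapping.keys p' \<subseteq> S
   \<Longrightarrow> Poly_Mapping.keys (p - p' :: 's \<Rightarrow>\<^sub>0 'k::field) \<subseteq> S"
  using keys_diff[of p p'] by blast

text \<open>The input from which (W4) follows by linear algebra: the products through all middle
  objects \<open>d\<close> form a basis of each morphism space. Injectivity is a separate assumption
  since the image set alone does not record that different triples have different products.\<close>

locale triangular_basis = lin_cat C for C :: "('k::field, 'o, 'm) lincat" +
  fixes Gm Gp :: "'o \<Rightarrow> 'o \<Rightarrow> 'm set" and G0 :: "'o \<Rightarrow> 'm set"
  assumes Gm: "Gm a d \<subseteq> carrier (Homs C d a)" and G0: "G0 d \<subseteq> carrier (Homs C d d)"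
    and Gp: "Gp d b \<subseteq> carrier (Homs C b d)"
    and prod_inj: "inj_on (\<lambda>(d, x, y, z). Cmp C b d a (Cmp C d d a x y) z) {(d, x, y, z). x \<in> Gm a d \<and> y \<in> G0 d \<and> z \<in> Gp d b}"
    and prod_basis: "vectorspace.basis class_ring (Homs C b a)
       ((\<lambda>(d, x, y, z). Cmp C b d a (Cmp C d d a x y) z) ` {(d, x, y, z). x \<in> Gm a d \<and> y \<in> G0 d \<and> z \<in> Gp d b})"
begin

definition "G0' = (\<lambda>a b. if a = b then G0 a else {})"

definition "Bm = gr Gm"
definition "B0 = gr G0'"
definition "Bp = gr Gp"

lemma graded: "graded Gm" "graded G0'" "graded Gp"
  using Gm G0 Gp by (auto simp: graded_def G0'_def)

lemma B_sub: "Bm \<subseteq> carrier A" "B0 \<subseteq> carrier A" "Bp \<subseteq> carrier A"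
  by (auto simp: Bm_def B0_def Bp_def gr_carrier)

lemma B_submodule: "submodule class_ring Bm A" "submodule class_ring B0 A" "submodule class_ring Bp A"
  by (simp_all add: Bm_def B0_def Bp_def gr_submodule graded)

abbreviation "FS \<equiv> free_space (Bm \<times> B0 \<times> Bp) :: ('k, ('o \<Rightarrow> 'o \<Rightarrow> 'm) \<times> ('o \<Rightarrow> 'o \<Rightarrow> 'm) \<times> ('o \<Rightarrow> 'o \<Rightarrow> 'm) \<Rightarrow>\<^sub>0 'k) module"
abbreviation "RL \<equiv> tensor_relators A (local_units C) Bm B0 Bp"
abbreviation "NN \<equiv> LinearCombinations.module.span class_ring FS RL"

sublocale F: vectorspace class_ring FS by (rule free_space_vectorspace)

lemma B_mult_local_units:
  "x \<in> Bm \<Longrightarrow> e \<in> local_units C \<Longrightarrow> x \<otimes>\<^bsub>A\<^esub> e \<in> Bm"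
  "y \<in> B0 \<Longrightarrow> e \<in> local_units C \<Longrightarrow> e \<otimes>\<^bsub>A\<^esub> y \<in> B0"
  "y \<in> B0 \<Longrightarrow> e \<in> local_units C \<Longrightarrow> y \<otimes>\<^bsub>A\<^esub> e \<in> B0"
  "z \<in> Bp \<Longrightarrow> e \<in> local_units C \<Longrightarrow> e \<otimes>\<^bsub>A\<^esub> z \<in> Bp"
  by (simp_all add: Bm_def B0_def Bp_def gr_mult_local_units graded)

lemmas B_closed = submoduleD(2-4)[OF B_submodule(1)] submoduleD(2-4)[OF B_submodule(2)] submoduleD(2-4)[OF B_submodule(3)]

lemma single_FS: "t \<in> Bm \<times> B0 \<times> Bp \<Longrightarrow> Poly_Mapping.single t s \<in> carrier FS"
  by auto

lemma minus_FS: "p \<in> carrier FS \<Longrightarrow> p' \<in> carrier FS \<Longrightarrow> p - p' \<in> carrier FS"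
  using keys_minus_sub by simp

lemma RL_sub: "RL \<subseteq> carrier FS"
  unfolding tensor_relators_def
  by (intro subsetI, elim UnE CollectE exE conjE; hypsubst)
    (simp_all add: minus_FS single_FS B_closed B_mult_local_units del: free_space_simps)

lemma NN_submodule: "submodule class_ring NN FS"
  by (rule F.span_is_submodule[OF RL_sub])

lemma RL_NN: "p \<in> RL \<Longrightarrow> p \<in> NN"
  using F.in_own_span[OF RL_sub] by blast

definition mu :: "('o \<Rightarrow> 'o \<Rightarrow> 'm) \<times> ('o \<Rightarrow> 'o \<Rightarrow> 'm) \<times> ('o \<Rightarrow> 'o \<Rightarrow> 'm) \<Rightarrow> 'o \<Rightarrow> 'o \<Rightarrow> 'm" where
  "mu = (\<lambda>(x, y, z). x \<otimes>\<^bsub>A\<^esub> y \<otimes>\<^bsub>A\<^esub> z)"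

lemma mu_closed: "t \<in> Bm \<times> B0 \<times> Bp \<Longrightarrow> mu t \<in> carrier A"
  using B_sub(1)[THEN subsetD] B_sub(2)[THEN subsetD] B_sub(3)[THEN subsetD] by (auto simp: mu_def)

lemma mult_lin_sum:
  assumes "finite S" "Poly_Mapping.keys p \<subseteq> S" "S \<subseteq> Bm \<times> B0 \<times> Bp"
  shows "mult_lin A p = (\<Oplus>\<^bsub>A\<^esub>t\<in>S. Poly_Mapping.lookup p t \<odot>\<^bsub>A\<^esub> mu t)"
  unfolding mult_lin_def mu_def[symmetric]
proof (rule A.add.finprod_mono_neutral_cong_left[OF assms(1,2)])
  have c: "mu t \<in> carrier A" if "t \<in> S" for t using that assms(3) mu_closed by blast
  show "Poly_Mapping.lookup p t \<odot>\<^bsub>A\<^esub> mu t = \<zero>\<^bsub>A\<^esub>" if "t \<in> S - Poly_Mapping.keys p" for t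
    using that A.lmult_0[OF c[of t]] by (simp add: in_keys_iff class_ring_simps)
  show "(\<lambda>t. Poly_Mapping.lookup p t \<odot>\<^bsub>A\<^esub> mu t) \<in> S \<rightarrow> carrier A" using c by auto
qed (simp add: mu_def)

lemma mult_lin_hom: "mult_lin A \<in> LinearCombinations.module_hom class_ring FS A"
  unfolding LinearCombinations.module_hom_def
proof (intro CollectI conjI allI impI funcsetI)
  fix p assume "p \<in> carrier FS"
  then have p: "Poly_Mapping.keys p \<subseteq> Bm \<times> B0 \<times> Bp" by simp
  then show "mult_lin A p \<in> carrier A"
    using mu_closed by (subst mult_lin_sum[OF _ Set.subset_refl p]) (auto intro!: A.finsum_closed)
next
  fix p p' assume "p \<in> carrier FS \<and> p' \<in> carrier FS"
  then have p: "Poly_Mapping.keys p \<subseteq> Bm \<times> B0 \<times> Bp" "Poly_Mapping.keys p' \<subseteq> Bm \<times> B0 \<times> Bp" by simp_all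
  let ?S = "Poly_Mapping.keys p \<union> Poly_Mapping.keys p'"
  have S: "finite ?S" "?S \<subseteq> Bm \<times> B0 \<times> Bp" using p by auto
  have c: "mu t \<in> carrier A" if "t \<in> ?S" for t using that S mu_closed by blast
  have "mult_lin A (p + p') = (\<Oplus>\<^bsub>A\<^esub>t\<in>?S. Poly_Mapping.lookup (p + p') t \<odot>\<^bsub>A\<^esub> mu t)"
    by (rule mult_lin_sum[OF S(1) _ S(2)]) (rule Poly_Mapping.keys_add)
  also have "\<dots> = (\<Oplus>\<^bsub>A\<^esub>t\<in>?S. Poly_Mapping.lookup p t \<odot>\<^bsub>A\<^esub> mu t \<oplus>\<^bsub>A\<^esub> Poly_Mapping.lookup p' t \<odot>\<^bsub>A\<^esub> mu t)"
  proof (rule A.finsum_cong')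
    show "Poly_Mapping.lookup (p + p') t \<odot>\<^bsub>A\<^esub> mu t = Poly_Mapping.lookup p t \<odot>\<^bsub>A\<^esub> mu t \<oplus>\<^bsub>A\<^esub> Poly_Mapping.lookup p' t \<odot>\<^bsub>A\<^esub> mu t"
      if "t \<in> ?S" for t
      using A.smult_l_distr[of "Poly_Mapping.lookup p t" "Poly_Mapping.lookup p' t" "mu t"] c[OF that]
      by (simp add: lookup_add class_ring_simps)
  qed (use c in auto)
  also have "\<dots> = (\<Oplus>\<^bsub>A\<^esub>t\<in>?S. Poly_Mapping.lookup p t \<odot>\<^bsub>A\<^esub> mu t) \<oplus>\<^bsub>A\<^esub> (\<Oplus>\<^bsub>A\<^esub>t\<in>?S. Poly_Mapping.lookup p' t \<odot>\<^bsub>A\<^esub> mu t)"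
    by (rule A.finsum_addf) (use c in auto)
  also have "\<dots> = mult_lin A p \<oplus>\<^bsub>A\<^esub> mult_lin A p'"
    using mult_lin_sum[OF S(1) _ S(2), of p] mult_lin_sum[OF S(1) _ S(2), of p'] by simp
  finally show "mult_lin A (p \<oplus>\<^bsub>FS\<^esub> p') = mult_lin A p \<oplus>\<^bsub>A\<^esub> mult_lin A p'" by simp
next
  fix s :: 'k and p assume "s \<in> carrier class_ring \<and> p \<in> carrier FS"
  then have p: "Poly_Mapping.keys p \<subseteq> Bm \<times> B0 \<times> Bp" by simp
  let ?S = "Poly_Mapping.keys p"
  have c: "mu t \<in> carrier A" if "t \<in> ?S" for t using that p mu_closed by blast
  have "mult_lin A (Poly_Mapping.map ((*) s) p) = (\<Oplus>\<^bsub>A\<^esub>t\<in>?S. Poly_Mapping.lookup (Poly_Mapping.map ((*) s) p) t \<odot>\<^bsub>A\<^esub> mu t)"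
    by (rule mult_lin_sum[OF _ keys_scale p]) simp
  also have "\<dots> = (\<Oplus>\<^bsub>A\<^esub>t\<in>?S. s \<odot>\<^bsub>A\<^esub> (Poly_Mapping.lookup p t \<odot>\<^bsub>A\<^esub> mu t))"
  proof (rule A.finsum_cong')
    show "Poly_Mapping.lookup (Poly_Mapping.map ((*) s) p) t \<odot>\<^bsub>A\<^esub> mu t = s \<odot>\<^bsub>A\<^esub> (Poly_Mapping.lookup p t \<odot>\<^bsub>A\<^esub> mu t)"
      if "t \<in> ?S" for t
      using A.smult_assoc1[of s "Poly_Mapping.lookup p t" "mu t"] c[OF that] by (simp add: class_ring_simps)
  qed (use c in auto)
  also have "\<dots> = s \<odot>\<^bsub>A\<^esub> (\<Oplus>\<^bsub>A\<^esub>t\<in>?S. Poly_Mapping.lookup p t \<odot>\<^bsub>A\<^esub> mu t)"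
    by (rule A.finsum_smult[symmetric]) (use c in auto)
  also have "\<dots> = s \<odot>\<^bsub>A\<^esub> mult_lin A p" using mult_lin_sum[OF _ Set.subset_refl p] by simp
  finally show "mult_lin A (s \<odot>\<^bsub>FS\<^esub> p) = s \<odot>\<^bsub>A\<^esub> mult_lin A p" by simp
qed

sublocale ml: mod_hom class_ring FS A "mult_lin A"
  using F.module_axioms A.module_axioms mult_lin_hom by (simp add: mod_hom_def mod_hom_axioms_def)

lemma mult_lin_single: "t \<in> Bm \<times> B0 \<times> Bp \<Longrightarrow> mult_lin A (Poly_Mapping.single t c) = c \<odot>\<^bsub>A\<^esub> mu t"
  using mult_lin_sum[of "{t}" "Poly_Mapping.single t c"] mu_closed[of t]
  by (simp add: A.finsum_insert)

lemma mult_lin_minus: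
  assumes "p \<in> carrier FS" "p' \<in> carrier FS" shows "mult_lin A (p - p') = mult_lin A p \<ominus>\<^bsub>A\<^esub> mult_lin A p'"
proof -
  have d: "p - p' \<in> carrier FS" using assms by (rule minus_FS)
  have "mult_lin A ((p - p') + p') = mult_lin A (p - p') \<oplus>\<^bsub>A\<^esub> mult_lin A p'"
    using ml.f_add[OF d assms(2)] by simp
  then show ?thesis using ml.f_im[OF d] ml.f_im[OF assms(2)] ml.f_im[OF assms(1)]
    by (simp add: a_minus_def A.a_assoc A.r_neg)
qed

text \<open>Each kind of relator is killed by one law of the multiplication: additivity,
  compatibility with scalars, or associativity with a local unit in the middle.\<close>

lemma RL_ker: "RL \<subseteq> ml.ker"
proof
  fix p assume p: "p \<in> RL"
  have c: "x \<in> carrier A" if "x \<in> Bm \<or> x \<in> B0 \<or> x \<in> Bp" for x using that B_sub by blast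
  have z: "a \<ominus>\<^bsub>A\<^esub> b = \<zero>\<^bsub>A\<^esub>" if "a = b" "b \<in> carrier A" for a b using that by (simp add: A.r_neg a_minus_def)
  have z2: "a \<ominus>\<^bsub>A\<^esub> b \<ominus>\<^bsub>A\<^esub> d = \<zero>\<^bsub>A\<^esub>" if "a = b \<oplus>\<^bsub>A\<^esub> d" "b \<in> carrier A" "d \<in> carrier A" for a b d
  proof -
    have "a \<ominus>\<^bsub>A\<^esub> b = d" using that(2,3) unfolding that(1) A.a_comm[OF that(2,3)]
      by (simp add: a_minus_def A.a_assoc A.r_neg)
    then show ?thesis using that(3) by (simp add: z)
  qed
  have one: "1 \<odot>\<^bsub>A\<^esub> x = x" if "x \<in> carrier A" for x using A.smult_one[OF that] by (simp add: class_ring_simps)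
  have "mult_lin A p = \<zero>\<^bsub>A\<^esub>"
    using p unfolding tensor_relators_def
    by (elim UnE CollectE exE conjE; hypsubst)
      (simp_all add: mult_lin_minus mult_lin_single mu_def B_closed B_mult_local_units c one mult_add_l mult_add_r
        mult_smult mult_local_units single_FS minus_FS z z2 del: free_space_simps)
  then show "p \<in> ml.ker" using p RL_sub by (auto simp: ml.ker_def)
qed

lemma NN_ker: "p \<in> NN \<Longrightarrow> mult_lin A p = \<zero>\<^bsub>A\<^esub>"
  using F.span_is_subset[OF RL_ker ml.ker_is_submodule] by (auto simp: ml.ker_def)

end

section \<open>Kernel and image of the multiplication map\<close>

context triangular_basis
begin

definition T :: "'o \<Rightarrow> 'o \<Rightarrow> ('o \<times> 'm \<times> 'm \<times> 'm) set" where
  "T a b = {(d, x, y, z). x \<in> Gm a d \<and> y \<in> G0 d \<and> z \<in> Gp d b}"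

definition P :: "'o \<Rightarrow> 'o \<Rightarrow> ('o \<times> 'm \<times> 'm \<times> 'm) \<Rightarrow> 'm" where
  "P a b = (\<lambda>(d, x, y, z). Cmp C b d a (Cmp C d d a x y) z)"

text \<open>The elementary tensors of matrix units that will turn out to represent a basis of the
  tensor product.\<close>

definition key :: "'o \<Rightarrow> 'o \<Rightarrow> ('o \<times> 'm \<times> 'm \<times> 'm) \<Rightarrow> ('o \<Rightarrow> 'o \<Rightarrow> 'm) \<times> ('o \<Rightarrow> 'o \<Rightarrow> 'm) \<times> ('o \<Rightarrow> 'o \<Rightarrow> 'm)" where
  "key a b = (\<lambda>(d, x, y, z). (E a d x, E d d y, E d b z))"

lemma P_inj: "inj_on (P a b) (T a b)"
  unfolding P_def T_def by (rule prod_inj)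

lemma P_basis: "H.basis b a (P a b ` T a b)"
  unfolding P_def T_def by (rule prod_basis)

lemma G_carrier: "x \<in> Gm a d \<Longrightarrow> x \<in> carrier (H d a)" "y \<in> G0 d \<Longrightarrow> y \<in> carrier (H d d)"
  "z \<in> Gp d b \<Longrightarrow> z \<in> carrier (H b d)"
  using Gm G0 Gp by blast+

lemma P_closed: "\<tau> \<in> T a b \<Longrightarrow> P a b \<tau> \<in> carrier (H b a)"
  by (auto simp: T_def P_def G_carrier)

lemma class_ring_one_ne: "carrier (class_ring :: 'k ring) \<noteq> {\<zero>\<^bsub>class_ring\<^esub>}"
proof -
  have "(1::'k) \<in> UNIV - {0}" by simp
  then show ?thesis unfolding class_ring_simps by blast
qed

lemma P_nonzero: "\<tau> \<in> T a b \<Longrightarrow> P a b \<tau> \<noteq> \<zero>\<^bsub>H b a\<^esub>"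
proof
  assume t: "\<tau> \<in> T a b" "P a b \<tau> = \<zero>\<^bsub>H b a\<^esub>"
  have "P a b \<tau> \<in> P a b ` T a b" using t(1) by (rule imageI)
  moreover have "P a b ` T a b \<subseteq> carrier (H b a)" "\<not> H.lin_dep b a (P a b ` T a b)"
    using P_basis by (simp_all add: H.basis_def)
  ultimately show False using H.zero_nin_lin_indpt[of "P a b ` T a b" b a] t(2) class_ring_one_ne by force
qed

lemma first_nonzero: "(d, x, y, z) \<in> T a b \<Longrightarrow> x \<noteq> \<zero>\<^bsub>H d a\<^esub>"
  using P_nonzero[of "(d, x, y, z)" a b] by (auto simp: P_def T_def G_carrier)

lemma E_in_B:
  "x \<in> Gm a d \<Longrightarrow> E a d x \<in> Bm" "y \<in> G0 d \<Longrightarrow> E d d y \<in> B0" "z \<in> Gp d b \<Longrightarrow> E d b z \<in> Bp"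
proof -
  show "x \<in> Gm a d \<Longrightarrow> E a d x \<in> Bm" unfolding Bm_def by (rule E_in_gr[OF graded(1) sp_gen[OF graded(1)]])
  have "y \<in> G0 d \<Longrightarrow> y \<in> G0' d d" by (simp add: G0'_def)
  then show "y \<in> G0 d \<Longrightarrow> E d d y \<in> B0" unfolding B0_def by (rule E_in_gr[OF graded(2) sp_gen[OF graded(2)]])
  show "z \<in> Gp d b \<Longrightarrow> E d b z \<in> Bp" unfolding Bp_def by (rule E_in_gr[OF graded(3) sp_gen[OF graded(3)]])
qed

lemma key_in: "\<tau> \<in> T a b \<Longrightarrow> key a b \<tau> \<in> Bm \<times> B0 \<times> Bp"
  by (auto simp: T_def key_def E_in_B)

lemma mu_key: "\<tau> \<in> T a b \<Longrightarrow> mu (key a b \<tau>) = E a b (P a b \<tau>)"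
  by (auto simp: T_def key_def mu_def P_def E_mult G_carrier)

text \<open>The middle object \<open>d\<close> is not stored in the key; it is recovered as the
  column of the only nonzero entry of \<open>E a d x\<close>, where \<open>x\<close> is nonzero
  because the products are basis vectors.\<close>

lemma key_inj: "inj_on (key a b) (T a b)"
proof (rule inj_onI)
  fix \<tau> \<tau>' assume t: "\<tau> \<in> T a b" "\<tau>' \<in> T a b" "key a b \<tau> = key a b \<tau>'"
  obtain d x y z where \<tau>: "\<tau> = (d, x, y, z)" by (cases \<tau>)
  obtain d' x' y' z' where \<tau>': "\<tau>' = (d', x', y', z')" by (cases \<tau>')
  have e: "E a d x = E a d' x'" "E d d y = E d' d' y'" "E d b z = E d' b z'"
    using t(3) by (auto simp: key_def \<tau> \<tau>')
  have "d = d'"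
  proof (rule ccontr)
    assume "d \<noteq> d'"
    then have "E a d' x' a d = \<zero>\<^bsub>H d a\<^esub>" by (simp add: E_apply)
    then have "x = \<zero>\<^bsub>H d a\<^esub>" using e(1) E_self[of a d x] by simp
    then show False using first_nonzero t(1) \<tau> by blast
  qed
  moreover have "x = x'" "y = y'" "z = z'"
    using e unfolding \<open>d = d'\<close> by (metis E_self)+
  ultimately show "\<tau> = \<tau>'" by (simp add: \<tau> \<tau>')
qed

text \<open>Modulo the tensor relations every element is supported on the triples of basis elements, and
  multiplication is injective on such elements because the products form bases.\<close>

definition K3 where "K3 = (\<Union>a b. key a b ` T a b)"

lemma K3_sub: "K3 \<subseteq> Bm \<times> B0 \<times> Bp"
  unfolding K3_def using key_in by blast

definition U where "U = {p \<in> carrier FS. \<exists>v. Poly_Mapping.keys v \<subseteq> K3 \<and> p - v \<in> NN}"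

lemma NN_closed: "p \<in> NN \<Longrightarrow> p' \<in> NN \<Longrightarrow> p + p' \<in> NN" "p \<in> NN \<Longrightarrow> Poly_Mapping.map ((*) s) p \<in> NN" "0 \<in> NN"
  using submoduleD(2-4)[OF NN_submodule] by (simp_all del: free_space_simps(1))

lemma U_add: "p \<in> U \<Longrightarrow> p' \<in> U \<Longrightarrow> p + p' \<in> U"
proof -
  assume "p \<in> U" "p' \<in> U"
  then obtain v v' where v: "Poly_Mapping.keys v \<subseteq> K3" "p - v \<in> NN" "Poly_Mapping.keys v' \<subseteq> K3" "p' - v' \<in> NN"
    and p: "p \<in> carrier FS" "p' \<in> carrier FS" by (auto simp: U_def)
  have "Poly_Mapping.keys (v + v') \<subseteq> K3" using v(1,3) Poly_Mapping.keys_add[of v v'] by blast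
  moreover have "p + p' - (v + v') \<in> NN" using NN_closed(1)[OF v(2,4)] by (simp add: algebra_simps)
  moreover have "p + p' \<in> carrier FS" using F.a_closed[OF p] by (simp del: free_space_simps(1))
  ultimately show ?thesis unfolding U_def by blast
qed

lemma U_scale: "p \<in> U \<Longrightarrow> Poly_Mapping.map ((*) s) p \<in> U"
proof -
  assume "p \<in> U"
  then obtain v where v: "Poly_Mapping.keys v \<subseteq> K3" "p - v \<in> NN" and p: "p \<in> carrier FS" by (auto simp: U_def)
  have "Poly_Mapping.keys (Poly_Mapping.map ((*) s) v) \<subseteq> K3" by (rule order.trans[OF keys_scale v(1)])
  moreover have e: "Poly_Mapping.map ((*) s) p - Poly_Mapping.map ((*) s) v = Poly_Mapping.map ((*) s) (p - v)"
    by (rule poly_mapping_eqI) (simp add: lookup_minus right_diff_distrib)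
  have "Poly_Mapping.map ((*) s) p - Poly_Mapping.map ((*) s) v \<in> NN" unfolding e by (rule NN_closed(2)[OF v(2)])
  moreover have "Poly_Mapping.map ((*) s) p \<in> carrier FS"
    using p order.trans[OF keys_scale[of s p]] by simp
  ultimately show ?thesis unfolding U_def by blast
qed

lemma U_cong: "p' \<in> U \<Longrightarrow> p \<in> carrier FS \<Longrightarrow> p - p' \<in> NN \<Longrightarrow> p \<in> U"
proof -
  assume "p' \<in> U" and p: "p \<in> carrier FS" "p - p' \<in> NN"
  then obtain v where v: "Poly_Mapping.keys v \<subseteq> K3" "p' - v \<in> NN" by (auto simp: U_def)
  have "p - v \<in> NN" using NN_closed(1)[OF p(2) v(2)] by simp
  then show ?thesis using v p unfolding U_def by blast
qed

lemma U_zero: "0 \<in> U"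
  unfolding U_def using NN_closed(3) by (auto intro!: exI[of _ 0])

lemma U_NN: "p \<in> carrier FS \<Longrightarrow> p \<in> NN \<Longrightarrow> p \<in> U"
  by (rule U_cong[OF U_zero]) simp_all

lemma scale_single: "Poly_Mapping.map ((*) s) (Poly_Mapping.single t (1::'k)) = Poly_Mapping.single t s"
  by (rule poly_mapping_eqI) (simp add: lookup_single when_def)

lemma U_single: "Poly_Mapping.single t 1 \<in> U \<Longrightarrow> Poly_Mapping.single t s \<in> U"
  using U_scale[of "Poly_Mapping.single t 1" s] by (simp add: scale_single)

lemma smult_0_A: "0 \<odot>\<^bsub>A\<^esub> \<zero>\<^bsub>A\<^esub> = \<zero>\<^bsub>A\<^esub>"
  by (rule A.rmult_0) simp

lemma RL_add:
  "x \<in> Bm \<Longrightarrow> x' \<in> Bm \<Longrightarrow> y \<in> B0 \<Longrightarrow> z \<in> Bp \<Longrightarrow> triple (x \<oplus>\<^bsub>A\<^esub> x') y z - (triple x y z + triple x' y z) \<in> NN"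
  "x \<in> Bm \<Longrightarrow> y \<in> B0 \<Longrightarrow> y' \<in> B0 \<Longrightarrow> z \<in> Bp \<Longrightarrow> triple x (y \<oplus>\<^bsub>A\<^esub> y') z - (triple x y z + triple x y' z) \<in> NN"
  "x \<in> Bm \<Longrightarrow> y \<in> B0 \<Longrightarrow> z \<in> Bp \<Longrightarrow> z' \<in> Bp \<Longrightarrow> triple x y (z \<oplus>\<^bsub>A\<^esub> z') - (triple x y z + triple x y z') \<in> NN"
proof -
  show "x \<in> Bm \<Longrightarrow> x' \<in> Bm \<Longrightarrow> y \<in> B0 \<Longrightarrow> z \<in> Bp \<Longrightarrow> triple (x \<oplus>\<^bsub>A\<^esub> x') y z - (triple x y z + triple x' y z) \<in> NN"
    unfolding diff_diff_eq[symmetric]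
    by (rule RL_NN, unfold tensor_relators_def, rule UnI1, rule UnI1, rule UnI1, rule UnI1, rule UnI1, rule UnI1, rule UnI1, rule CollectI, intro exI conjI, rule HOL.refl)
  show "x \<in> Bm \<Longrightarrow> y \<in> B0 \<Longrightarrow> y' \<in> B0 \<Longrightarrow> z \<in> Bp \<Longrightarrow> triple x (y \<oplus>\<^bsub>A\<^esub> y') z - (triple x y z + triple x y' z) \<in> NN"
    unfolding diff_diff_eq[symmetric]
    by (rule RL_NN, unfold tensor_relators_def, rule UnI1, rule UnI1, rule UnI1, rule UnI1, rule UnI1, rule UnI1, rule UnI2, rule CollectI, intro exI conjI, rule HOL.refl)
  show "x \<in> Bm \<Longrightarrow> y \<in> B0 \<Longrightarrow> z \<in> Bp \<Longrightarrow> z' \<in> Bp \<Longrightarrow> triple x y (z \<oplus>\<^bsub>A\<^esub> z') - (triple x y z + triple x y z') \<in> NN"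
    unfolding diff_diff_eq[symmetric]
    by (rule RL_NN, unfold tensor_relators_def, rule UnI1, rule UnI1, rule UnI1, rule UnI1, rule UnI1, rule UnI2, rule CollectI, intro exI conjI, rule HOL.refl)
qed

lemma RL_smult:
  "x \<in> Bm \<Longrightarrow> y \<in> B0 \<Longrightarrow> z \<in> Bp \<Longrightarrow> triple (s \<odot>\<^bsub>A\<^esub> x) y z - Poly_Mapping.single (x, y, z) s \<in> NN"
  "x \<in> Bm \<Longrightarrow> y \<in> B0 \<Longrightarrow> z \<in> Bp \<Longrightarrow> triple x (s \<odot>\<^bsub>A\<^esub> y) z - Poly_Mapping.single (x, y, z) s \<in> NN"
  "x \<in> Bm \<Longrightarrow> y \<in> B0 \<Longrightarrow> z \<in> Bp \<Longrightarrow> triple x y (s \<odot>\<^bsub>A\<^esub> z) - Poly_Mapping.single (x, y, z) s \<in> NN"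
proof -
  show "x \<in> Bm \<Longrightarrow> y \<in> B0 \<Longrightarrow> z \<in> Bp \<Longrightarrow> triple (s \<odot>\<^bsub>A\<^esub> x) y z - Poly_Mapping.single (x, y, z) s \<in> NN"
    by (rule RL_NN, unfold tensor_relators_def, blast)
  show "x \<in> Bm \<Longrightarrow> y \<in> B0 \<Longrightarrow> z \<in> Bp \<Longrightarrow> triple x (s \<odot>\<^bsub>A\<^esub> y) z - Poly_Mapping.single (x, y, z) s \<in> NN"
    by (rule RL_NN, unfold tensor_relators_def, blast)
  show "x \<in> Bm \<Longrightarrow> y \<in> B0 \<Longrightarrow> z \<in> Bp \<Longrightarrow> triple x y (s \<odot>\<^bsub>A\<^esub> z) - Poly_Mapping.single (x, y, z) s \<in> NN"
    by (rule RL_NN, unfold tensor_relators_def, blast)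
qed

lemma RL_bal:
  "x \<in> Bm \<Longrightarrow> y \<in> B0 \<Longrightarrow> z \<in> Bp \<Longrightarrow> e \<in> local_units C \<Longrightarrow> triple (x \<otimes>\<^bsub>A\<^esub> e) y z - triple x (e \<otimes>\<^bsub>A\<^esub> y) z \<in> NN"
  "x \<in> Bm \<Longrightarrow> y \<in> B0 \<Longrightarrow> z \<in> Bp \<Longrightarrow> e \<in> local_units C \<Longrightarrow> triple x (y \<otimes>\<^bsub>A\<^esub> e) z - triple x y (e \<otimes>\<^bsub>A\<^esub> z) \<in> NN"
proof -
  show "x \<in> Bm \<Longrightarrow> y \<in> B0 \<Longrightarrow> z \<in> Bp \<Longrightarrow> e \<in> local_units C \<Longrightarrow> triple (x \<otimes>\<^bsub>A\<^esub> e) y z - triple x (e \<otimes>\<^bsub>A\<^esub> y) z \<in> NN"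
    by (rule RL_NN, unfold tensor_relators_def, blast)
  show "x \<in> Bm \<Longrightarrow> y \<in> B0 \<Longrightarrow> z \<in> Bp \<Longrightarrow> e \<in> local_units C \<Longrightarrow> triple x (y \<otimes>\<^bsub>A\<^esub> e) z - triple x y (e \<otimes>\<^bsub>A\<^esub> z) \<in> NN"
    by (rule RL_NN, unfold tensor_relators_def, blast)
qed

lemma RL_zero:
  "y \<in> B0 \<Longrightarrow> z \<in> Bp \<Longrightarrow> triple \<zero>\<^bsub>A\<^esub> y z \<in> NN"
  "x \<in> Bm \<Longrightarrow> z \<in> Bp \<Longrightarrow> triple x \<zero>\<^bsub>A\<^esub> z \<in> NN"
  "x \<in> Bm \<Longrightarrow> y \<in> B0 \<Longrightarrow> triple x y \<zero>\<^bsub>A\<^esub> \<in> NN"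
  using RL_smult(1)[of "\<zero>\<^bsub>A\<^esub>" y z 0] RL_smult(2)[of x "\<zero>\<^bsub>A\<^esub>" z 0] RL_smult(3)[of x y "\<zero>\<^bsub>A\<^esub>" 0]
  by (simp_all add: smult_0_A B_closed)

text \<open>With two factors fixed, the third factors whose triple lies in \<open>U\<close> form a
  subspace. So \<open>gr_induct\<close> can be applied to one factor at a time and it suffices to
  treat generators.\<close>

lemma slots:
  "y \<in> B0 \<Longrightarrow> z \<in> Bp \<Longrightarrow> submodule class_ring {x \<in> Bm. triple x y z \<in> U} A"
  "x \<in> Bm \<Longrightarrow> z \<in> Bp \<Longrightarrow> submodule class_ring {y \<in> B0. triple x y z \<in> U} A"
  "x \<in> Bm \<Longrightarrow> y \<in> B0 \<Longrightarrow> submodule class_ring {z \<in> Bp. triple x y z \<in> U} A"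
proof -
  note c = single_FS[of "(_, _, _)" 1]
  show "submodule class_ring {x \<in> Bm. triple x y z \<in> U} A" if yz: "y \<in> B0" "z \<in> Bp"
  proof (rule submodule_A; (elim CollectE conjE)?; (intro CollectI conjI)?)
    show "{x \<in> Bm. triple x y z \<in> U} \<subseteq> carrier A" using B_sub by blast
    show "triple \<zero>\<^bsub>A\<^esub> y z \<in> U" using yz by (intro U_NN[OF c] RL_zero) (auto simp: B_closed)
    show "triple (x \<oplus>\<^bsub>A\<^esub> x') y z \<in> U" if "x \<in> Bm" "triple x y z \<in> U" "x' \<in> Bm" "triple x' y z \<in> U" for x x'
      using that yz by (intro U_cong[OF U_add[OF that(2,4)] c] RL_add) (auto simp: B_closed)
    show "triple (s \<odot>\<^bsub>A\<^esub> x) y z \<in> U" if "x \<in> Bm" "triple x y z \<in> U" for x s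
      using that yz by (intro U_cong[OF U_single[OF that(2), of s] c] RL_smult) (auto simp: B_closed)
  qed (auto simp: B_closed)
  show "submodule class_ring {y \<in> B0. triple x y z \<in> U} A" if yz: "x \<in> Bm" "z \<in> Bp"
  proof (rule submodule_A; (elim CollectE conjE)?; (intro CollectI conjI)?)
    show "{y \<in> B0. triple x y z \<in> U} \<subseteq> carrier A" using B_sub by blast
    show "triple x \<zero>\<^bsub>A\<^esub> z \<in> U" using yz by (intro U_NN[OF c] RL_zero) (auto simp: B_closed)
    show "triple x (y \<oplus>\<^bsub>A\<^esub> y') z \<in> U" if "y \<in> B0" "triple x y z \<in> U" "y' \<in> B0" "triple x y' z \<in> U" for y y'
      using that yz by (intro U_cong[OF U_add[OF that(2,4)] c] RL_add) (auto simp: B_closed)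
    show "triple x (s \<odot>\<^bsub>A\<^esub> y) z \<in> U" if "y \<in> B0" "triple x y z \<in> U" for y s
      using that yz by (intro U_cong[OF U_single[OF that(2), of s] c] RL_smult) (auto simp: B_closed)
  qed (auto simp: B_closed)
  show "submodule class_ring {z \<in> Bp. triple x y z \<in> U} A" if yz: "x \<in> Bm" "y \<in> B0"
  proof (rule submodule_A; (elim CollectE conjE)?; (intro CollectI conjI)?)
    show "{z \<in> Bp. triple x y z \<in> U} \<subseteq> carrier A" using B_sub by blast
    show "triple x y \<zero>\<^bsub>A\<^esub> \<in> U" using yz by (intro U_NN[OF c] RL_zero) (auto simp: B_closed)
    show "triple x y (z \<oplus>\<^bsub>A\<^esub> z') \<in> U" if "z \<in> Bp" "triple x y z \<in> U" "z' \<in> Bp" "triple x y z' \<in> U" for z z'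
      using that yz by (intro U_cong[OF U_add[OF that(2,4)] c] RL_add) (auto simp: B_closed)
    show "triple x y (s \<odot>\<^bsub>A\<^esub> z) \<in> U" if "z \<in> Bp" "triple x y z \<in> U" for z s
      using that yz by (intro U_cong[OF U_single[OF that(2), of s] c] RL_smult) (auto simp: B_closed)
  qed (auto simp: B_closed)
qed

lemma obj_idem_local: "obj_idem C d \<in> local_units C"
proof -
  have "obj_idem C ` Obj C \<subseteq> carrier A" by (auto simp: obj_idem_E)
  then show ?thesis unfolding local_units_def using A.in_own_span[of "obj_idem C ` Obj C"] Obj_UNIV by blast
qed

text \<open>If the middle objects agree, the tensor is itself one of the keys. If they differ, an
  idempotent moved across the tensor sign fixes one factor and kills its neighbour, so the tensor is
  zero modulo the relators.\<close>

lemma triple_elementary: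
  assumes x: "x \<in> Gm a d" and y: "y \<in> G0 d'" and z: "z \<in> Gp d'' b"
  shows "triple (E a d x) (E d' d' y) (E d'' b z) \<in> U"
proof -
  note B = E_in_B(1)[OF x] E_in_B(2)[OF y] E_in_B(3)[OF z]
  note c = single_FS[of "(E a d x, E d' d' y, E d'' b z)" 1]
  note Gc = G_carrier(1)[OF x] G_carrier(2)[OF y] G_carrier(3)[OF z]
  consider "d = d'" "d' = d''" | "d \<noteq> d'" | "d' \<noteq> d''" by blast
  then show ?thesis
  proof cases
    case 1
    then have "(E a d x, E d' d' y, E d'' b z) \<in> K3"
      using x y z unfolding K3_def by (auto simp: T_def key_def intro!: rev_image_eqI[of "(d, x, y, z)"])
    then show ?thesis unfolding U_def using c B NN_closed(3)
      by (auto intro!: exI[of _ "triple (E a d x) (E d' d' y) (E d'' b z)"])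
  next
    case 2
    have "E a d x \<otimes>\<^bsub>A\<^esub> obj_idem C d = E a d x" "obj_idem C d \<otimes>\<^bsub>A\<^esub> E d' d' y = \<zero>\<^bsub>A\<^esub>"
      using Gc 2 by (auto simp: obj_idem_E E_mult)
    then have "triple (E a d x) (E d' d' y) (E d'' b z) - triple (E a d x) \<zero>\<^bsub>A\<^esub> (E d'' b z) \<in> NN"
      using RL_bal(1)[OF B obj_idem_local[of d]] by simp
    moreover have "triple (E a d x) \<zero>\<^bsub>A\<^esub> (E d'' b z) \<in> U"
      using B by (intro U_NN single_FS RL_zero) (auto simp: B_closed)
    ultimately show ?thesis using U_cong c B by blast
  next
    case 3
    have "E d' d' y \<otimes>\<^bsub>A\<^esub> obj_idem C d' = E d' d' y" "obj_idem C d' \<otimes>\<^bsub>A\<^esub> E d'' b z = \<zero>\<^bsub>A\<^esub>"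
      using Gc 3 by (auto simp: obj_idem_E E_mult)
    then have "triple (E a d x) (E d' d' y) (E d'' b z) - triple (E a d x) (E d' d' y) \<zero>\<^bsub>A\<^esub> \<in> NN"
      using RL_bal(2)[OF B obj_idem_local[of d']] by simp
    moreover have "triple (E a d x) (E d' d' y) \<zero>\<^bsub>A\<^esub> \<in> U"
      using B by (intro U_NN single_FS RL_zero) (auto simp: B_closed)
    ultimately show ?thesis using U_cong c B by blast
  qed
qed

text \<open>Generators are replaced by arbitrary elements one factor at a time, from the right
  factor to the left one.\<close>

lemma triple_U:
  assumes "x \<in> Bm" "y \<in> B0" "z \<in> Bp" shows "triple x y z \<in> U"
proof -
  have 1: "Bp \<subseteq> {z \<in> Bp. triple (E a d x) (E d' d' y) z \<in> U}" if "x \<in> Gm a d" "y \<in> G0 d'" for a d x d' y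
    unfolding Bp_def by (rule gr_induct[OF slots(3)[OF E_in_B(1)[OF that(1)] E_in_B(2)[OF that(2)], unfolded Bp_def] graded(3)])
      (use that triple_elementary E_in_B in \<open>auto simp: Bp_def\<close>)
  have 1: "triple (E a d x) (E d' d' y) z \<in> U" if "x \<in> Gm a d" "y \<in> G0 d'" "z \<in> Bp" for a d x d' y z
    using 1[OF that(1,2)] that(3) by blast
  have 2: "B0 \<subseteq> {y \<in> B0. triple (E a d x) y z \<in> U}" if "x \<in> Gm a d" "z \<in> Bp" for a d x z
  proof -
    have "E b c g \<in> {y \<in> B0. triple (E a d x) y z \<in> U}" if "g \<in> G0' b c" for b c g
    proof -
      have g: "b = c" "g \<in> G0 c" using that by (simp_all add: G0'_def split: if_splits)
      show ?thesis unfolding g(1) using E_in_B(2)[OF g(2)] 1[OF \<open>x \<in> Gm a d\<close> g(2) \<open>z \<in> Bp\<close>] by blast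
    qed
    then show ?thesis
      using gr_induct[OF slots(2)[OF E_in_B(1)[OF that(1)] that(2)] graded(2)] unfolding B0_def[symmetric] by blast
  qed
  have 2: "triple (E a d x) y z \<in> U" if "x \<in> Gm a d" "y \<in> B0" "z \<in> Bp" for a d x y z
    using 2[OF that(1,3)] that(2) by blast
  have "E a d x \<in> {x \<in> Bm. triple x y z \<in> U}" if "x \<in> Gm a d" for a d x
    using 2[OF that assms(2,3)] E_in_B(1)[OF that] by blast
  then have "Bm \<subseteq> {x \<in> Bm. triple x y z \<in> U}"
    using gr_induct[OF slots(1)[OF assms(2,3)] graded(1)] unfolding Bm_def[symmetric] by blast
  then show ?thesis using assms by blast
qed

lemma U_all: "p \<in> carrier FS \<Longrightarrow> p \<in> U"
proof -
  have "finite S \<Longrightarrow> S \<subseteq> Bm \<times> B0 \<times> Bp \<Longrightarrow> Poly_Mapping.keys p \<subseteq> S \<Longrightarrow> p \<in> U" for S p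
  proof (induction S arbitrary: p rule: finite_induct)
    case empty
    then have "p = 0" by simp
    then show ?case using U_zero by simp
  next
    case (insert t S)
    define p' where "p' = p - Poly_Mapping.single t (Poly_Mapping.lookup p t)"
    have "Poly_Mapping.keys p' \<subseteq> S"
    proof
      fix k assume "k \<in> Poly_Mapping.keys p'"
      then have "Poly_Mapping.lookup p k - (Poly_Mapping.lookup p t when t = k) \<noteq> 0"
        by (simp add: p'_def in_keys_iff lookup_minus lookup_single)
      then have "k \<noteq> t" "Poly_Mapping.lookup p k \<noteq> 0" by (auto simp: when_def split: if_splits)
      then show "k \<in> S" using insert.prems(2) by (auto simp: in_keys_iff)
    qed
    then have "p' \<in> U" using insert.IH insert.prems(1) by blast
    moreover have "Poly_Mapping.single t 1 \<in> U" using triple_U insert.prems(1) by auto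
    ultimately have "p' + Poly_Mapping.single t (Poly_Mapping.lookup p t) \<in> U" using U_add U_single by blast
    then show ?case by (simp add: p'_def)
  qed
  from this[OF finite_keys _ Set.subset_refl] show "p \<in> carrier FS \<Longrightarrow> p \<in> U" by simp
qed

text \<open>The product of a key has a single nonzero entry. Looking at the position belonging to
  one key with nonzero coefficient leaves a linear relation among the products in one morphism
  space, which contradicts the basis property.\<close>

lemma K3_kernel:
  assumes v: "Poly_Mapping.keys v \<subseteq> K3" and z: "mult_lin A v = \<zero>\<^bsub>A\<^esub>"
  shows "v = 0"
proof (rule ccontr)
  assume "v \<noteq> 0"
  then obtain t0 where t0: "t0 \<in> Poly_Mapping.keys v" by (metis ex_in_conv keys_eq_empty)
  then obtain a b \<tau>0 where \<tau>0: "\<tau>0 \<in> T a b" "t0 = key a b \<tau>0" using v by (auto simp: K3_def)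
  define T' where "T' = {\<tau> \<in> T a b. key a b \<tau> \<in> Poly_Mapping.keys v}"
  have kinj: "inj_on (key a b) T'" using key_inj by (rule inj_on_subset) (auto simp: T'_def)
  have pinj: "inj_on (P a b) T'" using P_inj by (rule inj_on_subset) (auto simp: T'_def)
  have "key a b ` T' \<subseteq> Poly_Mapping.keys v" by (auto simp: T'_def)
  then have kT: "key a b ` T' \<subseteq> Poly_Mapping.keys v" .
  have fin: "finite T'" using finite_imageD[OF finite_subset[OF kT finite_keys] kinj] .
  have muc: "mu t \<in> carrier A" if "t \<in> Poly_Mapping.keys v" for t using that v K3_sub mu_closed by blast
  have muab: "mu t a b = \<zero>\<^bsub>H b a\<^esub>" if t: "t \<in> Poly_Mapping.keys v" "t \<notin> key a b ` T'" for t
  proof -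
    obtain a' b' \<tau> where \<tau>: "\<tau> \<in> T a' b'" "t = key a' b' \<tau>" using t(1) v by (auto simp: K3_def)
    then have "(a', b') \<noteq> (a, b)" using t by (auto simp: T'_def)
    then show ?thesis using mu_key[OF \<tau>(1)] \<tau>(2) by (auto simp: E_apply)
  qed
  have ev: "(\<Oplus>\<^bsub>A\<^esub>t\<in>S. f t) a b = (\<Oplus>\<^bsub>H b a\<^esub>t\<in>S. f t a b)" if "finite S" "f \<in> S \<rightarrow> carrier A"
    for S and f :: "('o \<Rightarrow> 'o \<Rightarrow> 'm) \<times> ('o \<Rightarrow> 'o \<Rightarrow> 'm) \<times> ('o \<Rightarrow> 'o \<Rightarrow> 'm) \<Rightarrow> 'o \<Rightarrow> 'o \<Rightarrow> 'm"
    using that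
  proof (induction S rule: finite_induct)
    case (insert t S)
    then have f: "f \<in> S \<rightarrow> carrier A" "f t \<in> carrier A" by simp_all
    have "(\<lambda>t. f t a b) \<in> S \<rightarrow> carrier (H b a)" using funcset_mem[OF f(1)] by (intro funcsetI A_component)
    then show ?case using insert f by (simp add: A.finsum_insert H.finsum_insert)
  qed simp
  have "mult_lin A v = (\<Oplus>\<^bsub>A\<^esub>t\<in>Poly_Mapping.keys v. Poly_Mapping.lookup v t \<odot>\<^bsub>A\<^esub> mu t)"
    using v K3_sub by (intro mult_lin_sum) auto
  then have "mult_lin A v a b = (\<Oplus>\<^bsub>H b a\<^esub>t\<in>Poly_Mapping.keys v. (Poly_Mapping.lookup v t \<odot>\<^bsub>A\<^esub> mu t) a b)"
    using muc by (simp only:) (rule ev, auto)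
  also have "\<dots> = (\<Oplus>\<^bsub>H b a\<^esub>t\<in>key a b ` T'. Poly_Mapping.lookup v t \<odot>\<^bsub>H b a\<^esub> mu t a b)"
    by (rule H.add.finprod_mono_neutral_cong_right) (use muc muab in \<open>auto simp: T'_def\<close>)
  also have "\<dots> = (\<Oplus>\<^bsub>H b a\<^esub>\<tau>\<in>T'. Poly_Mapping.lookup v (key a b \<tau>) \<odot>\<^bsub>H b a\<^esub> mu (key a b \<tau>) a b)"
    by (rule H.finsum_reindex[OF _ kinj], rule funcsetI, rule smult_closed_H, rule A_component, rule muc)
      (use kT in blast)
  also have "\<dots> = (\<Oplus>\<^bsub>H b a\<^esub>\<tau>\<in>T'. Poly_Mapping.lookup v (key a b \<tau>) \<odot>\<^bsub>H b a\<^esub> P a b \<tau>)"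
    by (rule H.finsum_cong') (auto simp: T'_def mu_key P_closed)
  finally have s: "(\<Oplus>\<^bsub>H b a\<^esub>\<tau>\<in>T'. Poly_Mapping.lookup v (key a b \<tau>) \<odot>\<^bsub>H b a\<^esub> P a b \<tau>) = \<zero>\<^bsub>H b a\<^esub>"
    by (simp add: z)
  \<comment> \<open>Linear combinations are indexed by vectors, the coefficients by keys; the
    injectivity of \<open>P a b\<close> on \<open>T'\<close> allows the transport.\<close>
  define c where "c = (\<lambda>f. Poly_Mapping.lookup v (key a b (the_inv_into T' (P a b) f)))"
  have c: "c (P a b \<tau>) = Poly_Mapping.lookup v (key a b \<tau>)" if "\<tau> \<in> T'" for \<tau>
    using the_inv_into_f_f[OF pinj that] by (simp add: c_def)
  have "H.lincomb b a c (P a b ` T') = (\<Oplus>\<^bsub>H b a\<^esub>\<tau>\<in>T'. c (P a b \<tau>) \<odot>\<^bsub>H b a\<^esub> P a b \<tau>)"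
    unfolding H.lincomb_def by (rule H.finsum_reindex[OF _ pinj]) (auto simp: T'_def P_closed)
  also have "\<dots> = \<zero>\<^bsub>H b a\<^esub>"
    unfolding s[symmetric] by (rule H.finsum_cong') (auto simp: c T'_def P_closed)
  finally have lc: "H.lincomb b a c (P a b ` T') = \<zero>\<^bsub>H b a\<^esub>" .
  have \<tau>T: "\<tau>0 \<in> T'" using \<tau>0 t0 by (simp add: T'_def)
  have "H.lin_dep b a (P a b ` T a b)"
    by (rule H.lin_dep_crit[of "P a b ` T'" _ c "P a b \<tau>0"])
      (use fin lc \<tau>T t0 \<tau>0 c[OF \<tau>T] in \<open>auto simp: T'_def in_keys_iff class_ring_simps\<close>)
  then show False using P_basis[of b a] by (simp add: H.basis_def)
qed

text \<open>Modulo the relators, which lie in the kernel, \<open>p\<close> is a combination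
  \<open>v\<close> of keys; then \<open>v\<close> lies in the kernel too and is
  \<open>0\<close>.\<close>

lemma mult_lin_kernel: "p \<in> carrier FS \<Longrightarrow> mult_lin A p = \<zero>\<^bsub>A\<^esub> \<longleftrightarrow> p \<in> NN"
proof
  assume p: "p \<in> carrier FS" and z: "mult_lin A p = \<zero>\<^bsub>A\<^esub>"
  obtain v where v: "Poly_Mapping.keys v \<subseteq> K3" "p - v \<in> NN" using U_all[OF p] by (auto simp: U_def)
  have vF: "v \<in> carrier FS" using v K3_sub by simp
  have "mult_lin A ((p - v) + v) = mult_lin A (p - v) \<oplus>\<^bsub>A\<^esub> mult_lin A v"
    using ml.f_add[OF minus_FS[OF p vF] vF] by simp
  then have "mult_lin A v = \<zero>\<^bsub>A\<^esub>" using z NN_ker[OF v(2)] ml.f_im[OF vF] by simp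
  then have "v = 0" by (rule K3_kernel[OF v(1)])
  then show "p \<in> NN" using v(2) by simp
qed (rule NN_ker)

lemma mult_lin_surj: "mult_lin A ` carrier FS = carrier A"
proof
  show "mult_lin A ` carrier FS \<subseteq> carrier A" using ml.f_im by blast
  have im: "submodule class_ring ml.im A" by (rule ml.im_is_submodule)
  show "carrier A \<subseteq> mult_lin A ` carrier FS"
  proof
    fix x assume x: "x \<in> carrier A"
    have "x \<in> ml.im"
    proof (rule submodule_by_components[OF im x])
      fix a b
      have g: "LinearCombinations.module.span class_ring (H b a) (P a b ` T a b) = carrier (H b a)"
        using P_basis[of b a] by (simp add: H.basis_def)
      have "P a b ` T a b \<subseteq> {f \<in> carrier (H b a). E a b f \<in> ml.im}"
      proof
        fix f assume "f \<in> P a b ` T a b"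
        then obtain \<tau> where \<tau>: "\<tau> \<in> T a b" "f = P a b \<tau>" by blast
        have "mult_lin A (Poly_Mapping.single (key a b \<tau>) 1) = E a b f"
          using mult_lin_single[OF key_in[OF \<tau>(1)], of 1] A.smult_one[of "E a b f"] P_closed[OF \<tau>(1)] \<tau>(2)
          by (simp add: mu_key[OF \<tau>(1)] class_ring_simps)
        moreover have "Poly_Mapping.single (key a b \<tau>) 1 \<in> carrier FS"
          by (rule single_FS[OF key_in[OF \<tau>(1)]])
        ultimately have "E a b f \<in> ml.im" unfolding ml.im_def by (metis imageI)
        then show "f \<in> {f \<in> carrier (H b a). E a b f \<in> ml.im}" using P_closed[OF \<tau>(1)] \<tau>(2) by simp
      qed
      then have "carrier (H b a) \<subseteq> {f \<in> carrier (H b a). E a b f \<in> ml.im}"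
        using H.span_is_subset[OF _ preimage_E[OF im]] g by blast
      then show "E a b (x a b) \<in> ml.im" using A_component[OF x, of a b] by blast
    qed
    then show "x \<in> mult_lin A ` carrier FS" by (simp only: ml.im_def)
  qed
qed

lemma mult_map_iso:
  "mult_map A \<in> LinearCombinations.module_hom class_ring (tensor3 A (local_units C) Bm B0 Bp) A"
  "bij_betw (mult_map A) (carrier (tensor3 A (local_units C) Bm B0 Bp)) (carrier A)"
  using quotient_map_iso[OF F.module_axioms A.module_axioms NN_submodule mult_lin_hom mult_lin_kernel mult_lin_surj]
  by (simp_all add: tensor3_def Let_def mult_map_def[abs_def])

end

section \<open>The decomposition for categories with natural numbers as objects\<close>

locale triangular_basis_nat = triangular_basis C Gm Gp G0
  for C :: "('k::field, nat, 'm) lincat" and Gm Gp :: "nat \<Rightarrow> nat \<Rightarrow> 'm set" and G0 :: "nat \<Rightarrow> 'm set" +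
  assumes Gm_upper: "a < d \<Longrightarrow> Gm a d = {}" and Gp_upper: "b < d \<Longrightarrow> Gp d b = {}"
    and Gm_diag: "Gm a a = {Ide C a}" and Gp_diag: "Gp a a = {Ide C a}"
begin

lemma upper_finite_weakly_triangular:
  assumes "finite_dim_homs C"
  shows "upper_finite_weakly_triangular_category C"
proof -
  \<comment> \<open>The order is opposite to that of the natural numbers: larger classes have fewer
    strands, so only the finitely many \<open>b \<le> a\<close> lie above \<open>a\<close>. The
    equivalence relation on objects is equality, \<open>Id\<close>.\<close>
  define po :: "(nat set \<times> nat set) set" where "po = {({a}, {b}) | a b. b \<le> a}"
  have I: "Obj C // Id = (\<lambda>a. {a}) ` UNIV" by (auto simp: quotient_def Obj_UNIV)
  have corner0: "class_part C (gr G) {a} {b} = {\<zero>\<^bsub>A\<^esub>}" if "graded G" "G a b = {}" for G a b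
    by (simp only: class_part_gr obj_part_gr[OF that(1)] that(2) sp_empty image_insert image_empty E_zero)
  have po: "partial_order_on ((\<lambda>a. {a}) ` UNIV) po"
    unfolding partial_order_on_def preorder_on_def
    by (auto simp: po_def refl_on_def trans_def antisym_def)
  have "weakly_triangular_decomposition C Id po Bm B0 Bp"
    unfolding weakly_triangular_decomposition_def Let_def unfolding I unfolding Obj_UNIV
  proof (intro conjI ballI impI po B_submodule mult_map_iso)
    show "internal_direct_sum A Bm (UNIV \<times> UNIV) (\<lambda>(b, c). obj_part C Bm b c)"
      unfolding Bm_def by (rule direct_sum_gr[OF graded(1)]) simp
    show "internal_direct_sum A Bp (UNIV \<times> UNIV) (\<lambda>(b, c). obj_part C Bp b c)"
      unfolding Bp_def by (rule direct_sum_gr[OF graded(3)]) simp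
    show "internal_direct_sum A B0 {(b, c). \<exists>\<aa>\<in>(\<lambda>a. {a}) ` UNIV. b \<in> \<aa> \<and> c \<in> \<aa>} (\<lambda>(b, c). obj_part C B0 b c)"
      unfolding B0_def by (rule direct_sum_gr[OF graded(2)]) (auto simp: G0'_def)
  next
    fix \<aa> \<bb> :: "nat set" assume "\<aa> \<in> range (\<lambda>a. {a})" "\<bb> \<in> range (\<lambda>a. {a})" "(\<aa>, \<bb>) \<notin> po"
    then obtain a b where ab: "\<aa> = {a}" "\<bb> = {b}" "a < b" by (auto simp: po_def not_le)
    show "class_part C Bm \<aa> \<bb> = {\<zero>\<^bsub>A\<^esub>}"
      unfolding ab(1,2) Bm_def by (rule corner0[OF graded(1) Gm_upper[OF ab(3)]])
    show "class_part C Bp \<bb> \<aa> = {\<zero>\<^bsub>A\<^esub>}"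
      unfolding ab(1,2) Bp_def by (rule corner0[OF graded(3) Gp_upper[OF ab(3)]])
  next
    fix \<aa> :: "nat set" assume "\<aa> \<in> range (\<lambda>a. {a})"
    then obtain a where a: "\<aa> = {a}" by blast
    show "internal_direct_sum A (class_part C Bm \<aa> \<aa>) \<aa> (\<lambda>c. {s \<odot>\<^bsub>A\<^esub> obj_idem C c | s. True})"
      unfolding a Bm_def by (rule direct_sum_one_line[OF graded(1) Gm_diag])
    show "internal_direct_sum A (class_part C Bp \<aa> \<aa>) \<aa> (\<lambda>c. {s \<odot>\<^bsub>A\<^esub> obj_idem C c | s. True})"
      unfolding a Bp_def by (rule direct_sum_one_line[OF graded(3) Gp_diag])
  qed
  moreover have "finite {\<bb> \<in> Obj C // Id. (\<aa>, \<bb>) \<in> po}" if aa: "\<aa> \<in> Obj C // Id" for \<aa>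
  proof -
    obtain a where a: "\<aa> = {a}" using aa unfolding I by blast
    have "{\<bb> \<in> Obj C // Id. (\<aa>, \<bb>) \<in> po} \<subseteq> (\<lambda>b. {b}) ` {..a}" unfolding I a po_def by auto
    then show ?thesis by (rule finite_subset) simp
  qed
  moreover have "equiv (Obj C) Id" by (auto simp: Obj_UNIV equiv_def refl_on_def sym_def trans_def)
  moreover have "\<forall>\<aa> \<in> Obj C // Id. finite \<aa>" unfolding I by auto
  ultimately show ?thesis
    unfolding upper_finite_weakly_triangular_category_def using linear_category_axioms assms by blast
qed

end

section \<open>Labellings of strands\<close>

definition matching :: "nat \<Rightarrow> (nat \<Rightarrow> nat) \<Rightarrow> bool" where
  "matching n \<pi> \<longleftrightarrow> (\<forall>e<n. \<pi> e < n \<and> \<pi> e \<noteq> e \<and> \<pi> (\<pi> e) = e)"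

text \<open>A strand is named by its smaller endpoint, in accordance with the minimum in the
  definition of totally descending diagrams.\<close>

definition lab :: "(nat \<Rightarrow> nat) \<Rightarrow> nat \<Rightarrow> nat" where
  "lab \<pi> e = min e (\<pi> e)"

lemma matchingD:
  assumes "matching n \<pi>" "e < n" shows "\<pi> e < n" "\<pi> e \<noteq> e" "\<pi> (\<pi> e) = e"
  using assms by (auto simp: matching_def)

lemma lab_mate: "matching n \<pi> \<Longrightarrow> e < n \<Longrightarrow> lab \<pi> (\<pi> e) = lab \<pi> e"
  by (auto simp: lab_def matching_def)

lemma lab_lt: "e < n \<Longrightarrow> lab \<pi> e < n"
  by (auto simp: lab_def)

lemma lab_eq_iff:
  assumes "matching n \<pi>" "e < n" "e' < n"
  shows "lab \<pi> e = lab \<pi> e' \<longleftrightarrow> e' = e \<or> e' = \<pi> e"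
proof
  have inv: "\<pi> (\<pi> e) = e" "\<pi> (\<pi> e') = e'" using assms by (auto simp: matching_def)
  assume eq: "lab \<pi> e = lab \<pi> e'"
  have "lab \<pi> e \<in> {e, \<pi> e}" "lab \<pi> e' \<in> {e', \<pi> e'}" by (auto simp: lab_def min_def)
  then have "e = e' \<or> e = \<pi> e' \<or> \<pi> e = e' \<or> \<pi> e = \<pi> e'" using eq by auto
  then show "e' = e \<or> e' = \<pi> e" by (elim disjE) (use inv in metis)+
next
  assume "e' = e \<or> e' = \<pi> e"
  then show "lab \<pi> e = lab \<pi> e'" using lab_mate[OF assms(1,2)] by (elim disjE) simp_all
qed

fun up1 :: "nat \<times> nat \<Rightarrow> nat \<times> nat" where "up1 (h, p) = (Suc h, p)"

lemma up1_conv: "up1 P = (Suc (fst P), snd P)" by (cases P) simp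

lemma slice_segments_Suc: "slice_segments (Suc h) s = map_prod up1 up1 ` slice_segments h s"
proof -
  obtain i g j where s: "s = (i, g, j)" by (cases s) auto
  have img: "map_prod up1 up1 ` {((h, f p), (Suc h, k p)) | p. Q p}
      = {((Suc h, f p), (Suc (Suc h), k p)) | p. Q p}" for f k and Q :: "nat \<Rightarrow> bool"
    by force
  show ?thesis unfolding s slice_segments.simps image_Un img
    by (cases g) (auto simp: image_iff)
qed

lemma segments_Cons: "segments (s # D) = slice_segments 0 s \<union> map_prod up1 up1 ` segments D"
  unfolding segments_def
  by (simp add: lessThan_Suc_eq_insert_0 slice_segments_Suc image_UN)

lemma segments_snoc: "segments (D @ [s]) = segments D \<union> slice_segments (length D) s"
  unfolding segments_def by (auto simp: lessThan_Suc nth_append)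

lemma segments_Nil [simp]: "segments [] = {}"
  by (simp add: segments_def)

lemma same_strand_refl [simp]: "same_strand D P P"
  by (simp add: same_strand_def)

lemma same_strand_sym: "same_strand D P Q \<Longrightarrow> same_strand D Q P"
  unfolding same_strand_def
  by (metis converse_Un converse_converse rtrancl_converseI sup_commute)

lemma same_strand_trans [trans]: "same_strand D P Q \<Longrightarrow> same_strand D Q R \<Longrightarrow> same_strand D P R"
  unfolding same_strand_def by simp

lemma same_strand_seg: "(P, Q) \<in> segments D \<Longrightarrow> same_strand D P Q"
  unfolding same_strand_def by blast

lemma same_strand_map:
  assumes "\<And>P Q. (P, Q) \<in> segments D \<Longrightarrow> (\<iota> P, \<iota> Q) \<in> segments D'" "same_strand D P Q"
  shows "same_strand D' (\<iota> P) (\<iota> Q)"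
  using assms(2) unfolding same_strand_def
proof (induction rule: rtrancl_induct)
  case (step y z)
  then show ?case using assms(1) by (meson Un_iff converse_iff rtrancl.rtrancl_into_rtrancl)
qed simp

lemma same_strand_Cons: "same_strand D P Q \<Longrightarrow> same_strand (s # D) (up1 P) (up1 Q)"
  by (rule same_strand_map[of D up1]) (auto simp: segments_Cons intro: rev_image_eqI)

lemma same_strand_snoc: "same_strand D P Q \<Longrightarrow> same_strand (D @ [s]) P Q"
  using same_strand_map[of D id "D @ [s]"] by (auto simp: segments_snoc)

lemma same_strand_const:
  assumes "\<forall>(P, Q) \<in> segments D. L P = L Q" "same_strand D P Q"
  shows "L P = L Q"
  using assms(2) unfolding same_strand_def
  by (induction rule: rtrancl_induct) (use assms(1) in auto)

lemma tangle_append: "tangle a (D1 @ D2) b \<longleftrightarrow> (\<exists>c. tangle a D1 c \<and> tangle c D2 b)"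
  by (induction a D1 b rule: tangle.induct) auto

lemma endpoint_low: "e < a \<Longrightarrow> endpoint a D b e = (0, e)"
  by (simp add: endpoint_def)

lemma endpoint_Cons_up: "endpoint a' (s # D) b (a' + e) = up1 (endpoint a D b (a + e))"
  by (simp add: endpoint_def)

lemma endpoint_up: "p < b \<Longrightarrow> endpoint a D b (a + b - 1 - p) = (length D, p)"
  by (simp add: endpoint_def)

text \<open>\<open>L\<close> sends every point to the smallest endpoint of its strand and so separates strands.\<close>

definition strand_labelling :: "nat \<Rightarrow> slice list \<Rightarrow> nat \<Rightarrow> (nat \<Rightarrow> nat) \<Rightarrow> (nat \<times> nat \<Rightarrow> nat) \<Rightarrow> bool" where
  "strand_labelling a D b \<pi> L \<longleftrightarrow> tangle a D b \<and> matching (a + b) \<pi> \<and>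
     (\<forall>(P, Q) \<in> segments D. L P = L Q) \<and>
     (\<forall>e < a + b. L (endpoint a D b e) = lab \<pi> e) \<and>
     (\<forall>e < a + b. same_strand D (endpoint a D b e) (endpoint a D b (\<pi> e)))"

text \<open>In the empty diagram the lower and the upper point at position \<open>p\<close>
  coincide; the upper one carries the number \<open>2 * a - 1 - p\<close> because upper endpoints
  are counted from the right.\<close>

lemma strand_labelling_Nil:
  "strand_labelling a [] a (\<lambda>e. 2 * a - 1 - e) (\<lambda>(h, p). p)"
  by (auto simp: strand_labelling_def matching_def endpoint_def lab_def mult_2) presburger

text \<open>Mates are connected by assumption; the labels are constant on strands and so exclude any
  further connection between endpoints.\<close>

lemma strand_labelling_iff:
  assumes "strand_labelling a D b \<pi> L" "e < a + b" "e' < a + b"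
  shows "same_strand D (endpoint a D b e) (endpoint a D b e') \<longleftrightarrow> e' = e \<or> e' = \<pi> e"
  using assms same_strand_const[of D L "endpoint a D b e" "endpoint a D b e'"]
  unfolding strand_labelling_def by (auto simp: lab_eq_iff)

lemma pairing_labelling:
  assumes "strand_labelling a D b \<pi> L"
  shows "pairing a D b = {(e, \<pi> e) | e. e < a + b}"
proof -
  have "matching (a + b) \<pi>" using assms by (simp add: strand_labelling_def)
  then show ?thesis
    using strand_labelling_iff[OF assms] by (auto simp: pairing_def matching_def)
qed

text \<open>The map \<open>r\<close> renumbers the endpoints of the old diagram for the extended
  one; \<open>lab\<close> afterwards returns to the smallest endpoint, which may have changed. The
  points on the new bottom line are endpoints themselves.\<close>

definition cons_label :: "(nat \<Rightarrow> nat) \<Rightarrow> (nat \<Rightarrow> nat) \<Rightarrow> (nat \<times> nat \<Rightarrow> nat) \<Rightarrow> nat \<times> nat \<Rightarrow> nat" where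
  "cons_label \<pi>' r L = (\<lambda>(h, p). case h of 0 \<Rightarrow> lab \<pi>' p | Suc h' \<Rightarrow> lab \<pi>' (r (L (h', p))))"

definition snoc_label :: "nat \<Rightarrow> nat \<Rightarrow> (nat \<Rightarrow> nat) \<Rightarrow> (nat \<Rightarrow> nat) \<Rightarrow> (nat \<times> nat \<Rightarrow> nat) \<Rightarrow> nat \<times> nat \<Rightarrow> nat" where
  "snoc_label n N \<pi>' r L = (\<lambda>(h, p). if h \<le> n then lab \<pi>' (r (L (h, p))) else lab \<pi>' (N - 1 - p))"

lemma relabel:
  assumes "\<And>e. e < n \<Longrightarrow> lab \<pi>' (r (\<pi> e)) = lab \<pi>' (r e)" "e < n"
  shows "lab \<pi>' (r (lab \<pi> e)) = lab \<pi>' (r e)"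
  using assms by (cases "e \<le> \<pi> e") (auto simp: lab_def min_def)

lemma slice_segments_bounds:
  assumes "(P, Q) \<in> slice_segments h (i, g, j)"
  shows "(fst P = h \<and> snd P < i + gsrc g + j \<or> fst P = Suc h \<and> snd P < i + gtgt g + j)
       \<and> (fst Q = h \<and> snd Q < i + gsrc g + j \<or> fst Q = Suc h \<and> snd Q < i + gtgt g + j)"
  using assms by (cases g) auto

lemma segments_bounds:
  "tangle a D b \<Longrightarrow> P \<in> Field (segments D) \<Longrightarrow> fst P \<le> length D"
proof -
  assume "P \<in> Field (segments D)"
  then obtain Q h where h: "h < length D" "(P, Q) \<in> slice_segments h (D ! h) \<or> (Q, P) \<in> slice_segments h (D ! h)"
    by (auto simp: segments_def Field_def)
  obtain i g j where "D ! h = (i, g, j)" by (cases "D ! h") auto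
  then show ?thesis using h slice_segments_bounds[of P Q h i g j] slice_segments_bounds[of Q P h i g j] by auto
qed

text \<open>The common part of adding a slice below. What depends on the kind of slice is isolated
  in the hypotheses: \<open>r\<close> respects the old pairing, the arcs of the slice join points
  with equal new labels, and new mates are connected.\<close>

lemma cons_labelling:
  assumes sl: "strand_labelling a D b \<pi> L" and g: "g \<in> {Cup, Cap, Cross, CrossInv}"
    and a: "a = i + gtgt g + j" and a': "a' = i + gsrc g + j" and mt: "matching (a' + b) \<pi>'"
    and r: "\<And>e. e < a + b \<Longrightarrow> lab \<pi>' (r (\<pi> e)) = lab \<pi>' (r e)"
    and r_up: "\<And>e. e < b \<Longrightarrow> r (a + e) = a' + e"
    and S: "\<And>p p'. ((0, p), (Suc 0, p')) \<in> slice_segments 0 (i, g, j) \<Longrightarrow> lab \<pi>' (r p') = lab \<pi>' p"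
      "g = Cap \<Longrightarrow> lab \<pi>' i = lab \<pi>' (Suc i)"
      "g = Cup \<Longrightarrow> lab \<pi>' (r i) = lab \<pi>' (r (Suc i))"
    and conn: "\<And>e. e < a' + b \<Longrightarrow> same_strand ((i, g, j) # D) (endpoint a' ((i, g, j) # D) b e)
       (endpoint a' ((i, g, j) # D) b (\<pi>' e))"
  shows "strand_labelling a' ((i, g, j) # D) b \<pi>' (cons_label \<pi>' r L)"
proof -
  let ?L = "cons_label \<pi>' r L"
  have L0: "?L (0, p) = lab \<pi>' p" and LS: "?L (up1 P) = lab \<pi>' (r (L P))" for p P
    by (auto simp: cons_label_def up1_conv)
  have Le: "?L (up1 (endpoint a D b e)) = lab \<pi>' (r e)" if "e < a + b" for e
    using sl that relabel[of "a + b" \<pi>' r \<pi>] r unfolding LS strand_labelling_def by auto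
  have L1: "?L (Suc 0, p) = lab \<pi>' (r p)" if "p < a" for p
    using Le[of p] that by (simp add: endpoint_low)
  have "?L P = ?L Q" if "(P, Q) \<in> slice_segments 0 (i, g, j)" for P Q
  proof (cases "fst P = 0 \<and> fst Q = Suc 0")
    case True
    then obtain p p' where PQ: "P = (0, p)" "Q = (Suc 0, p')" by (cases P; cases Q) auto
    moreover have "p' < a" using slice_segments_bounds[OF that] PQ a by auto
    ultimately show ?thesis using S(1)[of p p'] that by (simp add: L0 L1)
  next
    case False
    then have "P = (0, i) \<and> Q = (0, Suc i) \<and> g = Cap \<or> P = (Suc 0, i) \<and> Q = (Suc 0, Suc i) \<and> g = Cup"
      using that g by auto
    then show ?thesis using S(2,3) a by (auto simp: L0 L1)
  qed
  moreover have "?L (up1 P) = ?L (up1 Q)" if "(P, Q) \<in> segments D" for P Q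
    using sl that by (auto simp: LS strand_labelling_def)
  ultimately have seg: "\<forall>(P, Q) \<in> segments ((i, g, j) # D). ?L P = ?L Q"
    by (auto simp: segments_Cons)
  have ends: "?L (endpoint a' ((i, g, j) # D) b e) = lab \<pi>' e" if e: "e < a' + b" for e
  proof (cases "e < a'")
    case False
    then obtain k where k: "e = a' + k" "k < b" using e by (metis add_less_cancel_left le_Suc_ex not_le)
    show ?thesis using Le[of "a + k"] r_up[of k] k by (simp add: endpoint_Cons_up[of a' _ D b k a])
  qed (simp add: endpoint_low L0)
  have "tangle a' ((i, g, j) # D) b" using sl g a a' by (auto simp: strand_labelling_def)
  with mt seg ends conn show ?thesis by (auto simp: strand_labelling_def)
qed

definition sw :: "nat \<Rightarrow> nat \<Rightarrow> nat" where
  "sw i x = (if x = i then Suc i else if x = Suc i then i else x)"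

lemma sw_sw [simp]: "sw i (sw i x) = x" by (auto simp: sw_def)
lemma sw_same [simp]: "sw i i = Suc i" "sw i (Suc i) = i" by (auto simp: sw_def)
lemma sw_lt: "Suc i < n \<Longrightarrow> x < n \<Longrightarrow> sw i x < n" by (auto simp: sw_def)
lemma sw_ge: "Suc i < x \<Longrightarrow> sw i x = x" and sw_le: "x < i \<Longrightarrow> sw i x = x" by (auto simp: sw_def)
lemma sw_eq_iff [simp]: "sw i x = sw i y \<longleftrightarrow> x = y" by (auto simp: sw_def)
lemma sw_mono: "x < y \<Longrightarrow> \<not> (x = i \<and> y = Suc i) \<Longrightarrow> sw i x < sw i y" by (auto simp: sw_def)

lemma matching_sw: "matching n \<pi> \<Longrightarrow> Suc i < n \<Longrightarrow> matching n (\<lambda>x. sw i (\<pi> (sw i x)))"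
  unfolding matching_def by (metis sw_lt sw_sw)

lemma cross_seg:
  "g \<in> {Cross, CrossInv} \<Longrightarrow> p < i + 2 + j \<Longrightarrow> ((h, p), (Suc h, sw i p)) \<in> slice_segments h (i, g, j)"
proof -
  assume g: "g \<in> {Cross, CrossInv}" and p: "p < i + 2 + j"
  consider "p < i" | "p = i" | "p = Suc i" | "Suc (Suc i) \<le> p" by linarith
  then show ?thesis
  proof cases
    case 4
    then obtain k where "p = i + 2 + k" by (metis add_2_eq_Suc' add_Suc_right le_Suc_ex add.commute)
    then show ?thesis using g p by (auto simp: sw_def)
  qed (use g in \<open>auto simp: sw_def\<close>)
qed

lemma cross_seg_only:
  "g \<in> {Cross, CrossInv} \<Longrightarrow> ((h, p), (Suc h, p')) \<in> slice_segments h (i, g, j) \<Longrightarrow> p = sw i p'"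
  by (auto simp: sw_def)

text \<open>A crossing exchanges the numbers \<open>i\<close> and \<open>Suc i\<close>, so it
  conjugates the pairing by this transposition.\<close>

lemma cross_bottom_labelling:
  assumes sl: "strand_labelling a D b \<pi> L" and g: "g \<in> {Cross, CrossInv}" and a: "a = i + 2 + j"
  defines "\<pi>' \<equiv> \<lambda>x. sw i (\<pi> (sw i x))"
  shows "strand_labelling a ((i, g, j) # D) b \<pi>' (cons_label \<pi>' (sw i) L)"
    and "\<And>e. e < a + b \<Longrightarrow> same_strand ((i, g, j) # D) (endpoint a ((i, g, j) # D) b e) (up1 (endpoint a D b (sw i e)))"
proof -
  let ?D = "(i, g, j) # D"
  have mt: "matching (a + b) \<pi>" using sl by (simp add: strand_labelling_def)
  have mt': "matching (a + b) \<pi>'" unfolding \<pi>'_def using mt a by (intro matching_sw) auto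
  have [simp]: "gsrc g = 2" "gtgt g = 2" using g by auto
  show link: "same_strand ?D (endpoint a ?D b e) (up1 (endpoint a D b (sw i e)))" if e: "e < a + b" for e
  proof (cases "e < a")
    case True
    then have "((0, e), up1 (0, sw i e)) \<in> segments ?D"
      using cross_seg[OF g, of e i j 0] a by (auto simp: segments_Cons)
    moreover have "sw i e < a" using True a by (auto simp: sw_def)
    ultimately show ?thesis using True same_strand_seg by (simp add: endpoint_low)
  next
    case False
    then obtain k where "e = a + k" by (metis le_Suc_ex not_le)
    moreover have "sw i (a + k) = a + k" using a by (simp add: sw_ge)
    ultimately show ?thesis by (simp only: endpoint_Cons_up[of a _ D b k a]) simp
  qed
  show "strand_labelling a ?D b \<pi>' (cons_label \<pi>' (sw i) L)"
  proof (rule cons_labelling[OF sl])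
    show "lab \<pi>' (sw i (\<pi> e)) = lab \<pi>' (sw i e)" if "e < a + b" for e
      using mt that by (simp add: lab_def \<pi>'_def matching_def min.commute)
    show "same_strand ?D (endpoint a ?D b e) (endpoint a ?D b (\<pi>' e))" if e: "e < a + b" for e
    proof -
      have e': "sw i e < a + b" using e a by (intro sw_lt) auto
      have e'': "\<pi>' e < a + b" using matchingD(1)[OF mt' e] .
      note link[OF e]
      also have "same_strand ?D (up1 (endpoint a D b (sw i e))) (up1 (endpoint a D b (\<pi> (sw i e))))"
        using sl e' by (intro same_strand_Cons) (simp add: strand_labelling_def)
      also have "same_strand ?D \<dots> (endpoint a ?D b (\<pi>' e))"
        using link[OF e''] by - (rule same_strand_sym, simp add: \<pi>'_def)
      finally show ?thesis .
    qed
  qed (use g a mt' cross_seg_only[OF g] in \<open>auto simp: sw_ge\<close>)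
qed

text \<open>The increasing enumeration of the numbers other than \<open>i\<close> and
  \<open>Suc i\<close>; since it preserves the order, adding an arc between neighbours does not
  change which of the old strands interlace.\<close>

definition ins :: "nat \<Rightarrow> nat \<Rightarrow> nat" where "ins i e = (if e < i then e else e + 2)"
definition del :: "nat \<Rightarrow> nat \<Rightarrow> nat" where "del i e = (if e < i then e else e - 2)"

lemma del_ins [simp]: "del i (ins i e) = e" by (auto simp: ins_def del_def)
lemma ins_del [simp]: "e \<noteq> i \<Longrightarrow> e \<noteq> Suc i \<Longrightarrow> ins i (del i e) = e" by (auto simp: ins_def del_def)
lemma ins_neq [simp]: "ins i e \<noteq> i" "ins i e \<noteq> Suc i" "i \<noteq> ins i e" "Suc i \<noteq> ins i e" by (auto simp: ins_def)
lemma ins_less_iff [simp]: "ins i e < ins i e' \<longleftrightarrow> e < e'" by (auto simp: ins_def)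
lemma ins_eq_iff [simp]: "ins i e = ins i e' \<longleftrightarrow> e = e'" by (auto simp: ins_def)
lemma ins_lt: "e < n \<Longrightarrow> ins i e < Suc (Suc n)" by (auto simp: ins_def)
lemma del_lt: "e < Suc (Suc n) \<Longrightarrow> e \<noteq> i \<Longrightarrow> e \<noteq> Suc i \<Longrightarrow> i \<le> n \<Longrightarrow> del i e < n" by (auto simp: del_def)
definition ins_pair :: "nat \<Rightarrow> (nat \<Rightarrow> nat) \<Rightarrow> nat \<Rightarrow> nat" where
  "ins_pair i \<pi> e = (if e = i then Suc i else if e = Suc i then i else ins i (\<pi> (del i e)))"

lemma ins_pair_simps [simp]: "ins_pair i \<pi> i = Suc i" "ins_pair i \<pi> (Suc i) = i" "ins_pair i \<pi> (ins i e) = ins i (\<pi> e)"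
  by (auto simp: ins_pair_def)

lemma matching_ins_pair: "matching n \<pi> \<Longrightarrow> i \<le> n \<Longrightarrow> matching (Suc (Suc n)) (ins_pair i \<pi>)"
  unfolding matching_def
proof (intro allI impI)
  fix e assume m: "\<forall>e<n. \<pi> e < n \<and> \<pi> e \<noteq> e \<and> \<pi> (\<pi> e) = e" and i: "i \<le> n" and e: "e < Suc (Suc n)"
  show "ins_pair i \<pi> e < Suc (Suc n) \<and> ins_pair i \<pi> e \<noteq> e \<and> ins_pair i \<pi> (ins_pair i \<pi> e) = e"
  proof (cases "e = i \<or> e = Suc i")
    case False
    then obtain e0 where "e = ins i e0" "e0 < n" using ins_del del_lt e i by metis
    then show ?thesis using m by (auto intro: ins_lt)
  qed (use i in auto)
qed

lemma cap_bottom_labelling: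
  assumes sl: "strand_labelling a D b \<pi> L" and a: "a = i + j"
  defines "\<pi>' \<equiv> ins_pair i \<pi>"
  shows "strand_labelling (Suc (Suc a)) ((i, Cap, j) # D) b \<pi>' (cons_label \<pi>' (ins i) L)"
    and "\<And>e. e < a + b \<Longrightarrow> same_strand ((i, Cap, j) # D)
      (endpoint (Suc (Suc a)) ((i, Cap, j) # D) b (ins i e)) (up1 (endpoint a D b e))"
proof -
  let ?D = "(i, Cap, j) # D" and ?a = "Suc (Suc a)"
  have mt: "matching (a + b) \<pi>" using sl by (simp add: strand_labelling_def)
  have mt': "matching (Suc (Suc (a + b))) \<pi>'" unfolding \<pi>'_def using mt a by (intro matching_ins_pair) auto
  show link: "same_strand ?D (endpoint ?a ?D b (ins i e)) (up1 (endpoint a D b e))" if e: "e < a + b" for e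
  proof (cases "e < a")
    case True
    then have "((0, ins i e), up1 (0, e)) \<in> segments ?D"
      using a by (cases "e < i") (auto simp: segments_Cons ins_def intro!: exI[of _ "e - i"])
    moreover have "ins i e < ?a" using True by (auto simp: ins_def)
    ultimately show ?thesis using True same_strand_seg by (simp add: endpoint_low)
  next
    case False
    then obtain k where "e = a + k" by (metis le_Suc_ex not_le)
    moreover have "ins i (a + k) = ?a + k" using a by (simp add: ins_def)
    ultimately show ?thesis by (simp only: endpoint_Cons_up[of ?a _ D b k a]) simp
  qed
  show "strand_labelling ?a ?D b \<pi>' (cons_label \<pi>' (ins i) L)"
  proof (rule cons_labelling[OF sl])
    show "lab \<pi>' (ins i (\<pi> e)) = lab \<pi>' (ins i e)" if "e < a + b" for e
      using mt that by (simp add: lab_def \<pi>'_def matching_def min.commute)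
    show "same_strand ?D (endpoint ?a ?D b e) (endpoint ?a ?D b (\<pi>' e))" if e: "e < ?a + b" for e
    proof (cases "e = i \<or> e = Suc i")
      case True
      have "((0, i), (0, Suc i)) \<in> segments ?D" by (simp add: segments_Cons)
      then have "same_strand ?D (0, i) (0, Suc i)" by (rule same_strand_seg)
      then show ?thesis using True a by (auto simp: endpoint_low \<pi>'_def intro: same_strand_sym)
    next
      case False
      define e0 where "e0 = del i e"
      have e0: "e = ins i e0" "e0 < a + b" using False del_lt[of e "a + b" i] e a by (auto simp: e0_def)
      have e1: "\<pi> e0 < a + b" using mt e0 by (simp add: matching_def)
      have "same_strand ?D (endpoint ?a ?D b e) (up1 (endpoint a D b e0))" using link[OF e0(2)] e0 by simp
      also have "same_strand ?D \<dots> (up1 (endpoint a D b (\<pi> e0)))"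
        using sl e0 by (intro same_strand_Cons) (simp add: strand_labelling_def)
      also have "same_strand ?D \<dots> (endpoint ?a ?D b (\<pi>' e))"
        using link[OF e1] e0 by - (rule same_strand_sym, simp add: \<pi>'_def)
      finally show ?thesis .
    qed
    show "lab \<pi>' (ins i p') = lab \<pi>' p" if "((0, p), (Suc 0, p')) \<in> slice_segments 0 (i, Cap, j)" for p p'
      using that by (auto simp: ins_def)
    show "lab \<pi>' i = lab \<pi>' (Suc i)" by (simp add: \<pi>'_def lab_def min.commute)
  qed (use a mt' in \<open>auto simp: ins_def\<close>)
qed

text \<open>A cup added below closes off the endpoints \<open>i\<close> and \<open>Suc i\<close> of
  the old diagram and joins the strands that ended there, so their former mates become mates of each
  other.\<close>

definition cup_merge :: "nat \<Rightarrow> (nat \<Rightarrow> nat) \<Rightarrow> nat \<Rightarrow> nat" where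
  "cup_merge i \<pi> e = (let w = \<pi> (ins i e) in
     if w = i then del i (\<pi> (Suc i)) else if w = Suc i then del i (\<pi> i) else del i w)"

lemma matching_cup_merge:
  assumes m: "matching (Suc (Suc n)) \<pi>" and i: "i \<le> n"
  shows "matching n (cup_merge i \<pi>)"
  unfolding matching_def
proof (intro allI impI)
  fix e assume "e < n"
  then have e: "ins i e < Suc (Suc n)" by (rule ins_lt)
  note M = matchingD[OF m]
  have i2: "i < Suc (Suc n)" "Suc i < Suc (Suc n)" using i by auto
  consider "\<pi> (ins i e) = i" | "\<pi> (ins i e) = Suc i" | "\<pi> (ins i e) \<noteq> i" "\<pi> (ins i e) \<noteq> Suc i" by blast
  then show "cup_merge i \<pi> e < n \<and> cup_merge i \<pi> e \<noteq> e \<and> cup_merge i \<pi> (cup_merge i \<pi> e) = e"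
  proof cases
    case 1
    then have pi: "\<pi> i = ins i e" using M(3)[OF e] by simp
    then have x: "\<pi> (Suc i) \<noteq> i" "\<pi> (Suc i) \<noteq> Suc i" "\<pi> (Suc i) \<noteq> ins i e"
      using M(2)[OF i2(2)] M(3)[OF i2(2)] 1 by auto
    have c: "cup_merge i \<pi> e = del i (\<pi> (Suc i))" using 1 by (simp add: cup_merge_def)
    have "cup_merge i \<pi> (del i (\<pi> (Suc i))) = e" using x M(3)[OF i2(2)] pi by (simp add: cup_merge_def)
    then show ?thesis using c x del_lt[OF M(1)[OF i2(2)] x(1,2) i] by (metis ins_del)
  next
    case 2
    then have pi: "\<pi> (Suc i) = ins i e" using M(3)[OF e] by simp
    then have x: "\<pi> i \<noteq> i" "\<pi> i \<noteq> Suc i" "\<pi> i \<noteq> ins i e"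
      using M(2)[OF i2(1)] M(3)[OF i2(1)] 2 by auto
    have c: "cup_merge i \<pi> e = del i (\<pi> i)" using 2 by (simp add: cup_merge_def)
    have "cup_merge i \<pi> (del i (\<pi> i)) = e" using x M(3)[OF i2(1)] pi by (simp add: cup_merge_def)
    then show ?thesis using c x del_lt[OF M(1)[OF i2(1)] x(1,2) i] by (metis ins_del)
  next
    case 3
    have c: "cup_merge i \<pi> e = del i (\<pi> (ins i e))" using 3 by (simp add: cup_merge_def)
    have "cup_merge i \<pi> (del i (\<pi> (ins i e))) = e" using 3 M(3)[OF e] by (simp add: cup_merge_def)
    then show ?thesis using c 3 del_lt[OF M(1)[OF e] 3 i] M(2)[OF e] by (metis ins_del)
  qed
qed

lemma cup_bottom_labelling:
  assumes sl: "strand_labelling (Suc (Suc a)) D b \<pi> L" and a: "a = i + j"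
  shows "\<exists>\<pi>' L'. strand_labelling a ((i, Cup, j) # D) b \<pi>' L'"
proof -
  let ?D = "(i, Cup, j) # D" and ?a = "Suc (Suc a)"
  define \<pi>' where "\<pi>' = cup_merge i \<pi>"
  \<comment> \<open>The points \<open>i\<close> and \<open>Suc i\<close> stop being endpoints and
    are represented by their mates. If they are mates of each other, the cup closes a loop without
    endpoints, and the value \<open>0\<close> is an arbitrary choice.\<close>
  define r where "r l = (if l = i \<or> l = Suc i then (if \<pi> i = Suc i then 0 else del i (\<pi> l)) else del i l)" for l
  have mt: "matching (Suc (Suc (a + b))) \<pi>" using sl by (simp add: strand_labelling_def)
  have mt': "matching (a + b) \<pi>'" unfolding \<pi>'_def using mt a by (intro matching_cup_merge) auto
  note M = matchingD[OF mt]
  have i2: "i < Suc (Suc (a + b))" "Suc i < Suc (Suc (a + b))" using a by auto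
  have link: "same_strand ?D (endpoint a ?D b e) (up1 (endpoint ?a D b (ins i e)))" if e: "e < a + b" for e
  proof (cases "e < a")
    case True
    then have "((0, e), up1 (0, ins i e)) \<in> segments ?D"
      using a by (cases "e < i") (auto simp: segments_Cons ins_def intro!: exI[of _ "e - i"])
    moreover have "ins i e < ?a" using True by (auto simp: ins_def)
    ultimately show ?thesis using True same_strand_seg by (simp add: endpoint_low)
  next
    case False
    then obtain k where "e = a + k" by (metis le_Suc_ex not_le)
    moreover have "ins i (a + k) = ?a + k" using a by (simp add: ins_def)
    ultimately show ?thesis by (simp only: endpoint_Cons_up[of a _ D b k ?a]) simp
  qed
  have old: "same_strand ?D (up1 (endpoint ?a D b e)) (up1 (endpoint ?a D b (\<pi> e)))" if "e < Suc (Suc (a + b))" for e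
    using sl that by (intro same_strand_Cons) (simp add: strand_labelling_def)
  have "((Suc 0, i), (Suc 0, Suc i)) \<in> segments ?D" by (simp add: segments_Cons)
  then have cup: "same_strand ?D (up1 (endpoint ?a D b i)) (up1 (endpoint ?a D b (Suc i)))"
    using same_strand_seg a by (simp add: endpoint_low)
  have pair_i: "\<pi>' (del i (\<pi> i)) = del i (\<pi> (Suc i))" if "\<pi> i \<noteq> Suc i"
    using that M(2,3)[OF i2(1)] by (simp add: \<pi>'_def cup_merge_def)
  have sym: "\<pi> (Suc i) = i \<longleftrightarrow> \<pi> i = Suc i" using M(3)[OF i2(1)] M(3)[OF i2(2)] by metis
  have mate_del: "del i (\<pi> e) < a + b" if "e < Suc (Suc (a + b))" "\<pi> e \<noteq> i" "\<pi> e \<noteq> Suc i" for e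
    using M(1)[OF that(1)] that a by (intro del_lt) auto
  have "strand_labelling a ?D b \<pi>' (cons_label \<pi>' r L)"
  proof (rule cons_labelling[OF sl])
    show "lab \<pi>' (r (\<pi> e)) = lab \<pi>' (r e)" if "e < Suc (Suc a) + b" for e
    proof -
      have e: "e < Suc (Suc (a + b))" using that by simp
      consider "e = i \<or> e = Suc i" | "\<pi> e = i \<or> \<pi> e = Suc i"
        | "e \<noteq> i" "e \<noteq> Suc i" "\<pi> e \<noteq> i" "\<pi> e \<noteq> Suc i" by blast
      then show ?thesis
      proof cases
        case 1 then show ?thesis using sym M(2)[OF i2(1)] M(2)[OF i2(2)] by (auto simp: r_def)
      next
        case 2 then show ?thesis using sym M(2)[OF e] M(3)[OF e] by (auto simp: r_def)
      next
        case 3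
        then have "e = ins i (del i e)" "del i e < a + b" using e a by (auto intro: del_lt)
        moreover have "r (\<pi> e) = \<pi>' (r e)" using 3 by (simp add: r_def \<pi>'_def cup_merge_def)
        ultimately show ?thesis using lab_mate[OF mt', of "r e"] 3 by (simp add: r_def)
      qed
    qed
    show "lab \<pi>' (r i) = lab \<pi>' (r (Suc i))"
      using pair_i lab_mate[OF mt', of "del i (\<pi> i)"] mate_del[OF i2(1)] M(2)[OF i2(1)] by (auto simp: r_def)
    show "same_strand ?D (endpoint a ?D b e) (endpoint a ?D b (\<pi>' e))" if e: "e < a + b" for e
    proof -
      have e': "ins i e < Suc (Suc (a + b))" using e by (rule ins_lt)
      have e1: "\<pi>' e < a + b" using mt' e by (simp add: matching_def)
      have l1: "same_strand ?D (endpoint a ?D b e) (up1 (endpoint ?a D b (\<pi> (ins i e))))"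
        using same_strand_trans[OF link[OF e] old[OF e']] .
      have bk: "same_strand ?D (up1 (endpoint ?a D b (ins i (\<pi>' e)))) (endpoint a ?D b (\<pi>' e))"
        by (rule same_strand_sym[OF link[OF e1]])
      consider "\<pi> (ins i e) = i" | "\<pi> (ins i e) = Suc i" | "\<pi> (ins i e) \<noteq> i" "\<pi> (ins i e) \<noteq> Suc i" by blast
      then show ?thesis
      proof cases
        case 1
        have "\<pi> (Suc i) \<noteq> i" using sym 1 M(3)[OF e'] by auto
        then have "ins i (\<pi>' e) = \<pi> (Suc i)" using 1 M(2)[OF i2(2)] by (simp add: \<pi>'_def cup_merge_def)
        then show ?thesis using same_strand_trans[OF l1[unfolded 1] same_strand_trans[OF cup same_strand_trans[OF old[OF i2(2)]]]] bk by simp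
      next
        case 2
        have "\<pi> i \<noteq> Suc i" using sym 2 M(3)[OF e'] by auto
        then have "ins i (\<pi>' e) = \<pi> i" using 2 M(2)[OF i2(1)] by (simp add: \<pi>'_def cup_merge_def)
        then show ?thesis using same_strand_trans[OF l1[unfolded 2] same_strand_trans[OF same_strand_sym[OF cup] same_strand_trans[OF old[OF i2(1)]]]] bk by simp
      next
        case 3
        then have "ins i (\<pi>' e) = \<pi> (ins i e)" by (simp add: \<pi>'_def cup_merge_def)
        then show ?thesis using same_strand_trans[OF l1] bk by simp
      qed
    qed
    show "lab \<pi>' (r p') = lab \<pi>' p" if "((0, p), (Suc 0, p')) \<in> slice_segments 0 (i, Cup, j)" for p p'
      using that by (auto simp: r_def del_def)
  qed (use a mt' in \<open>auto simp: r_def del_def\<close>)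
  then show ?thesis by blast
qed

text \<open>Holds for every tangle diagram, reduced or not, since loops and repeated crossings do
  not disturb the pairing of the boundary points. It extracts a pairing from a given diagram;
  drawing a diagram for a given pairing comes later.\<close>

lemma tangle_labelling: "tangle a D b \<Longrightarrow> \<exists>\<pi> L. strand_labelling a D b \<pi> L"
proof (induction D arbitrary: a)
  case Nil
  then show ?case using strand_labelling_Nil by auto
next
  case (Cons s D)
  obtain i g j where s: "s = (i, g, j)" by (cases s) auto
  then have g: "g \<in> {Cup, Cap, Cross, CrossInv}" and a: "a = i + gsrc g + j"
    and t: "tangle (i + gtgt g + j) D b" using Cons.prems by auto
  obtain \<pi> L where sl: "strand_labelling (i + gtgt g + j) D b \<pi> L" using Cons.IH[OF t] by blast
  consider "g = Cup" | "g = Cap" | "g \<in> {Cross, CrossInv}" using g by blast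
  then show ?case
  proof cases
    case 1 then show ?thesis using cup_bottom_labelling[of a D b \<pi> L i j] sl a s by auto
  next
    case 2 then show ?thesis using cap_bottom_labelling(1)[of "i + j" D b \<pi> L i j] sl a s by auto
  next
    case 3
    then have "gsrc g = 2" "gtgt g = 2" by auto
    then show ?thesis using cross_bottom_labelling(1)[of a D b \<pi> L g i j] 3 sl a s by auto
  qed
qed

lemma endpoint_snoc_low: "e < a \<Longrightarrow> endpoint a (D @ [s]) b' e = endpoint a D b e"
  by (simp add: endpoint_def)

text \<open>The counterpart for a slice on top. Cups and crossings suffice here, because stacking on
  top serves to build the cup part of a diagram.\<close>

lemma snoc_labelling:
  assumes sl: "strand_labelling a D b \<pi> L" and g: "g \<in> {Cup, Cross, CrossInv}"
    and b: "b = i + gsrc g + j" and b': "b' = i + gtgt g + j" and mt: "matching (a + b') \<pi>'"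
    and r: "\<And>e. e < a + b \<Longrightarrow> lab \<pi>' (r (\<pi> e)) = lab \<pi>' (r e)"
    and r_low: "\<And>e. e < a \<Longrightarrow> r e = e"
    and S: "\<And>p p'. ((length D, p), (Suc (length D), p')) \<in> slice_segments (length D) (i, g, j)
       \<Longrightarrow> lab \<pi>' (r (a + b - 1 - p)) = lab \<pi>' (a + b' - 1 - p')"
      "g = Cup \<Longrightarrow> lab \<pi>' (a + b' - 1 - i) = lab \<pi>' (a + b' - 1 - Suc i)"
    and conn: "\<And>e. e < a + b' \<Longrightarrow> same_strand (D @ [(i, g, j)]) (endpoint a (D @ [(i, g, j)]) b' e)
       (endpoint a (D @ [(i, g, j)]) b' (\<pi>' e))"
  shows "strand_labelling a (D @ [(i, g, j)]) b' \<pi>' (snoc_label (length D) (a + b') \<pi>' r L)"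
proof -
  let ?L = "snoc_label (length D) (a + b') \<pi>' r L" and ?D = "D @ [(i, g, j)]"
  have LS: "?L (Suc (length D), p) = lab \<pi>' (a + b' - 1 - p)" for p
    by (simp add: snoc_label_def)
  have L0: "?L P = lab \<pi>' (r (L P))" if "fst P \<le> length D" for P
    using that by (cases P) (simp add: snoc_label_def)
  have Le: "?L (endpoint a D b e) = lab \<pi>' (r e)" if "e < a + b" for e
    using sl that relabel[of "a + b" \<pi>' r \<pi>] r
    by (subst L0) (auto simp: endpoint_def strand_labelling_def)
  have L1: "?L (length D, p) = lab \<pi>' (r (a + b - 1 - p))" if "p < b" for p
    using Le[of "a + b - 1 - p"] endpoint_up[OF that, of a D] that by simp
  have tg: "tangle a D b" using sl by (simp add: strand_labelling_def)
  have "?L P = ?L Q" if "(P, Q) \<in> slice_segments (length D) (i, g, j)" for P Q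
  proof (cases "fst P = length D \<and> fst Q = Suc (length D)")
    case True
    then obtain p p' where PQ: "P = (length D, p)" "Q = (Suc (length D), p')" by (cases P; cases Q) auto
    moreover have "p < b" using slice_segments_bounds[OF that] PQ b by auto
    ultimately show ?thesis using S(1)[of p p'] that by (simp add: LS L1)
  next
    case False
    then have "P = (Suc (length D), i) \<and> Q = (Suc (length D), Suc i) \<and> g = Cup"
      using that g by auto
    then show ?thesis using S(2) by (auto simp: LS)
  qed
  moreover have "?L P = ?L Q" if "(P, Q) \<in> segments D" for P Q
  proof -
    have "fst P \<le> length D" "fst Q \<le> length D"
      using segments_bounds[OF tg, of P] segments_bounds[OF tg, of Q] that by (auto simp: Field_def)
    then show ?thesis using sl that by (auto simp: L0 strand_labelling_def)
  qed
  ultimately have seg: "\<forall>(P, Q) \<in> segments ?D. ?L P = ?L Q"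
    by (auto simp: segments_snoc)
  have ends: "?L (endpoint a ?D b' e) = lab \<pi>' e" if e: "e < a + b'" for e
  proof (cases "e < a")
    case True
    then show ?thesis using Le[of e] r_low[of e] by (simp add: endpoint_snoc_low[of e a D _ b' b])
  next
    case False
    then have "a + b' - 1 - (a + b' - 1 - e) = e" using e by auto
    then show ?thesis using False by (simp add: endpoint_def LS)
  qed
  have "tangle a ?D b'" using tg g b b' by (auto simp: tangle_append)
  with mt seg ends conn show ?thesis by (auto simp: strand_labelling_def)
qed

text \<open>With \<open>j\<close> strands to its right, a crossing on top occupies the endpoint
  numbers \<open>a + j\<close> and \<open>Suc (a + j)\<close>, because upper endpoints are numbered
  from right to left.\<close>

lemma cross_top_labelling:
  assumes sl: "strand_labelling a D b \<pi> L" and g: "g \<in> {Cross, CrossInv}" and b: "b = i + 2 + j"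
  defines "\<pi>' \<equiv> \<lambda>x. sw (a + j) (\<pi> (sw (a + j) x))"
  shows "strand_labelling a (D @ [(i, g, j)]) b \<pi>' (snoc_label (length D) (a + b) \<pi>' (sw (a + j)) L)"
    and "\<And>e. e < a + b \<Longrightarrow> same_strand (D @ [(i, g, j)]) (endpoint a (D @ [(i, g, j)]) b e)
       (endpoint a D b (sw (a + j) e))"
proof -
  let ?D = "D @ [(i, g, j)]" and ?k = "a + j"
  have mt: "matching (a + b) \<pi>" using sl by (simp add: strand_labelling_def)
  have mt': "matching (a + b) \<pi>'" unfolding \<pi>'_def using mt b by (intro matching_sw) auto
  have [simp]: "gsrc g = 2" "gtgt g = 2" using g by auto
  have sw_up: "a + b - 1 - sw i p = sw ?k (a + b - 1 - p)" if "p < b" for p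
    using that b by (auto simp: sw_def)
  show link: "same_strand ?D (endpoint a ?D b e) (endpoint a D b (sw ?k e))" if e: "e < a + b" for e
  proof (cases "e < a")
    case True
    then show ?thesis by (simp add: endpoint_snoc_low[of e a D _ b b] sw_le)
  next
    case False
    define p where "p = a + b - 1 - e"
    have p: "p < b" "e = a + b - 1 - p" using False e by (auto simp: p_def)
    have "((length D, sw i p), (Suc (length D), p)) \<in> segments ?D"
      using cross_seg[OF g, of "sw i p" i j "length D"] sw_lt[of i b p] p b by (auto simp: segments_snoc)
    then have "same_strand ?D (Suc (length D), p) (length D, sw i p)"
      by (intro same_strand_sym[OF same_strand_seg])
    moreover have "sw i p < b" using sw_lt[of i b p] p b by simp
    ultimately show ?thesis unfolding p(2) sw_up[OF p(1), symmetric] using p(1)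
      by (simp only: endpoint_up length_append_singleton)
  qed
  show "strand_labelling a ?D b \<pi>' (snoc_label (length D) (a + b) \<pi>' (sw ?k) L)"
  proof (rule snoc_labelling[OF sl])
    show "lab \<pi>' (sw ?k (\<pi> e)) = lab \<pi>' (sw ?k e)" if "e < a + b" for e
      using matchingD(3)[OF mt that] by (simp add: lab_def \<pi>'_def min.commute)
    show "same_strand ?D (endpoint a ?D b e) (endpoint a ?D b (\<pi>' e))" if e: "e < a + b" for e
    proof -
      have e': "sw ?k e < a + b" using e b by (intro sw_lt) auto
      have e'': "\<pi>' e < a + b" using matchingD(1)[OF mt' e] .
      note link[OF e]
      also have "same_strand ?D (endpoint a D b (sw ?k e)) (endpoint a D b (\<pi> (sw ?k e)))"
        using sl e' by (intro same_strand_snoc) (simp add: strand_labelling_def)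
      also have "same_strand ?D \<dots> (endpoint a ?D b (\<pi>' e))"
        using link[OF e''] by - (rule same_strand_sym, simp add: \<pi>'_def)
      finally show ?thesis .
    qed
    show "lab \<pi>' (sw ?k (a + b - 1 - p)) = lab \<pi>' (a + b - 1 - p')"
      if "((length D, p), (Suc (length D), p')) \<in> slice_segments (length D) (i, g, j)" for p p'
    proof -
      have "p' < b" using slice_segments_bounds[OF that] b by auto
      moreover have "p = sw i p'" using cross_seg_only[OF g that] .
      ultimately show ?thesis using sw_up[of p'] by simp
    qed
  qed (use g b mt' in \<open>auto simp: sw_le\<close>)
qed

lemma cup_top_labelling:
  assumes sl: "strand_labelling a D b \<pi> L" and b: "b = i + j"
  defines "\<pi>' \<equiv> ins_pair (a + j) \<pi>"
  shows "strand_labelling a (D @ [(i, Cup, j)]) (Suc (Suc b)) \<pi>'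
      (snoc_label (length D) (a + Suc (Suc b)) \<pi>' (ins (a + j)) L)"
    and "\<And>e. e < a + b \<Longrightarrow> same_strand (D @ [(i, Cup, j)])
      (endpoint a (D @ [(i, Cup, j)]) (Suc (Suc b)) (ins (a + j) e)) (endpoint a D b e)"
proof -
  let ?D = "D @ [(i, Cup, j)]" and ?b = "Suc (Suc b)" and ?k = "a + j"
  have mt: "matching (a + b) \<pi>" using sl by (simp add: strand_labelling_def)
  have mt': "matching (Suc (Suc (a + b))) \<pi>'" unfolding \<pi>'_def using mt b by (intro matching_ins_pair) auto
  have ins_up: "ins ?k (a + b - 1 - p) = a + ?b - 1 - ins i p" if "p < b" for p
    using that b by (auto simp: ins_def)
  show link: "same_strand ?D (endpoint a ?D ?b (ins ?k e)) (endpoint a D b e)" if e: "e < a + b" for e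
  proof (cases "e < a")
    case True
    then have "ins ?k e = e" by (simp add: ins_def)
    then show ?thesis using True by (simp add: endpoint_snoc_low[of e a D _ ?b b])
  next
    case False
    define p where "p = a + b - 1 - e"
    have p: "p < b" "e = a + b - 1 - p" using False e by (auto simp: p_def)
    have "((length D, p), (Suc (length D), ins i p)) \<in> segments ?D"
      using p b by (cases "p < i") (auto simp: segments_snoc ins_def intro!: exI[of _ "p - i"])
    then have "same_strand ?D (Suc (length D), ins i p) (length D, p)"
      by (intro same_strand_sym[OF same_strand_seg])
    moreover have "ins i p < ?b" using p by (intro ins_lt) auto
    ultimately show ?thesis unfolding p(2) ins_up[OF p(1)] using p(1)
      by (simp only: endpoint_up length_append_singleton)
  qed
  show "strand_labelling a ?D ?b \<pi>' (snoc_label (length D) (a + ?b) \<pi>' (ins ?k) L)"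
  proof (rule snoc_labelling[OF sl])
    show "lab \<pi>' (ins ?k (\<pi> e)) = lab \<pi>' (ins ?k e)" if "e < a + b" for e
      using matchingD(3)[OF mt that] by (simp add: lab_def \<pi>'_def min.commute)
    show "same_strand ?D (endpoint a ?D ?b e) (endpoint a ?D ?b (\<pi>' e))" if e: "e < a + ?b" for e
    proof (cases "e = ?k \<or> e = Suc ?k")
      case True
      have "((Suc (length D), i), (Suc (length D), Suc i)) \<in> segments ?D" by (simp add: segments_snoc)
      then have s: "same_strand ?D (Suc (length D), i) (Suc (length D), Suc i)" by (rule same_strand_seg)
      have "endpoint a ?D ?b ?k = (Suc (length D), Suc i)" "endpoint a ?D ?b (Suc ?k) = (Suc (length D), i)"
        using b by (auto simp: endpoint_def)
      then show ?thesis using True s same_strand_sym[OF s] by (auto simp: \<pi>'_def)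
    next
      case False
      define e0 where "e0 = del ?k e"
      have e0: "e = ins ?k e0" "e0 < a + b" using False del_lt[of e "a + b" ?k] e b by (auto simp: e0_def)
      have e1: "\<pi> e0 < a + b" using matchingD(1)[OF mt e0(2)] .
      have "same_strand ?D (endpoint a ?D ?b e) (endpoint a D b e0)" using link[OF e0(2)] e0 by simp
      also have "same_strand ?D \<dots> (endpoint a D b (\<pi> e0))"
        using sl e0 by (intro same_strand_snoc) (simp add: strand_labelling_def)
      also have "same_strand ?D \<dots> (endpoint a ?D ?b (\<pi>' e))"
        using link[OF e1] e0 by - (rule same_strand_sym, simp add: \<pi>'_def)
      finally show ?thesis .
    qed
    show "lab \<pi>' (ins ?k (a + b - 1 - p)) = lab \<pi>' (a + ?b - 1 - p')"
      if "((length D, p), (Suc (length D), p')) \<in> slice_segments (length D) (i, Cup, j)" for p p'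
    proof -
      have "p < b" using slice_segments_bounds[OF that] b by auto
      moreover have "p' = ins i p" using that by (auto simp: ins_def)
      ultimately show ?thesis using ins_up[of p] by simp
    qed
    have "a + ?b - 1 - i = Suc ?k" "a + ?b - 1 - Suc i = ?k" using b by auto
    then show "lab \<pi>' (a + ?b - 1 - i) = lab \<pi>' (a + ?b - 1 - Suc i)"
      by (simp add: \<pi>'_def lab_def min.commute)
  qed (use b mt' in \<open>auto simp: ins_def\<close>)
qed

section \<open>Reduced totally descending diagrams with a given pairing\<close>

text \<open>Strands with smallest endpoints \<open>s < t\<close> whose four endpoints interlace have to cross. In a good
  diagram only such strands cross, once, and the strand of \<open>s\<close> is the upper one.\<close>

definition interl :: "(nat \<Rightarrow> nat) \<Rightarrow> nat \<Rightarrow> nat \<Rightarrow> bool" where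
  "interl \<pi> s t \<longleftrightarrow> s < t \<and> t < \<pi> s \<and> \<pi> s < \<pi> t"

definition crossing_rel :: "slice list \<Rightarrow> (nat \<times> nat \<Rightarrow> nat) \<Rightarrow> nat \<Rightarrow> nat \<times> nat" where
  "crossing_rel D L h = (L (over_pt D h), L (under_pt D h))"

definition good :: "nat \<Rightarrow> slice list \<Rightarrow> nat \<Rightarrow> (nat \<Rightarrow> nat) \<Rightarrow> (nat \<times> nat \<Rightarrow> nat) \<Rightarrow> bool" where
  "good a D b \<pi> L \<longleftrightarrow> strand_labelling a D b \<pi> L \<and>
     (\<forall>P \<in> Field (segments D). \<exists>e < a + b. same_strand D (endpoint a D b e) P) \<and>
     (\<forall>h \<in> crossings D. case_prod (interl \<pi>) (crossing_rel D L h)) \<and>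
     inj_on (crossing_rel D L) (crossings D)"

lemma good_matching: "good a D b \<pi> L \<Longrightarrow> matching (a + b) \<pi>"
  and good_tangle: "good a D b \<pi> L \<Longrightarrow> tangle a D b"
  and good_labelling: "good a D b \<pi> L \<Longrightarrow> strand_labelling a D b \<pi> L"
  by (auto simp: good_def strand_labelling_def)

lemma crossings_subset: "(P \<in> {over_pt D h, under_pt D h}) \<Longrightarrow> h \<in> crossings D \<Longrightarrow> P \<in> Field (segments D)"
proof -
  assume P: "P \<in> {over_pt D h, under_pt D h}" and h: "h \<in> crossings D"
  obtain i g j where s: "D ! h = (i, g, j)" by (cases "D ! h") auto
  have g: "g \<in> {Cross, CrossInv}" and hl: "h < length D" using h s by (auto simp: crossings_def)
  have "((h, i), (Suc h, Suc i)) \<in> segments D" "((h, Suc i), (Suc h, i)) \<in> segments D"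
    using hl s g unfolding segments_def by (auto intro!: bexI[of _ h])
  then have "(h, i) \<in> Field (segments D)" "(h, Suc i) \<in> Field (segments D)"
    by (auto simp: Field_def)
  then show ?thesis using P s g by (auto simp: over_pt_def under_pt_def)
qed

text \<open>Labels decide everything: \<open>strand_min\<close> is the label, interlacing puts the
  smaller label on top and excludes self-crossings, injectivity of \<open>crossing_rel\<close>
  excludes a second crossing with the same upper strand, and the asymmetry of interlacing excludes
  one with the roles exchanged.\<close>

lemma good_rtd:
  assumes gd: "good a D b \<pi> L" shows "reduced_totally_descending a D b"
proof -
  have mt: "matching (a + b) \<pi>" and tg: "tangle a D b" and sl: "strand_labelling a D b \<pi> L"
    using gd by (auto simp: good_def strand_labelling_def)
  have seg: "\<forall>(P, Q) \<in> segments D. L P = L Q" and Le: "\<And>e. e < a + b \<Longrightarrow> L (endpoint a D b e) = lab \<pi> e"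
    and mate: "\<And>e. e < a + b \<Longrightarrow> same_strand D (endpoint a D b e) (endpoint a D b (\<pi> e))"
    using sl by (auto simp: strand_labelling_def)
  have field: "\<And>P. P \<in> Field (segments D) \<Longrightarrow> \<exists>e < a + b. same_strand D (endpoint a D b e) P"
    using gd by (auto simp: good_def)
  have const: "same_strand D P Q \<Longrightarrow> L P = L Q" for P Q using same_strand_const[OF seg] .
  have smin: "strand_min a D b P = L P" if P: "P \<in> Field (segments D)" for P
  proof -
    obtain e where e: "e < a + b" "same_strand D (endpoint a D b e) P" using field[OF P] by blast
    have LP: "L P = lab \<pi> e" using const[OF e(2)] Le[OF e(1)] by simp
    have "same_strand D (endpoint a D b (lab \<pi> e)) P"
    proof (cases "lab \<pi> e = e")
      case False
      then have "lab \<pi> e = \<pi> e" by (auto simp: lab_def min_def split: if_splits)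
      then show ?thesis using same_strand_trans[OF same_strand_sym[OF mate[OF e(1)]] e(2)] by simp
    qed (use e in simp)
    moreover have "lab \<pi> e < a + b" using e by (simp add: lab_lt)
    moreover have "lab \<pi> e \<le> e'" if "e' < a + b" "same_strand D (endpoint a D b e') P" for e'
      using const[OF that(2)] Le[OF that(1)] LP by (simp add: lab_def)
    ultimately show ?thesis unfolding strand_min_def LP by (intro Least_equality) auto
  qed
  have inter: "interl \<pi> (L (over_pt D h)) (L (under_pt D h))" if "h \<in> crossings D" for h
    using gd that by (auto simp: good_def crossing_rel_def)
  have inj: "inj_on (crossing_rel D L) (crossings D)" using gd by (simp add: good_def)
  show ?thesis unfolding reduced_totally_descending_def
  proof (intro conjI ballI impI tg field)
    fix h assume h: "h \<in> crossings D"
    show "\<not> same_strand D (over_pt D h) (under_pt D h)"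
      using const[of "over_pt D h" "under_pt D h"] inter[OF h] by (auto simp: interl_def)
    show "strand_min a D b (over_pt D h) < strand_min a D b (under_pt D h)"
      using smin crossings_subset[of _ D h] h inter[OF h] by (auto simp: interl_def)
    fix k assume k: "k \<in> crossings D" "h \<noteq> k"
    show "\<not> (same_strand D (over_pt D h) (over_pt D k) \<and> same_strand D (under_pt D h) (under_pt D k))"
      using const[of "over_pt D h" "over_pt D k"] const[of "under_pt D h" "under_pt D k"]
        inj_onD[OF inj _ h k(1)] k(2) by (auto simp: crossing_rel_def)
    show "\<not> (same_strand D (over_pt D h) (under_pt D k) \<and> same_strand D (under_pt D h) (over_pt D k))"
      using const[of "over_pt D h" "under_pt D k"] const[of "under_pt D h" "over_pt D k"] inter[OF h] inter[OF k(1)]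
      by (auto simp: interl_def)
  qed
qed

lemma interl_lab: "interl \<pi> s t \<Longrightarrow> lab \<pi> s = s" "interl \<pi> s t \<Longrightarrow> lab \<pi> t = t"
  by (auto simp: interl_def lab_def)

lemma good_Nil: "good a [] a (\<lambda>e. 2 * a - 1 - e) (\<lambda>(h, p). p)"
  using strand_labelling_Nil[of a] by (simp add: good_def crossings_def)

lemma good_crossing_bounds:
  assumes gd: "good a D b \<pi> L" and h: "h \<in> crossings D" and st: "crossing_rel D L h = (s, t)"
  shows "interl \<pi> s t" "s < a + b" "t < a + b"
proof -
  show "interl \<pi> s t" using gd h st by (force simp: good_def)
  have sl: "strand_labelling a D b \<pi> L" using gd by (simp add: good_def)
  have lt: "L P < a + b" if "P \<in> Field (segments D)" for P
  proof -
    obtain e where e: "e < a + b" "same_strand D (endpoint a D b e) P" using gd \<open>P \<in> _\<close> by (auto simp: good_def)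
    have "L (endpoint a D b e) = L P" using sl e by (intro same_strand_const[of D]) (auto simp: strand_labelling_def)
    then show ?thesis using sl e by (auto simp: strand_labelling_def lab_def)
  qed
  show "s < a + b" "t < a + b" using lt[of "over_pt D h"] lt[of "under_pt D h"] crossings_subset[of "over_pt D h" D h] crossings_subset[of "under_pt D h" D h] h st
    by (auto simp: crossing_rel_def)
qed

text \<open>The bookkeeping shared by all extensions: \<open>\<iota>\<close> moves points,
  \<open>\<kappa>\<close> moves heights of crossings, \<open>r\<close> renumbers endpoints, and
  \<open>X\<close> holds at most one new crossing. Old crossings stay good if \<open>r\<close>
  preserves interlacing, and the new pair must not be the image of an interlacing old pair.\<close>

lemma good_extend:
  assumes gd: "good a D b \<pi> L" and sl: "strand_labelling a' D' b' \<pi>' L'"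
    and field: "\<And>P. P \<in> Field (segments D') \<Longrightarrow> (\<exists>e < a' + b'. P = endpoint a' D' b' e)
       \<or> (\<exists>P0 \<in> Field (segments D). P = \<iota> P0) \<or> (\<exists>e < a + b. P = \<iota> (endpoint a D b e))"
    and map: "\<And>P Q. same_strand D P Q \<Longrightarrow> same_strand D' (\<iota> P) (\<iota> Q)"
    and link: "\<And>e. e < a + b \<Longrightarrow> \<exists>e' < a' + b'. same_strand D' (endpoint a' D' b' e') (\<iota> (endpoint a D b e))"
    and cr: "crossings D' = \<kappa> ` crossings D \<union> X"
    and \<kappa>: "\<And>h. h \<in> crossings D \<Longrightarrow> crossing_rel D' L' (\<kappa> h) = map_prod (lab \<pi>' \<circ> r) (lab \<pi>' \<circ> r) (crossing_rel D L h)"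
    and r: "inj r" "\<And>s t. interl \<pi> s t \<Longrightarrow> s < a + b \<Longrightarrow> t < a + b \<Longrightarrow> interl \<pi>' (r s) (r t)"
    and X: "\<And>x. x \<in> X \<Longrightarrow> X = {x} \<and> case_prod (interl \<pi>') (crossing_rel D' L' x) \<and>
       (\<forall>s t. interl \<pi> s t \<longrightarrow> s < a + b \<longrightarrow> t < a + b \<longrightarrow> crossing_rel D' L' x \<noteq> (r s, r t))"
  shows "good a' D' b' \<pi>' L'"
proof -
  have \<kappa>': "\<exists>s t. crossing_rel D L h = (s, t) \<and> interl \<pi> s t \<and> s < a + b \<and> t < a + b \<and>
      crossing_rel D' L' (\<kappa> h) = (r s, r t) \<and> interl \<pi>' (r s) (r t)" if h: "h \<in> crossings D" for h
  proof -
    obtain s t where st: "crossing_rel D L h = (s, t)" by fastforce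
    note b = good_crossing_bounds[OF gd h st]
    have i: "interl \<pi>' (r s) (r t)" using r(2) b by blast
    then show ?thesis using \<kappa>[OF h] st b interl_lab[OF i] by auto
  qed
  have "\<exists>e < a' + b'. same_strand D' (endpoint a' D' b' e) P" if P: "P \<in> Field (segments D')" for P
  proof -
    consider e where "e < a' + b'" "P = endpoint a' D' b' e" | P0 where "P0 \<in> Field (segments D)" "P = \<iota> P0"
      | e where "e < a + b" "P = \<iota> (endpoint a D b e)" using field[OF P] by blast
    then show ?thesis
    proof cases
      case 1 then show ?thesis by (metis same_strand_refl)
    next
      case 2
      then obtain e where e: "e < a + b" "same_strand D (endpoint a D b e) P0" using gd by (auto simp: good_def)
      show ?thesis using link[OF e(1)] map[OF e(2)] 2 same_strand_trans by metis
    next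
      case 3 then show ?thesis using link by metis
    qed
  qed
  moreover have "case_prod (interl \<pi>') (crossing_rel D' L' h)" if "h \<in> crossings D'" for h
    using that \<kappa>' X unfolding cr by fastforce
  moreover have "inj_on (crossing_rel D' L') (crossings D')"
  proof (rule inj_onI)
    fix x y assume xy: "x \<in> crossings D'" "y \<in> crossings D'" "crossing_rel D' L' x = crossing_rel D' L' y"
    have neq: "crossing_rel D' L' (\<kappa> h) \<noteq> crossing_rel D' L' z" if "h \<in> crossings D" "z \<in> X" for h z
      using \<kappa>'[OF that(1)] X[OF that(2)] by metis
    consider "x \<in> X" "y \<in> X" | h k where "x = \<kappa> h" "y = \<kappa> k" "h \<in> crossings D" "k \<in> crossings D"
      using xy neq unfolding cr by (metis UnE imageE)
    then show "x = y"
    proof cases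
      case 1 then show ?thesis using X by blast
    next
      case 2
      obtain s t where st: "crossing_rel D L h = (s, t)" "crossing_rel D' L' (\<kappa> h) = (r s, r t)"
        using \<kappa>'[OF 2(3)] by blast
      obtain s' t' where st': "crossing_rel D L k = (s', t')" "crossing_rel D' L' (\<kappa> k) = (r s', r t')"
        using \<kappa>'[OF 2(4)] by blast
      have "r s = r s'" "r t = r t'" using xy(3) st(2) st'(2) 2(1,2) by simp_all
      then have "crossing_rel D L h = crossing_rel D L k" using r(1) st(1) st'(1) by (simp add: inj_eq)
      moreover have "inj_on (crossing_rel D L) (crossings D)" using gd by (simp add: good_def)
      ultimately have "h = k" using 2(3,4) by (simp add: inj_on_eq_iff)
      then show ?thesis using 2 by simp
    qed
  qed
  ultimately show ?thesis unfolding good_def using sl by simp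
qed

lemma crossings_Cons: "crossings ((i, g, j) # D) = Suc ` crossings D \<union> (if g \<in> {Cross, CrossInv} then {0} else {})"
proof -
  have "h \<in> crossings ((i, g, j) # D) \<longleftrightarrow> h \<in> Suc ` crossings D \<union> (if g \<in> {Cross, CrossInv} then {0} else {})" for h
    by (cases h) (auto simp: crossings_def)
  then show ?thesis by blast
qed

lemma crossings_snoc: "crossings (D @ [(i, g, j)]) = crossings D \<union> (if g \<in> {Cross, CrossInv} then {length D} else {})"
  by (auto simp: crossings_def nth_append less_Suc_eq)

lemma crossing_rel_Cons: "crossing_rel (s # D) (cons_label \<pi>' r L) (Suc h)
   = map_prod (lab \<pi>' \<circ> r) (lab \<pi>' \<circ> r) (crossing_rel D L h)"
  by (cases "D ! h") (auto simp: crossing_rel_def over_pt_def under_pt_def cons_label_def)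

lemma crossing_rel_snoc: "h \<in> crossings D \<Longrightarrow> crossing_rel (D @ [s]) (snoc_label (length D) N \<pi>' r L) h
   = map_prod (lab \<pi>' \<circ> r) (lab \<pi>' \<circ> r) (crossing_rel D L h)"
  by (cases "D ! h") (auto simp: crossing_rel_def over_pt_def under_pt_def snoc_label_def crossings_def nth_append)

lemma Field_segments_Cons:
  assumes P: "P \<in> Field (segments ((i, g, j) # D))" and a: "a = i + gtgt g + j" and a': "a' = i + gsrc g + j"
  shows "(\<exists>e < a' + b. P = endpoint a' ((i, g, j) # D) b e)
       \<or> (\<exists>P0 \<in> Field (segments D). P = up1 P0) \<or> (\<exists>e < a + b. P = up1 (endpoint a D b e))"
proof -
  obtain Q where "(P, Q) \<in> segments ((i, g, j) # D) \<or> (Q, P) \<in> segments ((i, g, j) # D)"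
    using P by (auto simp: Field_def)
  then consider "(P, Q) \<in> slice_segments 0 (i, g, j) \<or> (Q, P) \<in> slice_segments 0 (i, g, j)"
    | "\<exists>P0 \<in> Field (segments D). P = up1 P0"
    by (auto simp: segments_Cons Field_def)
  then show ?thesis
  proof cases
    case 1
    then have "fst P = 0 \<and> snd P < a' \<or> fst P = Suc 0 \<and> snd P < a"
      using slice_segments_bounds[of P Q 0 i g j] slice_segments_bounds[of Q P 0 i g j] a a' by blast
    then show ?thesis
    proof
      assume "fst P = 0 \<and> snd P < a'"
      then show ?thesis by (intro disjI1 exI[of _ "snd P"]) (cases P, auto simp: endpoint_low)
    next
      assume "fst P = Suc 0 \<and> snd P < a"
      then show ?thesis by (intro disjI2 exI[of _ "snd P"]) (cases P, auto simp: endpoint_low)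
    qed
  qed blast
qed

lemma Field_segments_snoc:
  assumes P: "P \<in> Field (segments (D @ [(i, g, j)]))" and b: "b = i + gsrc g + j" and b': "b' = i + gtgt g + j"
  shows "(\<exists>e < a + b'. P = endpoint a (D @ [(i, g, j)]) b' e)
       \<or> (\<exists>P0 \<in> Field (segments D). P = P0) \<or> (\<exists>e < a + b. P = endpoint a D b e)"
proof -
  obtain Q where "(P, Q) \<in> segments (D @ [(i, g, j)]) \<or> (Q, P) \<in> segments (D @ [(i, g, j)])"
    using P by (auto simp: Field_def)
  then consider "(P, Q) \<in> slice_segments (length D) (i, g, j) \<or> (Q, P) \<in> slice_segments (length D) (i, g, j)"
    | "P \<in> Field (segments D)"
    by (auto simp: segments_snoc Field_def)
  then show ?thesis
  proof cases
    case 1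
    then have "fst P = length D \<and> snd P < b \<or> fst P = Suc (length D) \<and> snd P < b'"
      using slice_segments_bounds[of P Q "length D" i g j] slice_segments_bounds[of Q P "length D" i g j] b b' by blast
    then show ?thesis
    proof
      assume "fst P = length D \<and> snd P < b"
      then show ?thesis using endpoint_up[of "snd P" b a D]
        by (intro disjI2 exI[of _ "a + b - 1 - snd P"]) (cases P, auto)
    next
      assume "fst P = Suc (length D) \<and> snd P < b'"
      then show ?thesis using endpoint_up[of "snd P" b' a "D @ [(i, g, j)]"]
        by (intro disjI1 exI[of _ "a + b' - 1 - snd P"]) (cases P, auto)
    qed
  qed blast
qed

text \<open>The transposition reverses the order of \<open>i\<close> and \<open>Suc i\<close> only.
  Two interlacing strands could lose this property only if they end at exactly these two points,
  which \<open>ni\<close> forbids.\<close>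

lemma interl_sw:
  assumes m: "matching n \<pi>" and i: "Suc i < n" "\<pi> i \<noteq> Suc i"
    and ni: "\<not> interl \<pi> (lab \<pi> i) (lab \<pi> (Suc i))" "\<not> interl \<pi> (lab \<pi> (Suc i)) (lab \<pi> i)"
    and st: "interl \<pi> s t" "s < n" "t < n"
  shows "interl (\<lambda>x. sw i (\<pi> (sw i x))) (sw i s) (sw i t)"
proof -
  have inv: "\<pi> (\<pi> s) = s" "\<pi> (\<pi> t) = t" using m st by (auto simp: matching_def)
  note I = st(1)[unfolded interl_def]
  have "sw i s < sw i t"
  proof (rule sw_mono)
    show "\<not> (s = i \<and> t = Suc i)" using interl_lab[OF st(1)] ni(1) st(1) by auto
  qed (use I in auto)
  moreover have "sw i t < sw i (\<pi> s)"
  proof (rule sw_mono)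
    show "\<not> (t = i \<and> \<pi> s = Suc i)"
    proof
      assume *: "t = i \<and> \<pi> s = Suc i"
      then have "lab \<pi> (Suc i) = s" using inv I by (auto simp: lab_def)
      then show False using * interl_lab(2)[OF st(1)] ni(2) st(1) by auto
    qed
  qed (use I in auto)
  moreover have "sw i (\<pi> s) < sw i (\<pi> t)"
  proof (rule sw_mono)
    show "\<not> (\<pi> s = i \<and> \<pi> t = Suc i)"
    proof
      assume *: "\<pi> s = i \<and> \<pi> t = Suc i"
      then have "lab \<pi> (Suc i) = t" "lab \<pi> i = s" using inv I by (auto simp: lab_def)
      then show False using ni(1) st(1) by auto
    qed
  qed (use I in auto)
  ultimately show ?thesis by (simp add: interl_def)
qed

text \<open>Two strands ending at neighbouring points are nested, disjoint or interlacing, and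
  exchanging these ends switches between interlacing and not interlacing. So the new crossing is
  forced, and its pair of strands has not crossed before.\<close>

lemma interl_new:
  assumes m: "matching n \<pi>" and i: "Suc i < n" "\<pi> i \<noteq> Suc i"
    and ni: "\<not> interl \<pi> (lab \<pi> i) (lab \<pi> (Suc i))" "\<not> interl \<pi> (lab \<pi> (Suc i)) (lab \<pi> i)"
  defines "\<pi>' \<equiv> \<lambda>x. sw i (\<pi> (sw i x))"
  shows "interl \<pi>' (lab \<pi>' i) (lab \<pi>' (Suc i)) \<or> interl \<pi>' (lab \<pi>' (Suc i)) (lab \<pi>' i)"
    and "\<And>s t. interl \<pi> s t \<Longrightarrow> s < n \<Longrightarrow> t < n
       \<Longrightarrow> {sw i s, sw i t} \<noteq> {lab \<pi>' i, lab \<pi>' (Suc i)}"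
proof -
  define x where "x = \<pi> i"
  define y where "y = \<pi> (Suc i)"
  have m': "matching n \<pi>'" unfolding \<pi>'_def using m i(1) by (rule matching_sw)
  have pm: "\<pi> (lab \<pi> e) = max e (\<pi> e)" if "e < n" for e
    using matchingD(3)[OF m that] by (auto simp: lab_def min_def max_def)
  have pm': "\<pi>' (lab \<pi>' e) = max e (\<pi>' e)" if "e < n" for e
    using matchingD(3)[OF m' that] by (auto simp: lab_def min_def max_def)
  have xy: "x \<noteq> i" "x \<noteq> Suc i" "y \<noteq> i" "y \<noteq> Suc i" "x \<noteq> y"
    using matchingD[OF m, of i] matchingD[OF m, of "Suc i"] i by (auto simp: x_def y_def)
  have p': "\<pi>' i = y" "\<pi>' (Suc i) = x" using xy by (auto simp: \<pi>'_def x_def[symmetric] y_def[symmetric] sw_def)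
  have l: "lab \<pi> i = min i x" "lab \<pi> (Suc i) = min (Suc i) y" "lab \<pi>' i = min i y" "lab \<pi>' (Suc i) = min (Suc i) x"
    using p' by (auto simp: lab_def x_def y_def)
  have pl: "\<pi> (min i x) = max i x" "\<pi> (min (Suc i) y) = max (Suc i) y"
    "\<pi>' (min i y) = max i y" "\<pi>' (min (Suc i) x) = max (Suc i) x"
    using pm[of i] pm[of "Suc i"] pm'[of i] pm'[of "Suc i"] i p' l by (auto simp: x_def[symmetric] y_def[symmetric])
  show "interl \<pi>' (lab \<pi>' i) (lab \<pi>' (Suc i)) \<or> interl \<pi>' (lab \<pi>' (Suc i)) (lab \<pi>' i)"
  proof -
    \<comment> \<open>No number lies strictly between \<open>i\<close> and \<open>Suc i\<close>, so
      each of the other two ends compares in the same way with both; this leaves four cases.\<close>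
    have c: "min i z = z \<and> min (Suc i) z = z \<and> max i z = i \<and> max (Suc i) z = Suc i \<and> z < i
        \<or> min i z = i \<and> min (Suc i) z = Suc i \<and> max i z = z \<and> max (Suc i) z = z \<and> Suc i < z"
      if "z \<noteq> i" "z \<noteq> Suc i" for z
    proof (cases "z < i")
      case False
      then have "Suc i < z" using that by simp
      then show ?thesis by (simp add: min_absorb1 max_absorb2)
    qed (simp add: min_absorb2 max_absorb1)
    note cx = c[OF xy(1,2)] and cy = c[OF xy(3,4)]
    show ?thesis
      using cx cy ni[unfolded l interl_def pl] xy(5) unfolding l interl_def pl by (elim disjE conjE) simp_all
  qed
  fix s t assume st: "interl \<pi> s t" "s < n" "t < n"
  show "{sw i s, sw i t} \<noteq> {lab \<pi>' i, lab \<pi>' (Suc i)}"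
  proof
    assume "{sw i s, sw i t} = {lab \<pi>' i, lab \<pi>' (Suc i)}"
    then have "sw i ` {sw i s, sw i t} = sw i ` {lab \<pi>' i, lab \<pi>' (Suc i)}" by simp
    moreover have "sw i (lab \<pi>' i) = lab \<pi> (Suc i)" "sw i (lab \<pi>' (Suc i)) = lab \<pi> i"
      using xy unfolding l by (auto simp: sw_def min_def)
    ultimately have "{s, t} = {lab \<pi> (Suc i), lab \<pi> i}" by simp
    then show False using st(1) ni by (auto simp: doubleton_eq_iff)
  qed
qed

lemma good_cross_bottom:
  assumes gd: "good a D b \<pi> L" and a: "a = i + 2 + j" and i: "\<pi> i \<noteq> Suc i"
    and ni: "\<not> interl \<pi> (lab \<pi> i) (lab \<pi> (Suc i))" "\<not> interl \<pi> (lab \<pi> (Suc i)) (lab \<pi> i)"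
  defines "\<pi>' \<equiv> \<lambda>x. sw i (\<pi> (sw i x))"
  shows "\<exists>g L'. good a ((i, g, j) # D) b \<pi>' L'"
proof -
  \<comment> \<open>The upper strand of \<open>Cross\<close> starts at the lower left point; the
    sign is chosen so that the strand with the smaller label is the upper one.\<close>
  define g where "g = (if lab \<pi>' i < lab \<pi>' (Suc i) then Cross else CrossInv)"
  have g: "g \<in> {Cross, CrossInv}" by (simp add: g_def)
  let ?D = "(i, g, j) # D" and ?L = "cons_label \<pi>' (sw i) L"
  have m: "matching (a + b) \<pi>" by (rule good_matching[OF gd])
  have i': "Suc i < a + b" using a by simp
  note new = interl_new[OF m i' i ni, folded \<pi>'_def]
  note lb = cross_bottom_labelling[OF good_labelling[OF gd] g a, folded \<pi>'_def]
  have "good a ?D b \<pi>' ?L"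
  proof (rule good_extend[OF gd lb(1), where \<iota> = up1 and \<kappa> = Suc and r = "sw i" and X = "{0}"])
    show "(\<exists>e < a + b. P = endpoint a ?D b e)
       \<or> (\<exists>P0 \<in> Field (segments D). P = up1 P0) \<or> (\<exists>e < a + b. P = up1 (endpoint a D b e))"
      if "P \<in> Field (segments ?D)" for P
      by (rule Field_segments_Cons[OF that]) (use g a in auto)
    show "\<exists>e'<a + b. same_strand ?D (endpoint a ?D b e') (up1 (endpoint a D b e))" if "e < a + b" for e
      using lb(2)[of "sw i e"] sw_lt[OF i' that] by auto
    show "crossings ?D = Suc ` crossings D \<union> {0}" using g by (auto simp: crossings_Cons)
    show "inj (sw i)" by (auto intro: injI)
    show "interl \<pi>' (sw i s) (sw i t)" if "interl \<pi> s t" "s < a + b" "t < a + b" for s t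
      using interl_sw[OF m i' i ni that] by (simp add: \<pi>'_def)
    show "{0} = {x} \<and> case_prod (interl \<pi>') (crossing_rel ?D ?L x) \<and>
       (\<forall>s t. interl \<pi> s t \<longrightarrow> s < a + b \<longrightarrow> t < a + b \<longrightarrow> crossing_rel ?D ?L x \<noteq> (sw i s, sw i t))"
      if "x \<in> {0}" for x
    proof -
      have c: "crossing_rel ?D ?L 0 = (if g = Cross then (lab \<pi>' i, lab \<pi>' (Suc i)) else (lab \<pi>' (Suc i), lab \<pi>' i))"
        by (auto simp: crossing_rel_def over_pt_def under_pt_def cons_label_def)
      have "case_prod (interl \<pi>') (crossing_rel ?D ?L 0)"
        using new(1) unfolding c by (auto simp: g_def interl_def)
      moreover have "crossing_rel ?D ?L 0 \<noteq> (sw i s, sw i t)" if "interl \<pi> s t" "s < a + b" "t < a + b" for s t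
        using new(2)[OF that] unfolding c by (auto split: if_splits)
      ultimately show ?thesis using that by auto
    qed
  qed (simp_all add: same_strand_Cons crossing_rel_Cons)
  then show ?thesis by blast
qed

text \<open>The upper strand of \<open>CrossInv\<close> leaves at the upper left, which is the
  endpoint \<open>Suc (a + j)\<close>. The hypothesis \<open>less\<close> says that this strand has
  the smaller label, so the sign is fixed without knowing the rest of the diagram.\<close>

lemma good_cross_top:
  assumes gd: "good a D b \<pi> L" and b: "b = i + 2 + j" and i: "\<pi> (a + j) \<noteq> Suc (a + j)"
    and ni: "\<not> interl \<pi> (lab \<pi> (a + j)) (lab \<pi> (Suc (a + j)))"
      "\<not> interl \<pi> (lab \<pi> (Suc (a + j))) (lab \<pi> (a + j))"
  defines "\<pi>' \<equiv> \<lambda>x. sw (a + j) (\<pi> (sw (a + j) x))"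
  assumes less: "lab \<pi>' (Suc (a + j)) < lab \<pi>' (a + j)"
  shows "\<exists>L'. good a (D @ [(i, CrossInv, j)]) b \<pi>' L'"
proof -
  let ?k = "a + j" and ?D = "D @ [(i, CrossInv, j)]"
  let ?L = "snoc_label (length D) (a + b) \<pi>' (sw ?k) L"
  have m: "matching (a + b) \<pi>" by (rule good_matching[OF gd])
  have i': "Suc ?k < a + b" using b by simp
  note new = interl_new[OF m i' i ni, folded \<pi>'_def]
  have sl: "strand_labelling a D b \<pi> L" by (rule good_labelling[OF gd])
  note lb = cross_top_labelling[OF sl _ b, of CrossInv, folded \<pi>'_def]
  have "good a ?D b \<pi>' ?L"
  proof (rule good_extend[OF gd lb(1), where \<iota> = "\<lambda>P. P" and \<kappa> = "\<lambda>h. h" and r = "sw ?k" and X = "{length D}"])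
    show "(\<exists>e < a + b. P = endpoint a ?D b e)
       \<or> (\<exists>P0 \<in> Field (segments D). P = P0) \<or> (\<exists>e < a + b. P = (endpoint a D b e))"
      if "P \<in> Field (segments ?D)" for P
      by (rule Field_segments_snoc[OF that]) (use b in auto)
    show "\<exists>e'<a + b. same_strand ?D (endpoint a ?D b e') (endpoint a D b e)" if "e < a + b" for e
      using lb(2)[of "sw ?k e"] sw_lt[OF i' that] by auto
    show "crossings ?D = (\<lambda>h. h) ` crossings D \<union> {length D}" by (auto simp: crossings_snoc)
    show "inj (sw ?k)" by (auto intro: injI)
    show "interl \<pi>' (sw ?k s) (sw ?k t)" if "interl \<pi> s t" "s < a + b" "t < a + b" for s t
      using interl_sw[OF m i' i ni that] by (simp add: \<pi>'_def)
    show "{length D} = {x} \<and> case_prod (interl \<pi>') (crossing_rel ?D ?L x) \<and>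
       (\<forall>s t. interl \<pi> s t \<longrightarrow> s < a + b \<longrightarrow> t < a + b \<longrightarrow> crossing_rel ?D ?L x \<noteq> (sw ?k s, sw ?k t))"
      if "x \<in> {length D}" for x
    proof -
      have end_lab: "L (length D, p) = lab \<pi> (a + b - 1 - p)" if "p < b" for p
      proof -
        have "a + b - 1 - p < a + b" using that by simp
        then have "L (endpoint a D b (a + b - 1 - p)) = lab \<pi> (a + b - 1 - p)"
          using sl unfolding strand_labelling_def by blast
        then show ?thesis unfolding endpoint_up[OF that] .
      qed
      have rl: "lab \<pi>' (sw ?k (lab \<pi> e)) = lab \<pi>' (sw ?k e)" if "e < a + b" for e
        using that matchingD(3)[OF m] by (intro relabel[of "a + b"]) (auto simp: lab_def \<pi>'_def min.commute)
      have "a + b - 1 - Suc i = ?k" "a + b - 1 - i = Suc ?k" using b by auto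
      then have c: "crossing_rel ?D ?L (length D) = (lab \<pi>' (Suc ?k), lab \<pi>' ?k)"
        using end_lab[of i] end_lab[of "Suc i"] rl[of ?k] rl[of "Suc ?k"] b
        by (auto simp: crossing_rel_def over_pt_def under_pt_def snoc_label_def)
      have "case_prod (interl \<pi>') (crossing_rel ?D ?L (length D))"
        using new(1) less unfolding c by (auto simp: interl_def)
      moreover have "crossing_rel ?D ?L (length D) \<noteq> (sw ?k s, sw ?k t)" if "interl \<pi> s t" "s < a + b" "t < a + b" for s t
        using new(2)[OF that] unfolding c by auto
      ultimately show ?thesis using that by auto
    qed
  qed (simp_all add: same_strand_snoc crossing_rel_snoc)
  then show ?thesis by blast
qed

lemma interl_ins: "interl \<pi> s t \<Longrightarrow> interl (ins_pair i \<pi>) (ins i s) (ins i t)"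
  by (auto simp: interl_def)

lemma good_cap_bottom:
  assumes gd: "good a D b \<pi> L" and a: "a = i + j"
  shows "\<exists>L'. good (Suc (Suc a)) ((i, Cap, j) # D) b (ins_pair i \<pi>) L'"
proof -
  let ?\<pi> = "ins_pair i \<pi>" and ?D = "(i, Cap, j) # D" and ?a = "Suc (Suc a)"
  note lb = cap_bottom_labelling[OF good_labelling[OF gd] a]
  have "good ?a ?D b ?\<pi> (cons_label ?\<pi> (ins i) L)"
  proof (rule good_extend[OF gd lb(1), where \<iota> = up1 and \<kappa> = Suc and r = "ins i" and X = "{}"])
    show "(\<exists>e < ?a + b. P = endpoint ?a ?D b e)
       \<or> (\<exists>P0 \<in> Field (segments D). P = up1 P0) \<or> (\<exists>e < a + b. P = up1 (endpoint a D b e))"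
      if "P \<in> Field (segments ?D)" for P
      by (rule Field_segments_Cons[OF that]) (use a in auto)
    show "\<exists>e'<?a + b. same_strand ?D (endpoint ?a ?D b e') (up1 (endpoint a D b e))" if "e < a + b" for e
      using lb(2)[OF that] ins_lt[OF that] by auto
    show "inj (ins i)" by (auto intro: injI)
  qed (simp_all add: same_strand_Cons crossing_rel_Cons crossings_Cons interl_ins)
  then show ?thesis by blast
qed

lemma good_cup_top:
  assumes gd: "good a D b \<pi> L" and b: "b = i + j"
  shows "\<exists>L'. good a (D @ [(i, Cup, j)]) (Suc (Suc b)) (ins_pair (a + j) \<pi>) L'"
proof -
  let ?\<pi> = "ins_pair (a + j) \<pi>" and ?D = "D @ [(i, Cup, j)]" and ?b = "Suc (Suc b)"
  note lb = cup_top_labelling[OF good_labelling[OF gd] b]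
  have "good a ?D ?b ?\<pi> (snoc_label (length D) (a + ?b) ?\<pi> (ins (a + j)) L)"
  proof (rule good_extend[OF gd lb(1), where \<iota> = "\<lambda>P. P" and \<kappa> = "\<lambda>h. h" and r = "ins (a + j)" and X = "{}"])
    show "(\<exists>e < a + ?b. P = endpoint a ?D ?b e)
       \<or> (\<exists>P0 \<in> Field (segments D). P = P0) \<or> (\<exists>e < a + b. P = endpoint a D b e)"
      if "P \<in> Field (segments ?D)" for P
      by (rule Field_segments_snoc[OF that]) (use b in auto)
    show "\<exists>e'<a + ?b. same_strand ?D (endpoint a ?D ?b e') (endpoint a D b e)" if "e < a + b" for e
      using lb(2)[OF that] ins_lt[OF that] by auto
    show "inj (ins (a + j))" by (auto intro: injI)
  qed (simp_all add: same_strand_snoc crossing_rel_snoc crossings_snoc interl_ins)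
  then show ?thesis by blast
qed

lemma good_cong:
  assumes gd: "good a D b \<pi> L" and eq: "\<And>e. e < a + b \<Longrightarrow> \<pi>' e = \<pi> e"
  shows "good a D b \<pi>' L"
proof -
  have m: "matching (a + b) \<pi>" by (rule good_matching[OF gd])
  have "matching (a + b) \<pi>'" using m eq by (simp add: matching_def)
  moreover have "lab \<pi>' e = lab \<pi> e" if "e < a + b" for e using eq[OF that] by (simp add: lab_def)
  ultimately have "strand_labelling a D b \<pi>' L"
    using good_labelling[OF gd] eq by (simp add: strand_labelling_def)
  moreover have "case_prod (interl \<pi>') (crossing_rel D L h)" if h: "h \<in> crossings D" for h
  proof -
    obtain s t where st: "crossing_rel D L h = (s, t)" by fastforce
    show ?thesis using good_crossing_bounds[OF gd h st] eq[of s] eq[of t] by (simp add: st interl_def)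
  qed
  ultimately show ?thesis using gd by (simp add: good_def)
qed

lemma sw_rev: "w < k + i + 2 \<Longrightarrow> k + i + 2 - 1 - sw k w = sw i (k + i + 2 - 1 - w)"
  by (auto simp: sw_def)

lemma del_rev: "w < k + i + 2 \<Longrightarrow> w \<noteq> k \<Longrightarrow> w \<noteq> Suc k \<Longrightarrow> k + i - 1 - del k w = del i (k + i + 2 - 1 - w)"
  by (auto simp: del_def)

text \<open>Bubble sort. The vertical diagram corresponds to the decreasing map
  \<open>2 * a - 1 - e\<close>; an adjacent ascent of \<open>\<pi>\<close> marks two strands that
  cross, and a crossing is split off at the bottom there. Exchanging the two values lowers the sum
  of all \<open>e * \<pi> e\<close> by their difference.\<close>

lemma exists_perm:
  assumes "matching (a + a) \<pi>" "\<And>e. e < a \<Longrightarrow> \<pi> e \<ge> a"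
  shows "\<exists>D L. good a D a \<pi> L"
  using assms
proof (induction "\<Sum>e<a. e * \<pi> e" arbitrary: \<pi> rule: less_induct)
  case less
  note m = less.prems(1) and up = less.prems(2)
  show ?case
  proof (cases "\<forall>e. Suc e < a \<longrightarrow> \<pi> (Suc e) < \<pi> e")
    case True
    \<comment> \<open>A strictly decreasing map from the \<open>a\<close> lower to the
      \<open>a\<close> upper numbers is unique: this estimate, taken from both ends, squeezes
      \<open>\<pi> e\<close> to one value.\<close>
    have dec: "\<pi> (e + k) + k \<le> \<pi> e" if "e + k < a" for e k
      using that
    proof (induction k)
      case (Suc k)
      then show ?case using True[rule_format, of "e + k"] by simp
    qed simp
    have low: "\<pi> e = 2 * a - 1 - e" if e: "e < a" for e
    proof -
      have "\<pi> (a - 1) + (a - 1 - e) \<le> \<pi> e" using dec[of e "a - 1 - e"] e by simp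
      moreover have "\<pi> e + e \<le> \<pi> 0" using dec[of 0 e] e by simp
      moreover have "a \<le> \<pi> (a - 1)" "\<pi> 0 < 2 * a" using up[of "a - 1"] matchingD(1)[OF m, of 0] e by auto
      ultimately show ?thesis using e by linarith
    qed
    have "\<pi> e = 2 * a - 1 - e" if e: "e < a + a" for e
    proof (cases "e < a")
      case False
      then have "\<pi> (2 * a - 1 - e) = e" using low[of "2 * a - 1 - e"] e by simp
      then show ?thesis using matchingD(3)[OF m, of "2 * a - 1 - e"] e by simp
    qed (simp add: low)
    then show ?thesis using good_cong[OF good_Nil] by blast
  next
    case False
    then obtain i where i: "Suc i < a" "\<not> \<pi> (Suc i) < \<pi> i" by blast
    have "\<pi> i \<noteq> \<pi> (Suc i)"
      using matchingD(3)[OF m, of i] matchingD(3)[OF m, of "Suc i"] i by (metis Suc_lessD n_not_Suc_n trans_less_add1)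
    then have lt: "\<pi> i < \<pi> (Suc i)" using i by simp
    define \<pi>0 where "\<pi>0 = (\<lambda>x. sw i (\<pi> (sw i x)))"
    have m0: "matching (a + a) \<pi>0" unfolding \<pi>0_def using m i by (intro matching_sw) auto
    have sw_up: "sw i x = x" if "x \<ge> a" for x using that i by (simp add: sw_def)
    have sw_a: "sw i e < a" if "e < a" for e using that i by (intro sw_lt)
    have eq0: "\<pi>0 e = \<pi> (sw i e)" if "e < a" for e
      using up[OF sw_a[OF that]] by (simp add: \<pi>0_def sw_up)
    have up0: "\<pi>0 e \<ge> a" if "e < a" for e using eq0[OF that] up[OF sw_a[OF that]] by simp
    let ?R = "{..<a} - {i, Suc i}"
    have split: "(\<Sum>e<a. f e) = f i + f (Suc i) + (\<Sum>e\<in>?R. f e)" for f :: "nat \<Rightarrow> nat"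
    proof -
      have "{..<a} = insert i (insert (Suc i) ?R)" using i by auto
      then have "(\<Sum>e<a. f e) = (\<Sum>e\<in>insert i (insert (Suc i) ?R). f e)" by simp
      also have "\<dots> = f i + f (Suc i) + (\<Sum>e\<in>?R. f e)" by (subst sum.insert) auto
      finally show ?thesis .
    qed
    have "(\<Sum>e<a. e * \<pi>0 e) = i * \<pi> (Suc i) + Suc i * \<pi> i + (\<Sum>e\<in>?R. e * \<pi> e)"
      unfolding split using eq0 i by (auto simp: sw_def intro!: sum.cong)
    moreover have "(\<Sum>e<a. e * \<pi> e) = i * \<pi> i + Suc i * \<pi> (Suc i) + (\<Sum>e\<in>?R. e * \<pi> e)"
      unfolding split ..
    ultimately have "(\<Sum>e<a. e * \<pi>0 e) < (\<Sum>e<a. e * \<pi> e)" using lt by simp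
    from less.hyps[OF this m0 up0] obtain D L where gd: "good a D a \<pi>0 L" by blast
    have p0: "\<pi>0 i = \<pi> (Suc i)" "\<pi>0 (Suc i) = \<pi> i" using eq0 i by auto
    have ge: "a \<le> \<pi> i" "a \<le> \<pi> (Suc i)" using up i by auto
    then have l0: "lab \<pi>0 i = i" "lab \<pi>0 (Suc i) = Suc i" using p0 i by (auto simp: lab_def)
    have "\<exists>g L'. good a ((i, g, a - 2 - i) # D) a (\<lambda>x. sw i (\<pi>0 (sw i x))) L'"
      using p0 ge i lt l0 by (intro good_cross_bottom[OF gd]) (auto simp: interl_def)
    moreover have "(\<lambda>x. sw i (\<pi>0 (sw i x))) = \<pi>" by (simp add: \<pi>0_def)
    ultimately show ?thesis by auto
  qed
qed

text \<open>Inverse to \<open>ins_pair\<close> on the endpoints; beyond them the two functions may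
  differ, which \<open>good_cong\<close> compensates.\<close>

lemma matching_del:
  assumes m: "matching (Suc (Suc n)) \<pi>" and k: "\<pi> k = Suc k" "k \<le> n"
  shows "matching n (\<lambda>e. del k (\<pi> (ins k e)))"
    and "\<And>e. e < Suc (Suc n) \<Longrightarrow> ins_pair k (\<lambda>e. del k (\<pi> (ins k e))) e = \<pi> e"
proof -
  have k2: "k < Suc (Suc n)" using k by simp
  have k': "\<pi> (Suc k) = k" using matchingD(3)[OF m k2] k by simp
  have ne: "\<pi> e \<noteq> k" "\<pi> e \<noteq> Suc k" if "e < Suc (Suc n)" "e \<noteq> k" "e \<noteq> Suc k" for e
    using matchingD(3)[OF m that(1)] that k k' by auto
  show "matching n (\<lambda>e. del k (\<pi> (ins k e)))"
    unfolding matching_def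
  proof (intro allI impI conjI)
    fix e assume "e < n"
    then have e: "ins k e < Suc (Suc n)" by (rule ins_lt)
    note n = ne[OF e ins_neq(1,2)]
    show "del k (\<pi> (ins k e)) < n" using del_lt[OF matchingD(1)[OF m e] n k(2)] .
    show "del k (\<pi> (ins k e)) \<noteq> e" using matchingD(2)[OF m e] n ins_del by metis
    show "del k (\<pi> (ins k (del k (\<pi> (ins k e))))) = e" using n matchingD(3)[OF m e] by simp
  qed
  show "ins_pair k (\<lambda>e. del k (\<pi> (ins k e))) e = \<pi> e" if "e < Suc (Suc n)" for e
    using ne[OF that] k k' by (auto simp: ins_pair_def)
qed

text \<open>Caps are peeled off at the bottom: the outer induction removes a cap, the inner one
  moves its left end to the right until it is next to the right end. When no cap is left either,
  every strand is vertical, so \<open>a = b\<close> and the pairing is a permutation.\<close>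

lemma exists_cupfree:
  assumes "matching (a + b) \<pi>" "\<And>e. a \<le> e \<Longrightarrow> e < a + b \<Longrightarrow> \<pi> e < a"
  shows "\<exists>D L. good a D b \<pi> L"
  using assms
proof (induction a arbitrary: \<pi> rule: less_induct)
  case (less a)
  note IH = less.IH
  have cap: "\<exists>D L. good a D b \<pi> L"
    if "matching (a + b) \<pi>" "\<And>e. a \<le> e \<Longrightarrow> e < a + b \<Longrightarrow> \<pi> e < a" "\<pi> k = k + Suc n" "\<pi> k < a"
      "\<And>l. k < l \<Longrightarrow> l < \<pi> l \<Longrightarrow> a \<le> \<pi> l" for n k \<pi>
    using that
  proof (induction n arbitrary: k \<pi>)
    case 0
    define a' where "a' = a - 2"
    have a: "a = Suc (Suc a')" and k: "k \<le> a'" "\<pi> k = Suc k" using 0 by (auto simp: a'_def)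
    have m: "matching (Suc (Suc (a' + b))) \<pi>" using 0(1) a by simp
    define \<pi>0 where "\<pi>0 = (\<lambda>e. del k (\<pi> (ins k e)))"
    have m0: "matching (a' + b) \<pi>0" unfolding \<pi>0_def using matching_del(1)[OF m k(2)] k by simp
    have cf: "\<pi>0 e < a'" if "a' \<le> e" "e < a' + b" for e
    proof -
      have e: "ins k e = e + 2" using that k by (simp add: ins_def)
      have lt: "\<pi> (e + 2) < a" using 0(2)[of "e + 2"] that a by simp
      have "\<pi> (\<pi> (e + 2)) = e + 2" using matchingD(3)[OF 0(1), of "e + 2"] that a by simp
      moreover have "\<pi> (Suc k) = k" using matchingD(3)[OF m, of k] k by simp
      ultimately have "\<pi> (e + 2) \<noteq> k" "\<pi> (e + 2) \<noteq> Suc k" using k that by auto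
      then show ?thesis using del_lt[of "\<pi> (e + 2)" a' k] lt a k by (simp add: \<pi>0_def e)
    qed
    obtain D L where gd: "good a' D b \<pi>0 L" using IH[OF _ m0 cf] a by auto
    obtain L' where "good a ((k, Cap, a' - k) # D) b (ins_pair k \<pi>0) L'"
      using good_cap_bottom[OF gd, of k "a' - k"] k a by auto
    from good_cong[OF this, of \<pi>] show ?case
      using matching_del(2)[OF m k(2)] k a unfolding \<pi>0_def by auto
  next
    case (Suc n)
    define \<pi>0 where "\<pi>0 = (\<lambda>x. sw k (\<pi> (sw k x)))"
    have k: "Suc k < \<pi> k" "\<pi> k < a" using Suc.prems by auto
    note m = Suc.prems(1)
    define x where "x = \<pi> k"
    define y where "y = \<pi> (Suc k)"
    have y: "y \<noteq> k" "y \<noteq> Suc k" "y \<noteq> x" "\<pi> y = Suc k"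
      using matchingD[OF m, of "Suc k"] matchingD[OF m, of k] k by (auto simp: x_def y_def)
    \<comment> \<open>No cap starts to the right of \<open>k\<close>, so the strand that is crossed
      leads to the left of \<open>k\<close> or to the top. Hence it does not interlace with the cap
      before the crossing is added.\<close>
    have y': "y < k \<or> a \<le> y" using Suc.prems(5)[of "Suc k"] y(1,2) unfolding y_def by linarith
    have p0: "\<pi>0 k = y" "\<pi>0 (Suc k) = x" using y k by (auto simp: \<pi>0_def sw_def y_def[symmetric] x_def)
    have m0: "matching (a + b) \<pi>0" unfolding \<pi>0_def using m k by (intro matching_sw) auto
    have "\<exists>D L. good a D b \<pi>0 L"
    proof (rule Suc.IH[of _ "Suc k"])
      show "\<pi>0 e < a" if "a \<le> e" "e < a + b" for e
        using Suc.prems(2)[OF that] that k by (simp add: \<pi>0_def sw_def)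
      show "\<pi>0 (Suc k) = Suc k + Suc n" using p0 Suc.prems(3) by (simp add: x_def)
      show "\<pi>0 (Suc k) < a" using p0 k by (simp add: x_def)
      show "a \<le> \<pi>0 l" if "Suc k < l" "l < \<pi>0 l" for l
        using Suc.prems(5)[of l] that by (auto simp: \<pi>0_def sw_def split: if_splits)
    qed (rule m0)
    then obtain D L where gd: "good a D b \<pi>0 L" by blast
    have p0y: "\<pi>0 y = k" using y by (simp add: \<pi>0_def sw_def)
    have "\<exists>g L'. good a ((k, g, a - 2 - k) # D) b (\<lambda>x. sw k (\<pi>0 (sw k x))) L'"
    proof (rule good_cross_bottom[OF gd])
      have l: "lab \<pi>0 (Suc k) = Suc k" "lab \<pi>0 k = min k y" using p0 k by (auto simp: lab_def x_def)
      show "\<not> interl \<pi>0 (lab \<pi>0 k) (lab \<pi>0 (Suc k))"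
        using y' p0 p0y k y(3) unfolding l by (auto simp: interl_def x_def min_def)
      show "\<not> interl \<pi>0 (lab \<pi>0 (Suc k)) (lab \<pi>0 k)"
        unfolding l by (auto simp: interl_def)
    qed (use k p0 y in auto)
    moreover have "(\<lambda>x. sw k (\<pi>0 (sw k x))) = \<pi>" by (simp add: \<pi>0_def)
    ultimately show ?case by auto
  qed
  note m = less.prems(1)
  let ?C = "{k. k < a \<and> k < \<pi> k \<and> \<pi> k < a}"
  show ?case
  proof (cases "?C = {}")
    case True
    have up: "\<pi> e \<ge> a" if "e < a" for e
    proof (rule ccontr)
      assume "\<not> \<pi> e \<ge> a"
      then have "e \<in> ?C \<or> \<pi> e \<in> ?C" using matchingD(2,3)[OF m, of e] that by auto
      then show False using True by blast
    qed
    have "bij_betw \<pi> {..<a} {a..<a + b}"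
    proof (rule bij_betwI[where g = \<pi>])
      show "\<pi> \<in> {..<a} \<rightarrow> {a..<a + b}" using up matchingD(1)[OF m] by auto
      show "\<pi> \<in> {a..<a + b} \<rightarrow> {..<a}" using less.prems(2) by auto
    qed (use matchingD(3)[OF m] in auto)
    then have "a = b" by (auto dest: bij_betw_same_card)
    then show ?thesis using exists_perm[of a \<pi>] m up by auto
  next
    case False
    have fin: "finite ?C" by simp
    \<comment> \<open>The cap whose left end is furthest to the right; no further cap starts inside
      it, as the inner induction demands.\<close>
    define k where "k = Max ?C"
    have kC: "k \<in> ?C" unfolding k_def using Max_in[OF fin False] .
    have "a \<le> \<pi> l" if "k < l" "l < \<pi> l" for l
    proof (rule ccontr)
      assume "\<not> a \<le> \<pi> l"
      then have "l \<in> ?C" using that by auto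
      then show False using Max_ge[OF fin] that(1) unfolding k_def by (simp add: leD)
    qed
    moreover have "\<pi> k = k + Suc (\<pi> k - k - 1)" using kC by auto
    ultimately show ?thesis using cap[OF m less.prems(2), of k "\<pi> k - k - 1"] kC by auto
  qed
qed

definition partial_matching :: "nat \<Rightarrow> (nat \<Rightarrow> nat) \<Rightarrow> bool" where
  "partial_matching b c \<longleftrightarrow> (\<forall>p<b. c p < b \<and> c (c p) = p)"

text \<open>Fixed points of a partial matching are the points on through-strands.\<close>

definition through :: "nat \<Rightarrow> (nat \<Rightarrow> nat) \<Rightarrow> nat set" where
  "through b c = {p. p < b \<and> c p = p}"

text \<open>Positions \<open>p\<close> count the upper points from the left, and
  \<open>a + b - 1 - p\<close> is the endpoint number of such a point. A point joined to a lower one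
  is made a fixed point.\<close>

definition cups_of :: "nat \<Rightarrow> nat \<Rightarrow> (nat \<Rightarrow> nat) \<Rightarrow> nat \<Rightarrow> nat" where
  "cups_of a b \<pi> p = (let w = \<pi> (a + b - 1 - p) in if a \<le> w then a + b - 1 - w else p)"

text \<open>A single diagram \<open>D\<close> on top creates the cups \<open>c\<close> for all matchings with these cups at once;
  this is what makes the cup part of the factorisation independent of the rest.\<close>

definition realises :: "nat \<Rightarrow> slice list \<Rightarrow> nat \<Rightarrow> (nat \<Rightarrow> nat) \<Rightarrow> bool" where
  "realises d D b c \<longleftrightarrow> tangle d D b \<and> (d = b \<longrightarrow> D = []) \<and>
     (\<forall>a \<pi>. matching (a + b) \<pi> \<longrightarrow> (\<forall>p<b. cups_of a b \<pi> p = c p) \<longrightarrow>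
        (\<exists>D1 L. tangle a D1 d \<and> good a (D1 @ D) b \<pi> L))"

lemma through_le: "card (through b c) \<le> b"
proof -
  have "card (through b c) \<le> card {..<b}" by (intro card_mono) (auto simp: through_def)
  then show ?thesis by simp
qed

text \<open>Take the cup with the leftmost right end and move this end to the left, one crossing at
  a time, until it is next to its left end; then the cup can be split off at the top. All points to
  the left of that right end are left ends or lie on through-strands, so every strand it meets has
  its other end at a smaller number and must pass over, for each \<open>\<pi>\<close> alike.\<close>

lemma exists_realisation:
  "partial_matching b c \<Longrightarrow> \<exists>D. realises (card (through b c)) D b c"
proof (induction b arbitrary: c rule: less_induct)
  case (less b)
  note IH = less.IH
  have cup: "\<exists>D. realises (card (through b c)) D b c"
    if "partial_matching b c" "j = c j + Suc n" "j < b" "\<And>l. l < j \<Longrightarrow> l \<le> c l" for n j c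
    using that
  proof (induction n arbitrary: j c)
    case 0
    define i where "i = c j"
    define b' where "b' = b - 2"
    have b: "b = Suc (Suc b')" and i: "i \<le> b'" "j = Suc i" and ci: "c (Suc i) = i"
      using 0 by (auto simp: b'_def i_def)
    have pm: "\<And>p. p < b \<Longrightarrow> c p < b" "\<And>p. p < b \<Longrightarrow> c (c p) = p" using 0(1) by (auto simp: partial_matching_def)
    have ci': "c i = Suc i" using pm(2)[of "Suc i"] ci i b by simp
    have ne: "c p \<noteq> i" "c p \<noteq> Suc i" if "p < b" "p \<noteq> i" "p \<noteq> Suc i" for p
      using pm(2)[OF that(1)] that ci ci' by auto
    define c' where "c' = (\<lambda>p. del i (c (ins i p)))"
    have ins_b: "ins i p < b" if "p < b'" for p using ins_lt[OF that] b by simp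
    have c'_ins: "ins i (c' p) = c (ins i p)" if "p < b'" for p
      using ne[OF ins_b[OF that]] by (simp add: c'_def)
    have pm': "partial_matching b' c'" unfolding partial_matching_def
    proof (intro allI impI conjI)
      fix p assume p: "p < b'"
      show "c' p < b'" using pm(1)[OF ins_b[OF p]] ne[OF ins_b[OF p]] i b unfolding c'_def by (intro del_lt) auto
      show "c' (c' p) = p" using c'_ins[OF p] pm(2)[OF ins_b[OF p]] by (simp add: c'_def)
    qed
    have th: "through b c = ins i ` through b' c'"
    proof (intro equalityI subsetI)
      fix p assume "p \<in> through b c"
      then have p: "p < b" "c p = p" "p \<noteq> i" "p \<noteq> Suc i" using ci ci' by (auto simp: through_def)
      then have "del i p \<in> through b' c'" using del_lt[of p b' i] i b by (simp add: through_def c'_def)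
      then show "p \<in> ins i ` through b' c'" using p by (intro image_eqI[of _ _ "del i p"]) auto
    next
      fix p assume "p \<in> ins i ` through b' c'"
      then show "p \<in> through b c" using ins_b by (auto simp: through_def c'_ins[symmetric])
    qed
    have "inj_on (ins i) (through b' c')" by (auto intro: inj_onI)
    then have d: "card (through b c) = card (through b' c')" unfolding th by (rule card_image)
    obtain D where D: "realises (card (through b' c')) D b' c'" using IH[OF _ pm'] b by auto
    let ?D = "D @ [(i, Cup, b' - i)]"
    have "\<exists>D1 L. tangle a D1 (card (through b c)) \<and> good a (D1 @ ?D) b \<pi> L"
      if m: "matching (a + b) \<pi>" and cp: "\<forall>p<b. cups_of a b \<pi> p = c p" for a \<pi>
    proof -
      define k where "k = a + (b' - i)"
      define \<pi>0 where "\<pi>0 = (\<lambda>e. del k (\<pi> (ins k e)))"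
      have m2: "matching (Suc (Suc (a + b'))) \<pi>" using m b by simp
      have k: "k \<le> a + b'" "a \<le> k" "a + b - 1 - Suc i = k" "a + b - 1 - i = Suc k" using i b by (auto simp: k_def)
      have "\<pi> k < a + b" using matchingD(1)[OF m, of k] k b by simp
      \<comment> \<open>In endpoint numbers, the cup between the positions \<open>i\<close> and
        \<open>Suc i\<close> joins \<open>Suc k\<close> and \<open>k\<close>.\<close>
      then have pk: "\<pi> k = Suc k"
        using cp[rule_format, of "Suc i"] ci i b k by (auto simp: cups_of_def Let_def split: if_splits)
      have m0: "matching (a + b') \<pi>0" unfolding \<pi>0_def using matching_del(1)[OF m2 pk k(1)] .
      have "cups_of a b' \<pi>0 p = c' p" if p: "p < b'" for p
      proof -
        have e: "ins k (a + b' - 1 - p) = a + b - 1 - ins i p"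
          using p i b by (auto simp: ins_def k_def)
        have el: "a + b - 1 - ins i p < a + b" using b by simp
        define w where "w = \<pi> (a + b - 1 - ins i p)"
        have w: "w < a + b" "\<pi> w = a + b - 1 - ins i p"
          using matchingD(1,3)[OF m el] by (auto simp: w_def)
        have "\<pi> (Suc k) = k" using matchingD(3)[OF m2, of k] pk k by simp
        moreover have "a + b - 1 - ins i p \<noteq> k" "a + b - 1 - ins i p \<noteq> Suc k" using e ins_neq by metis+
        ultimately have wk: "w \<noteq> k" "w \<noteq> Suc k" using w(2) pk by auto
        have c: "c (ins i p) = (if a \<le> w then a + b - 1 - w else ins i p)"
          using cp[rule_format, OF ins_b[OF p], symmetric] by (simp add: cups_of_def Let_def w_def)
        have "cups_of a b' \<pi>0 p = (if a \<le> del k w then a + b' - 1 - del k w else p)"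
          unfolding cups_of_def Let_def \<pi>0_def e w_def by (rule HOL.refl)
        also have "\<dots> = c' p"
        proof -
          have "a + b' - 1 - del k w = del i (a + b - 1 - w)"
            using del_rev[of w k i] w(1) wk i b by (simp add: k_def)
          moreover have "a \<le> del k w \<longleftrightarrow> a \<le> w" using wk k(2) by (auto simp: del_def)
          ultimately show ?thesis unfolding c'_def c by simp
        qed
        finally show ?thesis .
      qed
      then obtain D1 L where D1: "tangle a D1 (card (through b' c'))" "good a (D1 @ D) b' \<pi>0 L"
        using D m0 unfolding realises_def by blast
      obtain L' where "good a ((D1 @ D) @ [(i, Cup, b' - i)]) b (ins_pair k \<pi>0) L'"
        using good_cup_top[OF D1(2), of i "b' - i"] i b by (auto simp: k_def)
      then have "good a (D1 @ ?D) b \<pi> L'"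
        using good_cong[of a _ b "ins_pair k \<pi>0" L' \<pi>] matching_del(2)[OF m2 pk k(1)] b by (simp add: \<pi>0_def)
      then show ?thesis using D1 d by auto
    qed
    moreover have "tangle (card (through b c)) ?D b"
      using D i b d by (auto simp: realises_def tangle_append)
    \<comment> \<open>A cup is present, so the clause that asks for an empty diagram when all points
      are on through-strands is vacuous.\<close>
    moreover have "card (through b c) \<noteq> b" using d through_le[of b' c'] b by simp
    ultimately show ?case unfolding realises_def by blast
  next
    case (Suc n)
    define i where "i = j - 1"
    have j: "j = Suc i" "Suc i < b" "c (Suc i) < i" using Suc.prems by (auto simp: i_def)
    have pm: "\<And>p. p < b \<Longrightarrow> c p < b" "\<And>p. p < b \<Longrightarrow> c (c p) = p" using Suc.prems(1) by (auto simp: partial_matching_def)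
    define c' where "c' = (\<lambda>p. sw i (c (sw i p)))"
    have sb: "sw i p < b" if "p < b" for p using sw_lt[OF j(2) that] .
    have pm': "partial_matching b c'" unfolding partial_matching_def c'_def using sb pm by simp
    have th: "through b c = sw i ` through b c'"
    proof (intro equalityI subsetI)
      fix p assume "p \<in> through b c"
      then have "sw i p \<in> through b c'" using sb by (simp add: through_def c'_def)
      then show "p \<in> sw i ` through b c'" by (intro image_eqI[of _ _ "sw i p"]) auto
    next
      fix p assume "p \<in> sw i ` through b c'"
      then obtain p' where "p = sw i p'" "p' < b" "sw i (c (sw i p')) = p'" by (auto simp: through_def c'_def)
      moreover from this have "c (sw i p') = sw i p'"
        by (metis sw_sw)
      ultimately show "p \<in> through b c" using sb by (simp add: through_def)
    qed
    have "inj_on (sw i) (through b c')" by (auto intro: inj_onI)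
    then have d: "card (through b c) = card (through b c')" unfolding th by (rule card_image)
    have "\<exists>D. realises (card (through b c')) D b c'"
    proof (rule Suc.IH[of _ i, OF pm'])
      show "i = c' i + Suc n" using j Suc.prems(2) by (simp add: c'_def sw_def)
      show "i < b" using j by simp
      show "l \<le> c' l" if "l < i" for l
        using Suc.prems(4)[of l] j that by (auto simp: c'_def sw_def)
    qed
    then obtain D where D: "realises (card (through b c')) D b c'" by blast
    let ?D = "D @ [(i, CrossInv, b - 2 - i)]"
    have "\<exists>D1 L. tangle a D1 (card (through b c)) \<and> good a (D1 @ ?D) b \<pi> L"
      if m: "matching (a + b) \<pi>" and cp: "\<forall>p<b. cups_of a b \<pi> p = c p" for a \<pi>
    proof -
      define k where "k = a + (b - 2 - i)"
      define \<pi>0 where "\<pi>0 = (\<lambda>x. sw k (\<pi> (sw k x)))"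
      have k: "Suc k < a + b" "a \<le> k" "a + b - 1 - Suc i = k" "a + b - 1 - i = Suc k" using j by (auto simp: k_def)
      have m0: "matching (a + b) \<pi>0" unfolding \<pi>0_def by (rule matching_sw[OF m k(1)])
      define x where "x = \<pi> k"
      define z where "z = \<pi> (Suc k)"
      have xl: "x < a + b" "x \<noteq> k" "\<pi> x = k" using matchingD[OF m, of k] k by (auto simp: x_def)
      have zl: "z < a + b" "z \<noteq> Suc k" "\<pi> z = Suc k" using matchingD[OF m, of "Suc k"] k by (auto simp: z_def)
      have x: "Suc k < x"
        using cp[rule_format, of "Suc i"] j k xl unfolding cups_of_def Let_def k x_def[symmetric]
        by (auto simp: k_def split: if_splits)
      have zk: "z \<noteq> k" using zl x by (auto simp: x_def)
      \<comment> \<open>The strand at position \<open>i\<close> has its other end below the number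
        \<open>k\<close> of the cup: otherwise \<open>i\<close> would be a right end further to the
        left than \<open>j\<close>.\<close>
      have z: "z < k"
      proof (rule ccontr)
        assume "\<not> z < k"
        then have "Suc k < z" using zk zl by simp
        then have "c i < i"
          using cp[rule_format, of i] j k zl(1) unfolding cups_of_def Let_def k z_def[symmetric]
          by (auto simp: k_def split: if_splits)
        then show False using Suc.prems(4)[of i] j by simp
      qed
      have "cups_of a b \<pi>0 p = c' p" if p: "p < b" for p
      proof -
        have e: "sw k (a + b - 1 - p) = a + b - 1 - sw i p" using p j by (auto simp: sw_def k_def)
        define w where "w = \<pi> (a + b - 1 - sw i p)"
        have w: "w < a + b" using matchingD(1)[OF m] p by (auto simp: w_def)
        have c: "c (sw i p) = (if a \<le> w then a + b - 1 - w else sw i p)"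
          using cp[rule_format, OF sb[OF p], symmetric] by (simp add: cups_of_def Let_def w_def)
        have "cups_of a b \<pi>0 p = (if a \<le> sw k w then a + b - 1 - sw k w else p)"
          unfolding cups_of_def Let_def \<pi>0_def e w_def by (rule HOL.refl)
        also have "\<dots> = c' p"
        proof -
          have "a + b - 1 - sw k w = sw i (a + b - 1 - w)"
            using sw_rev[of w k i] w j by (simp add: k_def)
          moreover have "a \<le> sw k w \<longleftrightarrow> a \<le> w" using k(2) by (auto simp: sw_def)
          ultimately show ?thesis unfolding c'_def c by simp
        qed
        finally show ?thesis .
      qed
      then obtain D1 L where D1: "tangle a D1 (card (through b c'))" "good a (D1 @ D) b \<pi>0 L"
        using D m0 unfolding realises_def by blast
      have p0: "\<pi>0 k = z" "\<pi>0 (Suc k) = x" "\<pi>0 z = k"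
        using z x zl xl by (auto simp: \<pi>0_def sw_def z_def[symmetric] x_def[symmetric])
      have l0: "lab \<pi>0 k = z" "lab \<pi>0 (Suc k) = Suc k" using p0 z x by (auto simp: lab_def)
      have pe: "(\<lambda>x. sw k (\<pi>0 (sw k x))) = \<pi>" by (simp add: \<pi>0_def)
      have "\<exists>L'. good a ((D1 @ D) @ [(i, CrossInv, b - 2 - i)]) b (\<lambda>x. sw k (\<pi>0 (sw k x))) L'"
      proof (rule good_cross_top[OF D1(2), of i "b - 2 - i", folded k_def])
        show "b = i + 2 + (b - 2 - i)" using j by simp
        show "\<pi>0 k \<noteq> Suc k" using p0 z by simp
        show "\<not> interl \<pi>0 (lab \<pi>0 k) (lab \<pi>0 (Suc k))" using p0 unfolding l0 by (auto simp: interl_def)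
        show "\<not> interl \<pi>0 (lab \<pi>0 (Suc k)) (lab \<pi>0 k)" using z unfolding l0 by (auto simp: interl_def)
        show "lab (\<lambda>x. sw k (\<pi>0 (sw k x))) (Suc k) < lab (\<lambda>x. sw k (\<pi>0 (sw k x))) k"
          unfolding pe lab_def x_def[symmetric] z_def[symmetric] using x z by simp
      qed
      then obtain L' where "good a ((D1 @ D) @ [(i, CrossInv, b - 2 - i)]) b \<pi> L'"
        unfolding pe by blast
      then show ?thesis using D1 d by auto
    qed
    moreover have "tangle (card (through b c)) ?D b"
    proof -
      have "Suc (Suc (b - 2)) = b" using j by simp
      then show ?thesis using D j d by (auto simp: realises_def tangle_append)
    qed
    moreover have "card (through b c) \<noteq> b"
    proof
      assume "card (through b c) = b"
      moreover have "through b c \<subseteq> {..<b} - {Suc i}" using j by (auto simp: through_def)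
      then have "card (through b c) \<le> card ({..<b} - {Suc i})" by (intro card_mono) auto
      ultimately show False using j by (simp add: card_Diff_singleton)
    qed
    ultimately show ?case unfolding realises_def by blast
  qed
  note pm = less.prems
  show ?case
  proof (cases "\<exists>j<b. c j < j")
    case True
    define j where "j = (LEAST j. j < b \<and> c j < j)"
    have j: "j < b" "c j < j" unfolding j_def using LeastI_ex[OF True] by auto
    have "l \<le> c l" if "l < j" for l
      using not_less_Least[of l "\<lambda>j. j < b \<and> c j < j"] that j by (auto simp: j_def[symmetric])
    then show ?thesis using cup[OF pm, of j "j - c j - 1"] j by auto
  next
    case False
    have id: "c p = p" if "p < b" for p
      using pm False that unfolding partial_matching_def by (metis nat_neq_iff)
    then have "through b c = {..<b}" by (auto simp: through_def)
    then have "card (through b c) = b" by simp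
    moreover have "\<exists>D1 L. tangle a D1 b \<and> good a (D1 @ []) b \<pi> L"
      if m: "matching (a + b) \<pi>" and cp: "\<forall>p<b. cups_of a b \<pi> p = c p" for a \<pi>
    proof -
      have "\<pi> e < a" if e: "a \<le> e" "e < a + b" for e
      proof (rule ccontr)
        assume "\<not> \<pi> e < a"
        moreover have "a + b - 1 - (a + b - 1 - e) = e" "a + b - 1 - e < b" using e by auto
        moreover have "\<pi> e < a + b" "\<pi> e \<noteq> e" using matchingD[OF m e(2)] by auto
        ultimately show False
          using cp[rule_format, of "a + b - 1 - e"] id[of "a + b - 1 - e"] e
          by (auto simp: cups_of_def Let_def)
      qed
      then obtain D L where "good a D b \<pi> L" using exists_cupfree[OF m] by blast
      then show ?thesis using good_tangle[of a D b \<pi> L] by auto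
    qed
    ultimately show ?thesis by (intro exI[of _ "[]"]) (auto simp: realises_def)
  qed
qed

section \<open>Dotted pairings\<close>

definition dot_range :: "nat \<Rightarrow> int set" where
  "dot_range m = {- int (m div 2) .. int ((m - 1) div 2)}"

lemma zero_dot_range [simp]: "0 \<in> dot_range m"
  by (simp add: dot_range_def)

lemma finite_dot_range [simp]: "finite (dot_range m)"
  by (simp add: dot_range_def)

text \<open>Both inequalities put the dots at the endpoint of a strand with the smaller number: the
  lower end of a vertical strand, the left end of a cap and, as upper numbers decrease from left to
  right, the right end of a cup.\<close>

definition dotting :: "nat \<Rightarrow> nat \<Rightarrow> nat \<Rightarrow> (nat \<Rightarrow> nat) \<Rightarrow> int list \<Rightarrow> int list \<Rightarrow> bool" where
  "dotting m a b \<pi> lo up \<longleftrightarrow> length lo = a \<and> length up = b \<and>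
     (\<forall>p<a. lo ! p \<in> dot_range m \<and> (lo ! p \<noteq> 0 \<longrightarrow> p < \<pi> p)) \<and>
     (\<forall>p<b. - (up ! p) \<in> dot_range m \<and> (up ! p \<noteq> 0 \<longrightarrow> a + b - 1 - p < \<pi> (a + b - 1 - p)))"

text \<open>The value \<open>0\<close> beyond the endpoints makes equal pairings equal as functions,
  so these triples can be counted.\<close>

definition dotted_matchings :: "nat \<Rightarrow> nat \<Rightarrow> nat \<Rightarrow> ((nat \<Rightarrow> nat) \<times> int list \<times> int list) set" where
  "dotted_matchings m a b = {(\<pi>, lo, up). matching (a + b) \<pi> \<and> (\<forall>e\<ge>a + b. \<pi> e = 0) \<and> dotting m a b \<pi> lo up}"

lemma normally_ordered_iff:
  assumes sl: "strand_labelling a D b \<pi> L"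
  shows "normally_ordered m a b (lo, D, up) \<longleftrightarrow> reduced_totally_descending a D b \<and> dotting m a b \<pi> lo up"
proof -
  have m: "matching (a + b) \<pi>" using sl by (simp add: strand_labelling_def)
  note ss = strand_labelling_iff[OF sl]
  have ll: "same_strand D (0, p) (0, p') \<longleftrightarrow> p' = p \<or> p' = \<pi> p" if "p < a" "p' < a" for p p'
    using ss[of p p'] that by (simp add: endpoint_low)
  have lu: "same_strand D (0, p) (length D, p') \<longleftrightarrow> a + b - 1 - p' = \<pi> p" if "p < a" "p' < b" for p p'
  proof -
    have "a + b - 1 - p' < a + b" "a + b - 1 - p' \<noteq> p" using that by linarith+
    then show ?thesis using ss[of p "a + b - 1 - p'"] that endpoint_up[of p' b a D]
      by (simp add: endpoint_low del: One_nat_def)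
  qed
  have uu: "same_strand D (length D, p) (length D, p') \<longleftrightarrow> p' = p \<or> a + b - 1 - p' = \<pi> (a + b - 1 - p)"
    if "p < b" "p' < b" for p p'
  proof -
    have "a + b - 1 - p' < a + b" "a + b - 1 - p < a + b" "a + b - 1 - p' = a + b - 1 - p \<longleftrightarrow> p' = p"
      using that by linarith+
    then show ?thesis
      using ss[of "a + b - 1 - p" "a + b - 1 - p'"] endpoint_up[OF that(1), of a D] endpoint_up[OF that(2), of a D] by simp
  qed
  have low: "(\<exists>p'<b. same_strand D (0, p) (length D, p')) \<or> (\<exists>p'<a. p < p' \<and> same_strand D (0, p) (0, p')) \<longleftrightarrow> p < \<pi> p"
    if p: "p < a" for p
  proof
    assume "(\<exists>p'<b. same_strand D (0, p) (length D, p')) \<or> (\<exists>p'<a. p < p' \<and> same_strand D (0, p) (0, p'))"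
    then show "p < \<pi> p"
    proof
      assume "\<exists>p'<b. same_strand D (0, p) (length D, p')"
      then obtain p' where "p' < b" "a + b - 1 - p' = \<pi> p" using lu[OF p] by blast
      then show ?thesis using p by linarith
    qed (use ll[OF p] in auto)
  next
    assume lt: "p < \<pi> p"
    have "\<pi> p < a + b" using matchingD(1)[OF m, of p] p by simp
    then show "(\<exists>p'<b. same_strand D (0, p) (length D, p')) \<or> (\<exists>p'<a. p < p' \<and> same_strand D (0, p) (0, p'))"
    proof (cases "\<pi> p < a")
      case False
      then have "a + b - 1 - \<pi> p < b" "a + b - 1 - (a + b - 1 - \<pi> p) = \<pi> p" using \<open>\<pi> p < a + b\<close> by linarith+
      then show ?thesis using lu[OF p] by blast
    qed (use ll[OF p] lt in blast)
  qed
  have up: "(\<exists>p'<b. p' < p \<and> same_strand D (length D, p) (length D, p')) \<longleftrightarrow> a + b - 1 - p < \<pi> (a + b - 1 - p)"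
    if p: "p < b" for p
  proof
    assume "\<exists>p'<b. p' < p \<and> same_strand D (length D, p) (length D, p')"
    then obtain p' where "p' < p" "a + b - 1 - p' = \<pi> (a + b - 1 - p)" using uu[OF p] p by fastforce
    then show "a + b - 1 - p < \<pi> (a + b - 1 - p)" using p by linarith
  next
    assume lt: "a + b - 1 - p < \<pi> (a + b - 1 - p)"
    have "\<pi> (a + b - 1 - p) < a + b" using matchingD(1)[OF m, of "a + b - 1 - p"] p by simp
    then have "a + b - 1 - \<pi> (a + b - 1 - p) < p" "a + b - 1 - (a + b - 1 - \<pi> (a + b - 1 - p)) = \<pi> (a + b - 1 - p)"
      using lt p by linarith+
    then show "\<exists>p'<b. p' < p \<and> same_strand D (length D, p) (length D, p')"
      using uu[OF p, of "a + b - 1 - \<pi> (a + b - 1 - p)"] p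
      by (intro exI[of _ "a + b - 1 - \<pi> (a + b - 1 - p)"]) (simp del: One_nat_def)
  qed
  show ?thesis
    unfolding normally_ordered.simps dotting_def dot_range_def[symmetric] using low up by (auto simp del: One_nat_def)
qed

lemma strand_labelling_restrict:
  "strand_labelling a D b \<pi> L \<Longrightarrow> strand_labelling a D b (\<lambda>e. if e < a + b then \<pi> e else 0) L"
  unfolding strand_labelling_def by (auto simp: lab_def matching_def)

lemma partial_matching_cups_of:
  assumes m: "matching (a + b) \<pi>" shows "partial_matching b (cups_of a b \<pi>)"
  unfolding partial_matching_def
proof (intro allI impI)
  fix p assume p: "p < b"
  define w where "w = \<pi> (a + b - 1 - p)"
  have w: "w < a + b" "\<pi> w = a + b - 1 - p"
    using matchingD[OF m, of "a + b - 1 - p"] p by (simp_all add: w_def)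
  show "cups_of a b \<pi> p < b \<and> cups_of a b \<pi> (cups_of a b \<pi> p) = p"
  proof (cases "a \<le> w")
    case True
    have 1: "cups_of a b \<pi> p = a + b - 1 - w" using True by (simp add: cups_of_def w_def)
    have 2: "a + b - 1 - (a + b - 1 - w) = w" "a \<le> a + b - 1 - p" "a + b - 1 - (a + b - 1 - p) = p" "a + b - 1 - w < b"
      using w(1) p True by linarith+
    show ?thesis unfolding 1 using 2 w(2) by (simp add: cups_of_def Let_def)
  next
    case False
    then have "cups_of a b \<pi> p = p" by (simp add: cups_of_def w_def)
    then show ?thesis using p by simp
  qed
qed

lemma exists_good: "matching (a + b) \<pi> \<Longrightarrow> \<exists>D L. good a D b \<pi> L"
  using exists_realisation[OF partial_matching_cups_of[of a b \<pi>]] by (fastforce simp: realises_def)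

definition dotted_class :: "nat \<Rightarrow> nat \<Rightarrow> nat \<Rightarrow> (nat \<Rightarrow> nat) \<times> int list \<times> int list \<Rightarrow> dotted set" where
  "dotted_class m a b = (\<lambda>(\<pi>, lo, up).
     {(lo, D, up) | D. normally_ordered m a b (lo, D, up) \<and> pairing a D b = {(e, \<pi> e) | e. e < a + b}})"

lemma good_in_dotted_class:
  "(\<pi>, lo, up) \<in> dotted_matchings m a b \<Longrightarrow> good a D b \<pi> L \<Longrightarrow> (lo, D, up) \<in> dotted_class m a b (\<pi>, lo, up)"
  using normally_ordered_iff[OF good_labelling, of a D b \<pi> L] good_rtd[of a D b \<pi> L] pairing_labelling[OF good_labelling, of a D b \<pi> L]
  by (simp add: dotted_class_def dotted_matchings_def del: normally_ordered.simps)

lemma dotted_class_eq: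
  assumes "normally_ordered m a b (lo, D, up)" "pairing a D b = {(e, \<pi> e) | e. e < a + b}"
  shows "dotted_class m a b (\<pi>, lo, up) =
     {(D, D'). normally_ordered m a b D \<and> normally_ordered m a b D' \<and> dotted_equiv a b D D'} `` {(lo, D, up)}"
  unfolding dotted_class_def using assms by (auto simp del: normally_ordered.simps)

text \<open>A class is determined by its pairing and dots, which \<open>tangle_labelling\<close>
  extracts from a diagram. Conversely each dotted pairing is drawn by a good diagram, so none of
  these classes is empty.\<close>

lemma DB_eq: "DB m a b = dotted_class m a b ` dotted_matchings m a b"
proof (intro equalityI subsetI)
  fix X assume "X \<in> DB m a b"
  then obtain x where x: "x \<in> Collect (normally_ordered m a b)"
      "X = {(D, D'). normally_ordered m a b D \<and> normally_ordered m a b D' \<and> dotted_equiv a b D D'} `` {x}"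
    unfolding DB_def by (rule quotientE)
  obtain lo D up where e: "x = (lo, D, up)" by (rule prod_cases3)
  note D = x(1)[unfolded e mem_Collect_eq] and X = x(2)[unfolded e]
  from D have "tangle a D b" by (simp add: reduced_totally_descending_def)
  then obtain \<pi>0 L where "strand_labelling a D b \<pi>0 L" using tangle_labelling by blast
  then have sl: "strand_labelling a D b (\<lambda>e. if e < a + b then \<pi>0 e else 0) L" (is "strand_labelling a D b ?\<pi> L")
    by (rule strand_labelling_restrict)
  have "X = dotted_class m a b (?\<pi>, lo, up)"
    unfolding X by (rule dotted_class_eq[OF D pairing_labelling[OF sl], symmetric])
  moreover have "(?\<pi>, lo, up) \<in> dotted_matchings m a b"
    using sl D[unfolded normally_ordered_iff[OF sl]] by (simp add: dotted_matchings_def strand_labelling_def)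
  ultimately show "X \<in> dotted_class m a b ` dotted_matchings m a b" by blast
next
  fix X assume "X \<in> dotted_class m a b ` dotted_matchings m a b"
  then obtain \<pi> lo up where x: "(\<pi>, lo, up) \<in> dotted_matchings m a b" "X = dotted_class m a b (\<pi>, lo, up)" by auto
  then have "matching (a + b) \<pi>" by (simp add: dotted_matchings_def)
  then obtain D L where "good a D b \<pi> L" using exists_good by blast
  then have D: "normally_ordered m a b (lo, D, up)" "pairing a D b = {(e, \<pi> e) | e. e < a + b}"
    using good_in_dotted_class[OF x(1)] by (simp_all add: dotted_class_def del: normally_ordered.simps)
  show "X \<in> DB m a b"
    unfolding DB_def x(2) dotted_class_eq[OF D] using D(1) by (intro quotientI) simp
qed

text \<open>A common member, which exists because the classes are not empty, displays both the
  pairing and the dots.\<close>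

lemma dotted_class_inj: "inj_on (dotted_class m a b) (dotted_matchings m a b)"
proof (rule inj_onI)
  fix x x' assume x: "x \<in> dotted_matchings m a b" "x' \<in> dotted_matchings m a b" "dotted_class m a b x = dotted_class m a b x'"
  obtain \<pi> lo up \<pi>' lo' up' where e: "x = (\<pi>, lo, up)" "x' = (\<pi>', lo', up')" by (metis prod_cases3)
  have "matching (a + b) \<pi>" using x(1) by (simp add: e dotted_matchings_def)
  then obtain D L where "good a D b \<pi> L" using exists_good by blast
  then have D: "(lo, D, up) \<in> dotted_class m a b x" using good_in_dotted_class x(1) by (simp add: e)
  then have D': "(lo, D, up) \<in> dotted_class m a b x'" using x(3) by simp
  have "{(e, \<pi> e) | e. e < a + b} = {(e, \<pi>' e) | e. e < a + b}" and lu: "lo' = lo" "up' = up"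
    using D D' by (simp_all add: e dotted_class_def del: normally_ordered.simps)
  then have eq: "\<pi> e = \<pi>' e" if "e < a + b" for e using that by blast
  have "\<pi> e = \<pi>' e" for e
    using eq[of e] x(1,2) by (cases "e < a + b") (simp_all add: e dotted_matchings_def)
  then show "x = x'" using lu by (auto simp: e)
qed

lemma finite_dotted_matchings: "finite (dotted_matchings m a b)"
proof (rule finite_subset)
  let ?A = "{\<pi> :: nat \<Rightarrow> nat. \<forall>e. (e \<in> {..<a + b} \<longrightarrow> \<pi> e \<in> {..<a + b}) \<and> (e \<notin> {..<a + b} \<longrightarrow> \<pi> e = 0)}"
  let ?B = "\<lambda>S n. {xs :: int list. set xs \<subseteq> S \<and> length xs = n}"
  show "dotted_matchings m a b \<subseteq> ?A \<times> ?B (dot_range m) a \<times> ?B (uminus ` dot_range m) b"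
  proof
    fix x assume "x \<in> dotted_matchings m a b"
    then obtain \<pi> lo up where x: "x = (\<pi>, lo, up)" "matching (a + b) \<pi>" "\<forall>e\<ge>a + b. \<pi> e = 0" "dotting m a b \<pi> lo up"
      by (auto simp: dotted_matchings_def)
    have "set lo \<subseteq> dot_range m" using x(4) by (auto simp: dotting_def in_set_conv_nth)
    moreover have "set up \<subseteq> uminus ` dot_range m"
    proof
      fix y assume "y \<in> set up"
      then have "- y \<in> dot_range m" using x(4) by (auto simp: dotting_def in_set_conv_nth)
      then show "y \<in> uminus ` dot_range m" by (intro image_eqI[of _ _ "- y"]) simp_all
    qed
    moreover have "\<pi> \<in> ?A" using x(3) matchingD(1)[OF x(2)] by auto
    ultimately show "x \<in> ?A \<times> ?B (dot_range m) a \<times> ?B (uminus ` dot_range m) b"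
      using x(4) by (simp add: x(1) dotting_def)
  qed
  show "finite (?A \<times> ?B (dot_range m) a \<times> ?B (uminus ` dot_range m) b)"
    by (intro finite_cartesian_product finite_set_of_finite_funs finite_lists_length_eq) simp_all
qed

text \<open>A fixed point of \<open>c\<close> is the upper end of one of the \<open>d\<close> through-strands, the other points
  are joined in pairs by cups, which carry dots on the right.\<close>

definition cup_indices :: "nat \<Rightarrow> nat \<Rightarrow> nat \<Rightarrow> ((nat \<Rightarrow> nat) \<times> int list) set" where
  "cup_indices m a d = {(c, up). partial_matching a c \<and> (\<forall>p\<ge>a. c p = 0) \<and> card (through a c) = d \<and>
     length up = a \<and> (\<forall>p<a. - (up ! p) \<in> dot_range m \<and> (up ! p \<noteq> 0 \<longrightarrow> c p < p))}"

definition cup_free :: "nat \<Rightarrow> nat \<Rightarrow> (nat \<Rightarrow> nat) \<Rightarrow> bool" where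
  "cup_free a b \<pi> \<longleftrightarrow> (\<forall>e. a \<le> e \<longrightarrow> e < a + b \<longrightarrow> \<pi> e < a)"

definition perm_indices :: "nat \<Rightarrow> nat \<Rightarrow> ((nat \<Rightarrow> nat) \<times> int list \<times> int list) set" where
  "perm_indices m d = {(\<pi>, lo, up) \<in> dotted_matchings m d d. cup_free d d \<pi>}"

text \<open>By counting: the \<open>d\<close> upper points are sent injectively to the
  \<open>d\<close> lower ones, which are thereby exhausted. So there are no caps either.\<close>

lemma cup_free_low:
  assumes m: "matching (d + d) \<pi>" and cf: "cup_free d d \<pi>" and k: "k < d"
  shows "d \<le> \<pi> k"
proof -
  have inj: "inj_on \<pi> {d..<d + d}"
    by (rule inj_onI) (metis atLeastLessThan_iff matchingD(3)[OF m])
  have sub: "\<pi> ` {d..<d + d} \<subseteq> {..<d}" using cf by (auto simp: cup_free_def)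
  have "\<pi> ` {d..<d + d} = {..<d}"
    by (rule card_subset_eq[OF _ sub]) (simp_all add: card_image[OF inj])
  then obtain e where "e \<in> {d..<d + d}" "\<pi> e = k" using k by (metis imageE lessThan_iff)
  then show ?thesis using matchingD(3)[OF m, of e] by auto
qed

text \<open>Upper dots occur only at the right ends of cups.\<close>

lemma cup_free_no_dots:
  assumes "dotting m d d \<pi> lo up" "cup_free d d \<pi>" shows "up = replicate d 0"
proof (rule nth_equalityI)
  show "length up = length (replicate d (0::int))" using assms by (simp add: dotting_def)
  fix p assume "p < length up"
  then have p: "p < d" using assms by (simp add: dotting_def)
  then have "\<pi> (d + d - 1 - p) < d" using assms(2) by (simp add: cup_free_def)
  then have "\<not> d + d - 1 - p < \<pi> (d + d - 1 - p)" using p by linarith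
  then show "up ! p = replicate d 0 ! p" using assms(1) p by (auto simp: dotting_def)
qed

text \<open>Any enumeration of the through-strands will do: it only serves to compare cardinalities.\<close>

definition enum :: "nat \<Rightarrow> (nat \<Rightarrow> nat) \<Rightarrow> nat \<Rightarrow> nat" where
  "enum n c = (SOME f. bij_betw f {..<card (through n c)} (through n c))"

definition rank :: "nat \<Rightarrow> (nat \<Rightarrow> nat) \<Rightarrow> nat \<Rightarrow> nat" where
  "rank n c = inv_into {..<card (through n c)} (enum n c)"

lemma finite_through [simp]: "finite (through n c)"
  by (simp add: through_def)

lemma enum_bij: "bij_betw (enum n c) {..<card (through n c)} (through n c)"
proof -
  have "\<exists>f. bij_betw f {..<card (through n c)} (through n c)"
    using ex_bij_betw_nat_finite[OF finite_through] by (simp add: lessThan_atLeast0)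
  then show ?thesis unfolding enum_def by (rule someI_ex)
qed

lemma enum_rank:
  "k < card (through n c) \<Longrightarrow> enum n c k \<in> through n c" "k < card (through n c) \<Longrightarrow> rank n c (enum n c k) = k"
  "p \<in> through n c \<Longrightarrow> rank n c p < card (through n c)" "p \<in> through n c \<Longrightarrow> enum n c (rank n c p) = p"
proof -
  note b = enum_bij[of n c]
  show "k < card (through n c) \<Longrightarrow> enum n c k \<in> through n c" using bij_betwE[OF b] by simp
  show "k < card (through n c) \<Longrightarrow> rank n c (enum n c k) = k"
    unfolding rank_def by (rule inv_into_f_f[OF bij_betw_imp_inj_on[OF b]]) simp
  have im: "p \<in> through n c \<Longrightarrow> p \<in> enum n c ` {..<card (through n c)}" using bij_betw_imp_surj_on[OF b] by simp
  show "p \<in> through n c \<Longrightarrow> rank n c p < card (through n c)"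
    unfolding rank_def using inv_into_into[OF im] by simp
  show "p \<in> through n c \<Longrightarrow> enum n c (rank n c p) = p"
    unfolding rank_def by (rule f_inv_into_f[OF im])
qed

text \<open>The pairing with caps \<open>c2\<close> on \<open>b\<close> lower points, cups
  \<open>c1\<close> on \<open>a\<close> upper points, and through-strands matched by bijections
  \<open>\<tau>\<close> and \<open>\<tau>'\<close> inverse to each other. It serves as an index for
  counting, independently of how diagrams compose.\<close>

definition glue :: "nat \<Rightarrow> nat \<Rightarrow> (nat \<Rightarrow> nat) \<Rightarrow> (nat \<Rightarrow> nat) \<Rightarrow> (nat \<Rightarrow> nat) \<Rightarrow> (nat \<Rightarrow> nat) \<Rightarrow> nat \<Rightarrow> nat" where
  "glue b a c2 c1 \<tau> \<tau>' e = (if e < b then (if c2 e = e then b + a - 1 - \<tau> e else c2 e)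
     else if e < b + a then (let p = b + a - 1 - e in if c1 p = p then \<tau>' p else b + a - 1 - c1 p)
     else 0)"

lemma glue_low: "e < b \<Longrightarrow> glue b a c2 c1 \<tau> \<tau>' e = (if c2 e = e then b + a - 1 - \<tau> e else c2 e)"
  by (simp add: glue_def)

lemma glue_up: "p < a \<Longrightarrow> glue b a c2 c1 \<tau> \<tau>' (b + a - 1 - p) = (if c1 p = p then \<tau>' p else b + a - 1 - c1 p)"
proof -
  assume p: "p < a"
  then have "\<not> b + a - 1 - p < b" "b + a - 1 - p < b + a" "b + a - 1 - (b + a - 1 - p) = p" by linarith+
  then show ?thesis by (simp add: glue_def Let_def del: One_nat_def)
qed

lemma through_iff: "p \<in> through n c \<longleftrightarrow> p < n \<and> c p = p"
  by (simp add: through_def)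

lemma glue_matching:
  assumes c1: "partial_matching a c1" and c2: "partial_matching b c2"
    and \<tau>: "\<And>p. p \<in> through b c2 \<Longrightarrow> \<tau> p \<in> through a c1 \<and> \<tau>' (\<tau> p) = p"
    and \<tau>': "\<And>p. p \<in> through a c1 \<Longrightarrow> \<tau>' p \<in> through b c2 \<and> \<tau> (\<tau>' p) = p"
  shows "matching (b + a) (glue b a c2 c1 \<tau> \<tau>')"
  unfolding matching_def
proof (intro allI impI)
  fix e assume e: "e < b + a"
  let ?g = "glue b a c2 c1 \<tau> \<tau>'"
  consider (ll) "e < b" "c2 e \<noteq> e" | (lu) "e < b" "c2 e = e" | (up) p where "p < a" "e = b + a - 1 - p"
    using e that(3)[of "b + a - 1 - e"] by fastforce
  then show "?g e < b + a \<and> ?g e \<noteq> e \<and> ?g (?g e) = e"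
  proof cases
    case ll
    then have "c2 e < b" "c2 (c2 e) = e" using c2 by (simp_all add: partial_matching_def)
    then show ?thesis using ll by (simp add: glue_low)
  next
    case lu
    then have "e \<in> through b c2" by (simp add: through_iff)
    then have t: "\<tau> e < a" "c1 (\<tau> e) = \<tau> e" "\<tau>' (\<tau> e) = e" using \<tau>[of e] by (simp_all add: through_iff)
    have "b + a - 1 - \<tau> e < b + a" "b + a - 1 - \<tau> e \<noteq> e" using t(1) lu(1) by linarith+
    then show ?thesis using glue_up[OF t(1), of b c2 c1 \<tau> \<tau>'] lu t by (simp add: glue_low)
  next
    case up
    note g = glue_up[OF up(1), of b c2 c1 \<tau> \<tau>', folded up(2)]
    show ?thesis
    proof (cases "c1 p = p")
      case True
      then have "p \<in> through a c1" using up(1) by (simp add: through_iff)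
      then have t: "\<tau>' p < b" "c2 (\<tau>' p) = \<tau>' p" "\<tau> (\<tau>' p) = p" using \<tau>'[of p] by (simp_all add: through_iff)
      have "e \<noteq> \<tau>' p" "\<tau>' p < b + a" using t(1) up by linarith+
      then show ?thesis using g True t up(2) by (simp add: glue_low)
    next
      case False
      have t: "c1 p < a" "c1 (c1 p) = p" using c1 up(1) by (simp_all add: partial_matching_def)
      have "b + a - 1 - c1 p \<noteq> e" "b + a - 1 - c1 p < b + a" using t(1) up False by linarith+
      then show ?thesis using g False t up(2) glue_up[OF t(1), of b c2 c1 \<tau> \<tau>'] by (simp del: One_nat_def)
    qed
  qed
qed

text \<open>The last argument is an index for cups that stands for the reflected caps: its dots move
  from the right end to the left end with the opposite sign, just as a dot passing over a cap
  becomes inverse. The dots of the permutation go to the lower ends of the through-strands.\<close>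

definition glue_index ::
  "nat \<Rightarrow> nat \<Rightarrow> (nat \<Rightarrow> nat) \<times> int list \<Rightarrow> (nat \<Rightarrow> nat) \<times> int list \<times> int list \<Rightarrow> (nat \<Rightarrow> nat) \<times> int list
    \<Rightarrow> (nat \<Rightarrow> nat) \<times> int list \<times> int list" where
  "glue_index b a = (\<lambda>(c1, up) (\<pi>, lo, _) (c2, lo').
     let d = card (through b c2) in
     (glue b a c2 c1 (\<lambda>p. enum a c1 (d + d - 1 - \<pi> (rank b c2 p))) (\<lambda>p. enum b c2 (\<pi> (d + d - 1 - rank a c1 p))),
      map (\<lambda>p. if c2 p = p then lo ! rank b c2 p else if p < c2 p then - (lo' ! c2 p) else 0) [0..<b],
      up))"

definition triples :: "nat \<Rightarrow> nat \<Rightarrow> nat \<Rightarrow>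
    (nat \<times> ((nat \<Rightarrow> nat) \<times> int list) \<times> ((nat \<Rightarrow> nat) \<times> int list \<times> int list) \<times> (nat \<Rightarrow> nat) \<times> int list) set" where
  "triples m a b = {(d, i, k, j). i \<in> cup_indices m a d \<and> k \<in> perm_indices m d \<and> j \<in> cup_indices m b d}"

lemma glue_index_in_dotted_matchings:
  assumes "(d, i, k, j) \<in> triples m a b"
  shows "glue_index b a i k j \<in> dotted_matchings m b a"
proof -
  obtain c1 up \<pi> lo up0 c2 lo' where e: "i = (c1, up)" "k = (\<pi>, lo, up0)" "j = (c2, lo')" by (metis prod_cases3 surj_pair)
  have c1: "partial_matching a c1" "card (through a c1) = d" and up: "length up = a" "\<And>p. p < a \<Longrightarrow> - (up ! p) \<in> dot_range m"
      "\<And>p. p < a \<Longrightarrow> up ! p \<noteq> 0 \<Longrightarrow> c1 p < p"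
    using assms by (auto simp: triples_def e cup_indices_def)
  have c2: "partial_matching b c2" "card (through b c2) = d" and lo': "length lo' = b" "\<And>p. p < b \<Longrightarrow> - (lo' ! p) \<in> dot_range m"
    using assms by (auto simp: triples_def e cup_indices_def)
  have \<pi>: "matching (d + d) \<pi>" "cup_free d d \<pi>" and lo: "length lo = d" "\<And>p. p < d \<Longrightarrow> lo ! p \<in> dot_range m"
    using assms by (auto simp: triples_def e perm_indices_def dotted_matchings_def dotting_def)
  define \<tau> where "\<tau> = (\<lambda>p. enum a c1 (d + d - 1 - \<pi> (rank b c2 p)))"
  define \<tau>' where "\<tau>' = (\<lambda>p. enum b c2 (\<pi> (d + d - 1 - rank a c1 p)))"
  have \<tau>: "\<tau> p \<in> through a c1 \<and> \<tau>' (\<tau> p) = p" if p: "p \<in> through b c2" for p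
  proof -
    let ?k = "rank b c2 p"
    have k: "?k < d" "enum b c2 ?k = p" using enum_rank(3,4)[OF p] c2 by simp_all
    have w: "d \<le> \<pi> ?k" "\<pi> ?k < d + d" "\<pi> (\<pi> ?k) = ?k"
      using cup_free_low[OF \<pi> k(1)] matchingD[OF \<pi>(1), of ?k] k(1) by simp_all
    then have l: "d + d - 1 - \<pi> ?k < d" "d + d - 1 - (d + d - 1 - \<pi> ?k) = \<pi> ?k" by linarith+
    have l': "d + d - 1 - \<pi> ?k < card (through a c1)" using l(1) c1 by simp
    have t: "\<tau> p \<in> through a c1" unfolding \<tau>_def by (rule enum_rank(1)[OF l'])
    have "rank a c1 (\<tau> p) = d + d - 1 - \<pi> ?k" unfolding \<tau>_def by (rule enum_rank(2)[OF l'])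
    then have "\<tau>' (\<tau> p) = enum b c2 (\<pi> (d + d - 1 - (d + d - 1 - \<pi> ?k)))" by (simp add: \<tau>'_def)
    then show ?thesis using t unfolding l(2) w(3) k(2) by simp
  qed
  have \<tau>': "\<tau>' p \<in> through b c2 \<and> \<tau> (\<tau>' p) = p" if p: "p \<in> through a c1" for p
  proof -
    let ?k = "rank a c1 p"
    have k: "?k < d" "enum a c1 ?k = p" using enum_rank(3,4)[OF p] c1 by simp_all
    have kk: "d \<le> d + d - 1 - ?k" "d + d - 1 - ?k < d + d" "d + d - 1 - (d + d - 1 - ?k) = ?k" using k(1) by linarith+
    have w: "\<pi> (d + d - 1 - ?k) < card (through b c2)" "\<pi> (\<pi> (d + d - 1 - ?k)) = d + d - 1 - ?k"
      using \<pi>(2) kk matchingD[OF \<pi>(1) kk(2)] c2 unfolding cup_free_def by simp_all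
    have t: "\<tau>' p \<in> through b c2" unfolding \<tau>'_def by (rule enum_rank(1)[OF w(1)])
    have "rank b c2 (\<tau>' p) = \<pi> (d + d - 1 - ?k)" unfolding \<tau>'_def by (rule enum_rank(2)[OF w(1)])
    then have "\<tau> (\<tau>' p) = enum a c1 (d + d - 1 - \<pi> (\<pi> (d + d - 1 - ?k)))" by (simp add: \<tau>_def)
    then show ?thesis using t unfolding w(2) kk(3) k(2) by simp
  qed
  let ?g = "glue b a c2 c1 \<tau> \<tau>'"
  have g: "matching (b + a) ?g" by (rule glue_matching[OF c1(1) c2(1) \<tau> \<tau>'])
  let ?lo = "map (\<lambda>p. if c2 p = p then lo ! rank b c2 p else if p < c2 p then - (lo' ! c2 p) else 0) [0..<b]"
  have "dotting m b a ?g ?lo up"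
    unfolding dotting_def
  proof (intro conjI allI impI)
    fix p assume p: "p < b"
    then have c: "c2 p < b" using c2 by (simp add: partial_matching_def)
    have "rank b c2 p < d" if "c2 p = p" using enum_rank(3)[of p b c2] that p c2 by (simp add: through_iff)
    then show "?lo ! p \<in> dot_range m" using p lo lo' c by auto
    assume nz: "?lo ! p \<noteq> 0"
    show "p < ?g p"
    proof (cases "c2 p = p")
      case True
      then have "\<tau> p < a" using \<tau>[of p] p by (simp add: through_iff)
      then have "p < b + a - 1 - \<tau> p" using p by linarith
      then show ?thesis using True p by (simp add: glue_low)
    next
      case False
      then show ?thesis using nz p by (simp add: glue_low split: if_splits)
    qed
  next
    fix p assume p: "p < a"
    then show "- (up ! p) \<in> dot_range m" using up by simp
    assume "up ! p \<noteq> 0"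
    then have "c1 p < p" using up p by simp
    then have "b + a - 1 - p < b + a - 1 - c1 p" "c1 p \<noteq> p" using p by linarith+
    then show "b + a - 1 - p < ?g (b + a - 1 - p)" using glue_up[OF p, of b c2 c1 \<tau> \<tau>'] by (simp del: One_nat_def)
  qed (use up in simp_all)
  moreover have "glue_index b a i k j = (?g, ?lo, up)"
    unfolding e glue_index_def Let_def prod.case c2(2) \<tau>_def \<tau>'_def by (rule HOL.refl)
  moreover have "\<forall>e\<ge>b + a. ?g e = 0" by (simp add: glue_def)
  ultimately show ?thesis using g by (simp add: dotted_matchings_def)
qed

text \<open>Everything can be read off from the glued data: pairs within one side give
  \<open>c1\<close> and \<open>c2\<close>, the fixed points of \<open>c2\<close> give
  \<open>d\<close>, and the through-strands, renumbered by \<open>rank\<close> and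
  \<open>enum\<close>, give the lower half of \<open>\<pi>\<close>. The dots of the factors sit at
  separate places.\<close>

lemma glue_index_recover:
  assumes tr: "(d, (c1, up), (\<pi>, lo, up0), (c2, lo')) \<in> triples m a b"
    and G: "glue_index b a (c1, up) (\<pi>, lo, up0) (c2, lo') = (g, l, up')"
  shows "up = up'" "up0 = replicate d 0"
    and "c1 = (\<lambda>p. if p < a then let w = g (b + a - 1 - p) in if w < b then p else b + a - 1 - w else 0)"
    and "c2 = (\<lambda>p. if p < b then let w = g p in if w < b then w else p else 0)"
    and "d = card (through b c2)"
    and "lo' = map (\<lambda>p. if c2 p < p then - (l ! c2 p) else 0) [0..<b]"
    and "lo = map (\<lambda>k. l ! enum b c2 k) [0..<d]"
    and "\<And>k. k < d \<Longrightarrow> \<pi> k = d + d - 1 - rank a c1 (b + a - 1 - g (enum b c2 k))"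
proof -
  define \<tau> \<tau>' where "\<tau> = (\<lambda>p. enum a c1 (d + d - 1 - \<pi> (rank b c2 p)))"
    and "\<tau>' = (\<lambda>p. enum b c2 (\<pi> (d + d - 1 - rank a c1 p)))"
  have d: "card (through b c2) = d" "card (through a c1) = d"
    and c1: "\<And>p. p < a \<Longrightarrow> c1 p < a" "\<And>p. p \<ge> a \<Longrightarrow> c1 p = 0"
    and c2: "\<And>p. p < b \<Longrightarrow> c2 p < b" "\<And>p. p \<ge> b \<Longrightarrow> c2 p = 0" "\<And>p. p < b \<Longrightarrow> c2 (c2 p) = p"
    and lo': "length lo' = b" "\<And>p. p < b \<Longrightarrow> lo' ! p \<noteq> 0 \<Longrightarrow> c2 p < p"
    using tr by (auto simp: triples_def cup_indices_def partial_matching_def)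
  have m: "matching (d + d) \<pi>" "cup_free d d \<pi>" and lo: "length lo = d" and dt: "dotting d d d \<pi> lo up0 \<or> dotting m d d \<pi> lo up0"
    using tr by (auto simp: triples_def perm_indices_def dotted_matchings_def dotting_def)
  show "d = card (through b c2)" by (simp add: d)
  show "up0 = replicate d 0" using dt cup_free_no_dots m(2) by blast
  have g: "g = glue b a c2 c1 \<tau> \<tau>'" and "up = up'"
    and l: "l = map (\<lambda>p. if c2 p = p then lo ! rank b c2 p else if p < c2 p then - (lo' ! c2 p) else 0) [0..<b]"
    using G by (simp_all add: glue_index_def Let_def d \<tau>_def \<tau>'_def del: One_nat_def)
  then show "up = up'" by simp
  have w: "\<pi> k \<ge> d" "\<pi> k < d + d" "d + d - 1 - \<pi> k < d" "d + d - 1 - (d + d - 1 - \<pi> k) = \<pi> k" if "k < d" for k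
  proof -
    show "\<pi> k \<ge> d" "\<pi> k < d + d" using cup_free_low[OF m that] matchingD(1)[OF m(1), of k] that by simp_all
    then show "d + d - 1 - \<pi> k < d" "d + d - 1 - (d + d - 1 - \<pi> k) = \<pi> k" by linarith+
  qed
  have \<tau>': "\<tau>' p < b" if "p < a" "c1 p = p" for p
  proof -
    have "rank a c1 p < d" using enum_rank(3)[of p a c1] d that by (simp add: through_iff)
    then have "d \<le> d + d - 1 - rank a c1 p" "d + d - 1 - rank a c1 p < d + d" by linarith+
    then have "\<pi> (d + d - 1 - rank a c1 p) < card (through b c2)" using m(2) d unfolding cup_free_def by simp
    from enum_rank(1)[OF this] show ?thesis unfolding \<tau>'_def by (simp add: through_iff)
  qed
  have \<tau>: "\<tau> p < a" if "p < b" "c2 p = p" for p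
  proof -
    have "rank b c2 p < d" using enum_rank(3)[of p b c2] d that by (simp add: through_iff)
    then have "d + d - 1 - \<pi> (rank b c2 p) < card (through a c1)" using w d by simp
    from enum_rank(1)[OF this] show ?thesis unfolding \<tau>_def by (simp add: through_iff)
  qed
  show "c1 = (\<lambda>p. if p < a then let w = g (b + a - 1 - p) in if w < b then p else b + a - 1 - w else 0)"
  proof
    fix p show "c1 p = (if p < a then let w = g (b + a - 1 - p) in if w < b then p else b + a - 1 - w else 0)"
    proof (cases "p < a")
      case True
      have "\<not> b + a - 1 - c1 p < b" "b + a - 1 - (b + a - 1 - c1 p) = c1 p" using c1(1)[OF True] by linarith+
      then show ?thesis unfolding g glue_up[OF True] Let_def using \<tau>'[OF True] True by (simp del: One_nat_def)
    qed (simp add: c1)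
  qed
  show "c2 = (\<lambda>p. if p < b then let w = g p in if w < b then w else p else 0)"
  proof
    fix p show "c2 p = (if p < b then let w = g p in if w < b then w else p else 0)"
    proof (cases "p < b")
      case True
      have "\<not> b + a - 1 - \<tau> p < b" if "c2 p = p" using \<tau>[OF True that] by linarith
      then show ?thesis unfolding g glue_low[OF True] Let_def using c2(1)[OF True] True by (simp del: One_nat_def)
    qed (simp add: c2)
  qed
  show "lo' = map (\<lambda>p. if c2 p < p then - (l ! c2 p) else 0) [0..<b]"
  proof (rule nth_equalityI)
    fix p assume "p < length lo'"
    then have p: "p < b" using lo' by simp
    have "l ! c2 p = - (lo' ! p)" if "c2 p < p" using c2(1,3)[OF p] that by (simp add: l)
    then show "lo' ! p = map (\<lambda>p. if c2 p < p then - (l ! c2 p) else 0) [0..<b] ! p" using lo'(2)[OF p] p by auto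
  qed (simp add: lo')
  have en: "enum b c2 k < b" "c2 (enum b c2 k) = enum b c2 k" "rank b c2 (enum b c2 k) = k" if "k < d" for k
    using enum_rank(1,2)[of k b c2] that d by (simp_all add: through_iff)
  show "lo = map (\<lambda>k. l ! enum b c2 k) [0..<d]"
    by (rule nth_equalityI) (simp_all add: lo l en)
  show "\<pi> k = d + d - 1 - rank a c1 (b + a - 1 - g (enum b c2 k))" if k: "k < d" for k
  proof -
    have "b + a - 1 - (b + a - 1 - \<tau> (enum b c2 k)) = \<tau> (enum b c2 k)" using \<tau>[OF en(1,2)[OF k]] by linarith
    then have "b + a - 1 - g (enum b c2 k) = \<tau> (enum b c2 k)" unfolding g glue_low[OF en(1)[OF k]] using en(2)[OF k] by simp
    also have "rank a c1 (\<tau> (enum b c2 k)) = d + d - 1 - \<pi> k"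
      unfolding \<tau>_def en(3)[OF k] by (rule enum_rank(2)) (unfold d, rule w(3)[OF k])
    finally show ?thesis using w(4)[OF k] by simp
  qed
qed

lemma glue_index_inj: "inj_on (\<lambda>(d, i, k, j). glue_index b a i k j) (triples m a b)"
proof (rule inj_onI)
  fix t t' assume t: "t \<in> triples m a b" "t' \<in> triples m a b"
    and eq: "(case t of (d, i, k, j) \<Rightarrow> glue_index b a i k j) = (case t' of (d, i, k, j) \<Rightarrow> glue_index b a i k j)"
  obtain d c1 up \<pi> lo up0 c2 lo' where e: "t = (d, (c1, up), (\<pi>, lo, up0), (c2, lo'))" by (metis prod_cases3 surj_pair)
  obtain d' c1' up' \<pi>' ko up0' c2' ko' where e': "t' = (d', (c1', up'), (\<pi>', ko, up0'), (c2', ko'))" by (metis prod_cases3 surj_pair)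
  obtain g l v where G: "glue_index b a (c1, up) (\<pi>, lo, up0) (c2, lo') = (g, l, v)" by (metis prod_cases3)
  have G': "glue_index b a (c1', up') (\<pi>', ko, up0') (c2', ko') = (g, l, v)" using eq G by (simp add: e e')
  note R = glue_index_recover[OF t(1)[unfolded e] G] and R' = glue_index_recover[OF t(2)[unfolded e'] G']
  have 1: "up = up'" "c1 = c1'" "c2 = c2'" using R(1,3,4) R'(1,3,4) by simp_all
  have 2: "d = d'" using R(5) R'(5) 1 by simp
  have 3: "lo' = ko'" "lo = ko" "up0 = up0'" using R(2,6,7) R'(2,6,7) 1 2 by simp_all
  have eqk: "\<pi> k = \<pi>' k" if "k < d" for k using R(8)[of k] R'(8)[of k] 1 2 that by simp
  have m: "matching (d + d) \<pi>" "cup_free d d \<pi>" "\<forall>e\<ge>d + d. \<pi> e = 0"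
    and m': "matching (d + d) \<pi>'" "\<forall>e\<ge>d + d. \<pi>' e = 0"
    using t by (simp_all add: e e' 2 triples_def perm_indices_def dotted_matchings_def)
  \<comment> \<open>Agreement on the lower points suffices: a cup-free matching sends upper points
    to lower ones and is an involution.\<close>
  have "\<pi> e = \<pi>' e" for e
  proof -
    consider "e < d" | "d \<le> e" "e < d + d" | "d + d \<le> e" by linarith
    then show ?thesis
    proof cases
      case 2
      then have k: "\<pi> e < d" "\<pi> (\<pi> e) = e" using m(2) matchingD(3)[OF m(1), of e] by (simp_all add: cup_free_def)
      then have "\<pi>' (\<pi> e) = e" using eqk by simp
      then show ?thesis using matchingD(3)[OF m'(1), of "\<pi> e"] k(1) by simp
    qed (use eqk m(3) m'(2) in simp_all)
  qed
  then have "\<pi> = \<pi>'" by blast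
  then show "t = t'" using 1 2 3 by (simp add: e e')
qed

text \<open>Together with the spanning property of the products this inequality will become an
  equality.\<close>

lemma card_triples: "finite (triples m a b)" "card (triples m a b) \<le> card (dotted_matchings m b a)"
proof -
  have sub: "(\<lambda>(d, i, k, j). glue_index b a i k j) ` triples m a b \<subseteq> dotted_matchings m b a"
    using glue_index_in_dotted_matchings by auto
  show "finite (triples m a b)" by (rule inj_on_finite[OF glue_index_inj sub finite_dotted_matchings])
  show "card (triples m a b) \<le> card (dotted_matchings m b a)" by (rule card_inj_on_le[OF glue_index_inj sub finite_dotted_matchings])
qed

section \<open>A triangular basis of the cyclotomic Kauffman category\<close>

locale ck_admissible = kauffman q \<delta> m u \<omega>
  for q \<delta> :: "'k::field" and m :: nat and u :: "nat \<Rightarrow> 'k" and \<omega> :: "int \<Rightarrow> 'k" +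
  assumes adm: "u_admissible q \<delta> m u \<omega>"
begin

sublocale K: lin_cat CC
  by (intro lin_cat.intro lin_cat_axioms.intro linear_category_CK Obj_CC)

lemma dots_tm_wt [simp]: "wt (dots_tm ds)" "src (dots_tm ds) = length ds" "tgt (dots_tm ds) = length ds"
  by (induction ds) (simp_all add: dots_tm_def)

lemma dots_tm_zero: "dots_tm (replicate n 0) \<approx> Idt n"
proof (induction n)
  case (Suc n)
  have "dots_tm (replicate (Suc n) 0) = Idt 1 \<star> dots_tm (replicate n 0)"
    by (simp add: dots_tm_def dot_power_def)
  also have "\<dots> \<approx> Idt 1 \<star> Idt n" by (rule eqv_tens_r[OF Suc]) simp
  also have "\<dots> \<approx> Idt (Suc n)" by (rule idt_tens) simp
  finally show ?case .
qed (simp add: dots_tm_def)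

lemma tangle_tm_wt: "tangle a D b \<Longrightarrow> wt (tangle_tm a D :: 'k tm) \<and> src (tangle_tm a D :: 'k tm) = a \<and> tgt (tangle_tm a D :: 'k tm) = b"
proof (induction D arbitrary: a)
  case (Cons s D)
  obtain i g j where s: "s = (i, g, j)" by (rule prod_cases3)
  then show ?case using Cons.prems Cons.IH[of "i + gtgt g + j"] by (simp add: add.assoc)
qed simp

lemma tangle_tm_append:
  "tangle a D d \<Longrightarrow> tangle d D' b \<Longrightarrow> tangle_tm a (D @ D') \<approx> tangle_tm d D' \<cdot> tangle_tm a D"
proof (induction D arbitrary: a)
  case Nil
  then show ?case using tangle_tm_wt[of a D' b] by (auto intro!: eqv_sym[OF id_r])
next
  case (Cons s D)
  obtain i g j where s: "s = (i, g, j)" by (rule prod_cases3)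
  let ?n = "i + gtgt g + j" let ?s = "Idt i \<star> Gen g \<star> Idt j"
  have t: "tangle ?n D d" "a = i + gsrc g + j" using Cons.prems(1) by (simp_all add: s)
  have "tangle ?n (D @ D') b" using t(1) Cons.prems(2) tangle_append by blast
  note w = tangle_tm_wt[OF t(1)] tangle_tm_wt[OF Cons.prems(2)] tangle_tm_wt[OF this]
  have "tangle_tm ?n (D @ D') \<cdot> ?s \<approx> (tangle_tm d D' \<cdot> tangle_tm ?n D) \<cdot> ?s"
    by (rule eqv_comp_l[OF Cons.IH[OF t(1) Cons.prems(2)]]) (use w in \<open>simp_all add: add.assoc\<close>)
  also have "\<dots> \<approx> tangle_tm d D' \<cdot> (tangle_tm ?n D \<cdot> ?s)"
    by (rule assoc) (use w in \<open>simp add: add.assoc\<close>)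
  finally show ?case by (simp add: s)
qed

text \<open>The basis morphism of a dotted pairing. The representative is arbitrary; by
  \<open>val_basis\<close> every diagram in the class gives the same morphism.\<close>

definition val :: "nat \<Rightarrow> nat \<Rightarrow> (nat \<Rightarrow> nat) \<times> int list \<times> int list \<Rightarrow> 'k tm set" where
  "val c a x = cls c a (dotted_tm c (SOME y. y \<in> dotted_class m c a x))"

lemma dotted_class_nonempty: "x \<in> dotted_matchings m c a \<Longrightarrow> \<exists>y. y \<in> dotted_class m c a x"
proof -
  assume x: "x \<in> dotted_matchings m c a"
  obtain \<pi> lo up where e: "x = (\<pi>, lo, up)" by (rule prod_cases3)
  have "matching (c + a) \<pi>" using x by (simp add: e dotted_matchings_def)
  then show ?thesis using exists_good good_in_dotted_class x unfolding e by blast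
qed

text \<open>Admissibility carried over from classes of diagrams to dotted pairings. The first claim
  is the freedom to redraw a diagram within its class.\<close>

lemma val_basis:
  "x \<in> dotted_matchings m c a \<Longrightarrow> y \<in> dotted_class m c a x \<Longrightarrow> cls c a (dotted_tm c y) = val c a x"
  "inj_on (val c a) (dotted_matchings m c a)"
  "K.H.basis c a (val c a ` dotted_matchings m c a)"
proof -
  have "DB_is_basis q \<delta> m u \<omega> c a" using adm unfolding u_admissible_def by (elim allE)
  then obtain \<phi> where "\<forall>X\<in>DB m c a. \<forall>D\<in>X. cls c a (dotted_tm c D) = \<phi> X"
      and \<phi>': "inj_on \<phi> (DB m c a)" "K.H.basis c a (\<phi> ` DB m c a)"
    unfolding DB_is_basis_def by (elim exE conjE)
  then have \<phi>: "\<And>X D. X \<in> DB m c a \<Longrightarrow> D \<in> X \<Longrightarrow> cls c a (dotted_tm c D) = \<phi> X" by blast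
  have 1: "cls c a (dotted_tm c y) = \<phi> (dotted_class m c a x)" if "x \<in> dotted_matchings m c a" "y \<in> dotted_class m c a x" for x y
    using \<phi>[OF _ that(2)] that(1) by (simp add: DB_eq)
  have 2: "val c a x = \<phi> (dotted_class m c a x)" if "x \<in> dotted_matchings m c a" for x
    unfolding val_def by (rule 1[OF that someI_ex[OF dotted_class_nonempty[OF that]]])
  show "x \<in> dotted_matchings m c a \<Longrightarrow> y \<in> dotted_class m c a x \<Longrightarrow> cls c a (dotted_tm c y) = val c a x"
    using 1 2 by simp
  have "inj_on (\<phi> \<circ> dotted_class m c a) (dotted_matchings m c a)"
    using \<phi>'(1) by (intro comp_inj_on dotted_class_inj) (simp add: DB_eq)
  then show "inj_on (val c a) (dotted_matchings m c a)" using 2 by (simp add: inj_on_def)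
  have "val c a ` dotted_matchings m c a = \<phi> ` DB m c a" unfolding DB_eq image_image by (rule image_cong) (simp_all add: 2)
  then show "K.H.basis c a (val c a ` dotted_matchings m c a)" using \<phi>'(2) by simp
qed

lemma val_closed: "x \<in> dotted_matchings m c a \<Longrightarrow> val c a x \<in> carrier (Hom c a)"
  using val_basis(3)[of c a] by (auto simp: K.H.basis_def)

text \<open>Fixed once for each \<open>c\<close>, so that it does not vary with the pairing in which
  the cups occur.\<close>

definition cup_diagram :: "nat \<Rightarrow> (nat \<Rightarrow> nat) \<Rightarrow> slice list" where
  "cup_diagram a c = (SOME D. realises (card (through a c)) D a c)"

lemma cup_diagram: "partial_matching a c \<Longrightarrow> realises (card (through a c)) (cup_diagram a c) a c"
  unfolding cup_diagram_def by (rule someI_ex[OF exists_realisation])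

definition cup_val :: "nat \<Rightarrow> (nat \<Rightarrow> nat) \<times> int list \<Rightarrow> 'k tm set" where
  "cup_val a = (\<lambda>(c, up). cls (card (through a c)) a (dots_tm up \<cdot> tangle_tm (card (through a c)) (cup_diagram a c)))"

lemma cup_val_closed: "i \<in> cup_indices m a d \<Longrightarrow> cup_val a i \<in> carrier (Hom d a)"
  using tangle_tm_wt[of d "cup_diagram a (fst i)" a] cup_diagram[of a "fst i"]
  by (auto simp: cup_indices_def cup_val_def realises_def arr_iff intro!: cls_in_Hom)

text \<open>Redraw the diagram with the chosen cup diagram on top. The left factor then depends only
  on the cups and their dots; the remainder \<open>h\<close> is just some morphism, to be expanded
  again later. The through-strands end at distinct lower points, hence
  \<open>d \<le> c\<close>.\<close>

lemma val_factor:
  assumes x: "(\<pi>, lo, up) \<in> dotted_matchings m c a"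
  obtains d i h where "i \<in> cup_indices m a d" "h \<in> carrier (Hom c d)" "d \<le> c" "d \<le> a" "d = a \<Longrightarrow> cup_free c a \<pi>"
    "val c a (\<pi>, lo, up) = Cmp CC c d a (cup_val a i) h"
proof -
  define c' where "c' = (\<lambda>p. if p < a then cups_of c a \<pi> p else 0)"
  define d where "d = card (through a c')"
  have mt: "matching (c + a) \<pi>" and dt: "dotting m c a \<pi> lo up" using x by (simp_all add: dotted_matchings_def)
  have pm: "partial_matching a c'" using partial_matching_cups_of[OF mt] by (simp add: partial_matching_def c'_def)
  have c': "\<forall>p<a. cups_of c a \<pi> p = c' p" by (simp add: c'_def)
  \<comment> \<open>Upper dots sit at the endpoint with the smaller number, whose mate is then an
    upper point further to the left, that is, the left end of the cup.\<close>
  have "c' p < p" if p: "p < a" "up ! p \<noteq> 0" for p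
  proof -
    have "c + a - 1 - p < \<pi> (c + a - 1 - p)" using dt p by (simp add: dotting_def)
    moreover have "c + a - 1 - p < c + a" using p(1) by linarith
    note matchingD(1)[OF mt this]
    ultimately have "c \<le> \<pi> (c + a - 1 - p)" "c + a - 1 - \<pi> (c + a - 1 - p) < p" using p by linarith+
    then show ?thesis using p(1) by (simp add: c'_def cups_of_def Let_def)
  qed
  then have i: "(c', up) \<in> cup_indices m a d"
    using pm dt by (simp add: cup_indices_def d_def dotting_def) (simp add: c'_def)
  \<comment> \<open>If the mate of a fixed point were an upper point, it would be the point
    itself.\<close>
  have low: "\<pi> (c + a - 1 - p) < c" if p: "p \<in> through a c'" for p
  proof (rule ccontr)
    assume n: "\<not> \<pi> (c + a - 1 - p) < c"
    have p': "p < a" "c' p = p" using p by (simp_all add: through_iff)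
    then have e: "c + a - 1 - \<pi> (c + a - 1 - p) = p" using n by (simp add: c'_def cups_of_def Let_def)
    have "c + a - 1 - p < c + a" using p'(1) by linarith
    note M = matchingD(1,2)[OF mt this]
    show False using e M n p'(1) by linarith
  qed
  have "inj_on (\<lambda>p. \<pi> (c + a - 1 - p)) (through a c')"
  proof (rule inj_onI)
    fix p p' assume p: "p \<in> through a c'" "p' \<in> through a c'" "\<pi> (c + a - 1 - p) = \<pi> (c + a - 1 - p')"
    then have l: "c + a - 1 - p < c + a" "c + a - 1 - p' < c + a" "p < a" "p' < a" by (auto simp: through_iff)
    then have "c + a - 1 - p = c + a - 1 - p'" using matchingD(3)[OF mt] p(3) by metis
    then show "p = p'" using l by linarith
  qed
  then have "d \<le> card {..<c}" unfolding d_def by (rule card_inj_on_le) (use low in auto)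
  then have dc: "d \<le> c" by simp
  have da: "d \<le> a" unfolding d_def by (rule through_le)
  have cf: "cup_free c a \<pi>" if "d = a"
  proof -
    have "through a c' = {..<a}" using that by (intro card_subset_eq) (auto simp: through_iff d_def)
    then have l: "\<pi> (c + a - 1 - p) < c" if "p < a" for p using low that by simp
    show ?thesis unfolding cup_free_def
    proof (intro allI impI)
      fix e assume e: "c \<le> e" "e < c + a"
      then have "c + a - 1 - e < a" "c + a - 1 - (c + a - 1 - e) = e" by linarith+
      then show "\<pi> e < c" using l by metis
    qed
  qed
  have re: "realises d (cup_diagram a c') a c'" unfolding d_def by (rule cup_diagram[OF pm])
  then obtain D L where D: "tangle c D d" "good c (D @ cup_diagram a c') a \<pi> L" "tangle d (cup_diagram a c') a"
    using mt c' unfolding realises_def by blast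
  let ?R = "tangle_tm d (cup_diagram a c')"
  note w = tangle_tm_wt[OF D(1)] tangle_tm_wt[OF D(3)] tangle_tm_wt[OF good_tangle[OF D(2)]]
  have len: "length lo = c" "length up = a" using dt by (simp_all add: dotting_def)
  have "val c a (\<pi>, lo, up) = cls c a (dotted_tm c (lo, D @ cup_diagram a c', up))"
    by (rule val_basis(1)[OF x good_in_dotted_class[OF x D(2)], symmetric])
  also have "\<dots> = cls c a ((dots_tm up \<cdot> ?R) \<cdot> (tangle_tm c D \<cdot> dots_tm lo))"
  proof (rule cls_eqI)
    have "tangle_tm c (D @ cup_diagram a c') \<cdot> dots_tm lo \<approx> (?R \<cdot> tangle_tm c D) \<cdot> dots_tm lo"
      by (rule eqv_comp_l[OF tangle_tm_append[OF D(1,3)]]) (use w len in simp_all)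
    also have "\<dots> \<approx> ?R \<cdot> (tangle_tm c D \<cdot> dots_tm lo)" by (rule assoc) (use w len in simp)
    finally have "dots_tm up \<cdot> tangle_tm c (D @ cup_diagram a c') \<cdot> dots_tm lo
        \<approx> dots_tm up \<cdot> (?R \<cdot> (tangle_tm c D \<cdot> dots_tm lo))"
      by (rule eqv_comp_r) (use w len in simp_all)
    also have "\<dots> \<approx> (dots_tm up \<cdot> ?R) \<cdot> (tangle_tm c D \<cdot> dots_tm lo)" by (rule assoc') (use w len in simp)
    finally show "dotted_tm c (lo, D @ cup_diagram a c', up) \<approx> (dots_tm up \<cdot> ?R) \<cdot> (tangle_tm c D \<cdot> dots_tm lo)" by simp
    show "arr (dotted_tm c (lo, D @ cup_diagram a c', up) :: 'k tm) c a" using w len by (simp add: arr_iff)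
  qed
  also have "\<dots> = Cmp CC c d a (cls d a (dots_tm up \<cdot> ?R)) (cls c d (tangle_tm c D \<cdot> dots_tm lo))"
    by (rule Cmp_cls[symmetric]) (use w len in \<open>simp_all add: arr_iff\<close>)
  also have "cls d a (dots_tm up \<cdot> ?R) = cup_val a (c', up)" by (simp add: cup_val_def d_def)
  finally have v: "val c a (\<pi>, lo, up) = Cmp CC c d a (cup_val a (c', up)) (cls c d (tangle_tm c D \<cdot> dots_tm lo))" .
  have "cls c d (tangle_tm c D \<cdot> dots_tm lo) \<in> carrier (Hom c d)"
    by (rule cls_in_Hom) (use w len in \<open>simp add: arr_iff\<close>)
  from that[OF i this dc da cf v] show thesis by blast
qed

section \<open>Generators, spanning and the dimension count\<close>

definition "Gm a d = cup_val a ` cup_indices m a d"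
definition "G0 d = val d d ` perm_indices m d"
text \<open>Cap generators are reflected cup generators instead of diagrams drawn anew, so their
  properties follow from those of \<open>Gm\<close>.\<close>

definition "Gp d b = flip_cls ` Gm b d"

lemma G_closed: "x \<in> Gm a d \<Longrightarrow> x \<in> carrier (Hom d a)" "y \<in> G0 d \<Longrightarrow> y \<in> carrier (Hom d d)"
  "z \<in> Gp d b \<Longrightarrow> z \<in> carrier (Hom b d)"
  by (auto simp: Gm_def G0_def Gp_def cup_val_closed perm_indices_def intro!: val_closed)

definition "factors a b = {(d, x, y, z). x \<in> Gm a d \<and> y \<in> G0 d \<and> z \<in> Gp d b}"
definition "product a b = (\<lambda>(d, x, y, z). Cmp CC b d a (Cmp CC d d a x y) z)"
definition "product_span a b = LinearCombinations.module.span class_ring (Hom b a) (product a b ` factors a b)"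

lemma product_closed: "product a b ` factors a b \<subseteq> carrier (Hom b a)"
  by (auto simp: product_def factors_def G_closed)

lemma product_span: "submodule class_ring (product_span a b) (Hom b a)" "product a b ` factors a b \<subseteq> product_span a b"
  unfolding product_span_def
  by (rule K.H.span_is_submodule[OF product_closed]) (rule K.H.in_own_span[OF product_closed])

lemma Hom_induct:
  assumes W: "submodule class_ring W (Hom c a)" and g: "\<And>x. x \<in> dotted_matchings m c a \<Longrightarrow> val c a x \<in> W"
    and f: "f \<in> carrier (Hom c a)"
  shows "f \<in> W"
proof -
  have "LinearCombinations.module.span class_ring (Hom c a) (val c a ` dotted_matchings m c a) \<subseteq> W"
    by (rule K.H.span_is_subset[OF _ W]) (use g in blast)
  then show ?thesis using val_basis(3)[of c a] f by (auto simp: K.H.basis_def)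
qed

lemma flip_cls_linear:
  "X \<in> carrier (Hom a b) \<Longrightarrow> Y \<in> carrier (Hom a b) \<Longrightarrow> flip_cls (X \<oplus>\<^bsub>Hom a b\<^esub> Y) = flip_cls X \<oplus>\<^bsub>Hom b a\<^esub> flip_cls Y"
  "X \<in> carrier (Hom a b) \<Longrightarrow> flip_cls (s \<odot>\<^bsub>Hom a b\<^esub> X) = s \<odot>\<^bsub>Hom b a\<^esub> flip_cls X"
  "flip_cls \<zero>\<^bsub>Hom a b\<^esub> = \<zero>\<^bsub>Hom b a\<^esub>"
proof -
  show "X \<in> carrier (Hom a b) \<Longrightarrow> Y \<in> carrier (Hom a b) \<Longrightarrow> flip_cls (X \<oplus>\<^bsub>Hom a b\<^esub> Y) = flip_cls X \<oplus>\<^bsub>Hom b a\<^esub> flip_cls Y"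
    by (rule LinearCombinations.module_hom_add[OF flip_cls_hom])
  show "X \<in> carrier (Hom a b) \<Longrightarrow> flip_cls (s \<odot>\<^bsub>Hom a b\<^esub> X) = s \<odot>\<^bsub>Hom b a\<^esub> flip_cls X"
    by (rule LinearCombinations.module_hom_smult[OF flip_cls_hom]) simp_all
  show "flip_cls \<zero>\<^bsub>Hom a b\<^esub> = \<zero>\<^bsub>Hom b a\<^esub>" by (simp add: zero_cls flip_cls_cls)
qed

text \<open>Reflection is a linear bijection, so the reflected basis also spans; its elements factor
  with a reflected cup diagram on the right.\<close>

lemma Hom_induct_flip:
  assumes W: "submodule class_ring W (Hom b n)" and g: "\<And>x. x \<in> dotted_matchings m n b \<Longrightarrow> flip_cls (val n b x) \<in> W"
    and f: "f \<in> carrier (Hom b n)"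
  shows "f \<in> W"
proof -
  note Wd = K.submoduleD[OF W]
  have "flip_cls f \<in> {h \<in> carrier (Hom n b). flip_cls h \<in> W}"
  proof (rule Hom_induct)
    show "submodule class_ring {h \<in> carrier (Hom n b). flip_cls h \<in> W} (Hom n b)"
      by (rule K.submodule_H) (auto simp: flip_cls_linear Wd(2-4))
  qed (use g val_closed f in auto)
  then show ?thesis by simp
qed

text \<open>Strong induction on the middle object \<open>n\<close>. Both factors are expanded in
  bases whose elements factor through some \<open>d \<le> n\<close>. If \<open>d < n\<close>, the
  composite passes through a smaller object and the induction hypothesis applies; otherwise the
  outer factors are a cup and a cap generator and an endomorphism of \<open>n\<close> remains
  between them.\<close>

lemma comp_in_product_span:
  "f \<in> carrier (Hom b n) \<Longrightarrow> g \<in> carrier (Hom n a) \<Longrightarrow> Cmp CC b n a g f \<in> product_span a b"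
proof (induction n arbitrary: a b f g rule: less_induct)
  case (less n)
  note Wd = K.submoduleD[OF product_span(1)]
  note asc = K.cmp_assoc[simplified]
  \<comment> \<open>The innermost case: a basis endomorphism of \<open>n\<close> either factors
    through fewer strands, or is cup-free and hence one of the middle generators, which makes the
    composite one of the products.\<close>
  have 1: "Cmp CC b n a x (Cmp CC b n n y z) \<in> product_span a b"
    if x: "x \<in> Gm a n" and z: "z \<in> Gp n b" and y: "y \<in> carrier (Hom n n)" for a b x y z
  proof -
    note c = G_closed(1)[OF x] G_closed(3)[OF z]
    have "y \<in> {y \<in> carrier (Hom n n). Cmp CC b n a x (Cmp CC b n n y z) \<in> product_span a b}"
    proof (rule Hom_induct)
      show "submodule class_ring {y \<in> carrier (Hom n n). Cmp CC b n a x (Cmp CC b n n y z) \<in> product_span a b} (Hom n n)"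
        by (rule K.submodule_H) (auto simp: c K.Cmp_add K.Cmp_smult Wd(2-4))
      fix k assume k: "k \<in> dotted_matchings m n n"
      obtain \<pi> lo up where e: "k = (\<pi>, lo, up)" by (rule prod_cases3)
      obtain d i h where f: "i \<in> cup_indices m n d" "h \<in> carrier (Hom n d)" "d \<le> n" "d = n \<Longrightarrow> cup_free n n \<pi>"
        and v: "val n n k = Cmp CC n d n (cup_val n i) h"
        using val_factor[OF k[unfolded e]] unfolding e by metis
      have "Cmp CC b n a x (Cmp CC b n n (val n n k) z) \<in> product_span a b"
      proof (cases "d = n")
        case True
        then have "val n n k \<in> G0 n" using f(4) k unfolding G0_def perm_indices_def e by blast
        then have "product a b (n, x, val n n k, z) \<in> product_span a b"
          using x z product_span(2)[of a b] by (auto simp: factors_def)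
        then show ?thesis using asc[OF c(2) val_closed[OF k] c(1)] by (simp add: product_def)
      next
        case False
        note i = cup_val_closed[OF f(1)]
        have "Cmp CC b n a x (Cmp CC b n n (val n n k) z) = Cmp CC b d a (Cmp CC d n a x (cup_val n i)) (Cmp CC b n d h z)"
          unfolding v using asc[OF c(2) f(2) i] asc[OF _ i c(1)] c f(2) i by simp
        then show ?thesis using less.IH[of d "Cmp CC b n d h z" b "Cmp CC d n a x (cup_val n i)" a] False f c i by simp
      qed
      then show "val n n k \<in> {y \<in> carrier (Hom n n). Cmp CC b n a x (Cmp CC b n n y z) \<in> product_span a b}"
        using val_closed[OF k] by blast
    qed (rule y)
    then show ?thesis by blast
  qed
  \<comment> \<open>The right factor is expanded in the reflected basis; for \<open>d = n\<close> it
    has a cap generator on the right, and its reflected remainder becomes the middle endomorphism of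
    case \<open>1\<close>.\<close>
  have 2: "Cmp CC b n a x f \<in> product_span a b" if x: "x \<in> Gm a n" and f: "f \<in> carrier (Hom b n)" for a b x f
  proof -
    note c = G_closed(1)[OF x]
    have "f \<in> {f \<in> carrier (Hom b n). Cmp CC b n a x f \<in> product_span a b}"
    proof (rule Hom_induct_flip)
      show "submodule class_ring {f \<in> carrier (Hom b n). Cmp CC b n a x f \<in> product_span a b} (Hom b n)"
        by (rule K.submodule_H) (auto simp: c K.Cmp_add K.Cmp_smult Wd(2-4))
      fix k assume k: "k \<in> dotted_matchings m n b"
      obtain \<pi> lo up where e: "k = (\<pi>, lo, up)" by (rule prod_cases3)
      obtain d i h where f: "i \<in> cup_indices m b d" "h \<in> carrier (Hom n d)" "d \<le> n"
        and v: "val n b k = Cmp CC n d b (cup_val b i) h"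
        using val_factor[OF k[unfolded e]] unfolding e by metis
      note i = cup_val_closed[OF f(1)]
      have v': "flip_cls (val n b k) = Cmp CC b d n (flip_cls h) (flip_cls (cup_val b i))"
        unfolding v by (rule flip_cls_Cmp[OF f(2) i])
      have "Cmp CC b n a x (flip_cls (val n b k)) \<in> product_span a b"
      proof (cases "d = n")
        case True
        have "flip_cls (cup_val b i) \<in> Gp n b" using f(1) unfolding Gp_def Gm_def True by blast
        then show ?thesis unfolding v' using 1[OF x] f(2) True by simp
      next
        case False
        have "Cmp CC b n a x (flip_cls (val n b k)) = Cmp CC b d a (Cmp CC d n a x (flip_cls h)) (flip_cls (cup_val b i))"
          unfolding v' using asc[OF _ _ c] f(2) i by simp
        then show ?thesis
          using less.IH[of d "flip_cls (cup_val b i)" b "Cmp CC d n a x (flip_cls h)" a] False f c i by simp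
      qed
      then show "flip_cls (val n b k) \<in> {f \<in> carrier (Hom b n). Cmp CC b n a x f \<in> product_span a b}"
        using val_closed[OF k] by simp
    qed (rule f)
    then show ?thesis by blast
  qed
  note f = less.prems(1)
  have "g \<in> {g \<in> carrier (Hom n a). Cmp CC b n a g f \<in> product_span a b}"
  proof (rule Hom_induct)
    show "submodule class_ring {g \<in> carrier (Hom n a). Cmp CC b n a g f \<in> product_span a b} (Hom n a)"
      by (rule K.submodule_H) (auto simp: f K.Cmp_add K.Cmp_smult Wd(2-4))
    fix k assume k: "k \<in> dotted_matchings m n a"
    obtain \<pi> lo up where e: "k = (\<pi>, lo, up)" by (rule prod_cases3)
    obtain d i h where F: "i \<in> cup_indices m a d" "h \<in> carrier (Hom n d)" "d \<le> n"
      and v: "val n a k = Cmp CC n d a (cup_val a i) h"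
      using val_factor[OF k[unfolded e]] unfolding e by metis
    note i = cup_val_closed[OF F(1)]
    have eq: "Cmp CC b n a (val n a k) f = Cmp CC b d a (cup_val a i) (Cmp CC b n d h f)"
      unfolding v by (rule asc[OF f F(2) i])
    have "Cmp CC b n a (val n a k) f \<in> product_span a b"
    proof (cases "d = n")
      case True
      then have "cup_val a i \<in> Gm a n" using F(1) unfolding Gm_def by blast
      then show ?thesis unfolding eq using 2 f F(2) True by simp
    next
      case False
      then show ?thesis unfolding eq using less.IH[of d "Cmp CC b n d h f" b "cup_val a i" a] F f i by simp
    qed
    then show "val n a k \<in> {g \<in> carrier (Hom n a). Cmp CC b n a g f \<in> product_span a b}" using val_closed[OF k] by blast
  qed (rule less.prems(2))
  then show ?case by blast
qed

text \<open>Every morphism is its own composite with an identity.\<close>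

lemma product_span_eq: "product_span a b = carrier (Hom b a)"
  using comp_in_product_span[of _ b a "Ide CC a" a] K.submoduleD(1)[OF product_span(1)] by force

lemma finite_dim_CK: "finite_dim_homs CC"
proof -
  have "K.H.fin_dim a b" for a b
    using val_basis(3)[of a b] finite_imageI[OF finite_dotted_matchings[of m a b], of "val a b"]
    unfolding K.H.fin_dim_def K.H.basis_def by (intro exI[of _ "val a b ` dotted_matchings m a b"]) simp
  then show ?thesis by (simp add: finite_dim_homs_def)
qed

lemma dim_Hom: "K.H.dim c a = card (dotted_matchings m c a)"
  using K.H.dim_basis[OF _ val_basis(3)] finite_dotted_matchings by (simp add: card_image val_basis(2))

text \<open>Different indices could give the same morphism, so at this stage the number of index
  triples is an upper bound.\<close>

lemma card_factors: "finite (factors a b)" "card (factors a b) \<le> card (dotted_matchings m b a)"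
proof -
  have eq: "factors a b = (\<lambda>(d, i, k, j). (d, cup_val a i, val d d k, flip_cls (cup_val b j))) ` triples m a b"
    unfolding factors_def triples_def Gm_def G0_def Gp_def by (auto simp: image_iff) blast+
  show "finite (factors a b)" unfolding eq by (rule finite_imageI[OF card_triples(1)])
  show "card (factors a b) \<le> card (dotted_matchings m b a)"
    unfolding eq by (rule order.trans[OF card_image_le[OF card_triples(1)] card_triples(2)])
qed

text \<open>A spanning set with at most as many elements as the dimension is a basis.\<close>

lemma product_basis: "K.H.basis b a (product a b ` factors a b)"
proof (rule K.H.dim_gen_is_basis)
  show "card (product a b ` factors a b) \<le> K.H.dim b a"
    unfolding dim_Hom by (rule order.trans[OF card_image_le[OF card_factors(1)] card_factors(2)])
qed (use product_closed product_span_eq card_factors in \<open>auto simp: product_span_def\<close>)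

text \<open>A squeeze: the dimension equals the number of distinct products, which is at most the
  number of factor triples, which is at most the dimension.\<close>

lemma product_inj: "inj_on (product a b) (factors a b)"
proof (rule eq_card_imp_inj_on[OF card_factors(1)])
  have "card (product a b ` factors a b) = card (dotted_matchings m b a)"
    using K.H.dim_basis[OF _ product_basis] card_factors(1) dim_Hom by simp
  then show "card (product a b ` factors a b) = card (factors a b)"
    using card_factors(2)[of a b] card_image_le[OF card_factors(1), of "product a b" a b] by simp
qed

text \<open>If all \<open>a\<close> points lie on through-strands, there are no cups, hence no dots,
  and \<open>realises\<close> demands the empty diagram; what remains is the identity.\<close>

lemma Gm_diag: "Gm a a = {Ide CC a}"
proof -
  have 1: "cup_val a i = Ide CC a" if "i \<in> cup_indices m a a" for i
  proof -
    obtain c up where i: "i = (c, up)" by fastforce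
    have c: "partial_matching a c" "card (through a c) = a" "length up = a" "\<And>p. p < a \<Longrightarrow> up ! p \<noteq> 0 \<Longrightarrow> c p < p"
      using that by (auto simp: cup_indices_def i)
    have "through a c = {..<a}" using c(2) by (intro card_subset_eq) (auto simp: through_iff)
    then have "c p = p" if "p < a" for p using that by (auto simp: through_def)
    then have up: "up = replicate a 0" using c(3,4) by (intro nth_equalityI) auto
    have "cup_diagram a c = []" using cup_diagram[OF c(1)] c(2) by (simp add: realises_def)
    then have "cup_val a i = cls a a (dots_tm (replicate a 0) \<cdot> Idt a)" using c(2) by (simp add: cup_val_def i up)
    also have "\<dots> = cls a a (Idt a)"
    proof (rule cls_eqI)
      have "dots_tm (replicate a 0) \<cdot> Idt a \<approx> dots_tm (replicate a 0)" by (rule id_r) simp_all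
      also have "\<dots> \<approx> Idt a" by (rule dots_tm_zero)
      finally show "dots_tm (replicate a 0) \<cdot> Idt a \<approx> Idt a" .
    qed (simp add: arr_iff)
    finally show ?thesis by (simp add: Ide_cls)
  qed
  have "((\<lambda>p. if p < a then p else 0), replicate a 0) \<in> cup_indices m a a"
  proof -
    have "through a (\<lambda>p. if p < a then p else 0) = {..<a}" by (auto simp: through_def)
    then show ?thesis by (simp add: cup_indices_def partial_matching_def)
  qed
  then show ?thesis unfolding Gm_def using 1 by (auto intro: rev_image_eqI)
qed

lemma Gm_upper: "a < d \<Longrightarrow> Gm a d = {}"
proof -
  assume d: "a < d"
  have "x \<notin> cup_indices m a d" for x
    using through_le[of a "fst x"] d by (auto simp: cup_indices_def)
  then show ?thesis unfolding Gm_def by blast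
qed

sublocale triangular_basis_nat CC Gm Gp G0
proof (unfold_locales)
  show "Gm a d \<subseteq> carrier (Hom d a)" "G0 d \<subseteq> carrier (Hom d d)" "Gp d b \<subseteq> carrier (Hom b d)" for a b d
    using G_closed by blast+
  show "inj_on (\<lambda>(d, x, y, z). Cmp CC b d a (Cmp CC d d a x y) z) {(d, x, y, z). x \<in> Gm a d \<and> y \<in> G0 d \<and> z \<in> Gp d b}" for a b
    using product_inj[of a b] unfolding product_def factors_def .
  show "K.H.basis b a
       ((\<lambda>(d, x, y, z). Cmp CC b d a (Cmp CC d d a x y) z) ` {(d, x, y, z). x \<in> Gm a d \<and> y \<in> G0 d \<and> z \<in> Gp d b})" for a b
    using product_basis[of b a] unfolding product_def factors_def .
  show "a < d \<Longrightarrow> Gm a d = {}" for a d by (rule Gm_upper)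
  show "b < d \<Longrightarrow> Gp d b = {}" for b d by (simp add: Gp_def Gm_upper)
  show "Gm a a = {Ide CC a}" for a by (rule Gm_diag)
  show "Gp a a = {Ide CC a}" for a by (simp add: Gp_def Gm_diag flip_cls_Ide)
qed

end

theorem proposition6p6:
  fixes q \<delta> :: "'k::alg_closed_field" and m :: nat and u :: "nat \<Rightarrow> 'k" and \<omega> :: "int \<Rightarrow> 'k"
  assumes "q \<noteq> 0" and "q - inverse q \<noteq> 0" and "\<delta> \<noteq> 0"
    and "m \<ge> 1" and "\<forall>i\<in>{1..m}. u i \<noteq> 0"
    and "\<omega> 0 = 1 + (\<delta> - inverse \<delta>) / (q - inverse q)"
    and "u_admissible q \<delta> m u \<omega>"
  shows "upper_finite_weakly_triangular_category (CK q \<delta> m u \<omega>)"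
proof -
  interpret ck_admissible q \<delta> m u \<omega> using assms(7) by unfold_locales
  show ?thesis by (rule upper_finite_weakly_triangular[OF finite_dim_CK])
qed

end
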